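(* Let $1\le d<n$, $\mathrm{rch}_{\min}>0$, $R\ge144\,\mathrm{rch}_{\min}$, $0<f_{\min}\le f_{\max}/96$, $L\ge0$, $\tau>0$, $\alpha<1/2$. Assume $$\min_{1\le k\le n}\left(\frac{192\,\mathrm{rch}_{\min}\sqrt k}{R}\right)^k\le 36\cdot8^d\sigma_{d-1}f_{\min}\mathrm{rch}_{\min}^d\le1.$$ Then no randomized SQ algorithm (with any number of queries to $\mathrm{STAT}(\tau)$) estimates $M=\mathrm{Supp}(D)$ over the bounding ball model $\mathcal{D}^{n,d}_{\mathrm{rch}_{\min}}(f_{\min},f_{\max},L;R)$ with respect to $d_H$ with precision $$\varepsilon<\frac{\mathrm{rch}_{\min}}{2^{31}}\min\left\{\frac{1}{2^{10}d^2},\left(\frac{\tau}{\omega_d f_{\min}\mathrm{rch}_{\min}^d}\right)^{2/d}\right\}$$ and probability of success $1-\alpha$.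
   Context: Notation: $\omega_d$ is the volume of the unit ball of $\mathbb{R}^d$, $\sigma_{d-1}$ the $(d-1)$-dimensional volume of the unit sphere of $\mathbb{R}^d$. $\mathrm{B}(x,r)$ closed Euclidean ball, $\mathrm{d}(z,K)=\inf_{p\in K}\|p-z\|$. The reach $\mathrm{rch}_K$ of a closed set $K$ is the infimum of $\mathrm{d}(z,K)$ over the medial axis (points with at least two distinct nearest points in $K$). $\mathcal{M}^{n,d}_{\rho}$ is the set of compact connected $d$-dimensional $C^2$ submanifolds of $\mathbb{R}^n$ without boundary with reach $\ge\rho$. $\mathcal{D}^{n,d}_{\mathrm{rch}_{\min}}(f_{\min},f_{\max},L)$ is the set of Borel probability distributions $D$ on $\mathbb{R}^n$ with support $M\in\mathcal{M}^{n,d}_{\mathrm{rch}_{\min}}$ having a density $f$ w.r.t. the $d$-dimensional Hausdorff measure restricted to $M$ with $f_{\min}\le f\le f_{\max}$ and $f$ $L$-Lipschitz on $M$; the bounding ball model $\mathcal{D}^{n,d}_{\mathrm{rch}_{\min}}(f_{\min},f_{\max},L;R)$ consists of those with support in $\mathrm{B}(0,R)$. $d_H(K,K')=\sup_x|\mathrm{d}(x,K)-\mathrm{d}(x,K')|$. SQ framework: a $\mathrm{STAT}(\tau)$ oracle for $D$ answers each measurable query $r:\mathbb{R}^n\to[-1,1]$ with an arbitrary adversarial real $a$ with $|a-\mathbb{E}_D[r]|\le\tau$. A deterministic SQ algorithm chooses its queries adaptively and outputs a function of all answers; a randomized SQ algorithm is a probability distribution over deterministic ones; it estimates $\mathrm{Supp}(D)$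 with precision $\varepsilon$ and probability of success $1-\alpha$ if for every $D$ in the model and every valid $\mathrm{STAT}(\tau)$ oracle for $D$, with probability at least $1-\alpha$ its output $\hat M$ satisfies $d_H(\mathrm{Supp}(D),\hat M)\le\varepsilon$. *)

theory Defs
  imports "HOL-Analysis.Analysis" "HOL-Probability.Probability"
begin

text \<open>omega_d: volume of the unit ball of R^d; sigma_{d-1} = d * omega_d: the (d-1)-volume of the unit sphere of R^d.\<close>
definition omega :: "nat \<Rightarrow> real" where
  "omega d = unit_ball_vol (real d)"

definition sigma_sph :: "nat \<Rightarrow> real" where
  "sigma_sph d = real d * omega d"

definition hausdorff_pre :: "nat \<Rightarrow> real \<Rightarrow> 'a::metric_space set \<Rightarrow> ennreal" where
  "hausdorff_pre d \<delta> A =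
     (INF C \<in> {C :: nat \<Rightarrow> 'a set. A \<subseteq> (\<Union>i. C i) \<and> (\<forall>i. bounded (C i) \<and> diameter (C i) \<le> \<delta>)}.
        (\<Sum>i. ennreal (omega d * (diameter (C i) / 2) ^ d)))"

definition hausdorff_outer :: "nat \<Rightarrow> 'a::metric_space set \<Rightarrow> ennreal" where
  "hausdorff_outer d A = (SUP \<delta> \<in> {0<..}. hausdorff_pre d \<delta> A)"

definition hausdorff_measure :: "nat \<Rightarrow> 'a::metric_space measure" where
  "hausdorff_measure d = measure_of UNIV (sets borel) (hausdorff_outer d)"

definition medial_axis :: "'a::metric_space set \<Rightarrow> 'a set" where
  "medial_axis K = {z. \<exists>p q. p \<in> K \<and> q \<in> K \<and> p \<noteq> q \<and>
                        dist p z = infdist z K \<and> dist q z = infdist z K}"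

text \<open>Infimum over the medial axis; +infinity if the medial axis is empty.\<close>
definition reach :: "'a::metric_space set \<Rightarrow> ereal" where
  "reach K = (INF z \<in> medial_axis K. ereal (infdist z K))"

definition C2_map :: "('a::euclidean_space \<Rightarrow> 'a) \<Rightarrow> bool" where
  "C2_map g \<longleftrightarrow> (\<exists>g' g''.
      (\<forall>x. (g has_derivative blinfun_apply (g' x)) (at x)) \<and>
      (\<forall>x. (g' has_derivative blinfun_apply (g'' x)) (at x)) \<and>
      continuous_on UNIV g'')"

definition C2_submanifold :: "nat \<Rightarrow> 'a::euclidean_space set \<Rightarrow> bool" where
  "C2_submanifold d M \<longleftrightarrow> (\<forall>p\<in>M. \<exists>U T g.
      open U \<and> p \<in> U \<and> subspace T \<and> dim T = d \<and> C2_map g \<and>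
      (\<forall>x. \<forall>t\<in>T. inner t (g x) = 0) \<and>
      M \<inter> U = {x + g x | x. x \<in> T} \<inter> U)"

definition manifold_class :: "nat \<Rightarrow> real \<Rightarrow> 'a::euclidean_space set set" where
  "manifold_class d \<rho> = {M. compact M \<and> connected M \<and> M \<noteq> {} \<and>
                              C2_submanifold d M \<and> ereal \<rho> \<le> reach M}"

definition support :: "'a::metric_space measure \<Rightarrow> 'a set" where
  "support D = {x. \<forall>e>0. emeasure D (ball x e) > 0}"

definition model ::
  "nat \<Rightarrow> real \<Rightarrow> real \<Rightarrow> real \<Rightarrow> real \<Rightarrow> real \<Rightarrow> 'a::euclidean_space measure set" where
  "model d rchmin fmin fmax L R = {D. prob_space D \<and> sets D = sets borel \<and>
      support D \<in> manifold_class d rchmin \<and> support D \<subseteq> cball 0 R \<and>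
      (\<exists>f :: 'a \<Rightarrow> real.
         (\<forall>A \<in> sets borel. emeasure D A =
              (\<integral>\<^sup>+ x \<in> A \<inter> support D. ennreal (f x) \<partial>hausdorff_measure d)) \<and>
         (\<forall>x \<in> support D. fmin \<le> f x \<and> f x \<le> fmax) \<and>
         L-lipschitz_on (support D) f)}"

definition dH :: "'a::metric_space set \<Rightarrow> 'a set \<Rightarrow> ereal" where
  "dH K K' = (SUP x. ereal \<bar>infdist x K - infdist x K'\<bar>)"

text \<open>A deterministic SQ algorithm: an adaptive query strategy (next query as a function
  of the previous answers) and an output map from the sequence of answers to a set.
  A countable (possibly infinite) sequence of queries is allowed; algorithms using finitely
  many (possibly adaptively many) queries are the special case where later queries are
  ignored.\<close>
record 'a sq_alg =
  query :: "real list \<Rightarrow> ('a \<Rightarrow> real)"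
  outp :: "(nat \<Rightarrow> real) \<Rightarrow> 'a set"

definition valid_query :: "('a::euclidean_space \<Rightarrow> real) \<Rightarrow> bool" where
  "valid_query r \<longleftrightarrow> r \<in> borel_measurable borel \<and> (\<forall>x. \<bar>r x\<bar> \<le> 1)"

definition valid_alg :: "'a::euclidean_space sq_alg \<Rightarrow> bool" where
  "valid_alg A \<longleftrightarrow> (\<forall>h. valid_query (query A h))"

text \<open>An adversarial STAT(tau) oracle: the answer may depend on the whole history of
  queries (the last list element is the current query).\<close>
definition valid_oracle ::
  "'a::euclidean_space measure \<Rightarrow> real \<Rightarrow> (('a \<Rightarrow> real) list \<Rightarrow> real) \<Rightarrow> bool" where
  "valid_oracle D \<tau> Orc \<longleftrightarrow> (\<forall>qs r. valid_query r \<longrightarrow>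
       \<bar>Orc (qs @ [r]) - integral\<^sup>L D r\<bar> \<le> \<tau>)"

primrec answers_hist ::
  "'a sq_alg \<Rightarrow> (('a \<Rightarrow> real) list \<Rightarrow> real) \<Rightarrow> nat \<Rightarrow> real list" where
  "answers_hist A Orc 0 = []"
| "answers_hist A Orc (Suc k) = answers_hist A Orc k @
     [Orc (map (\<lambda>j. query A (take j (answers_hist A Orc k))) [0..<Suc k])]"

definition run :: "'a sq_alg \<Rightarrow> (('a \<Rightarrow> real) list \<Rightarrow> real) \<Rightarrow> 'a set" where
  "run A Orc = outp A (\<lambda>k. answers_hist A Orc (Suc k) ! k)"

text \<open>A randomized SQ algorithm is a probability space P together with a (random)
  deterministic algorithm A. It estimates the support over the model with precision eps
  and probability of success 1 - alpha.\<close>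
definition estimates ::
  "'w measure \<Rightarrow> ('w \<Rightarrow> 'a::euclidean_space sq_alg) \<Rightarrow> 'a measure set \<Rightarrow> real \<Rightarrow> real \<Rightarrow> real \<Rightarrow> bool" where
  "estimates P A Dset \<tau> \<epsilon> \<alpha> \<longleftrightarrow>
     prob_space P \<and> (\<forall>w \<in> space P. valid_alg (A w)) \<and>
     (\<forall>D \<in> Dset. \<forall>Orc. valid_oracle D \<tau> Orc \<longrightarrow>
        measure P {w \<in> space P. dH (support D) (run (A w) Orc) \<le> ereal \<epsilon>} \<ge> 1 - \<alpha>)"

end

theory Submission
  imports Defs
begin

text \<open>Le Cam's two point method. Two manifolds of volume comparable to \<open>1 / fmin\<close> that differ only in a bump of width
  \<open>\<delta> rchmin\<close> and height of order \<open>\<delta>\<^sup>2 rchmin\<close> carry uniform distributions at total variation distance of order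
  \<open>fmin (\<delta> rchmin)\<^sup>d\<close>. For \<open>\<delta>\<^sup>d\<close> of order \<open>\<tau> / (omega d fmin rchmin\<^sup>d)\<close> one oracle is valid for both, although the
  supports are at Hausdorff distance more than \<open>2 \<epsilon>\<close>. The manifolds are closed tubes around a lattice path that visits
  cells of a grid in the ball of radius \<open>R\<close>; the number of cells adjusts the volume. All pieces are straight or
  bent tubes of radius 4 or quartic caps, of curvature at most 1, and the reach is bounded through the criterion
  \<open>\<bar>(q - p) \<bullet> v\<bar> \<le> \<bar>v\<bar> \<bar>q - p\<bar>\<^sup>2 / (2 \<rho>)\<close> for all points \<open>p, q\<close> and normal vectors \<open>v\<close> at \<open>p\<close>.\<close>

subsection \<open>Hausdorff measure\<close>

text \<open>Write V = 1 / fmin. A uniform distribution satisfies the density bounds once the volume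
  of its support lies between V/96 and V. The volume estimates for a chain of cells lose factors
  exponential in d (flat unit balls are only located between omega d / 2^d and omega d, and
  parametrisations have Lipschitz constant up to 2), so the volume cannot be tuned by the number of
  cells alone: a dilation by a factor between rchmin and 4 rchmin, which keeps the reach at least
  rchmin, makes up for them. The bound by 1 in the assumptions says that two caps glued together are
  not yet too large; the minimum over k says that a k-dimensional block of cells inside the ball of
  radius R provides enough volume. Two facts shape the geometry. A hemisphere closes a tube only in
  class C^1, with a jump of the curvature; hence the quartic caps. For d = 1 the tube is a pair of
  curves, so connectedness cannot be shown cell by cell; it is carried from the first cap along
  strands.\<close>

lemma omega_pos: "0 < omega d"
  by (simp add: omega_def)

lemma hausdorff_pre_mono: "A \<subseteq> B \<Longrightarrow> hausdorff_pre d \<delta> A \<le> hausdorff_pre d \<delta> B"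
  unfolding hausdorff_pre_def by (rule INF_superset_mono) auto

lemma hausdorff_pre_antimono: "\<delta> \<le> \<delta>' \<Longrightarrow> hausdorff_pre d \<delta>' A \<le> hausdorff_pre d \<delta> A"
  unfolding hausdorff_pre_def by (rule INF_superset_mono) (use order_trans in blast)+

lemma hausdorff_pre_le:
  assumes "A \<subseteq> (\<Union>i. C i)" "\<And>i. bounded (C i)" "\<And>i. diameter (C i) \<le> \<delta>"
  shows "hausdorff_pre d \<delta> A \<le> (\<Sum>i. ennreal (omega d * (diameter (C i) / 2) ^ d))"
  unfolding hausdorff_pre_def by (rule INF_lower) (use assms in auto)

lemma hausdorff_pre_less_imp_cover:
  assumes "hausdorff_pre d \<delta> A < x"
  obtains C where "A \<subseteq> (\<Union>i. C i)" "\<And>i. bounded (C i)" "\<And>i. diameter (C i) \<le> \<delta>"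
    "(\<Sum>i. ennreal (omega d * (diameter (C i) / 2) ^ d)) < x"
  using assms unfolding hausdorff_pre_def INF_less_iff by auto

lemma hausdorff_pre_empty:
  assumes "1 \<le> d" "0 \<le> \<delta>"
  shows "hausdorff_pre d \<delta> {} = 0"
  using hausdorff_pre_le[of "{}" "\<lambda>_. {}" \<delta> d] assms by (simp add: diameter_def power_0_left)

lemma hausdorff_pre_UN:
  "hausdorff_pre d \<delta> (\<Union>i. A i) \<le> (\<Sum>i::nat. hausdorff_pre d \<delta> (A i))"
proof (rule ennreal_le_epsilon)
  fix e :: real assume fin: "(\<Sum>i. hausdorff_pre d \<delta> (A i)) < top" and e: "0 < e"
  have "\<exists>C. A i \<subseteq> (\<Union>j. C j) \<and> (\<forall>j. bounded (C j) \<and> diameter (C j) \<le> \<delta>) \<and>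
      (\<Sum>j. ennreal (omega d * (diameter (C j) / 2) ^ d)) \<le> hausdorff_pre d \<delta> (A i) + ennreal (e * (1/2)^Suc i)" for i
  proof -
    have "hausdorff_pre d \<delta> (A i) \<le> (\<Sum>i. hausdorff_pre d \<delta> (A i))"
      using sum_le_suminf[of "\<lambda>i. hausdorff_pre d \<delta> (A i)" "{i}"] by simp
    then have "hausdorff_pre d \<delta> (A i) < top" using fin by (rule le_less_trans)
    then have "hausdorff_pre d \<delta> (A i) < hausdorff_pre d \<delta> (A i) + ennreal (e * (1/2)^Suc i)"
      using e by (cases "hausdorff_pre d \<delta> (A i)") (auto simp: ennreal_plus[symmetric] ennreal_less_iff simp del: ennreal_plus)
    from hausdorff_pre_less_imp_cover[OF this] show ?thesis
      by (metis less_imp_le)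
  qed
  then obtain C where C: "\<And>i. A i \<subseteq> (\<Union>j. C i j)" "\<And>i j. bounded (C i j)" "\<And>i j. diameter (C i j) \<le> \<delta>"
    "\<And>i. (\<Sum>j. ennreal (omega d * (diameter (C i j) / 2) ^ d)) \<le> hausdorff_pre d \<delta> (A i) + ennreal (e * (1/2)^Suc i)"
    by metis
  define c where "c p = C (fst p) (snd p)" for p
  define f where "f p = ennreal (omega d * (diameter (c p) / 2) ^ d)" for p
  have "(\<Union>i. A i) \<subseteq> (\<Union>k. c (prod_decode k))"
  proof
    fix x assume "x \<in> (\<Union>i. A i)"
    then obtain i j where "x \<in> C i j" using C(1) by blast
    then have "x \<in> c (prod_decode (prod_encode (i, j)))" by (simp add: c_def)
    then show "x \<in> (\<Union>k. c (prod_decode k))" by blast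
  qed
  then have "hausdorff_pre d \<delta> (\<Union>i. A i) \<le> (\<Sum>k. f (prod_decode k))"
    unfolding f_def by (rule hausdorff_pre_le) (auto simp: c_def C)
  also have "\<dots> = (\<Sum>i. \<Sum>j. f (i, j))"
    by (rule suminf_ennreal_2dimen) simp
  also have "\<dots> \<le> (\<Sum>i. hausdorff_pre d \<delta> (A i) + ennreal (e * (1/2)^Suc i))"
    by (rule suminf_le) (use C(4) in \<open>auto simp: f_def c_def\<close>)
  also have "\<dots> = (\<Sum>i. hausdorff_pre d \<delta> (A i)) + (\<Sum>i. ennreal (e * (1/2)^Suc i))"
    by (rule suminf_add[symmetric]) auto
  also have "(\<Sum>i. ennreal (e * (1/2)^Suc i)) = ennreal e"
    using e sums_mult[OF power_half_series, of e] by (subst suminf_ennreal2) (auto simp: sums_iff)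
  finally show "hausdorff_pre d \<delta> (\<Union>i. A i) \<le> (\<Sum>i. hausdorff_pre d \<delta> (A i)) + ennreal e" .
qed

section \<open>Hausdorff outer measure as the limit of the pre-measures\<close>

lemma hausdorff_pre_le_outer: "0 < \<delta> \<Longrightarrow> hausdorff_pre d \<delta> A \<le> hausdorff_outer d A"
  unfolding hausdorff_outer_def by (rule SUP_upper) auto

lemma hausdorff_outer_leI:
  "(\<And>\<delta>. 0 < \<delta> \<Longrightarrow> hausdorff_pre d \<delta> A \<le> x) \<Longrightarrow> hausdorff_outer d A \<le> x"
  unfolding hausdorff_outer_def by (rule SUP_least) auto

lemma hausdorff_outer_mono: "A \<subseteq> B \<Longrightarrow> hausdorff_outer d A \<le> hausdorff_outer d B"
  by (rule hausdorff_outer_leI) (meson hausdorff_pre_mono hausdorff_pre_le_outer order_trans)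

lemma hausdorff_outer_empty: "1 \<le> d \<Longrightarrow> hausdorff_outer d {} = 0"
  unfolding hausdorff_outer_def by (auto simp: hausdorff_pre_empty)

lemma hausdorff_outer_UN:
  "hausdorff_outer d (\<Union>i. A i) \<le> (\<Sum>i::nat. hausdorff_outer d (A i))"
proof (rule hausdorff_outer_leI)
  fix \<delta> :: real assume "0 < \<delta>"
  then have "(\<Sum>i. hausdorff_pre d \<delta> (A i)) \<le> (\<Sum>i. hausdorff_outer d (A i))"
    by (intro suminf_le hausdorff_pre_le_outer) auto
  then show "hausdorff_pre d \<delta> (\<Union>i. A i) \<le> (\<Sum>i. hausdorff_outer d (A i))"
    by (rule order_trans[OF hausdorff_pre_UN])
qed

lemma hausdorff_outer_Un:
  assumes "1 \<le> d"
  shows "hausdorff_outer d (A \<union> B) \<le> hausdorff_outer d A + hausdorff_outer d B"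
proof -
  have "hausdorff_outer d (\<Union>i. binaryset A B i) \<le> (\<Sum>i. hausdorff_outer d (binaryset A B i))"
    by (rule hausdorff_outer_UN)
  then show ?thesis
    using suminf_binaryset_eq[of "hausdorff_outer d" A B] assms
    by (simp add: UN_binaryset_eq hausdorff_outer_empty)
qed

lemma hausdorff_outer_finite_UN:
  assumes "1 \<le> d" "finite I"
  shows "hausdorff_outer d (\<Union>i\<in>I. A i) \<le> (\<Sum>i\<in>I. hausdorff_outer d (A i))"
  using assms(2)
proof induction
  case empty then show ?case using hausdorff_outer_empty[OF assms(1)] by simp
next
  case (insert i I)
  have "hausdorff_outer d (\<Union>i\<in>insert i I. A i) \<le> hausdorff_outer d (A i) + hausdorff_outer d (\<Union>i\<in>I. A i)"
    using hausdorff_outer_Un[OF assms(1), of "A i" "\<Union>i\<in>I. A i"] by simp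
  also have "\<dots> \<le> hausdorff_outer d (A i) + (\<Sum>i\<in>I. hausdorff_outer d (A i))"
    by (intro add_left_mono insert.IH)
  finally show ?case using insert by simp
qed

text \<open>A covering set of diameter at most \<delta> cannot meet both \<open>A\<close> and
  \<open>B\<close>, so every cover splits into two. Members that miss \<open>A\<close> (or
  \<open>B\<close>) are replaced by {} and not dropped, which keeps the index set; {} has weight 0
  because \<open>d\<close> is positive.\<close>

lemma hausdorff_pre_add_separated:
  assumes "1 \<le> d" "0 \<le> \<delta>" and sep: "\<And>a b. a \<in> A \<Longrightarrow> b \<in> B \<Longrightarrow> \<delta> < dist a b"
  shows "hausdorff_pre d \<delta> A + hausdorff_pre d \<delta> B \<le> hausdorff_pre d \<delta> (A \<union> B)"
  unfolding hausdorff_pre_def[of d \<delta> "A \<union> B"]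
proof (rule INF_greatest, clarsimp)
  fix C :: "nat \<Rightarrow> 'a set"
  assume C: "A \<subseteq> (\<Union>i. C i)" "B \<subseteq> (\<Union>i. C i)" "\<forall>i. bounded (C i) \<and> diameter (C i) \<le> \<delta>"
  define f where "f S = ennreal (omega d * (diameter S / 2) ^ d)" for S :: "'a set"
  have f0: "f {} = 0" using assms(1) by (simp add: f_def diameter_def power_0_left)
  define CA where "CA i = (if C i \<inter> A = {} then {} else C i)" for i
  define CB where "CB i = (if C i \<inter> B = {} then {} else C i)" for i
  have "hausdorff_pre d \<delta> A \<le> (\<Sum>i. f (CA i))" unfolding f_def
  proof (rule hausdorff_pre_le)
    show "A \<subseteq> (\<Union>i. CA i)"
    proof
      fix x assume x: "x \<in> A"
      then obtain i where "x \<in> C i" using C by blast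
      with x have "x \<in> CA i" by (auto simp: CA_def)
      then show "x \<in> (\<Union>i. CA i)" by blast
    qed
  qed (use C assms(2) in \<open>auto simp: CA_def diameter_def[of "{}"]\<close>)
  moreover have "hausdorff_pre d \<delta> B \<le> (\<Sum>i. f (CB i))" unfolding f_def
  proof (rule hausdorff_pre_le)
    show "B \<subseteq> (\<Union>i. CB i)"
    proof
      fix x assume x: "x \<in> B"
      then obtain i where "x \<in> C i" using C by blast
      with x have "x \<in> CB i" by (auto simp: CB_def)
      then show "x \<in> (\<Union>i. CB i)" by blast
    qed
  qed (use C assms(2) in \<open>auto simp: CB_def diameter_def[of "{}"]\<close>)
  ultimately have "hausdorff_pre d \<delta> A + hausdorff_pre d \<delta> B \<le> (\<Sum>i. f (CA i)) + (\<Sum>i. f (CB i))"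
    by (rule add_mono)
  also have "\<dots> = (\<Sum>i. f (CA i) + f (CB i))" by (rule suminf_add) auto
  also have "\<dots> \<le> (\<Sum>i. f (C i))"
  proof (rule suminf_le)
    fix i
    have "C i \<inter> A = {} \<or> C i \<inter> B = {}"
    proof (rule ccontr)
      assume "\<not> ?thesis"
      then obtain a b where "a \<in> C i" "a \<in> A" "b \<in> C i" "b \<in> B" by auto
      then have "\<delta> < dist a b" "dist a b \<le> diameter (C i)"
        using sep[of a b] diameter_bounded_bound[of "C i" a b] C(3) by auto
      then show False using C(3) by (meson not_le order_trans)
    qed
    then show "f (CA i) + f (CB i) \<le> f (C i)" by (auto simp: CA_def CB_def f0)
  qed auto
  finally show "hausdorff_pre d \<delta> A + hausdorff_pre d \<delta> B \<le> (\<Sum>i. ennreal (omega d * (diameter (C i) / 2) ^ d))"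
    by (simp add: f_def)
qed

lemma hausdorff_outer_add_separated:
  assumes "1 \<le> d" "0 < e" and sep: "\<And>a b. a \<in> A \<Longrightarrow> b \<in> B \<Longrightarrow> e \<le> dist a b"
  shows "hausdorff_outer d A + hausdorff_outer d B \<le> hausdorff_outer d (A \<union> B)"
proof -
  have "hausdorff_outer d A + hausdorff_outer d B =
        (SUP \<delta>\<in>{0<..}. hausdorff_pre d \<delta> A + hausdorff_pre d \<delta> B)"
    unfolding hausdorff_outer_def
  proof (rule SUP_add_directed_ennreal[symmetric])
    fix i j :: real assume "i \<in> {0<..}" "j \<in> {0<..}"
    then show "\<exists>k\<in>{0<..}. hausdorff_pre d i A + hausdorff_pre d j B \<le> hausdorff_pre d k A + hausdorff_pre d k B"
      by (intro bexI[of _ "min i j"] add_mono hausdorff_pre_antimono) auto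
  qed
  also have "\<dots> \<le> hausdorff_outer d (A \<union> B)"
  proof (rule SUP_least)
    fix \<delta> :: real assume "\<delta> \<in> {0<..}"
    then have m: "0 < min \<delta> (e/2)" using assms(2) by auto
    have "hausdorff_pre d \<delta> A + hausdorff_pre d \<delta> B
        \<le> hausdorff_pre d (min \<delta> (e/2)) A + hausdorff_pre d (min \<delta> (e/2)) B"
      by (intro add_mono hausdorff_pre_antimono) auto
    also have "\<dots> \<le> hausdorff_pre d (min \<delta> (e/2)) (A \<union> B)"
      by (rule hausdorff_pre_add_separated) (use assms m sep in fastforce)+
    also have "\<dots> \<le> hausdorff_outer d (A \<union> B)" by (rule hausdorff_pre_le_outer[OF m])
    finally show "hausdorff_pre d \<delta> A + hausdorff_pre d \<delta> B \<le> hausdorff_outer d (A \<union> B)" .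
  qed
  finally show ?thesis .
qed

text \<open>The gap may depend on \<open>j\<close>: each induction step only separates
  \<open>R m\<close> from the union of its predecessors. Every second shell around a closed set has
  such gaps, but no uniform one.\<close>

lemma hausdorff_outer_sum_separated:
  fixes R :: "nat \<Rightarrow> 'a::metric_space set"
  assumes "1 \<le> d" and sep: "\<And>j. \<exists>e>0. \<forall>i<j. \<forall>a\<in>R i. \<forall>b\<in>R j. e \<le> dist a b"
  shows "(\<Sum>i<m. hausdorff_outer d (R i)) \<le> hausdorff_outer d (\<Union>i<m. R i)"
proof (induction m)
  case (Suc m)
  obtain e where e: "0 < e" "\<forall>i<m. \<forall>a\<in>R i. \<forall>b\<in>R m. e \<le> dist a b" using sep by blast
  have "(\<Sum>i<Suc m. hausdorff_outer d (R i)) \<le> hausdorff_outer d (\<Union>i<m. R i) + hausdorff_outer d (R m)"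
    using Suc.IH by (simp add: add_right_mono)
  also have "\<dots> \<le> hausdorff_outer d ((\<Union>i<m. R i) \<union> R m)"
    by (rule hausdorff_outer_add_separated[OF assms(1) e(1)]) (use e in auto)
  also have "(\<Union>i<m. R i) \<union> R m = (\<Union>i<Suc m. R i)" by (auto simp: less_Suc_eq)
  finally show ?case .
qed simp

text \<open>Caratheodory's criterion: exhaust the complement of \<open>F\<close> by the points at distance at least
  \<open>1/(k+1)\<close>; the shells in between have a convergent sum because every second one is separated.\<close>
lemma hausdorff_outer_closed_split:
  fixes F X :: "'a::metric_space set"
  assumes d: "1 \<le> d" and F: "closed F"
  shows "hausdorff_outer d (X \<inter> F) + hausdorff_outer d (X - F) \<le> hausdorff_outer d X"
proof (cases "F = {} \<or> hausdorff_outer d X = \<infinity>")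
  case True
  then show ?thesis using hausdorff_outer_empty[OF d] by auto
next
  case False
  then have Fne: "F \<noteq> {}" and fin: "hausdorff_outer d X < \<infinity>" by (auto simp: less_top)
  define Y where "Y k = {x \<in> X. 1 / real (Suc k) \<le> infdist x F}" for k
  define R where "R k = {x \<in> X. 1 / real (Suc (Suc k)) \<le> infdist x F \<and> infdist x F < 1 / real (Suc k)}" for k
  have infd: "infdist a F - infdist b F \<le> dist a b" for a b
    using infdist_triangle[of a F b] by simp
  have half: "(\<Sum>k<m. hausdorff_outer d (R (2*k + s))) \<le> hausdorff_outer d X" for m s
  proof -
    have "(\<Sum>k<m. hausdorff_outer d (R (2*k + s))) \<le> hausdorff_outer d (\<Union>k<m. R (2*k + s))"
    proof (rule hausdorff_outer_sum_separated[OF d])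
      fix j :: nat
      \<comment> \<open>For j = 0 there is no earlier shell. Otherwise the shell
        \<open>2*i+s\<close> with i < j keeps distance at least 1 / (2j+s) from \<open>F\<close>,
        while every point of the shell \<open>2*j+s\<close> is closer than 1 / (2j+s+1). Consecutive
        shells can touch, hence the step 2 in the index.\<close>
      let ?e = "if j = 0 then 1 else 1 / real (2*j+s) - 1 / real (Suc (2*j+s))"
      show "\<exists>e>0. \<forall>i<j. \<forall>a\<in>R (2*i+s). \<forall>b\<in>R (2*j+s). e \<le> dist a b"
      proof (intro exI[of _ ?e] conjI allI impI ballI)
        show "0 < ?e" by (auto intro!: divide_strict_left_mono)
        fix i a b assume "i < j" "a \<in> R (2*i+s)" "b \<in> R (2*j+s)"
        then have "1 / real (2*j+s) \<le> 1 / real (Suc (Suc (2*i+s)))"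
          by (intro divide_left_mono) auto
        then show "?e \<le> dist a b"
          using infd[of a b] \<open>i < j\<close> \<open>a \<in> _\<close> \<open>b \<in> _\<close> by (auto simp: R_def)
      qed
    qed
    also have "\<dots> \<le> hausdorff_outer d X" by (rule hausdorff_outer_mono) (auto simp: R_def)
    finally show ?thesis .
  qed
  have "(\<Sum>k<2*m. hausdorff_outer d (R k)) = (\<Sum>k<m. hausdorff_outer d (R (2*k + 0))) + (\<Sum>k<m. hausdorff_outer d (R (2*k + 1)))" for m
    by (induction m) (auto simp: algebra_simps)
  then have "(\<Sum>k<2*m. hausdorff_outer d (R k)) \<le> hausdorff_outer d X + hausdorff_outer d X" for m
    using add_mono[OF half[where m = m and s = 0] half[where m = m and s = 1]] by simp
  then have sumR: "(\<Sum>k<m. hausdorff_outer d (R k)) \<le> hausdorff_outer d X + hausdorff_outer d X" for m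
    by (meson order_trans sum_mono2 finite_lessThan lessThan_subset_iff zero_le
        mult_2 le_add1 order_trans[OF le_add1[of m m] eq_refl[OF mult_2[symmetric]]])
  then have tot: "(\<Sum>k. hausdorff_outer d (R k)) \<le> hausdorff_outer d X + hausdorff_outer d X"
    by (intro suminf_le_const) auto
  have tfin: "(\<Sum>k. hausdorff_outer d (R k)) \<noteq> top"
    using tot fin by (metis ennreal_add_eq_top infinity_ennreal_def less_irrefl top_unique)
  \<comment> \<open>The partial sum is added on both sides in place of writing the tail as a
    difference in \<open>ennreal\<close>. As k grows, the left side also acquires the full shell
    sum, which is finite and cancels at the end.\<close>
  have step: "hausdorff_outer d (X \<inter> F) + hausdorff_outer d (X - F) + (\<Sum>j<k. hausdorff_outer d (R j))
      \<le> hausdorff_outer d X + (\<Sum>j. hausdorff_outer d (R j))" for k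
  proof -
    have "X - F \<subseteq> Y k \<union> (\<Union>j. R (j + k))"
    proof
      fix x assume x: "x \<in> X - F"
      then have pos: "0 < infdist x F" using F Fne by (metis DiffE in_closed_iff_infdist_zero infdist_nonneg less_eq_real_def)
      then obtain n where "1 / real (Suc n) < infdist x F" using nat_approx_posE by metis
      \<comment> \<open>Minimality of n puts x into the shell \<open>R (n - 1)\<close>, where the
        distance to \<open>F\<close> runs from 1/(n+1) up to 1/n.\<close>
      define n where "n = (LEAST n. 1 / real (Suc n) \<le> infdist x F)"
      have n: "1 / real (Suc n) \<le> infdist x F" unfolding n_def
        by (rule LeastI_ex) (meson \<open>1 / real (Suc _) < infdist x F\<close> less_imp_le)
      show "x \<in> Y k \<union> (\<Union>j. R (j + k))"
      proof (cases "n \<le> k")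
        case True
        then have "1 / real (Suc k) \<le> 1 / real (Suc n)" by (intro divide_left_mono) auto
        with n x show ?thesis by (auto simp: Y_def)
      next
        case False
        then have "\<not> 1 / real (Suc (n-1)) \<le> infdist x F" unfolding n_def by (intro not_less_Least) auto
        with n x False have "x \<in> R (n - 1)" by (auto simp: R_def)
        then have "x \<in> R ((n - 1 - k) + k)" using False by simp
        then show ?thesis by blast
      qed
    qed
    then have "hausdorff_outer d (X - F) \<le> hausdorff_outer d (Y k \<union> (\<Union>j. R (j + k)))"
      by (rule hausdorff_outer_mono)
    also have "\<dots> \<le> hausdorff_outer d (Y k) + (\<Sum>j. hausdorff_outer d (R (j + k)))"
      by (rule order_trans[OF hausdorff_outer_Un[OF d] add_left_mono[OF hausdorff_outer_UN]])
    finally have 1: "hausdorff_outer d (X - F) \<le> hausdorff_outer d (Y k) + (\<Sum>j. hausdorff_outer d (R (j + k)))" .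
    have "hausdorff_outer d (X \<inter> F) + hausdorff_outer d (Y k) \<le> hausdorff_outer d (X \<inter> F \<union> Y k)"
    proof (rule hausdorff_outer_add_separated[OF d, of "1 / real (Suc k)"])
      fix a b assume "a \<in> X \<inter> F" "b \<in> Y k"
      then show "1 / real (Suc k) \<le> dist a b" using infd[of b a] by (auto simp: Y_def dist_commute)
    qed auto
    also have "\<dots> \<le> hausdorff_outer d X" by (rule hausdorff_outer_mono) (auto simp: Y_def)
    finally have 2: "hausdorff_outer d (X \<inter> F) + hausdorff_outer d (Y k) \<le> hausdorff_outer d X" .
    have 3: "(\<Sum>j. hausdorff_outer d (R (j + k))) + (\<Sum>j<k. hausdorff_outer d (R j)) = (\<Sum>j. hausdorff_outer d (R j))"
    proof (induction k)
      case (Suc k)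
      have "(\<lambda>j. hausdorff_outer d (R (Suc j + k))) sums (\<Sum>j. hausdorff_outer d (R (j + Suc k)))"
        by (simp add: summable_sums)
      then have "(\<Sum>j. hausdorff_outer d (R (j + k))) = (\<Sum>j. hausdorff_outer d (R (j + Suc k))) + hausdorff_outer d (R k)"
        using sums_Suc[of "\<lambda>j. hausdorff_outer d (R (j + k))"] by (auto simp: sums_iff)
      then show ?case using Suc by (simp add: ac_simps)
    qed simp
    have "hausdorff_outer d (X \<inter> F) + hausdorff_outer d (X - F) + (\<Sum>j<k. hausdorff_outer d (R j))
       \<le> (hausdorff_outer d (X \<inter> F) + hausdorff_outer d (Y k)) + ((\<Sum>j. hausdorff_outer d (R (j + k))) + (\<Sum>j<k. hausdorff_outer d (R j)))"
      using add_mono[OF add_left_mono[OF 1, of "hausdorff_outer d (X \<inter> F)"] order_refl[of "\<Sum>j<k. hausdorff_outer d (R j)"]]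
      by (simp only: add.assoc)
    also have "\<dots> \<le> hausdorff_outer d X + (\<Sum>j. hausdorff_outer d (R j))"
      unfolding 3 by (rule add_right_mono[OF 2])
    finally show ?thesis .
  qed
  have "(\<lambda>k. hausdorff_outer d (X \<inter> F) + hausdorff_outer d (X - F) + (\<Sum>j<k. hausdorff_outer d (R j)))
     \<longlonglongrightarrow> hausdorff_outer d (X \<inter> F) + hausdorff_outer d (X - F) + (\<Sum>j. hausdorff_outer d (R j))"
    by (intro tendsto_add tendsto_const summable_LIMSEQ) auto
  then have "hausdorff_outer d (X \<inter> F) + hausdorff_outer d (X - F) + (\<Sum>j. hausdorff_outer d (R j))
     \<le> hausdorff_outer d X + (\<Sum>j. hausdorff_outer d (R j))"
    by (rule LIMSEQ_le_const2) (use step in auto)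
  then show ?thesis using tfin by (simp add: add.commute ennreal_add_left_cancel_le)
qed

section \<open>Caratheodory extension to the Borel sets\<close>

lemma measure_space_hausdorff_outer:
  assumes d: "1 \<le> d"
  shows "measure_space UNIV (sets borel) (hausdorff_outer d :: 'a::metric_space set \<Rightarrow> ennreal)"
proof -
  let ?f = "hausdorff_outer d :: 'a set \<Rightarrow> ennreal"
  interpret P: sigma_algebra UNIV "Pow (UNIV::'a set)" by (rule sigma_algebra_Pow)
  have "outer_measure_space (Pow UNIV) ?f"
    unfolding outer_measure_space_def positive_def increasing_def countably_subadditive_def
    using hausdorff_outer_empty[OF d] by (auto simp: hausdorff_outer_mono hausdorff_outer_UN)
  from P.caratheodory_lemma[OF this]
  have ms: "measure_space UNIV (lambda_system UNIV (Pow UNIV) ?f) ?f" .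
  have sub: "{F. closed F} \<subseteq> lambda_system UNIV (Pow UNIV) ?f"
  proof (clarsimp simp: lambda_system_def)
    fix F X :: "'a set" assume "closed F"
    then have "?f (F \<inter> X) + ?f (X - F) \<le> ?f X"
      using hausdorff_outer_closed_split[OF d, of F X] by (simp add: Int_commute)
    moreover have "?f X \<le> ?f (F \<inter> X) + ?f (X - F)"
      by (rule order_trans[OF hausdorff_outer_mono hausdorff_outer_Un[OF d]]) auto
    ultimately show "?f (F \<inter> X) + ?f ((UNIV - F) \<inter> X) = ?f X"
      by (simp add: Diff_eq Int_commute antisym)
  qed
  have sl: "sigma_algebra UNIV (lambda_system UNIV (Pow UNIV) ?f)" using ms by (simp add: measure_space_def)
  have "sets borel = sigma_sets UNIV {F::'a set. closed F}"
    by (subst borel_eq_closed) (simp add: sets_measure_of)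
  also have "\<dots> \<subseteq> lambda_system UNIV (Pow UNIV) ?f"
    by (rule sigma_algebra.sigma_sets_subset[OF sl sub])
  finally show ?thesis
    by (rule measure_down[OF ms, rotated]) (metis sets.sigma_algebra_axioms space_borel)
qed

lemma sets_hausdorff_measure [simp, measurable_cong]: "sets (hausdorff_measure d) = sets borel"
  by (simp add: hausdorff_measure_def sets_measure_of sets.sigma_sets_eq[of borel, simplified])

lemma space_hausdorff_measure [simp]: "space (hausdorff_measure d) = UNIV"
  by (simp add: hausdorff_measure_def space_measure_of_conv)

lemma emeasure_hausdorff_measure:
  assumes "1 \<le> d" "A \<in> sets borel"
  shows "emeasure (hausdorff_measure d) A = hausdorff_outer d A"
proof -
  have "measure_space UNIV (sets borel) (hausdorff_outer d :: 'a set \<Rightarrow> ennreal)"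
    by (rule measure_space_hausdorff_outer[OF assms(1)])
  then show ?thesis
    unfolding hausdorff_measure_def using assms(2)
    by (intro emeasure_measure_of_sigma) (auto simp: measure_space_def)
qed

lemma hausdorff_outer_Un_disjoint:
  assumes "1 \<le> d" "A \<in> sets borel" "B \<in> sets borel" "A \<inter> B = {}"
  shows "hausdorff_outer d (A \<union> B) = hausdorff_outer d A + hausdorff_outer d B"
  using assms plus_emeasure[of A "hausdorff_measure d" B] by (simp add: emeasure_hausdorff_measure)

lemma hausdorff_outer_UN_disjoint:
  assumes "1 \<le> d" "finite I" "\<And>i. i \<in> I \<Longrightarrow> A i \<in> sets borel" "disjoint_family_on A I"
  shows "hausdorff_outer d (\<Union>i\<in>I. A i) = (\<Sum>i\<in>I. hausdorff_outer d (A i))"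
proof -
  have "(\<Sum>i\<in>I. emeasure (hausdorff_measure d) (A i)) = emeasure (hausdorff_measure d) (\<Union>i\<in>I. A i)"
    by (rule sum_emeasure) (use assms in auto)
  moreover have "(\<Union>i\<in>I. A i) \<in> sets borel" using assms by auto
  ultimately show ?thesis using assms by (simp add: emeasure_hausdorff_measure)
qed

text \<open>Images of the members of a cover of \<open>A\<close> cover the image of
  \<open>A\<close>; each member is first cut down to \<open>A\<close>, the only place where the
  Lipschitz bound is available. All volume bounds for curved pieces are reduced to flat balls and
  straight tubes in this way.\<close>

lemma hausdorff_outer_lipschitz_image:
  fixes f :: "'a::metric_space \<Rightarrow> 'b::metric_space"
  assumes L: "0 < L" and lip: "\<And>x y. x \<in> A \<Longrightarrow> y \<in> A \<Longrightarrow> dist (f x) (f y) \<le> L * dist x y"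
  shows "hausdorff_outer d (f ` A) \<le> ennreal (L ^ d) * hausdorff_outer d A"
proof (rule hausdorff_outer_leI)
  fix \<delta> :: real assume \<delta>: "0 < \<delta>"
  have inv: "ennreal (L ^ d) * (ennreal (inverse (L ^ d)) * x) = x" for x
    using L by (simp add: mult.assoc[symmetric] ennreal_mult'[symmetric])
  \<comment> \<open>Dividing by L^d first leaves the infimum over the covers of \<open>A\<close>
    alone on the right, where it can be bounded cover by cover.\<close>
  have "ennreal (inverse (L ^ d)) * hausdorff_pre d \<delta> (f ` A) \<le> hausdorff_pre d (\<delta> / L) A"
    unfolding hausdorff_pre_def[of d "\<delta>/L" A]
    proof (rule INF_greatest, clarsimp)
      fix C :: "nat \<Rightarrow> 'a set" assume C: "A \<subseteq> (\<Union>i. C i)" "\<forall>i. bounded (C i) \<and> diameter (C i) \<le> \<delta> / L"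
      define C' where "C' i = f ` (C i \<inter> A)" for i
      have C': "bounded (C' i) \<and> diameter (C' i) \<le> L * diameter (C i)" for i
      proof -
        have dd: "dist x y \<le> L * diameter (C i)" if xy: "x \<in> C' i" "y \<in> C' i" for x y
        proof -
          obtain a b where ab: "a \<in> C i" "a \<in> A" "b \<in> C i" "b \<in> A" "x = f a" "y = f b"
            using xy by (auto simp: C'_def)
          have "dist x y \<le> L * dist a b" using ab lip by auto
          also have "\<dots> \<le> L * diameter (C i)"
            using ab C L by (intro mult_left_mono diameter_bounded_bound) auto
          finally show ?thesis .
        qed
        have "bounded (C' i)" using dd by (auto simp: bounded_two_points)
        moreover have "diameter (C' i) \<le> L * diameter (C i)"
        proof (cases "C' i = {}")
          case True
          then show ?thesis using L diameter_ge_0[of "C i"] C by (simp add: diameter_def[of "{}"])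
        next
          case False
          then show ?thesis unfolding diameter_def[of "C' i"] by (auto intro!: cSUP_least dd)
        qed
        ultimately show ?thesis by blast
      qed
      have "hausdorff_pre d \<delta> (f ` A) \<le> (\<Sum>i. ennreal (omega d * (diameter (C' i) / 2) ^ d))"
      proof (rule hausdorff_pre_le)
        show "f ` A \<subseteq> (\<Union>i. C' i)" using C(1) by (fastforce simp: C'_def)
        fix i show "bounded (C' i)" using C' by blast
        have "diameter (C' i) \<le> L * diameter (C i)" using C' by blast
        also have "\<dots> \<le> L * (\<delta> / L)" using C L by (intro mult_left_mono) auto
        finally show "diameter (C' i) \<le> \<delta>" using L by simp
      qed
      also have "\<dots> \<le> (\<Sum>i. ennreal (L ^ d) * ennreal (omega d * (diameter (C i) / 2) ^ d))"
      proof (rule suminf_le)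
        fix i
        have "omega d * (diameter (C' i) / 2) ^ d \<le> omega d * (L * diameter (C i) / 2) ^ d"
          using C'[of i] omega_pos[of d] by (intro mult_left_mono power_mono) (auto simp: diameter_ge_0)
        also have "\<dots> = L ^ d * (omega d * (diameter (C i) / 2) ^ d)" by (simp add: power_mult_distrib power_divide)
        finally show "ennreal (omega d * (diameter (C' i) / 2) ^ d) \<le> ennreal (L ^ d) * ennreal (omega d * (diameter (C i) / 2) ^ d)"
          using L by (simp add: ennreal_mult'[symmetric] ennreal_leI)
      qed auto
      also have "\<dots> = ennreal (L ^ d) * (\<Sum>i. ennreal (omega d * (diameter (C i) / 2) ^ d))" by simp
      finally have "ennreal (inverse (L ^ d)) * hausdorff_pre d \<delta> (f ` A)
          \<le> ennreal (inverse (L ^ d)) * (ennreal (L ^ d) * (\<Sum>i. ennreal (omega d * (diameter (C i) / 2) ^ d)))"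
        by (rule mult_left_mono) simp
      then show "ennreal (inverse (L ^ d)) * hausdorff_pre d \<delta> (f ` A) \<le> (\<Sum>i. ennreal (omega d * (diameter (C i) / 2) ^ d))"
        using inv by (simp add: mult.left_commute)
    qed
  then have "ennreal (L ^ d) * (ennreal (inverse (L ^ d)) * hausdorff_pre d \<delta> (f ` A)) \<le> ennreal (L ^ d) * hausdorff_pre d (\<delta> / L) A"
    by (rule mult_left_mono) simp
  then have "hausdorff_pre d \<delta> (f ` A) \<le> ennreal (L ^ d) * hausdorff_pre d (\<delta> / L) A" by (simp add: inv)
  also have "\<dots> \<le> ennreal (L ^ d) * hausdorff_outer d A"
    using L \<delta> by (intro mult_left_mono hausdorff_pre_le_outer) auto
  finally show "hausdorff_pre d \<delta> (f ` A) \<le> ennreal (L ^ d) * hausdorff_outer d A" .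
qed

subsection \<open>Orthonormal families and flat balls\<close>

definition orthonormal :: "'a::euclidean_space set \<Rightarrow> bool" where
  "orthonormal Z \<longleftrightarrow> finite Z \<and> (\<forall>a\<in>Z. \<forall>b\<in>Z. a \<bullet> b = (if a = b then 1 else 0))"

lemma orthonormal_finite: "orthonormal Z \<Longrightarrow> finite Z"
  by (simp add: orthonormal_def)

lemma orthonormal_inner: "orthonormal Z \<Longrightarrow> a \<in> Z \<Longrightarrow> b \<in> Z \<Longrightarrow> a \<bullet> b = (if a = b then 1 else 0)"
  by (simp add: orthonormal_def)

lemma orthonormal_norm: "orthonormal Z \<Longrightarrow> a \<in> Z \<Longrightarrow> norm a = 1"
  by (simp add: orthonormal_def norm_eq_1)

lemma orthonormal_subset: "orthonormal Z \<Longrightarrow> Y \<subseteq> Z \<Longrightarrow> orthonormal Y"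
  unfolding orthonormal_def by (meson finite_subset subsetD)

lemma orthonormal_Basis: "orthonormal Basis"
  by (simp add: orthonormal_def inner_Basis)

lemma orthonormal_sum_inner:
  assumes "orthonormal Z" "b \<in> Z"
  shows "(\<Sum>a\<in>Z. c a *\<^sub>R a) \<bullet> b = c b"
proof -
  have "(\<Sum>a\<in>Z. c a *\<^sub>R a) \<bullet> b = (\<Sum>a\<in>Z. if a = b then c a else 0)"
    unfolding inner_sum_left using assms by (intro sum.cong) (auto simp: orthonormal_inner)
  then show ?thesis using assms by (simp add: orthonormal_finite)
qed

lemma orthonormal_norm_sum:
  assumes "orthonormal Z"
  shows "(norm (\<Sum>a\<in>Z. c a *\<^sub>R a))\<^sup>2 = (\<Sum>a\<in>Z. (c a)\<^sup>2)"
proof -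
  have "(norm (\<Sum>a\<in>Z. c a *\<^sub>R a))\<^sup>2 = (\<Sum>b\<in>Z. (\<Sum>a\<in>Z. c a *\<^sub>R a) \<bullet> (c b *\<^sub>R b))"
    unfolding power2_norm_eq_inner by (rule inner_sum_right)
  also have "\<dots> = (\<Sum>b\<in>Z. (c b)\<^sup>2)"
    by (intro sum.cong refl) (simp only: inner_scaleR_right orthonormal_sum_inner[OF assms] power2_eq_square)
  finally show ?thesis .
qed

lemma orthonormal_span_expansion:
  assumes "orthonormal Z" "x \<in> span Z"
  shows "(\<Sum>a\<in>Z. (x \<bullet> a) *\<^sub>R a) = x"
proof -
  obtain c where x: "x = (\<Sum>a\<in>Z. c a *\<^sub>R a)"
    using assms by (auto simp: span_finite orthonormal_finite)
  show ?thesis unfolding x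
    by (intro sum.cong refl) (simp only: orthonormal_sum_inner[OF assms(1)])
qed

lemma orthonormal_span_norm:
  assumes "orthonormal Z" "x \<in> span Z"
  shows "(norm x)\<^sup>2 = (\<Sum>a\<in>Z. (x \<bullet> a)\<^sup>2)"
  using orthonormal_norm_sum[OF assms(1), of "\<lambda>a. x \<bullet> a"] orthonormal_span_expansion[OF assms] by simp

lemma orthonormal_bessel:
  assumes "orthonormal Z"
  shows "(\<Sum>a\<in>Z. (x \<bullet> a)\<^sup>2) \<le> (norm x)\<^sup>2"
proof -
  define y where "y = (\<Sum>a\<in>Z. (x \<bullet> a) *\<^sub>R a)"
  have "x \<bullet> y = (\<Sum>a\<in>Z. (x \<bullet> a)\<^sup>2)" by (simp add: y_def inner_sum_right power2_eq_square)
  moreover have "(norm y)\<^sup>2 = (\<Sum>a\<in>Z. (x \<bullet> a)\<^sup>2)" unfolding y_def by (rule orthonormal_norm_sum[OF assms])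
  moreover have "0 \<le> (norm (x - y))\<^sup>2" by simp
  ultimately show ?thesis
    by (simp add: power2_norm_eq_inner inner_diff_left inner_diff_right inner_commute)
qed

lemma orthonormal_independent:
  assumes "orthonormal Z" shows "independent Z"
proof (rule pairwise_orthogonal_independent)
  show "pairwise orthogonal Z" using assms by (auto simp: pairwise_def orthogonal_def orthonormal_def)
  show "0 \<notin> Z" using assms by (force simp: orthonormal_def)
qed

lemma orthonormal_dim_span: "orthonormal Z \<Longrightarrow> dim (span Z) = card Z"
  by (simp add: dim_eq_card_independent orthonormal_independent dim_span)

lemma orthonormal_span_UNIV:
  fixes Z :: "'a::euclidean_space set"
  assumes "orthonormal Z" "card Z = DIM('a)" shows "span Z = UNIV"
  using assms by (metis dim_eq_full orthonormal_dim_span span_span)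

section \<open>Flat balls and their volumes\<close>

definition flat_ball :: "'a::euclidean_space set \<Rightarrow> real \<Rightarrow> 'a set" where
  "flat_ball Z r = {x \<in> span Z. norm x \<le> r}"

lemma closed_flat_ball: "closed (flat_ball Z r)"
proof -
  have "flat_ball Z r = span Z \<inter> cball 0 r" by (auto simp: flat_ball_def)
  then show ?thesis by (simp add: closed_Int closed_subspace)
qed

lemma borel_flat_ball [measurable]: "flat_ball Z r \<in> sets borel"
  by (simp add: closed_flat_ball borel_closed)

lemma flat_ball_scale:
  assumes "0 < s" shows "(\<lambda>x. s *\<^sub>R x) ` flat_ball Z r = flat_ball Z (s * r)"
proof (safe)
  fix x assume "x \<in> flat_ball Z (s * r)"
  then have "x = s *\<^sub>R (x /\<^sub>R s)" "x /\<^sub>R s \<in> flat_ball Z r"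
    using assms by (auto simp: flat_ball_def span_mul field_simps)
  then show "x \<in> (\<lambda>x. s *\<^sub>R x) ` flat_ball Z r" by blast
qed (use assms in \<open>auto simp: flat_ball_def span_mul\<close>)

lemma hausdorff_outer_scale_le:
  fixes A :: "'a::real_normed_vector set"
  assumes "0 < s" shows "hausdorff_outer d ((\<lambda>x. s *\<^sub>R x) ` A) \<le> ennreal (s ^ d) * hausdorff_outer d A"
  by (rule hausdorff_outer_lipschitz_image[OF assms])
     (use assms in \<open>simp add: dist_norm flip: scaleR_diff_right\<close>)

lemma hausdorff_outer_scale:
  fixes A :: "'a::real_normed_vector set"
  assumes s: "0 < s" shows "hausdorff_outer d ((\<lambda>x. s *\<^sub>R x) ` A) = ennreal (s ^ d) * hausdorff_outer d A"
proof (rule antisym[OF hausdorff_outer_scale_le[OF s]])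
  have "A = (\<lambda>x. inverse s *\<^sub>R x) ` (\<lambda>x. s *\<^sub>R x) ` A" using s by (auto simp: image_image)
  then have "hausdorff_outer d A \<le> ennreal (inverse s ^ d) * hausdorff_outer d ((\<lambda>x. s *\<^sub>R x) ` A)"
    using hausdorff_outer_scale_le[of "inverse s" d "(\<lambda>x. s *\<^sub>R x) ` A"] s by simp
  then have "ennreal (s ^ d) * hausdorff_outer d A \<le> ennreal (s ^ d) * (ennreal (inverse s ^ d) * hausdorff_outer d ((\<lambda>x. s *\<^sub>R x) ` A))"
    by (rule mult_left_mono) simp
  also have "\<dots> = hausdorff_outer d ((\<lambda>x. s *\<^sub>R x) ` A)"
    using s by (simp add: mult.assoc[symmetric] ennreal_mult'[symmetric] flip: power_mult_distrib)
  finally show "ennreal (s ^ d) * hausdorff_outer d A \<le> hausdorff_outer d ((\<lambda>x. s *\<^sub>R x) ` A)" .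
qed

lemma hausdorff_outer_translation:
  fixes A :: "'a::real_normed_vector set"
  shows "hausdorff_outer d ((+) c ` A) = hausdorff_outer d A"
proof -
  have le: "hausdorff_outer d ((+) c ` A) \<le> hausdorff_outer d A" for c and A :: "'a set"
    using hausdorff_outer_lipschitz_image[of 1 A "(+) c" d] by simp
  have "A = (+) (-c) ` (+) c ` A" by (simp add: image_image)
  then show ?thesis using le[of c A] le[of "-c" "(+) c ` A"] by simp
qed

text \<open>For an orthonormal \<open>Z\<close> this is the orthogonal projection onto its span
  followed by the isometry that carries \<open>Z\<close> to its image; with \<open>\<phi>\<close>
  the identity it is the projection itself.\<close>

definition frame_map :: "('a \<Rightarrow> 'b) \<Rightarrow> 'a::euclidean_space set \<Rightarrow> 'a \<Rightarrow> 'b::euclidean_space" where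
  "frame_map \<phi> Z x = (\<Sum>a\<in>Z. (x \<bullet> a) *\<^sub>R \<phi> a)"

lemma frame_map_norm:
  assumes "orthonormal (\<phi> ` Z)" "inj_on \<phi> Z"
  shows "(norm (frame_map \<phi> Z x))\<^sup>2 = (\<Sum>a\<in>Z. (x \<bullet> a)\<^sup>2)"
proof -
  have "frame_map \<phi> Z x = (\<Sum>a\<in>\<phi> ` Z. (x \<bullet> inv_into Z \<phi> a) *\<^sub>R a)"
    using assms by (simp add: frame_map_def sum.reindex)
  then have "(norm (frame_map \<phi> Z x))\<^sup>2 = (\<Sum>a\<in>\<phi> ` Z. (x \<bullet> inv_into Z \<phi> a)\<^sup>2)"
    by (simp only: orthonormal_norm_sum[OF assms(1)])
  then show ?thesis using assms by (simp add: sum.reindex)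
qed

lemma frame_map_diff: "frame_map \<phi> Z x - frame_map \<phi> Z y = frame_map \<phi> Z (x - y)"
  by (simp add: frame_map_def inner_diff_left scaleR_diff_left sum_subtractf)

lemma frame_map_dist_le:
  assumes "orthonormal Z" "orthonormal (\<phi> ` Z)" "inj_on \<phi> Z"
  shows "dist (frame_map \<phi> Z x) (frame_map \<phi> Z y) \<le> dist x y"
proof -
  have "(norm (frame_map \<phi> Z (x - y)))\<^sup>2 \<le> (norm (x - y))\<^sup>2"
    using frame_map_norm[OF assms(2,3), of "x - y"] orthonormal_bessel[OF assms(1), of "x - y"] by simp
  then show ?thesis
    by (simp add: dist_norm frame_map_diff power2_le_iff_abs_le)
qed

text \<open>The frame map is 1-Lipschitz and sends the first ball onto the second. The frames may
  live in different spaces; used in both directions this makes the volume a function of the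
  dimension only.\<close>

lemma flat_ball_measure_le:
  fixes Z :: "'a::euclidean_space set" and Z' :: "'b::euclidean_space set"
  assumes "orthonormal Z" "orthonormal Z'" "card Z = card Z'"
  shows "hausdorff_outer d (flat_ball Z' r) \<le> hausdorff_outer d (flat_ball Z r)"
proof -
  obtain \<phi> where bij: "bij_betw \<phi> Z Z'"
    using finite_same_card_bij[OF orthonormal_finite[OF assms(1)] orthonormal_finite[OF assms(2)] assms(3)] by blast
  then have \<phi>: "inj_on \<phi> Z" "\<phi> ` Z = Z'" by (auto simp: bij_betw_def)
  have "flat_ball Z' r \<subseteq> frame_map \<phi> Z ` flat_ball Z r"
  proof
    fix y assume y: "y \<in> flat_ball Z' r"
    define x where "x = (\<Sum>a\<in>Z. (y \<bullet> \<phi> a) *\<^sub>R a)"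
    have "(norm x)\<^sup>2 = (\<Sum>a\<in>Z. (y \<bullet> \<phi> a)\<^sup>2)" unfolding x_def by (rule orthonormal_norm_sum[OF assms(1)])
    also have "\<dots> = (\<Sum>b\<in>Z'. (y \<bullet> b)\<^sup>2)" unfolding \<phi>(2)[symmetric] using \<phi>(1) by (simp add: sum.reindex)
    also have "\<dots> = (norm y)\<^sup>2" using y assms(2) by (simp add: orthonormal_span_norm flat_ball_def)
    finally have "norm x = norm y" by simp
    moreover have "x \<in> span Z" unfolding x_def by (intro span_sum span_mul span_base)
    ultimately have "x \<in> flat_ball Z r" using y by (simp add: flat_ball_def)
    moreover have "frame_map \<phi> Z x = (\<Sum>a\<in>Z. (y \<bullet> \<phi> a) *\<^sub>R \<phi> a)"
      unfolding frame_map_def x_def by (intro sum.cong refl) (simp only: orthonormal_sum_inner[OF assms(1)])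
    moreover have "\<dots> = (\<Sum>b\<in>Z'. (y \<bullet> b) *\<^sub>R b)" unfolding \<phi>(2)[symmetric] using \<phi>(1) by (simp add: sum.reindex)
    moreover have "\<dots> = y" using y assms(2) by (simp add: orthonormal_span_expansion flat_ball_def)
    ultimately show "y \<in> frame_map \<phi> Z ` flat_ball Z r" by (metis image_eqI)
  qed
  then have "hausdorff_outer d (flat_ball Z' r) \<le> hausdorff_outer d (frame_map \<phi> Z ` flat_ball Z r)"
    by (rule hausdorff_outer_mono)
  also have "\<dots> \<le> ennreal (1 ^ d) * hausdorff_outer d (flat_ball Z r)"
    by (rule hausdorff_outer_lipschitz_image) (use frame_map_dist_le[of Z \<phi>] assms \<phi> in auto)
  finally show ?thesis by simp
qed

lemma hausdorff_pre_single:
  assumes "1 \<le> d" "bounded C" "diameter C \<le> \<delta>" "0 \<le> \<delta>"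
  shows "hausdorff_pre d \<delta> C \<le> ennreal (omega d * (diameter C / 2) ^ d)"
proof -
  have "hausdorff_pre d \<delta> C \<le> (\<Sum>i. ennreal (omega d * (diameter (if i = (0::nat) then C else {}) / 2) ^ d))"
    by (rule hausdorff_pre_le) (use assms in \<open>auto simp: diameter_def[of "{}"]\<close>)
  also have "\<dots> = (\<Sum>i\<in>{0::nat}. ennreal (omega d * (diameter (if i = (0::nat) then C else {}) / 2) ^ d))"
    by (rule suminf_finite) (use assms in \<open>auto simp: diameter_def[of "{}"] power_0_left\<close>)
  finally show ?thesis by simp
qed

lemma hausdorff_pre_Un:
  assumes "1 \<le> d" "0 \<le> \<delta>"
  shows "hausdorff_pre d \<delta> (A \<union> B) \<le> hausdorff_pre d \<delta> A + hausdorff_pre d \<delta> B"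
proof -
  have "hausdorff_pre d \<delta> (\<Union>i. binaryset A B i) \<le> (\<Sum>i. hausdorff_pre d \<delta> (binaryset A B i))"
    by (rule hausdorff_pre_UN)
  then show ?thesis
    using suminf_binaryset_eq[of "hausdorff_pre d \<delta>" A B, OF hausdorff_pre_empty[OF assms]]
    by (simp add: UN_binaryset_eq)
qed

lemma hausdorff_pre_finite_UN:
  assumes "1 \<le> d" "0 \<le> \<delta>" "finite I"
  shows "hausdorff_pre d \<delta> (\<Union>i\<in>I. A i) \<le> (\<Sum>i\<in>I. hausdorff_pre d \<delta> (A i))"
  using assms(3)
proof induction
  case empty then show ?case using hausdorff_pre_empty[OF assms(1,2)] by simp
next
  case (insert i I)
  have "hausdorff_pre d \<delta> (\<Union>i\<in>insert i I. A i) \<le> hausdorff_pre d \<delta> (A i) + hausdorff_pre d \<delta> (\<Union>i\<in>I. A i)"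
    using hausdorff_pre_Un[OF assms(1,2), of "A i" "\<Union>i\<in>I. A i"] by simp
  also have "\<dots> \<le> hausdorff_pre d \<delta> (A i) + (\<Sum>i\<in>I. hausdorff_pre d \<delta> (A i))"
    by (intro add_left_mono insert.IH)
  finally show ?case using insert by simp
qed

text \<open>A grid of mesh 1/m covers the ball by (2m+1)^d cubes of diameter sqrt d / m. Their total
  weight is bounded independently of m, hence of the scale \<delta>.\<close>

lemma flat_ball_measure_finite:
  assumes Z: "orthonormal Z" and d: "1 \<le> card Z"
  shows "hausdorff_outer (card Z) (flat_ball Z 1) < \<infinity>"
proof -
  let ?d = "card Z"
  have "hausdorff_pre ?d \<delta> (flat_ball Z 1) \<le> ennreal (omega ?d * (3/2 * sqrt ?d) ^ ?d)" if \<delta>: "0 < \<delta>" for \<delta>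
  proof -
    obtain m :: nat where m: "sqrt ?d / \<delta> < real m" using reals_Archimedean2 by blast
    have m0: "0 < real m"
    proof -
      have "0 < sqrt ?d / \<delta>" using d \<delta> by simp
      then show ?thesis using m by linarith
    qed
    have m\<delta>: "sqrt ?d / real m \<le> \<delta>" using m m0 \<delta> by (simp add: field_simps)
    define F where "F = (Z \<rightarrow>\<^sub>E {- int m..<int m + 1})"
    define C where "C k = {x \<in> span Z. \<forall>a\<in>Z. real_of_int (k a) / m \<le> x \<bullet> a \<and> x \<bullet> a \<le> (real_of_int (k a) + 1) / m}" for k
    have finF: "finite F" unfolding F_def by (intro finite_PiE orthonormal_finite[OF Z]) auto
    have cardF: "card F = (2 * m + 1) ^ ?d" unfolding F_def
      by (subst card_PiE) (auto simp: orthonormal_finite[OF Z] nat_add_distrib nat_mult_distrib)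
    have dist: "dist x y \<le> sqrt ?d / m" if "x \<in> C k" "y \<in> C k" for x y k
    proof -
      have s: "x - y \<in> span Z" using that by (auto simp: C_def intro: span_diff)
      have "(norm (x - y))\<^sup>2 = (\<Sum>a\<in>Z. ((x - y) \<bullet> a)\<^sup>2)" by (rule orthonormal_span_norm[OF Z s])
      also have "\<dots> \<le> (\<Sum>a\<in>Z. (1 / m)\<^sup>2)"
      proof (rule sum_mono)
        fix a assume "a \<in> Z"
        then have "real_of_int (k a) / m \<le> x \<bullet> a" "x \<bullet> a \<le> (real_of_int (k a) + 1) / m"
          "real_of_int (k a) / m \<le> y \<bullet> a" "y \<bullet> a \<le> (real_of_int (k a) + 1) / m" using that by (auto simp: C_def)
        then have "\<bar>(x - y) \<bullet> a\<bar> \<le> 1 / m" by (simp add: inner_diff_left add_divide_distrib abs_le_iff)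
        then show "((x - y) \<bullet> a)\<^sup>2 \<le> (1 / m)\<^sup>2" by (simp add: abs_le_square_iff[symmetric])
      qed
      also have "\<dots> = (sqrt ?d / m)\<^sup>2" by (simp add: power_divide)
      finally show ?thesis using m0 by (simp add: dist_norm power2_le_iff_abs_le)
    qed
    have cover: "flat_ball Z 1 \<subseteq> (\<Union>k\<in>F. C k)"
    proof
      fix x assume x: "x \<in> flat_ball Z 1"
      define k where "k = restrict (\<lambda>a. \<lfloor>m * (x \<bullet> a)\<rfloor>) Z"
      have "k \<in> F" unfolding F_def k_def
      proof (rule restrict_PiE_iff[THEN iffD2], safe)
        fix a assume a: "a \<in> Z"
        have "\<bar>x \<bullet> a\<bar> \<le> norm x * norm a" by (rule Cauchy_Schwarz_ineq2)
        then have "\<bar>x \<bullet> a\<bar> \<le> 1" using x orthonormal_norm[OF Z a] by (simp add: flat_ball_def)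
        then have "- real m \<le> m * (x \<bullet> a)" "m * (x \<bullet> a) \<le> real m" using m0 mult_left_mono[of "-1" "x \<bullet> a" m] mult_left_mono[of "x \<bullet> a" 1 m] by (auto simp: abs_le_iff)
        then show "\<lfloor>m * (x \<bullet> a)\<rfloor> \<in> {- int m..<int m + 1}" by (auto simp: le_floor_iff floor_le_iff)
      qed
      moreover have "x \<in> C k"
        unfolding C_def
      proof (intro CollectI conjI ballI)
        show "x \<in> span Z" using x by (simp add: flat_ball_def)
        fix a assume a: "a \<in> Z"
        have "real_of_int \<lfloor>m * (x \<bullet> a)\<rfloor> \<le> m * (x \<bullet> a)" "m * (x \<bullet> a) \<le> real_of_int \<lfloor>m * (x \<bullet> a)\<rfloor> + 1"
          by linarith+
        then show "real_of_int (k a) / m \<le> x \<bullet> a" "x \<bullet> a \<le> (real_of_int (k a) + 1) / m"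
          using m0 a by (auto simp: k_def divide_le_eq le_divide_eq mult.commute)
      qed
      ultimately show "x \<in> (\<Union>k\<in>F. C k)" by blast
    qed
    have preC: "hausdorff_pre ?d \<delta> (C k) \<le> ennreal (omega ?d * (sqrt ?d / m / 2) ^ ?d)" for k
    proof -
      have bd: "bounded (C k)" using dist by (auto simp: bounded_two_points)
      have dm: "diameter (C k) \<le> sqrt ?d / m"
      proof (cases "C k = {}")
        case False then show ?thesis unfolding diameter_def by (auto intro!: cSUP_least dist)
      qed (simp add: diameter_def)
      have "hausdorff_pre ?d \<delta> (C k) \<le> ennreal (omega ?d * (diameter (C k) / 2) ^ ?d)"
        by (rule hausdorff_pre_single) (use d bd dm m\<delta> \<delta> in auto)
      also have "\<dots> \<le> ennreal (omega ?d * (sqrt ?d / m / 2) ^ ?d)"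
        using dm bd omega_pos[of ?d]
        by (intro ennreal_leI mult_left_mono power_mono divide_right_mono) (auto simp: diameter_ge_0)
      finally show ?thesis .
    qed
    have "hausdorff_pre ?d \<delta> (flat_ball Z 1) \<le> hausdorff_pre ?d \<delta> (\<Union>k\<in>F. C k)"
      by (rule hausdorff_pre_mono[OF cover])
    also have "\<dots> \<le> (\<Sum>k\<in>F. hausdorff_pre ?d \<delta> (C k))"
      by (rule hausdorff_pre_finite_UN[OF d _ finF]) (use \<delta> in simp)
    also have "\<dots> \<le> (\<Sum>k\<in>F. ennreal (omega ?d * (sqrt ?d / m / 2) ^ ?d))" by (rule sum_mono[OF preC])
    also have "\<dots> = ennreal (real (card F) * (omega ?d * (sqrt ?d / m / 2) ^ ?d))"
      using omega_pos[of ?d] by (subst sum_ennreal) (auto simp: less_imp_le)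
    also have "real (card F) * (omega ?d * (sqrt ?d / m / 2) ^ ?d) = omega ?d * ((2 * m + 1) * (sqrt ?d / m / 2)) ^ ?d"
      unfolding cardF of_nat_power power_mult_distrib by (simp add: ac_simps)
    also have "ennreal \<dots> \<le> ennreal (omega ?d * (3/2 * sqrt ?d) ^ ?d)"
    proof (intro ennreal_leI mult_left_mono power_mono)
      have "1 \<le> real m" using m0 by (simp add: Suc_leI)
      then have "(2 * real m + 1) / (2 * m) \<le> 3/2" by (simp add: field_simps)
      from mult_right_mono[OF this, of "sqrt ?d"]
      show "real (2 * m + 1) * (sqrt ?d / m / 2) \<le> 3/2 * sqrt ?d" by (simp add: algebra_simps)
    qed (use omega_pos[of ?d] in auto)
    finally show ?thesis .
  qed
  then have "hausdorff_outer ?d (flat_ball Z 1) \<le> ennreal (omega ?d * (3/2 * sqrt ?d) ^ ?d)"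
    by (rule hausdorff_outer_leI)
  then show ?thesis by (metis ennreal_less_top infinity_ennreal_def le_less_trans)
qed

text \<open>Lebesgue measure on the coordinates with respect to \<open>Z\<close> bounds the Hausdorff measure from
  below: a set of diameter \<open>\<delta>\<close> lies in a ball of radius \<open>\<delta>\<close>, which costs the factor \<open>2\<^sup>d\<close>.\<close>

lemma PiM_lborel_translation:
  fixes c :: "'i \<Rightarrow> real"
  assumes "finite I"
  shows "distr (Pi\<^sub>M I (\<lambda>_. lborel)) (Pi\<^sub>M I (\<lambda>_. lborel)) (\<lambda>f. \<lambda>i\<in>I. f i + c i) = Pi\<^sub>M I (\<lambda>_. lborel)"
    (is "?N = ?M")
proof -
  interpret product_sigma_finite "\<lambda>_. lborel :: real measure" by standard
  show ?thesis
  proof (rule PiM_eqI[OF assms])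
    have m: "(\<lambda>f. \<lambda>i\<in>I. f i + c i) \<in> measurable ?M ?M" by measurable
    fix A assume A: "\<And>i. i \<in> I \<Longrightarrow> A i \<in> sets (lborel :: real measure)"
    have eq: "(\<lambda>f. \<lambda>i\<in>I. f i + c i) -` (Pi\<^sub>E I A) \<inter> space ?M = Pi\<^sub>E I (\<lambda>i. (\<lambda>x. x + c i) -` A i)"
      by (auto simp: space_PiM PiE_iff)
    have "emeasure ?N (Pi\<^sub>E I A) = emeasure ?M (Pi\<^sub>E I (\<lambda>i. (\<lambda>x. x + c i) -` A i))"
      using A assms by (subst emeasure_distr[OF m]) (auto simp: eq intro!: sets_PiM_I_finite)
    also have "\<dots> = (\<Prod>i\<in>I. emeasure lborel ((\<lambda>x. x + c i) -` A i))"
      using A assms by (intro emeasure_PiM) (auto intro!: measurable_sets_borel[of "\<lambda>x. x + c _" borel, simplified])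
    also have "\<dots> = (\<Prod>i\<in>I. emeasure lborel (A i))"
    proof (rule prod.cong[OF refl])
      fix i assume i: "i \<in> I"
      have "emeasure lborel (A i) = emeasure (distr lborel borel ((+) (c i))) (A i)" by (simp add: lborel_distr_plus)
      also have "\<dots> = emeasure lborel ((\<lambda>x. x + c i) -` A i)"
        using A[OF i] by (subst emeasure_distr) (auto simp: add.commute vimage_def)
      finally show "emeasure lborel ((\<lambda>x. x + c i) -` A i) = emeasure lborel (A i)" by simp
    qed
    finally show "emeasure ?N (Pi\<^sub>E I A) = (\<Prod>i\<in>I. emeasure lborel (A i))" .
  qed simp
qed

lemma emeasure_PiM_lborel_ball:
  fixes c :: "'i \<Rightarrow> real"
  assumes I: "finite I" "1 \<le> card I" and r: "0 \<le> r"
  shows "emeasure (Pi\<^sub>M I (\<lambda>_. lborel)) ({f. (\<Sum>i\<in>I. (f i - c i)\<^sup>2) \<le> r\<^sup>2} \<inter> space (Pi\<^sub>M I (\<lambda>_. lborel)))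
     \<le> ennreal (omega (card I) * r ^ card I)" (is "emeasure ?M (?B r) \<le> _")
proof -
  have pos: "emeasure ?M (?B s) = ennreal (omega (card I) * s ^ card I)" if s: "0 < s" for s
  proof -
    have m: "(\<lambda>f. \<lambda>i\<in>I. f i + c i) \<in> measurable ?M ?M" by measurable
    have mB: "?B s \<in> sets ?M"
    proof -
      have "?B s = {f \<in> space ?M. (\<Sum>i\<in>I. (f i - c i)\<^sup>2) \<le> s\<^sup>2}" by auto
      also have "\<dots> \<in> sets ?M" by measurable
      finally show ?thesis .
    qed
    have "(\<lambda>f. \<lambda>i\<in>I. f i + c i) -` ?B s \<inter> space ?M = {f. sqrt (\<Sum>i\<in>I. (f i)\<^sup>2) \<le> s} \<inter> space ?M"
      using s by (auto simp: space_PiM real_sqrt_le_iff real_le_lsqrt sum_nonneg dest: sqrt_le_D)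
    then have "emeasure (distr ?M ?M (\<lambda>f. \<lambda>i\<in>I. f i + c i)) (?B s) = ennreal (omega (card I) * s ^ card I)"
      using emeasure_cball_aux[OF I(1) s] by (simp add: emeasure_distr[OF m mB] omega_def)
    then show ?thesis by (simp add: PiM_lborel_translation[OF I(1)])
  qed
  show ?thesis
  proof (cases "r = 0")
    case True
    \<comment> \<open>A covering set with a single point has diameter 0, so radius 0 does occur; it
      is the limit of small positive radii.\<close>
    have "emeasure ?M (?B 0) \<le> ennreal (omega (card I) * s ^ card I)" if "0 < s" for s
    proof -
      have "?B s = {f \<in> space ?M. (\<Sum>i\<in>I. (f i - c i)\<^sup>2) \<le> s\<^sup>2}" by auto
      also have "\<dots> \<in> sets ?M" by measurable
      finally have "emeasure ?M (?B 0) \<le> emeasure ?M (?B s)"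
        by (rule emeasure_mono[rotated]) (auto intro: order_trans)
      then show ?thesis using pos[OF that] by simp
    qed
    then have "\<forall>\<^sub>F s in at_right 0. emeasure ?M (?B 0) \<le> ennreal (omega (card I) * s ^ card I)"
      by (auto simp: eventually_at_right_less intro: eventually_mono[OF eventually_at_right_less])
    moreover have "((\<lambda>s. ennreal (omega (card I) * s ^ card I)) \<longlongrightarrow> ennreal (omega (card I) * 0 ^ card I)) (at_right 0)"
      by (intro tendsto_intros)
    ultimately have "emeasure ?M (?B 0) \<le> ennreal (omega (card I) * 0 ^ card I)"
      by (intro tendsto_lowerbound[of "\<lambda>s. ennreal (omega (card I) * s ^ card I)" _ "at_right 0"]) simp_all
    then show ?thesis using True by simp
  next
    case False
    then show ?thesis using pos[of r] r by simp
  qed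
qed

lemma flat_ball_measure_ge:
  assumes Z: "orthonormal Z" and d: "1 \<le> card Z"
  shows "ennreal (omega (card Z) / 2 ^ card Z) \<le> hausdorff_outer (card Z) (flat_ball Z 1)"
proof -
  let ?d = "card Z" and ?M = "Pi\<^sub>M Z (\<lambda>_. lborel) :: ('a \<Rightarrow> real) measure"
  have fin: "finite Z" by (rule orthonormal_finite[OF Z])
  have "ennreal (omega ?d / 2 ^ ?d) \<le> hausdorff_pre ?d 1 (flat_ball Z 1)"
    unfolding hausdorff_pre_def
  proof (rule INF_greatest, clarsimp)
    fix C :: "nat \<Rightarrow> 'a set" assume C: "flat_ball Z 1 \<subseteq> (\<Union>i. C i)" "\<forall>i. bounded (C i) \<and> diameter (C i) \<le> 1"
    define y where "y i = (SOME y. y \<in> C i)" for i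
    define B where "B i = {f. (\<Sum>a\<in>Z. (f a - y i \<bullet> a)\<^sup>2) \<le> (diameter (C i))\<^sup>2} \<inter> space ?M" for i
    have mB: "B i \<in> sets ?M" for i
    proof -
      have "B i = {f \<in> space ?M. (\<Sum>a\<in>Z. (f a - y i \<bullet> a)\<^sup>2) \<le> (diameter (C i))\<^sup>2}" by (auto simp: B_def)
      also have "\<dots> \<in> sets ?M" by measurable
      finally show ?thesis .
    qed
    have "{f. sqrt (\<Sum>a\<in>Z. (f a)\<^sup>2) \<le> 1} \<inter> space ?M \<subseteq> (\<Union>i. B i)"
    proof
      fix f assume f: "f \<in> {f. sqrt (\<Sum>a\<in>Z. (f a)\<^sup>2) \<le> 1} \<inter> space ?M"
      define x where "x = (\<Sum>a\<in>Z. f a *\<^sub>R a)"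
      have xa: "x \<bullet> a = f a" if "a \<in> Z" for a unfolding x_def by (rule orthonormal_sum_inner[OF Z that])
      have "(norm x)\<^sup>2 = (\<Sum>a\<in>Z. (f a)\<^sup>2)" unfolding x_def by (rule orthonormal_norm_sum[OF Z])
      then have "norm x = sqrt (\<Sum>a\<in>Z. (f a)\<^sup>2)" by (metis norm_ge_zero real_sqrt_unique)
      moreover have "x \<in> span Z" unfolding x_def by (intro span_sum span_mul span_base)
      ultimately have "x \<in> flat_ball Z 1" using f by (simp add: flat_ball_def)
      then obtain i where i: "x \<in> C i" using C by blast
      then have "y i \<in> C i" unfolding y_def by (rule someI)
      then have "norm (x - y i) \<le> diameter (C i)" using diameter_bounded_bound[OF _ i] C by (auto simp: dist_norm)
      then have "(norm (x - y i))\<^sup>2 \<le> (diameter (C i))\<^sup>2" by (rule power_mono) simp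
      then have "(\<Sum>a\<in>Z. ((x - y i) \<bullet> a)\<^sup>2) \<le> (diameter (C i))\<^sup>2"
        using orthonormal_bessel[OF Z, of "x - y i"] by simp
      then have "f \<in> B i" using f xa by (simp add: B_def inner_diff_left)
      then show "f \<in> (\<Union>i. B i)" by blast
    qed
    then have "emeasure ?M ({f. sqrt (\<Sum>a\<in>Z. (f a)\<^sup>2) \<le> 1} \<inter> space ?M) \<le> emeasure ?M (\<Union>i. B i)"
      using mB by (intro emeasure_mono) auto
    also have "\<dots> \<le> (\<Sum>i. emeasure ?M (B i))"
      using mB by (intro emeasure_subadditive_countably) auto
    also have "\<dots> \<le> (\<Sum>i. ennreal (2 ^ ?d) * ennreal (omega ?d * (diameter (C i) / 2) ^ ?d))"
    proof (rule suminf_le)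
      fix i
      have "emeasure ?M (B i) \<le> ennreal (omega ?d * diameter (C i) ^ ?d)"
        unfolding B_def by (rule emeasure_PiM_lborel_ball[OF fin d]) (use C diameter_ge_0 in auto)
      also have "omega ?d * diameter (C i) ^ ?d = 2 ^ ?d * (omega ?d * (diameter (C i) / 2) ^ ?d)"
        by (simp add: power_divide)
      finally show "emeasure ?M (B i) \<le> ennreal (2 ^ ?d) * ennreal (omega ?d * (diameter (C i) / 2) ^ ?d)"
        by (simp add: ennreal_mult')
    qed auto
    also have "\<dots> = ennreal (2 ^ ?d) * (\<Sum>i. ennreal (omega ?d * (diameter (C i) / 2) ^ ?d))" by simp
    finally have "ennreal (omega ?d) \<le> ennreal (2 ^ ?d) * (\<Sum>i. ennreal (omega ?d * (diameter (C i) / 2) ^ ?d))"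
      using emeasure_cball_aux[OF fin, of 1] by (simp add: omega_def)
    then have "ennreal (1 / 2 ^ ?d) * ennreal (omega ?d) \<le> ennreal (1 / 2 ^ ?d) * (ennreal (2 ^ ?d) * (\<Sum>i. ennreal (omega ?d * (diameter (C i) / 2) ^ ?d)))"
      by (rule mult_left_mono) simp
    then show "ennreal (omega ?d / 2 ^ ?d) \<le> (\<Sum>i. ennreal (omega ?d * (diameter (C i) / 2) ^ ?d))"
      by (simp add: mult.assoc[symmetric] ennreal_mult'[symmetric])
  qed
  also have "\<dots> \<le> hausdorff_outer ?d (flat_ball Z 1)" by (rule hausdorff_pre_le_outer) simp
  finally show ?thesis .
qed

text \<open>By the isodiametric inequality this number is \<open>omega (card Z)\<close>. The
  argument works with the bounds \<open>flat_vol_ge\<close> and \<open>flat_vol_le\<close>; the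
  factor 2^d between them reappears when 8^d turns into 16^d in the choice of the number of
  cells.\<close>

definition flat_vol :: "'a::euclidean_space set \<Rightarrow> real" where
  "flat_vol Z = enn2real (hausdorff_outer (card Z) (flat_ball Z 1))"

lemma flat_ball_measure:
  assumes Z: "orthonormal Z" "1 \<le> card Z" and r: "0 < r"
  shows "hausdorff_outer (card Z) (flat_ball Z r) = ennreal (flat_vol Z * r ^ card Z)"
proof -
  have "hausdorff_outer (card Z) (flat_ball Z 1) = ennreal (flat_vol Z)"
    unfolding flat_vol_def using flat_ball_measure_finite[OF Z] by simp
  moreover have "hausdorff_outer (card Z) (flat_ball Z r) = ennreal (r ^ card Z) * hausdorff_outer (card Z) (flat_ball Z 1)"
    using hausdorff_outer_scale[OF r, of "card Z" "flat_ball Z 1"] flat_ball_scale[OF r, of Z 1] by simp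
  ultimately show ?thesis using r by (simp add: ennreal_mult'' mult.commute)
qed

lemma flat_vol_ge:
  assumes "orthonormal Z" "1 \<le> card Z"
  shows "omega (card Z) / 2 ^ card Z \<le> flat_vol Z"
proof -
  have "ennreal (omega (card Z) / 2 ^ card Z) \<le> ennreal (flat_vol Z)"
    using flat_ball_measure_ge[OF assms] flat_ball_measure[OF assms, of 1] by simp
  then show ?thesis by (subst (asm) ennreal_le_iff) (auto simp: flat_vol_def)
qed

lemma flat_vol_pos: "orthonormal Z \<Longrightarrow> 1 \<le> card Z \<Longrightarrow> 0 < flat_vol Z"
  by (rule less_le_trans[OF _ flat_vol_ge]) (auto simp: omega_pos)

lemma flat_vol_eq:
  fixes Z :: "'a::euclidean_space set" and Z' :: "'b::euclidean_space set"
  assumes "orthonormal Z" "orthonormal Z'" "card Z = card Z'"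
  shows "flat_vol Z = flat_vol Z'"
  unfolding flat_vol_def
  using flat_ball_measure_le[OF assms, of "card Z" 1] flat_ball_measure_le[OF assms(2,1) assms(3)[symmetric], of "card Z" 1] assms(3)
  by (simp add: antisym)

text \<open>If the flat unit ball had more than \<open>\<omega>\<^sub>d\<close>, replace a fixed proportion of it by small disjoint
  balls, whose pre-measure is the sharp one; the total drops by a fixed amount at every scale.\<close>
lemma flat_vol_le:
  fixes Z :: "'a::euclidean_space set"
  assumes Z: "orthonormal Z" and d: "1 \<le> card Z"
  shows "flat_vol Z \<le> omega (card Z)"
proof (rule ccontr)
  let ?d = "card Z"
  define h where "h = flat_vol Z"
  assume "\<not> flat_vol Z \<le> omega ?d"
  then have gt: "omega ?d < h" by (simp add: h_def)
  have h0: "0 < h" unfolding h_def by (rule flat_vol_pos[OF Z d])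
  have mB: "hausdorff_outer ?d ((+) c ` flat_ball Z r) = ennreal (h * r ^ ?d)" if "0 < r" for c r
    using flat_ball_measure[OF Z d that] by (simp add: hausdorff_outer_translation h_def)
  have mB0: "hausdorff_outer ?d (flat_ball Z r) = ennreal (h * r ^ ?d)" if "0 < r" for r
    using flat_ball_measure[OF Z d that] by (simp add: h_def)
  have bB: "(+) c ` flat_ball Z r \<in> sets borel" for c r
    by (intro borel_closed closed_translation closed_flat_ball)
  have "hausdorff_pre ?d \<delta> (flat_ball Z 1) \<le> ennreal (h - (1/4) ^ ?d * (h - omega ?d))" if \<delta>: "0 < \<delta>" for \<delta>
  proof -
    define \<epsilon> where "\<epsilon> = min (\<delta>/2) (1/2)"
    have \<epsilon>: "0 < \<epsilon>" "\<epsilon> \<le> 1/2" "2 * \<epsilon> \<le> \<delta>" using \<delta> by (auto simp: \<epsilon>_def)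
    \<comment> \<open>Centres of a packing: the balls of radius \<epsilon> around them are disjoint,
      and they stay in the unit ball because the centres have norm at most 1 - \<epsilon>.\<close>
    define P where "P S \<longleftrightarrow> finite S \<and> S \<subseteq> flat_ball Z (1 - \<epsilon>) \<and> (\<forall>s\<in>S. \<forall>t\<in>S. s \<noteq> t \<longrightarrow> 2 * \<epsilon> < dist s t)" for S
    define U where "U S = (\<Union>s\<in>S. (+) s ` flat_ball Z \<epsilon>)" for S
    have US: "U S \<in> sets borel" if "P S" for S
      using that bB unfolding P_def U_def by (intro sets.finite_UN) auto
    have Usub: "U S \<subseteq> flat_ball Z 1" if "P S" for S
    proof (clarsimp simp: U_def)
      fix s y assume "s \<in> S" "y \<in> flat_ball Z \<epsilon>"
      then show "s + y \<in> flat_ball Z 1"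
        using that norm_triangle_ineq[of s y] by (force simp: P_def flat_ball_def intro: span_add)
    qed
    have Um: "hausdorff_outer ?d (U S) = ennreal (real (card S) * (h * \<epsilon> ^ ?d))" if S: "P S" for S
    proof -
      have "disjoint_family_on (\<lambda>s. (+) s ` flat_ball Z \<epsilon>) S"
      proof (clarsimp simp: disjoint_family_on_def disjoint_iff)
        fix s t y y' assume st: "s \<in> S" "t \<in> S" "s \<noteq> t" "y \<in> flat_ball Z \<epsilon>" "y' \<in> flat_ball Z \<epsilon>" "s + y = t + y'"
        have "2 * \<epsilon> < dist s t" using st S by (auto simp: P_def)
        also have "dist s t = norm (y' - y)" using st(6) by (simp add: dist_norm algebra_simps) (metis add_diff_cancel_left' diff_add_cancel add.commute add_diff_eq diff_diff_eq2)
        also have "\<dots> \<le> 2 * \<epsilon>" using st norm_triangle_ineq4[of y' y] by (simp add: flat_ball_def)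
        finally show False by simp
      qed
      then have "hausdorff_outer ?d (U S) = (\<Sum>s\<in>S. hausdorff_outer ?d ((+) s ` flat_ball Z \<epsilon>))"
        unfolding U_def using S bB by (intro hausdorff_outer_UN_disjoint[OF d]) (auto simp: P_def)
      also have "\<dots> = (\<Sum>s\<in>S. ennreal (h * \<epsilon> ^ ?d))" using mB[OF \<epsilon>(1)] by simp
      also have "\<dots> = ennreal (real (card S) * (h * \<epsilon> ^ ?d))"
        using h0 \<epsilon> by (subst sum_ennreal) auto
      finally show ?thesis .
    qed
    \<comment> \<open>Comparing volumes bounds the size of every packing, so one of maximal size
      exists.\<close>
    have "card S \<le> nat \<lceil>(1/\<epsilon>) ^ ?d\<rceil>" if S: "P S" for S
    proof -
      have "ennreal (real (card S) * (h * \<epsilon> ^ ?d)) \<le> ennreal (h * 1 ^ ?d)"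
        using hausdorff_outer_mono[OF Usub[OF S], of ?d] Um[OF S] mB0[of 1] by simp
      then have "h * (real (card S) * \<epsilon> ^ ?d) \<le> h * 1" using h0 by (simp add: ennreal_le_iff ac_simps)
      then have "real (card S) * \<epsilon> ^ ?d \<le> 1" using h0 by (simp only: mult_le_cancel_left_pos)
      then have "real (card S) \<le> (1/\<epsilon>) ^ ?d" using \<epsilon> by (simp add: power_divide pos_le_divide_eq)
      then show ?thesis by linarith
    qed
    moreover have "P {}" by (simp add: P_def)
    ultimately obtain S where S: "P S" and Smax: "\<And>S'. P S' \<Longrightarrow> card S' \<le> card S"
      using ex_has_greatest_nat[of P "{}" card "Suc (nat \<lceil>(1/\<epsilon>) ^ ?d\<rceil>)"] by (auto simp: less_Suc_eq_le)
    \<comment> \<open>By maximality the balls of twice the radius cover the ball of radius 1 -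
      \<epsilon> \<ge> 1/2. Hence the packed balls occupy at least the fraction (1/4)^d of the unit
      ball.\<close>
    have "flat_ball Z (1 - \<epsilon>) \<subseteq> (\<Union>s\<in>S. (+) s ` flat_ball Z (2 * \<epsilon>))"
    proof
      fix x assume x: "x \<in> flat_ball Z (1 - \<epsilon>)"
      have "\<exists>s\<in>S. dist s x \<le> 2 * \<epsilon>"
      proof (rule ccontr)
        assume c: "\<not> ?thesis"
        then have "x \<notin> S" using \<epsilon> by force
        have "P (insert x S)" using S x c by (auto simp: P_def dist_commute)
        from Smax[OF this] show False using \<open>x \<notin> S\<close> S by (simp add: P_def)
      qed
      then obtain s where s: "s \<in> S" "dist s x \<le> 2 * \<epsilon>" by blast
      then have "x - s \<in> flat_ball Z (2 * \<epsilon>)" using S x by (auto simp: flat_ball_def P_def dist_norm norm_minus_commute intro: span_diff)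
      then have "s + (x - s) \<in> (+) s ` flat_ball Z (2 * \<epsilon>)" by blast
      then show "x \<in> (\<Union>s\<in>S. (+) s ` flat_ball Z (2 * \<epsilon>))" using s(1) by auto
    qed
    then have "hausdorff_outer ?d (flat_ball Z (1 - \<epsilon>)) \<le> hausdorff_outer ?d (\<Union>s\<in>S. (+) s ` flat_ball Z (2 * \<epsilon>))"
      by (rule hausdorff_outer_mono)
    also have "\<dots> \<le> (\<Sum>s\<in>S. hausdorff_outer ?d ((+) s ` flat_ball Z (2 * \<epsilon>)))"
      by (rule hausdorff_outer_finite_UN[OF d]) (use S in \<open>simp add: P_def\<close>)
    also have "\<dots> = (\<Sum>s\<in>S. ennreal (h * (2 * \<epsilon>) ^ ?d))" using mB[of "2 * \<epsilon>"] \<epsilon> by simp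
    also have "\<dots> = ennreal (real (card S) * (h * (2 * \<epsilon>) ^ ?d))"
      using h0 \<epsilon> by (subst sum_ennreal) auto
    finally have "ennreal (h * (1 - \<epsilon>) ^ ?d) \<le> ennreal (real (card S) * (h * (2 * \<epsilon>) ^ ?d))"
      using mB0[of "1 - \<epsilon>"] \<epsilon> by simp
    then have "h * (1 - \<epsilon>) ^ ?d \<le> h * (real (card S) * (2 * \<epsilon>) ^ ?d)" using h0 \<epsilon> by (simp add: ennreal_le_iff ac_simps)
    then have "(1 - \<epsilon>) ^ ?d \<le> real (card S) * (2 * \<epsilon>) ^ ?d" using h0 by (simp only: mult_le_cancel_left_pos)
    moreover have "(1/2) ^ ?d \<le> (1 - \<epsilon>) ^ ?d" using \<epsilon> by (intro power_mono) auto
    ultimately have half: "(1/2) ^ ?d \<le> real (card S) * (2 * \<epsilon>) ^ ?d" by linarith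
    have e1: "(1/4::real) ^ ?d = (1/2) ^ ?d * (1/2) ^ ?d" "(2 * \<epsilon>) ^ ?d * (1/2) ^ ?d = \<epsilon> ^ ?d"
      unfolding power_mult_distrib[symmetric] by simp_all
    then have frac: "(1/4) ^ ?d \<le> real (card S) * \<epsilon> ^ ?d"
    proof -
      have "(1/2) ^ ?d * (1/2) ^ ?d \<le> real (card S) * (2 * \<epsilon>) ^ ?d * (1/2) ^ ?d"
        by (rule mult_right_mono[OF half]) simp
      then show ?thesis by (simp only: mult.assoc e1)
    qed
    define m where "m = real (card S) * \<epsilon> ^ ?d"
    have "h = h * 1 ^ ?d" by simp
    have m1: "m \<le> 1"
    proof -
      have "ennreal (real (card S) * (h * \<epsilon> ^ ?d)) \<le> ennreal (h * 1 ^ ?d)"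
        using hausdorff_outer_mono[OF Usub[OF S], of ?d] Um[OF S] mB0[of 1] by simp
      then have "h * m \<le> h * 1" using h0 by (simp add: m_def ennreal_le_iff ac_simps)
      then show ?thesis using h0 by (simp only: mult_le_cancel_left_pos)
    qed
    have dec: "flat_ball Z 1 = U S \<union> (flat_ball Z 1 - U S)" using Usub[OF S] by blast
    have "hausdorff_outer ?d (U S) + hausdorff_outer ?d (flat_ball Z 1 - U S) = hausdorff_outer ?d (flat_ball Z 1)"
      using hausdorff_outer_Un_disjoint[OF d, of "U S" "flat_ball Z 1 - U S"] US[OF S] dec by auto
    then have "ennreal (h * m) + hausdorff_outer ?d (flat_ball Z 1 - U S) = ennreal h"
      using mB0[of 1] by (simp add: Um[OF S] m_def ac_simps)
    then have "hausdorff_outer ?d (flat_ball Z 1 - U S) = ennreal h - ennreal (h * m)"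
      by (metis ennreal_add_diff_cancel_left ennreal_neq_top)
    also have "\<dots> = ennreal (h - h * m)" using h0 \<epsilon> by (subst ennreal_minus) (simp_all add: m_def)
    finally have rest: "hausdorff_outer ?d (flat_ball Z 1 - U S) = ennreal (h - h * m)" .
    have small: "hausdorff_pre ?d (2 * \<epsilon>) ((+) s ` flat_ball Z \<epsilon>) \<le> ennreal (omega ?d * \<epsilon> ^ ?d)" for s
    proof -
      have dd: "dist x y \<le> 2 * \<epsilon>" if "x \<in> (+) s ` flat_ball Z \<epsilon>" "y \<in> (+) s ` flat_ball Z \<epsilon>" for x y
      proof -
        from that obtain a b where "norm a \<le> \<epsilon>" "norm b \<le> \<epsilon>" "x = s + a" "y = s + b" by (auto simp: flat_ball_def)
        then show ?thesis using norm_triangle_ineq4[of a b] by (simp add: dist_norm)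
      qed
      have bd: "bounded ((+) s ` flat_ball Z \<epsilon>)" unfolding bounded_two_points using dd by blast
      have "0 \<in> flat_ball Z \<epsilon>" using \<epsilon> by (simp add: flat_ball_def span_0)
      then have dm: "diameter ((+) s ` flat_ball Z \<epsilon>) \<le> 2 * \<epsilon>"
        using dd by (auto simp: diameter_def[of "(+) s ` flat_ball Z \<epsilon>"] intro!: cSUP_least)
      have "hausdorff_pre ?d (2 * \<epsilon>) ((+) s ` flat_ball Z \<epsilon>) \<le> ennreal (omega ?d * (diameter ((+) s ` flat_ball Z \<epsilon>) / 2) ^ ?d)"
        by (rule hausdorff_pre_single) (use d bd dm \<epsilon> in auto)
      also have "\<dots> \<le> ennreal (omega ?d * \<epsilon> ^ ?d)"
        using dm bd omega_pos[of ?d] by (intro ennreal_leI mult_left_mono power_mono) (auto simp: diameter_ge_0)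
      finally show ?thesis .
    qed
    have "hausdorff_pre ?d (2 * \<epsilon>) (U S) \<le> (\<Sum>s\<in>S. hausdorff_pre ?d (2 * \<epsilon>) ((+) s ` flat_ball Z \<epsilon>))"
      unfolding U_def by (rule hausdorff_pre_finite_UN[OF d]) (use S \<epsilon> in \<open>auto simp: P_def\<close>)
    also have "\<dots> \<le> (\<Sum>s\<in>S. ennreal (omega ?d * \<epsilon> ^ ?d))" by (rule sum_mono[OF small])
    also have "\<dots> = ennreal (omega ?d * m)"
      using omega_pos[of ?d] \<epsilon> by (subst sum_ennreal) (auto simp: m_def ac_simps)
    finally have preU: "hausdorff_pre ?d (2 * \<epsilon>) (U S) \<le> ennreal (omega ?d * m)" .
    have "hausdorff_pre ?d \<delta> (flat_ball Z 1) \<le> hausdorff_pre ?d (2 * \<epsilon>) (flat_ball Z 1)"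
      by (rule hausdorff_pre_antimono[OF \<epsilon>(3)])
    also have "\<dots> \<le> hausdorff_pre ?d (2 * \<epsilon>) (U S) + hausdorff_pre ?d (2 * \<epsilon>) (flat_ball Z 1 - U S)"
      using hausdorff_pre_Un[OF d, of "2 * \<epsilon>" "U S" "flat_ball Z 1 - U S"] \<epsilon> dec by auto
    \<comment> \<open>The packed balls are charged omega times \<epsilon>^d each, the rest its true
      measure. The saving m (h - omega) is at least (1/4)^d (h - omega), whatever \<delta>
      is.\<close>
    also have "\<dots> \<le> ennreal (omega ?d * m) + ennreal (h - h * m)"
      unfolding rest[symmetric] using \<epsilon> by (intro add_mono preU hausdorff_pre_le_outer) auto
    also have "\<dots> = ennreal (h - m * (h - omega ?d))"
      using omega_pos[of ?d] h0 m1 \<epsilon> by (subst ennreal_plus[symmetric]) (auto simp: m_def algebra_simps)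
    also have "\<dots> \<le> ennreal (h - (1/4) ^ ?d * (h - omega ?d))"
      using frac gt by (intro ennreal_leI diff_left_mono mult_right_mono) (auto simp: m_def)
    finally show ?thesis .
  qed
  then have "hausdorff_outer ?d (flat_ball Z 1) \<le> ennreal (h - (1/4) ^ ?d * (h - omega ?d))"
    by (rule hausdorff_outer_leI)
  then have le: "ennreal h \<le> ennreal (h - (1/4) ^ ?d * (h - omega ?d))" using mB0[of 1] by simp
  have pos: "0 < (1/4) ^ ?d * (h - omega ?d)" using gt by simp
  then have "h - (1/4) ^ ?d * (h - omega ?d) < h" by simp
  then show False using le h0 unfolding ennreal_le_iff2 by linarith
qed

subsection \<open>Volumes of round tubes\<close>

definition tube :: "'a \<Rightarrow> 'a::euclidean_space set \<Rightarrow> real \<Rightarrow> real set \<Rightarrow> 'a set" where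
  "tube e Z r I = {x \<in> span (insert e Z). x \<bullet> e \<in> I \<and> (\<Sum>a\<in>Z. (x \<bullet> a)\<^sup>2) = r\<^sup>2}"

text \<open>With q = 1 + 1/d the annulus between the radii r and q r has between one and two times
  the volume of the ball of radius r.\<close>

lemma one_plus_inverse_power:
  assumes "1 \<le> d" shows "2 \<le> (1 + 1 / real d) ^ d" "(1 + 1 / real d) ^ d \<le> 3"
proof -
  show "2 \<le> (1 + 1 / real d) ^ d"
    using Bernoulli_inequality[of "1 / real d" d] assms order_trans[of "-1::real" 0 "1 / real d"] by simp
  have "(1 + 1 / real d) ^ d \<le> exp (1 / real d) ^ d"
    by (intro power_mono exp_ge_add_one_self) auto
  also have "\<dots> = exp 1" using assms by (simp flip: exp_of_nat_mult)
  also have "\<dots> \<le> 3" by (rule exp_le)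
  finally show "(1 + 1 / real d) ^ d \<le> 3" .
qed

lemma borel_tube [measurable]:
  assumes "I \<in> sets borel" shows "tube e Z r I \<in> sets borel"
proof -
  have s[measurable]: "span (insert e Z) \<in> sets borel" by (simp add: borel_closed closed_subspace)
  have "tube e Z r I = span (insert e Z) \<inter> {x \<in> space borel. x \<bullet> e \<in> I \<and> (\<Sum>a\<in>Z. (x \<bullet> a)\<^sup>2) = r\<^sup>2}"
    by (auto simp: tube_def)
  also have "\<dots> \<in> sets borel" using assms by measurable
  finally show ?thesis .
qed

lemma orthonormal_insert_split:
  assumes Z: "orthonormal (insert e Z)" "e \<notin> Z" and x: "x \<in> span (insert e Z)"
  shows "x - (x \<bullet> e) *\<^sub>R e \<in> span Z" "(norm (x - (x \<bullet> e) *\<^sub>R e))\<^sup>2 = (\<Sum>a\<in>Z. (x \<bullet> a)\<^sup>2)"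
proof -
  have fin: "finite Z" using orthonormal_finite[OF Z(1)] by simp
  have "x - (x \<bullet> e) *\<^sub>R e = (\<Sum>a\<in>Z. (x \<bullet> a) *\<^sub>R a)"
    using orthonormal_span_expansion[OF Z(1) x] fin Z(2) by (simp add: algebra_simps)
  then show "x - (x \<bullet> e) *\<^sub>R e \<in> span Z" "(norm (x - (x \<bullet> e) *\<^sub>R e))\<^sup>2 = (\<Sum>a\<in>Z. (x \<bullet> a)\<^sup>2)"
    using orthonormal_norm_sum[OF orthonormal_subset[OF Z(1)], of Z "\<lambda>a. x \<bullet> a"]
    by (auto intro: span_sum span_mul span_base)
qed

lemma orthonormal_insert_orth:
  assumes Z: "orthonormal (insert e Z)" "e \<notin> Z" and x: "x \<in> span Z"
  shows "x \<bullet> e = 0"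
proof -
  have "orthogonal e x"
    by (rule orthogonal_to_span[OF x]) (use Z in \<open>auto simp: orthogonal_def orthonormal_def\<close>)
  then show ?thesis by (simp add: orthogonal_def inner_commute)
qed

lemma tube_iff:
  assumes Z: "orthonormal (insert e Z)" "e \<notin> Z" and r: "0 \<le> r"
  shows "x \<in> tube e Z r I \<longleftrightarrow> (\<exists>t\<in>I. \<exists>y\<in>span Z. norm y = r \<and> x = t *\<^sub>R e + y)"
proof
  assume x: "x \<in> tube e Z r I"
  then have "(norm (x - (x \<bullet> e) *\<^sub>R e))\<^sup>2 = r\<^sup>2" "x - (x \<bullet> e) *\<^sub>R e \<in> span Z"
    using orthonormal_insert_split[OF Z, of x] by (auto simp: tube_def)
  then show "\<exists>t\<in>I. \<exists>y\<in>span Z. norm y = r \<and> x = t *\<^sub>R e + y"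
    using x r by (intro bexI[of _ "x \<bullet> e"] bexI[of _ "x - (x \<bullet> e) *\<^sub>R e"]) (auto simp: tube_def)
next
  assume "\<exists>t\<in>I. \<exists>y\<in>span Z. norm y = r \<and> x = t *\<^sub>R e + y"
  then obtain t y where ty: "t \<in> I" "y \<in> span Z" "norm y = r" "x = t *\<^sub>R e + y" by blast
  have ye: "y \<bullet> e = 0" by (rule orthonormal_insert_orth[OF Z ty(2)])
  have ee: "e \<bullet> e = 1" using Z(1) by (simp add: orthonormal_def)
  have xs: "x \<in> span (insert e Z)" unfolding ty(4)
    using ty(2) by (intro span_add span_mul) (auto intro: span_base subsetD[OF span_mono, of Z])
  have xe: "x \<bullet> e = t" using ye ee ty(4) by (simp add: inner_add_left)
  have "(\<Sum>a\<in>Z. (x \<bullet> a)\<^sup>2) = (norm y)\<^sup>2"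
    using orthonormal_insert_split(2)[OF Z xs] by (simp add: xe) (simp add: ty(4))
  then show "x \<in> tube e Z r I" using xs xe ty by (simp add: tube_def)
qed

lemma norm_sq_orth:
  assumes "e \<bullet> e = 1" "w \<bullet> e = 0"
  shows "(norm (k *\<^sub>R e + w))\<^sup>2 = k\<^sup>2 + (norm w)\<^sup>2"
  using assms by (simp add: power2_norm_eq_inner inner_add_left inner_add_right inner_commute[of e w])
     (simp add: power2_eq_square)

lemma norm_sq_diff_scaled:
  "(norm (a *\<^sub>R x - b *\<^sub>R y))\<^sup>2 = a\<^sup>2 * (norm x)\<^sup>2 + b\<^sup>2 * (norm y)\<^sup>2 - 2 * a * b * (x \<bullet> y)"
  by (simp add: power2_norm_eq_inner inner_diff_left inner_diff_right inner_commute[of y x])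
     (simp add: power2_eq_square algebra_simps)

lemma annulus_measure:
  fixes Z :: "'a::euclidean_space set"
  assumes Z: "orthonormal Z" and d: "1 \<le> card Z" and r: "0 < r" "r \<le> s"
  shows "hausdorff_outer (card Z) (flat_ball Z s - flat_ball Z r) = ennreal (flat_vol Z * (s ^ card Z - r ^ card Z))"
proof -
  have dec: "flat_ball Z s = flat_ball Z r \<union> (flat_ball Z s - flat_ball Z r)" using r by (auto simp: flat_ball_def)
  have "hausdorff_outer (card Z) (flat_ball Z r) + hausdorff_outer (card Z) (flat_ball Z s - flat_ball Z r) = hausdorff_outer (card Z) (flat_ball Z s)"
    using hausdorff_outer_Un_disjoint[OF d, of "flat_ball Z r" "flat_ball Z s - flat_ball Z r"] dec by auto
  then have "ennreal (flat_vol Z * r ^ card Z) + hausdorff_outer (card Z) (flat_ball Z s - flat_ball Z r) = ennreal (flat_vol Z * s ^ card Z)"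
    using r by (simp add: flat_ball_measure[OF Z d])
  then have "hausdorff_outer (card Z) (flat_ball Z s - flat_ball Z r) = ennreal (flat_vol Z * s ^ card Z) - ennreal (flat_vol Z * r ^ card Z)"
    by (metis ennreal_add_diff_cancel_left ennreal_neq_top)
  also have "\<dots> = ennreal (flat_vol Z * (s ^ card Z - r ^ card Z))"
    using flat_vol_pos[OF Z d] r by (subst ennreal_minus) (auto simp: algebra_simps)
  finally show ?thesis .
qed

text \<open>The annulus \<open>r < |x| \<le> r + r/d\<close> is mapped onto the tube of length \<open>r/d\<close> in polar coordinates
  without expanding distances; the inverse expands them by \<open>1 + 1/d\<close> at most, which costs only a factor \<open>3\<close>.\<close>
lemma tube_measure_thin:
  fixes Z :: "'a::euclidean_space set" and r :: real
  assumes Z: "orthonormal (insert e Z)" "e \<notin> Z" and d: "1 \<le> card Z" and r: "0 < r"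
  shows "hausdorff_outer (card Z) (tube e Z r {0<..r / card Z}) \<le> ennreal (2 * r ^ card Z * flat_vol Z)"
    and "ennreal (1/2 * r ^ card Z * flat_vol Z) \<le> hausdorff_outer (card Z) (tube e Z r {0<..r / card Z})"
proof -
  let ?d = "card Z"
  let ?T = "tube e Z r {0<..r / ?d}"
  define q where "q = 1 + 1 / real ?d"
  have q: "2 \<le> q ^ ?d" "q ^ ?d \<le> 3" "1 < q" using one_plus_inverse_power[OF d] d by (auto simp: q_def)
  have Z': "orthonormal Z" using Z(1) by (rule orthonormal_subset) auto
  have ee: "e \<bullet> e = 1" using Z(1) by (simp add: orthonormal_def)
  have rq: "r + r / ?d = r * q" by (simp add: q_def algebra_simps)
  define An where "An = flat_ball Z (r * q) - flat_ball Z r"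
  have "hausdorff_outer ?d An = ennreal (flat_vol Z * ((r * q) ^ ?d - r ^ ?d))"
    unfolding An_def using r q by (intro annulus_measure[OF Z' d]) auto
  also have "flat_vol Z * ((r * q) ^ ?d - r ^ ?d) = (q ^ ?d - 1) * r ^ ?d * flat_vol Z"
    by (simp add: power_mult_distrib algebra_simps)
  finally have mAn: "hausdorff_outer ?d An = ennreal ((q ^ ?d - 1) * r ^ ?d * flat_vol Z)" .
  have An: "x \<in> span Z" "r < norm x" "norm x \<le> r * q" "x \<bullet> e = 0" if "x \<in> An" for x
    using that orthonormal_insert_orth[OF Z] by (auto simp: An_def flat_ball_def)
  have vp: "0 < r ^ ?d * flat_vol Z" using r flat_vol_pos[OF Z' d] by simp
  \<comment> \<open>\<open>F\<close> and \<open>G\<close> are the two directions of the polar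
    coordinate map between annulus and tube: \<open>F\<close> yields the upper bound,
    \<open>G\<close> the lower one.\<close>
  define F where "F x = (norm x - r) *\<^sub>R e + (r / norm x) *\<^sub>R x" for x
  define G where "G p = (1 + (p \<bullet> e) / r) *\<^sub>R (p - (p \<bullet> e) *\<^sub>R e)" for p
  have TF: "?T \<subseteq> F ` An"
  proof
    fix p assume "p \<in> ?T"
    then obtain t y where p: "0 < t" "t \<le> r / ?d" "y \<in> span Z" "norm y = r" "p = t *\<^sub>R e + y"
      using tube_iff[OF Z, of r p] r by auto
    let ?x = "(1 + t / r) *\<^sub>R y"
    have n: "norm ?x = r + t" using p r by (simp add: field_simps)
    have "?x \<in> An" using p r n rq by (simp add: An_def flat_ball_def span_mul)
    moreover have "F ?x = p"
    proof -
      have "(r / (r + t)) * (1 + t / r) = 1" using r p(1) add_pos_pos[of "r * r" "r * t"] by (simp add: field_simps)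
      then have "(r / (r + t)) *\<^sub>R (1 + t / r) *\<^sub>R y = y" by (simp only: scaleR_scaleR scaleR_one)
      then show ?thesis unfolding F_def n by (simp only: p(5)) simp
    qed
    ultimately show "p \<in> F ` An" by (metis image_eqI)
  qed
  have lipF: "dist (F x) (F y) \<le> 1 * dist x y" if xy: "x \<in> An" "y \<in> An" for x y
  proof -
    have n: "0 < norm x" "0 < norm y" using An(2)[OF xy(1)] An(2)[OF xy(2)] r by auto
    define c where "c = x \<bullet> y / (norm x * norm y)"
    have xyc: "x \<bullet> y = c * norm x * norm y" using n by (simp add: c_def)
    have c1: "c \<le> 1" using norm_cauchy_schwarz[of x y] n by (simp add: c_def divide_le_eq)
    have "(dist (F x) (F y))\<^sup>2 = (norm x - norm y)\<^sup>2 + 2 * r\<^sup>2 * (1 - c)"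
    proof -
      have "F x - F y = (norm x - norm y) *\<^sub>R e + ((r / norm x) *\<^sub>R x - (r / norm y) *\<^sub>R y)" by (simp add: F_def algebra_simps)
      moreover have "((r / norm x) *\<^sub>R x - (r / norm y) *\<^sub>R y) \<bullet> e = 0"
        using An(4)[OF xy(1)] An(4)[OF xy(2)] by (simp add: inner_diff_left)
      ultimately have "(dist (F x) (F y))\<^sup>2 = (norm x - norm y)\<^sup>2 + ((r / norm x)\<^sup>2 * (norm x)\<^sup>2 + (r / norm y)\<^sup>2 * (norm y)\<^sup>2 - 2 * (r / norm x) * (r / norm y) * (x \<bullet> y))"
        by (simp only: dist_norm norm_sq_orth[OF ee] norm_sq_diff_scaled)
      also have "\<dots> = (norm x - norm y)\<^sup>2 + 2 * r\<^sup>2 * (1 - c)"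
        unfolding xyc using n by (simp add: power2_eq_square field_simps)
      finally show ?thesis .
    qed
    \<comment> \<open>Outside the ball of radius r the angular part only shrinks under
      \<open>F\<close>, because r^2 is at most |x| |y|; the radial part is kept.\<close>
    also have "\<dots> \<le> (norm x - norm y)\<^sup>2 + 2 * (norm x * norm y) * (1 - c)"
    proof -
      have "r\<^sup>2 \<le> norm x * norm y" unfolding power2_eq_square
        using An(2)[OF xy(1)] An(2)[OF xy(2)] r by (intro mult_mono) auto
      then show ?thesis using c1 by (intro add_left_mono mult_right_mono) auto
    qed
    also have "\<dots> = (norm x)\<^sup>2 + (norm y)\<^sup>2 - 2 * (x \<bullet> y)"
      unfolding xyc by (simp add: power2_eq_square algebra_simps)
    also have "\<dots> = (dist x y)\<^sup>2"
      by (simp add: dist_norm power2_norm_eq_inner inner_diff_left inner_diff_right inner_commute)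
    finally show ?thesis by (simp add: power2_le_iff_abs_le)
  qed
  have "hausdorff_outer ?d ?T \<le> hausdorff_outer ?d (F ` An)" by (rule hausdorff_outer_mono[OF TF])
  also have "\<dots> \<le> ennreal (1 ^ ?d) * hausdorff_outer ?d An"
    by (rule hausdorff_outer_lipschitz_image[OF _ lipF]) auto
  also have "\<dots> \<le> ennreal (2 * r ^ ?d * flat_vol Z)"
    using mult_right_mono[of "q ^ ?d - 1" 2 "r ^ ?d * flat_vol Z"] q vp
    by (simp add: mAn ennreal_leI mult.assoc)
  finally show "hausdorff_outer ?d ?T \<le> ennreal (2 * r ^ ?d * flat_vol Z)" .
  have AG: "An \<subseteq> G ` ?T"
  proof
    fix x assume x: "x \<in> An"
    have n: "0 < norm x" using An(2)[OF x] r by auto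
    let ?p = "(norm x - r) *\<^sub>R e + (r / norm x) *\<^sub>R x"
    have "\<exists>t\<in>{0<..r / ?d}. \<exists>y\<in>span Z. norm y = r \<and> ?p = t *\<^sub>R e + y"
      by (rule bexI[of _ "norm x - r"], rule bexI[of _ "(r / norm x) *\<^sub>R x"])
         (use An[OF x] r n rq in \<open>auto simp: span_mul\<close>)
    then have "?p \<in> ?T" using tube_iff[OF Z, of r ?p] r by auto
    moreover have "G ?p = x"
    proof -
      have "?p \<bullet> e = norm x - r" using ee An(4)[OF x] by (simp add: inner_add_left)
      then have "G ?p = (1 + (norm x - r) / r) *\<^sub>R (r / norm x) *\<^sub>R x" by (simp add: G_def)
      moreover have "(1 + (norm x - r) / r) * (r / norm x) = 1" using r n by (simp add: field_simps)
      ultimately show ?thesis by (simp only: scaleR_scaleR scaleR_one)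
    qed
    ultimately show "x \<in> G ` ?T" by (metis image_eqI)
  qed
  have lipG: "dist (G p) (G p') \<le> q * dist p p'" if pp: "p \<in> ?T" "p' \<in> ?T" for p p'
  proof -
    obtain t y where p: "0 < t" "t \<le> r / ?d" "y \<in> span Z" "norm y = r" "p = t *\<^sub>R e + y"
      using tube_iff[OF Z, of r p] r pp by auto
    obtain t' y' where p': "0 < t'" "t' \<le> r / ?d" "y' \<in> span Z" "norm y' = r" "p' = t' *\<^sub>R e + y'"
      using tube_iff[OF Z, of r p'] r pp by auto
    have o: "y \<bullet> e = 0" "y' \<bullet> e = 0" using orthonormal_insert_orth[OF Z] p p' by auto
    have G: "G p = (1 + t / r) *\<^sub>R y" "G p' = (1 + t' / r) *\<^sub>R y'"
      using o ee by (auto simp: G_def p(5) p'(5) inner_add_left)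
    define s where "s = 1 + t / r"
    define s' where "s' = 1 + t' / r"
    have s: "1 \<le> s" "s \<le> q" "1 \<le> s'" "s' \<le> q" using p p' r by (auto simp: s_def s'_def q_def field_simps)
    have yy: "y \<bullet> y = r\<^sup>2" "y' \<bullet> y' = r\<^sup>2" using p p' by (auto simp flip: power2_norm_eq_inner)
    have "y \<bullet> y' \<le> r * r" using norm_cauchy_schwarz[of y y'] p p' by simp
    then have nn: "0 \<le> 2 * (r\<^sup>2 - y \<bullet> y')" by (simp add: power2_eq_square)
    \<comment> \<open>The squared angular distance is multiplied by s s', with both factors at most
      q, while the axial distance is unchanged.\<close>
    have "(dist (G p) (G p'))\<^sup>2 = (s - s')\<^sup>2 * r\<^sup>2 + s * s' * (2 * (r\<^sup>2 - y \<bullet> y'))"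
      unfolding G s_def[symmetric] s'_def[symmetric] dist_norm norm_sq_diff_scaled p(4) p'(4)
      by (simp add: power2_eq_square algebra_simps)
    also have "(s - s')\<^sup>2 * r\<^sup>2 = (t - t')\<^sup>2" using r by (simp add: s_def s'_def power2_eq_square field_simps)
    also have "(t - t')\<^sup>2 + s * s' * (2 * (r\<^sup>2 - y \<bullet> y')) \<le> q\<^sup>2 * (t - t')\<^sup>2 + q\<^sup>2 * (2 * (r\<^sup>2 - y \<bullet> y'))"
    proof (rule add_mono)
      have "1 \<le> q\<^sup>2" using q by simp
      then show "(t - t')\<^sup>2 \<le> q\<^sup>2 * (t - t')\<^sup>2" using mult_right_mono[of 1 "q\<^sup>2" "(t - t')\<^sup>2"] by simp
      have "s * s' \<le> q\<^sup>2" unfolding power2_eq_square using s by (intro mult_mono) auto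
      then show "s * s' * (2 * (r\<^sup>2 - y \<bullet> y')) \<le> q\<^sup>2 * (2 * (r\<^sup>2 - y \<bullet> y'))" using nn by (rule mult_right_mono)
    qed
    also have "\<dots> = (q * dist p p')\<^sup>2"
    proof -
      have "(dist p p')\<^sup>2 = (t - t')\<^sup>2 + 2 * (r\<^sup>2 - y \<bullet> y')"
      proof -
        have "p - p' = (t - t') *\<^sub>R e + (1 *\<^sub>R y - 1 *\<^sub>R y')" by (simp add: p(5) p'(5) algebra_simps)
        moreover have "(1 *\<^sub>R y - 1 *\<^sub>R y') \<bullet> e = 0" using o by (simp add: inner_diff_left)
        ultimately have "(dist p p')\<^sup>2 = (t - t')\<^sup>2 + (1\<^sup>2 * (norm y)\<^sup>2 + 1\<^sup>2 * (norm y')\<^sup>2 - 2 * 1 * 1 * (y \<bullet> y'))"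
          by (simp only: dist_norm norm_sq_orth[OF ee] norm_sq_diff_scaled)
        then show ?thesis by (simp add: p(4) p'(4))
      qed
      then show ?thesis by (simp only: power_mult_distrib distrib_left)
    qed
    finally show ?thesis using q by (simp add: power2_le_iff_abs_le)
  qed
  have "hausdorff_outer ?d An \<le> hausdorff_outer ?d (G ` ?T)" by (rule hausdorff_outer_mono[OF AG])
  also have "\<dots> \<le> ennreal (q ^ ?d) * hausdorff_outer ?d ?T"
    by (rule hausdorff_outer_lipschitz_image[OF _ lipG]) (use q in auto)
  finally have "ennreal (1 / q ^ ?d) * hausdorff_outer ?d An \<le> ennreal (1 / q ^ ?d) * (ennreal (q ^ ?d) * hausdorff_outer ?d ?T)"
    by (intro mult_left_mono) auto
  also have "\<dots> = hausdorff_outer ?d ?T" using q by (simp add: mult.assoc[symmetric] ennreal_mult'[symmetric])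
  finally have "ennreal (1 / q ^ ?d * ((q ^ ?d - 1) * r ^ ?d * flat_vol Z)) \<le> hausdorff_outer ?d ?T"
    unfolding mAn using q by (simp add: ennreal_mult'[symmetric])
  moreover have "1/2 * r ^ ?d * flat_vol Z \<le> 1 / q ^ ?d * ((q ^ ?d - 1) * r ^ ?d * flat_vol Z)"
  proof -
    have "1/2 \<le> (q ^ ?d - 1) / q ^ ?d" using q by (simp add: field_simps)
    from mult_right_mono[OF this, of "r ^ ?d * flat_vol Z"] vp show ?thesis by simp
  qed
  ultimately show "ennreal (1/2 * r ^ ?d * flat_vol Z) \<le> hausdorff_outer ?d ?T"
    by (meson ennreal_leI order_trans)
qed

lemma tube_translation:
  assumes Z: "orthonormal (insert e Z)" "e \<notin> Z" and r: "0 \<le> r"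
  shows "(+) (s *\<^sub>R e) ` tube e Z r {a<..b} = tube e Z r {s + a<..s + b}"
proof (intro set_eqI iffI)
  fix x assume "x \<in> (+) (s *\<^sub>R e) ` tube e Z r {a<..b}"
  then obtain x' where x': "x' \<in> tube e Z r {a<..b}" "x = s *\<^sub>R e + x'" by blast
  obtain t y where "t \<in> {a<..b}" "y \<in> span Z" "norm y = r" "x' = t *\<^sub>R e + y"
    using x'(1) unfolding tube_iff[OF Z r] by blast
  then have "s + t \<in> {s + a<..s + b}" "y \<in> span Z" "norm y = r" "x = (s + t) *\<^sub>R e + y"
    using x'(2) by (auto simp: algebra_simps)
  then show "x \<in> tube e Z r {s + a<..s + b}" unfolding tube_iff[OF Z r] by blast
next
  fix x assume "x \<in> tube e Z r {s + a<..s + b}"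
  then obtain t y where t: "t \<in> {s + a<..s + b}" "y \<in> span Z" "norm y = r" "x = t *\<^sub>R e + y"
    unfolding tube_iff[OF Z r] by blast
  have "t - s \<in> {a<..b}" using t(1) by auto
  with t(2,3) have "(t - s) *\<^sub>R e + y \<in> tube e Z r {a<..b}" unfolding tube_iff[OF Z r] by blast
  moreover have "x = s *\<^sub>R e + ((t - s) *\<^sub>R e + y)" using t by (simp add: algebra_simps)
  ultimately show "x \<in> (+) (s *\<^sub>R e) ` tube e Z r {a<..b}" by blast
qed

lemma tube_split:
  assumes "0 < l" "1 \<le> m"
  shows "tube e Z r {s<..s + real m * l} = (\<Union>j<m. tube e Z r {s + real j * l<..s + real j * l + l})"
proof (intro set_eqI iffI)
  fix x assume x: "x \<in> tube e Z r {s<..s + real m * l}"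
  define j where "j = nat (\<lceil>(x \<bullet> e - s) / l\<rceil> - 1)"
  have p: "0 < (x \<bullet> e - s) / l" "(x \<bullet> e - s) / l \<le> real m" using x assms by (auto simp: tube_def field_simps)
  have j: "real j < (x \<bullet> e - s) / l" "(x \<bullet> e - s) / l \<le> real j + 1"
    unfolding j_def using p by linarith+
  have "j < m" using j p by linarith
  moreover have "s + real j * l < x \<bullet> e" "x \<bullet> e \<le> s + real j * l + l" using j assms by (auto simp: field_simps)
  ultimately show "x \<in> (\<Union>j<m. tube e Z r {s + real j * l<..s + real j * l + l})" using x by (auto simp: tube_def)
next
  fix x assume "x \<in> (\<Union>j<m. tube e Z r {s + real j * l<..s + real j * l + l})"
  then obtain j where j: "j < m" "x \<in> tube e Z r {s + real j * l<..s + real j * l + l}" by blast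
  have "(real j + 1) * l \<le> real m * l" using j assms by (intro mult_right_mono) auto
  then have "s + real j * l + l \<le> s + real m * l" by (simp add: algebra_simps)
  moreover have "s + 0 \<le> s + real j * l" using assms by (intro add_left_mono) simp
  ultimately show "x \<in> tube e Z r {s<..s + real m * l}" using j unfolding tube_def greaterThanAtMost_iff mem_Collect_eq by linarith
qed

text \<open>Half-open intervals let translates of a thin tube tile a longer one without common
  boundary, so the measure is exactly additive.\<close>

lemma tube_measure_multiple:
  fixes Z :: "'a::euclidean_space set"
  assumes Z: "orthonormal (insert e Z)" "e \<notin> Z" and d: "1 \<le> d" and r: "0 \<le> r" and l: "0 < l"
  shows "hausdorff_outer d (tube e Z r {s<..s + real m * l}) = of_nat m * hausdorff_outer d (tube e Z r {0<..l})"
proof (cases "m = 0")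
  case True
  then show ?thesis using hausdorff_outer_empty[OF d] by (simp add: tube_def)
next
  case False
  have "disjoint_family_on (\<lambda>j. tube e Z r {s + real j * l<..s + real j * l + l}) {..<m}"
  proof (clarsimp simp: disjoint_family_on_def disjoint_iff tube_def)
    fix i j :: nat and x assume ij: "i \<noteq> j" "s + real i * l < x \<bullet> e" "x \<bullet> e \<le> s + real i * l + l"
      "s + real j * l < x \<bullet> e" "x \<bullet> e \<le> s + real j * l + l"
    then have "real i * l < (real j + 1) * l" "real j * l < (real i + 1) * l" by (auto simp: algebra_simps)
    then have "real i < real j + 1" "real j < real i + 1" using l by (auto simp only: mult_less_cancel_right_pos)
    then show False using ij(1) by linarith
  qed
  then have "hausdorff_outer d (tube e Z r {s<..s + real m * l}) = (\<Sum>j<m. hausdorff_outer d (tube e Z r {s + real j * l<..s + real j * l + l}))"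
    using l False by (subst tube_split) (auto intro!: hausdorff_outer_UN_disjoint[OF d])
  also have "\<dots> = (\<Sum>j<m. hausdorff_outer d (tube e Z r {0<..l}))"
  proof (rule sum.cong[OF refl])
    fix j
    show "hausdorff_outer d (tube e Z r {s + real j * l<..s + real j * l + l}) = hausdorff_outer d (tube e Z r {0<..l})"
      using tube_translation[OF Z r, of "s + real j * l" 0 l]
        hausdorff_outer_translation[of d "(s + real j * l) *\<^sub>R e" "tube e Z r {0<..l}"] by simp
  qed
  finally show ?thesis by simp
qed

text \<open>A tube of length m r consists of m d thin tubes of length r / d. The thin bounds lose a
  factor 2 in either direction, hence 2 d here and d / 2 in the companion
  \<open>tube_measure_ge\<close>.\<close>

lemma tube_measure_le:
  fixes Z :: "'a::euclidean_space set" and r :: real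
  assumes Z: "orthonormal (insert e Z)" "e \<notin> Z" and d: "1 \<le> card Z" and r: "0 < r"
  shows "hausdorff_outer (card Z) (tube e Z r {s<..s + real m * r}) \<le> ennreal (real m * (2 * card Z * r ^ card Z * flat_vol Z))"
proof -
  have v: "0 < flat_vol Z" by (rule flat_vol_pos[OF orthonormal_subset[OF Z(1)] d]) auto
  have "hausdorff_outer (card Z) (tube e Z r {s<..s + real m * r})
     = of_nat (m * card Z) * hausdorff_outer (card Z) (tube e Z r {0<..r / card Z})"
    using tube_measure_multiple[OF Z d, of r "r / card Z" s "m * card Z"] r d by simp
  also have "\<dots> \<le> of_nat (m * card Z) * ennreal (2 * r ^ card Z * flat_vol Z)"
    by (intro mult_left_mono tube_measure_thin(1)[OF Z d r]) simp
  also have "\<dots> = ennreal (real m * (2 * card Z * r ^ card Z * flat_vol Z))"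
    using r v unfolding ennreal_of_nat_eq_real_of_nat by (subst ennreal_mult'[symmetric]) (auto simp: ac_simps)
  finally show ?thesis .
qed

lemma tube_measure_ge:
  fixes Z :: "'a::euclidean_space set" and r :: real
  assumes Z: "orthonormal (insert e Z)" "e \<notin> Z" and d: "1 \<le> card Z" and r: "0 < r"
  shows "ennreal (real m * (1/2 * card Z * r ^ card Z * flat_vol Z)) \<le> hausdorff_outer (card Z) (tube e Z r {s<..s + real m * r})"
proof -
  have v: "0 < flat_vol Z" by (rule flat_vol_pos[OF orthonormal_subset[OF Z(1)] d]) auto
  have "ennreal (real m * (1/2 * card Z * r ^ card Z * flat_vol Z)) = of_nat (m * card Z) * ennreal (1/2 * r ^ card Z * flat_vol Z)"
    using r v unfolding ennreal_of_nat_eq_real_of_nat by (subst ennreal_mult'[symmetric]) (auto simp: ac_simps)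
  also have "\<dots> \<le> of_nat (m * card Z) * hausdorff_outer (card Z) (tube e Z r {0<..r / card Z})"
    by (intro mult_left_mono tube_measure_thin(2)[OF Z d r]) simp
  also have "\<dots> = hausdorff_outer (card Z) (tube e Z r {s<..s + real m * r})"
    using tube_measure_multiple[OF Z d, of r "r / card Z" s "m * card Z"] r d by simp
  finally show ?thesis .
qed

subsection \<open>Twice continuously differentiable graphs\<close>

text \<open>The first derivative is recorded as a gradient, the second by its value in each fixed
  direction. In finite dimension continuity in every direction is continuity in operator norm, and
  this form is easily verified for sums, products and compositions; \<open>C2_map_sum\<close>
  converts it to \<open>C2_map\<close>.\<close>

definition C2_real :: "('a::euclidean_space \<Rightarrow> real) \<Rightarrow> bool" where
  "C2_real h \<longleftrightarrow> (\<exists>G H. (\<forall>x. (h has_derivative (\<lambda>v. G x \<bullet> v)) (at x)) \<and>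
      (\<forall>x. (G has_derivative H x) (at x)) \<and> (\<forall>v. continuous_on UNIV (\<lambda>x. H x v)))"

lemma C2_realI:
  assumes "\<And>x. (h has_derivative (\<lambda>v. G x \<bullet> v)) (at x)" "\<And>x. (G has_derivative H x) (at x)"
    "\<And>v. continuous_on UNIV (\<lambda>x. H x v)"
  shows "C2_real h"
  using assms unfolding C2_real_def by blast

lemma C2_realE:
  assumes "C2_real h"
  obtains G H where "\<And>x. (h has_derivative (\<lambda>v. G x \<bullet> v)) (at x)" "\<And>x. (G has_derivative H x) (at x)"
    "\<And>v. continuous_on UNIV (\<lambda>x. H x v)" "continuous_on UNIV h" "continuous_on UNIV G"
proof -
  obtain G H where *: "\<And>x. (h has_derivative (\<lambda>v. G x \<bullet> v)) (at x)" "\<And>x. (G has_derivative H x) (at x)"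
    "\<And>v. continuous_on UNIV (\<lambda>x. H x v)" using assms unfolding C2_real_def by blast
  moreover have "continuous_on UNIV h" "continuous_on UNIV G"
    using * by (auto simp: continuous_on_eq_continuous_at intro: has_derivative_continuous)
  ultimately show ?thesis using that by blast
qed

lemma C2_real_continuous: "C2_real h \<Longrightarrow> continuous_on UNIV h"
  by (erule C2_realE)

lemma C2_real_const: "C2_real (\<lambda>x. c)"
  by (rule C2_realI[of _ "\<lambda>_. 0" "\<lambda>_ _. 0"]) (auto intro!: derivative_eq_intros)

lemma C2_real_inner: "C2_real (\<lambda>x. x \<bullet> a)"
  by (rule C2_realI[of _ "\<lambda>_. a" "\<lambda>_ _. 0"]) (auto intro!: derivative_eq_intros simp: inner_commute)

lemma C2_real_add:
  assumes "C2_real f" "C2_real g" shows "C2_real (\<lambda>x. f x + g x)"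
proof -
  obtain F F' where F: "\<And>x. (f has_derivative (\<lambda>v. F x \<bullet> v)) (at x)" "\<And>x. (F has_derivative F' x) (at x)"
    "\<And>v. continuous_on UNIV (\<lambda>x. F' x v)" using C2_realE[OF assms(1)] by metis
  obtain G G' where G: "\<And>x. (g has_derivative (\<lambda>v. G x \<bullet> v)) (at x)" "\<And>x. (G has_derivative G' x) (at x)"
    "\<And>v. continuous_on UNIV (\<lambda>x. G' x v)" using C2_realE[OF assms(2)] by metis
  show ?thesis
    by (rule C2_realI[of _ "\<lambda>x. F x + G x" "\<lambda>x v. F' x v + G' x v"])
       (auto intro!: has_derivative_add F G continuous_on_add has_derivative_eq_rhs[OF has_derivative_add[OF F(1) G(1)]] simp: inner_add_left)
qed

lemma C2_real_mult:
  assumes "C2_real f" "C2_real g" shows "C2_real (\<lambda>x. f x * g x)"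
proof -
  obtain F F' where F: "\<And>x. (f has_derivative (\<lambda>v. F x \<bullet> v)) (at x)" "\<And>x. (F has_derivative F' x) (at x)"
    "\<And>v. continuous_on UNIV (\<lambda>x. F' x v)" "continuous_on UNIV f" "continuous_on UNIV F" using C2_realE[OF assms(1)] by metis
  obtain G G' where G: "\<And>x. (g has_derivative (\<lambda>v. G x \<bullet> v)) (at x)" "\<And>x. (G has_derivative G' x) (at x)"
    "\<And>v. continuous_on UNIV (\<lambda>x. G' x v)" "continuous_on UNIV g" "continuous_on UNIV G" using C2_realE[OF assms(2)] by metis
  show ?thesis
  proof (rule C2_realI)
    show "((\<lambda>x. f x * g x) has_derivative (\<lambda>v. (f x *\<^sub>R G x + g x *\<^sub>R F x) \<bullet> v)) (at x)" for x
      by (rule has_derivative_eq_rhs[OF has_derivative_mult[OF F(1) G(1)]]) (auto simp: inner_add_left algebra_simps)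
    show "((\<lambda>x. f x *\<^sub>R G x + g x *\<^sub>R F x) has_derivative
        (\<lambda>v. f x *\<^sub>R G' x v + (F x \<bullet> v) *\<^sub>R G x + (g x *\<^sub>R F' x v + (G x \<bullet> v) *\<^sub>R F x))) (at x)" for x
      by (intro has_derivative_add has_derivative_scaleR F G)
    show "continuous_on UNIV (\<lambda>x. f x *\<^sub>R G' x v + (F x \<bullet> v) *\<^sub>R G x + (g x *\<^sub>R F' x v + (G x \<bullet> v) *\<^sub>R F x))" for v
      by (intro continuous_intros F G)
  qed
qed

definition C2_fun :: "(real \<Rightarrow> real) \<Rightarrow> bool" where
  "C2_fun \<phi> \<longleftrightarrow> (\<exists>\<phi>' \<phi>''. (\<forall>t. (\<phi> has_real_derivative \<phi>' t) (at t)) \<and>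
      (\<forall>t. (\<phi>' has_real_derivative \<phi>'' t) (at t)) \<and> continuous_on UNIV \<phi>'')"

lemma C2_real_compose:
  assumes "C2_fun \<phi>" "C2_real f" shows "C2_real (\<lambda>x. \<phi> (f x))"
proof -
  obtain F F' where F: "\<And>x. (f has_derivative (\<lambda>v. F x \<bullet> v)) (at x)" "\<And>x. (F has_derivative F' x) (at x)"
    "\<And>v. continuous_on UNIV (\<lambda>x. F' x v)" "continuous_on UNIV f" "continuous_on UNIV F" using C2_realE[OF assms(2)] by metis
  obtain \<phi>' \<phi>'' where \<phi>: "\<And>t. (\<phi> has_real_derivative \<phi>' t) (at t)" "\<And>t. (\<phi>' has_real_derivative \<phi>'' t) (at t)"
    "continuous_on UNIV \<phi>''" using assms(1) unfolding C2_fun_def by blast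
  have c: "continuous_on UNIV \<phi>'" using \<phi>(2) by (auto simp: continuous_on_eq_continuous_at intro: DERIV_isCont)
  have d: "((\<lambda>x. \<psi> (f x)) has_derivative (\<lambda>v. \<psi>' (f x) * (F x \<bullet> v))) (at x)"
    if "\<And>t. (\<psi> has_real_derivative \<psi>' t) (at t)" for \<psi> \<psi>' x
    using has_derivative_compose[OF F(1), of \<psi> "(*) (\<psi>' (f x))" x] that[of "f x"]
    by (simp add: has_field_derivative_def)
  show ?thesis
  proof (rule C2_realI)
    show "((\<lambda>x. \<phi> (f x)) has_derivative (\<lambda>v. (\<phi>' (f x) *\<^sub>R F x) \<bullet> v)) (at x)" for x
      using d[OF \<phi>(1)] by simp
    show "((\<lambda>x. \<phi>' (f x) *\<^sub>R F x) has_derivative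
        (\<lambda>v. \<phi>' (f x) *\<^sub>R F' x v + (\<phi>'' (f x) * (F x \<bullet> v)) *\<^sub>R F x)) (at x)" for x
      by (intro has_derivative_scaleR F d \<phi>)
    show "continuous_on UNIV (\<lambda>x. \<phi>' (f x) *\<^sub>R F' x v + (\<phi>'' (f x) * (F x \<bullet> v)) *\<^sub>R F x)" for v
      by (intro continuous_intros F continuous_on_compose2[OF c F(4)] continuous_on_compose2[OF \<phi>(3) F(4)]) auto
  qed
qed

lemma C2_real_minus: "C2_real f \<Longrightarrow> C2_real (\<lambda>x. - f x)"
  using C2_real_mult[OF C2_real_const[of "-1"], of f] by simp

lemma C2_real_diff: "C2_real f \<Longrightarrow> C2_real g \<Longrightarrow> C2_real (\<lambda>x. f x - g x)"
  using C2_real_add[OF _ C2_real_minus, of f g] by simp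

lemma C2_real_power: "C2_real f \<Longrightarrow> C2_real (\<lambda>x. f x ^ k)"
  by (induction k) (auto intro: C2_real_const C2_real_mult)

lemma C2_real_sum: "(\<And>i. i \<in> I \<Longrightarrow> C2_real (f i)) \<Longrightarrow> C2_real (\<lambda>x. \<Sum>i\<in>I. f i x)"
  by (induction I rule: infinite_finite_induct) (auto intro: C2_real_const C2_real_add)

lemmas C2_real_intros = C2_real_const C2_real_inner C2_real_add C2_real_mult C2_real_minus C2_real_diff
  C2_real_power C2_real_sum

text \<open>Positive-part powers and a global \<open>C\<^sup>2\<close> extension of the square root, so that all local
  graphs can be written with globally defined functions.\<close>

lemma DERIV_pos_part_power:
  "((\<lambda>t::real. max t 0 ^ Suc (Suc k)) has_real_derivative (real (Suc (Suc k)) * max t 0 ^ Suc k)) (at t)"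
proof (cases "t = 0")
  case False
  then consider "t < 0" | "t > 0" by linarith
  then show ?thesis
  proof cases
    case 1
    then have D: "((\<lambda>t::real. 0) has_real_derivative (real (Suc (Suc k)) * max t 0 ^ Suc k)) (at t)"
      by (simp add: max_def)
    have ev: "\<forall>\<^sub>F x in nhds t. max x 0 ^ Suc (Suc k) = 0"
      using 1 eventually_nhds_in_open[of "{..<0}" t] by (auto elim!: eventually_mono simp: max_def)
    show ?thesis unfolding DERIV_cong_ev[OF refl ev refl] by (rule D)
  next
    case 2
    then have D: "((\<lambda>t::real. t ^ Suc (Suc k)) has_real_derivative (real (Suc (Suc k)) * max t 0 ^ Suc k)) (at t)"
      using DERIV_pow[of "Suc (Suc k)" t UNIV] by (simp add: max_def)
    have ev: "\<forall>\<^sub>F x in nhds t. max x 0 ^ Suc (Suc k) = x ^ Suc (Suc k)"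
      using 2 eventually_nhds_in_open[of "{0<..}" t] by (auto elim!: eventually_mono simp: max_def)
    show ?thesis unfolding DERIV_cong_ev[OF refl ev refl] by (rule D)
  qed
next
  case True
  have "((\<lambda>h::real. max h 0 ^ Suc (Suc k) / h) \<longlongrightarrow> 0) (at 0)"
  proof (rule Lim_null_comparison)
    show "\<forall>\<^sub>F h in at 0. norm (max h 0 ^ Suc (Suc k) / h) \<le> \<bar>h\<bar> ^ Suc k"
    proof (rule always_eventually, rule allI)
      fix h :: real
      show "norm (max h 0 ^ Suc (Suc k) / h) \<le> \<bar>h\<bar> ^ Suc k"
      proof (cases "h \<le> 0")
        case True
        then have "max h 0 = 0" by simp
        then show ?thesis by (simp only: power_0_Suc div_0 norm_zero zero_le_power abs_ge_zero)
      next
        case False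
        then show ?thesis by simp
      qed
    qed
    show "((\<lambda>h::real. \<bar>h\<bar> ^ Suc k) \<longlongrightarrow> 0) (at 0)"
      by (auto intro!: tendsto_eq_intros)
  qed
  then show ?thesis using True by (simp add: has_field_derivative_iff)
qed

text \<open>From exponent 3 on the second derivative is continuous at 0. Exponent 3 serves the bump,
  exponent 4 the cap.\<close>

lemma C2_fun_pos_part: "C2_fun (\<lambda>t. max t 0 ^ (3 + k))"
  unfolding C2_fun_def
proof (intro exI conjI allI)
  fix t :: real
  show "((\<lambda>t. max t 0 ^ (3 + k)) has_real_derivative real (3 + k) * max t 0 ^ (2 + k)) (at t)"
    using DERIV_pos_part_power[of "Suc k" t] by (simp add: eval_nat_numeral)
  show "((\<lambda>t. real (3 + k) * max t 0 ^ (2 + k)) has_real_derivative real (3 + k) * (real (2 + k) * max t 0 ^ (1 + k))) (at t)"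
    using DERIV_cmult[OF DERIV_pos_part_power[of k t], of "real (3 + k)"] by (simp add: eval_nat_numeral)
  show "continuous_on UNIV (\<lambda>t::real. real (3 + k) * (real (2 + k) * max t 0 ^ (1 + k)))"
    by (intro continuous_intros)
qed

lemma C2_fun_sqrt_extension:
  assumes e: "0 < \<epsilon>"
  obtains \<sigma> where "C2_fun \<sigma>" "\<And>t. \<epsilon> \<le> t \<Longrightarrow> \<sigma> t = sqrt t"
proof
  \<comment> \<open>Below \<epsilon> the square root is continued by its quadratic Taylor polynomial
    at \<epsilon>, so the value and two derivatives agree there.\<close>
  define \<sigma> where "\<sigma> t = (if \<epsilon> \<le> t then sqrt t else sqrt \<epsilon> + (t - \<epsilon>) / (2 * sqrt \<epsilon>) - (t - \<epsilon>)\<^sup>2 / (8 * \<epsilon> * sqrt \<epsilon>))" for t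
  define \<sigma>1 where "\<sigma>1 t = (if \<epsilon> \<le> t then 1 / (2 * sqrt t) else 1 / (2 * sqrt \<epsilon>) - (t - \<epsilon>) / (4 * \<epsilon> * sqrt \<epsilon>))" for t
  define \<sigma>2 where "\<sigma>2 t = (if \<epsilon> \<le> t then - 1 / (4 * t * sqrt t) else - 1 / (4 * \<epsilon> * sqrt \<epsilon>))" for t
  show "\<sigma> t = sqrt t" if "\<epsilon> \<le> t" for t using that by (simp add: \<sigma>_def)
  have glue: "((\<lambda>t. if \<epsilon> \<le> t then f t else g t) has_real_derivative (if \<epsilon> \<le> t then f' t else g' t)) (at t)"
    if fd: "\<And>t. \<epsilon> \<le> t \<Longrightarrow> (f has_real_derivative f' t) (at t)" and gd: "\<And>t. (g has_real_derivative g' t) (at t)"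
      and eq: "f \<epsilon> = g \<epsilon>" "f' \<epsilon> = g' \<epsilon>" for f g f' g' and t :: real
  proof -
    have "((\<lambda>t. if t \<in> {\<epsilon>..} then f t else g t) has_derivative (if t \<in> {\<epsilon>..} then (*) (f' t) else (*) (g' t))) (at t within ({\<epsilon>..} \<union> {..<\<epsilon>}))"
    proof (rule has_derivative_If_within_closures[where S = "{\<epsilon>..}" and T = "{..<\<epsilon>}" and f' = "\<lambda>t. (*) (f' t)" and g' = "\<lambda>t. (*) (g' t)"])
      show "(f has_derivative (*) (f' t)) (at t within {\<epsilon>..} \<union> (closure {\<epsilon>..} \<inter> closure {..<\<epsilon>}))"
        if "t \<in> {\<epsilon>..} \<union> (closure {\<epsilon>..} \<inter> closure {..<\<epsilon>})"
        using that fd[of t] by (auto simp: has_field_derivative_def intro: has_derivative_at_withinI)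
      show "(g has_derivative (*) (g' t)) (at t within {..<\<epsilon>} \<union> (closure {\<epsilon>..} \<inter> closure {..<\<epsilon>}))"
        using gd[of t] by (auto simp: has_field_derivative_def intro: has_derivative_at_withinI)
      show "f t = g t" if "t \<in> closure {\<epsilon>..}" "t \<in> closure {..<\<epsilon>}" using that eq by auto
      show "(*) (f' t) = (*) (g' t)" if "t \<in> closure {\<epsilon>..}" "t \<in> closure {..<\<epsilon>}"
      proof -
        have "t = \<epsilon>" using that by auto
        then show ?thesis using eq by simp
      qed
    qed auto
    moreover have "{\<epsilon>..} \<union> {..<\<epsilon>} = UNIV" by auto
    ultimately show ?thesis by (auto simp: has_field_derivative_def split: if_splits)
  qed
  show "C2_fun \<sigma>" unfolding C2_fun_def
  proof (intro exI conjI allI)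
    show "(\<sigma> has_real_derivative \<sigma>1 t) (at t)" for t
      unfolding \<sigma>_def \<sigma>1_def
      by (rule glue) (use e in \<open>auto intro!: derivative_eq_intros simp: field_simps\<close>)
    show "(\<sigma>1 has_real_derivative \<sigma>2 t) (at t)" for t
      unfolding \<sigma>1_def \<sigma>2_def
      by (rule glue) (use e in \<open>auto intro!: derivative_eq_intros simp: field_simps power2_eq_square\<close>)
    have "continuous_on ({\<epsilon>..} \<union> {..\<epsilon>}) \<sigma>2"
      unfolding \<sigma>2_def by (rule continuous_on_If) (use e in \<open>auto intro!: continuous_intros\<close>)
    moreover have "{\<epsilon>..} \<union> {..\<epsilon>} = UNIV" by auto
    ultimately show "continuous_on UNIV \<sigma>2" by simp
  qed
qed

section \<open>Local graph charts\<close>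

definition C2_chart :: "nat \<Rightarrow> 'a::euclidean_space set \<Rightarrow> 'a \<Rightarrow> bool" where
  "C2_chart d M p \<longleftrightarrow> (\<exists>U T g. open U \<and> p \<in> U \<and> subspace T \<and> dim T = d \<and> C2_map g \<and>
      (\<forall>x. \<forall>t\<in>T. inner t (g x) = 0) \<and> M \<inter> U = {x + g x | x. x \<in> T} \<inter> U)"

lemma C2_submanifold_iff_chart: "C2_submanifold d M \<longleftrightarrow> (\<forall>p\<in>M. C2_chart d M p)"
  by (simp add: C2_submanifold_def C2_chart_def)

lemma C2_chart_local:
  assumes "open V" "p \<in> V" "M \<inter> V = E \<inter> V" "C2_chart d E p"
  shows "C2_chart d M p"
proof -
  obtain U T g where *: "open U" "p \<in> U" "subspace T" "dim T = d" "C2_map g"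
      "\<forall>x. \<forall>t\<in>T. inner t (g x) = 0" "E \<inter> U = {x + g x | x. x \<in> T} \<inter> U"
    using assms(4) unfolding C2_chart_def by blast
  have "M \<inter> (U \<inter> V) = (E \<inter> U) \<inter> V" using assms(3) by blast
  also have "\<dots> = {x + g x | x. x \<in> T} \<inter> (U \<inter> V)" unfolding *(7) by blast
  finally show ?thesis unfolding C2_chart_def using * assms(1,2)
    by (intro exI[of _ "U \<inter> V"] exI[of _ T] exI[of _ g]) auto
qed

lemma C2_map_sum:
  assumes "\<And>a. a \<in> A \<Longrightarrow> C2_real (h a)"
  shows "C2_map (\<lambda>x. \<Sum>a\<in>A. h a x *\<^sub>R (a::'a::euclidean_space))"
proof -
  have "\<exists>G H. (\<forall>x. (h a has_derivative (\<lambda>v. G x \<bullet> v)) (at x)) \<and> (\<forall>x. (G has_derivative H x) (at x)) \<and>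
      (\<forall>v. continuous_on UNIV (\<lambda>x. H x v))" if "a \<in> A" for a using assms[OF that] unfolding C2_real_def .
  then obtain G H where h: "\<And>a x. a \<in> A \<Longrightarrow> (h a has_derivative (\<lambda>v. G a x \<bullet> v)) (at x)"
    "\<And>a x. a \<in> A \<Longrightarrow> (G a has_derivative H a x) (at x)" "\<And>a v. a \<in> A \<Longrightarrow> continuous_on UNIV (\<lambda>x. H a x v)"
    by metis
  \<comment> \<open>The rank one map that sends v to (u . v) a: the derivative contributed by a
    component in direction a with gradient u. It is linear in u, so differentiating the gradient
    passes through it.\<close>
  define K :: "'a \<Rightarrow> 'a \<Rightarrow> ('a \<Rightarrow>\<^sub>L 'a)" where "K a u = blinfun_scaleR_left a o\<^sub>L blinfun_inner_right u" for a u
  have Kv: "blinfun_apply (K a u) v = (u \<bullet> v) *\<^sub>R a" for a u v by (simp add: K_def)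
  have bK: "bounded_linear (K a)" for a unfolding K_def
    by (intro bounded_linear_compose[OF bounded_bilinear.bounded_linear_right[OF bounded_bilinear_blinfun_compose]] bounded_linear_blinfun_inner_right)
  have bH: "bounded_linear (H a x)" if "a \<in> A" for a x using h(2)[OF that] by (rule has_derivative_bounded_linear)
  define g' where "g' x = (\<Sum>a\<in>A. K a (G a x))" for x
  define g'' where "g'' x = Blinfun (\<lambda>w. \<Sum>a\<in>A. K a (H a x w))" for x
  have g'': "blinfun_apply (g'' x) = (\<lambda>w. \<Sum>a\<in>A. K a (H a x w))" for x
    unfolding g''_def by (intro bounded_linear_Blinfun_apply bounded_linear_sum bounded_linear_compose[OF bK] bH)
  show ?thesis unfolding C2_map_def
  proof (intro exI conjI allI)
    show "((\<lambda>x. \<Sum>a\<in>A. h a x *\<^sub>R a) has_derivative blinfun_apply (g' x)) (at x)" for x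
      by (rule has_derivative_eq_rhs[OF has_derivative_sum[OF has_derivative_scaleR_left[OF h(1)]]])
         (auto simp: g'_def blinfun.sum_left Kv)
    show "(g' has_derivative blinfun_apply (g'' x)) (at x)" for x
      unfolding g'' g'_def by (intro has_derivative_sum bounded_linear.has_derivative[OF bK] h(2))
    show "continuous_on UNIV g''"
      by (rule continuous_on_blinfun_componentwise)
         (auto simp: g'' intro!: continuous_on_sum bounded_linear.continuous_on[OF bK] h(3))
  qed
qed

text \<open>The equations x . a = h a x describe a graph over \<open>span B\<close> because, by
  \<open>inv\<close>, their right sides see only the coordinates in \<open>B\<close>. The charts of
  tubes and caps are obtained from this by solving for one coordinate.\<close>

lemma C2_chart_graph:
  fixes O' :: "'a::euclidean_space set"
  assumes O: "orthonormal O'" "card O' = DIM('a)" and B: "B \<subseteq> O'" "card B = d"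
    and U: "open U" "p \<in> U"
    and h: "\<And>a. a \<in> O' - B \<Longrightarrow> C2_real (h a)"
    and inv: "\<And>a x y. a \<in> O' - B \<Longrightarrow> (\<And>b. b \<in> B \<Longrightarrow> x \<bullet> b = y \<bullet> b) \<Longrightarrow> h a x = h a y"
    and M: "\<And>x. x \<in> U \<Longrightarrow> x \<in> M \<longleftrightarrow> (\<forall>a\<in>O' - B. x \<bullet> a = h a x)"
  shows "C2_chart d M p"
proof -
  define g where "g x = (\<Sum>a\<in>O' - B. h a x *\<^sub>R a)" for x
  have fin: "finite O'" by (rule orthonormal_finite[OF O(1)])
  have OB: "orthonormal B" "orthonormal (O' - B)" using O B by (auto intro: orthonormal_subset)
  have o: "a \<bullet> b = 0" if "a \<in> B" "b \<in> O' - B" for a b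
    using that O(1) B orthonormal_inner[OF O(1), of a b] by auto
  have orthT: "t \<bullet> b = 0" if "t \<in> span B" "b \<in> O' - B" for t b
    using orthonormal_insert_orth[of b B t] that O(1) B by (meson DiffD1 DiffD2 insert_subset orthonormal_subset)
  have gB: "g x \<bullet> b = 0" if "b \<in> B" for x b
    unfolding g_def inner_sum_left using o[OF that] by (intro sum.neutral) (auto simp: inner_commute)
  have ga: "g x \<bullet> a = h a x" if "a \<in> O' - B" for x a
    unfolding g_def by (rule orthonormal_sum_inner[OF OB(2) that])
  show ?thesis unfolding C2_chart_def
  proof (intro exI conjI)
    show "open U" "p \<in> U" by fact+
    show "subspace (span B)" by simp
    show "dim (span B) = d" using orthonormal_dim_span[OF OB(1)] B by simp
    show "C2_map g" unfolding g_def by (rule C2_map_sum[OF h])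
    show "\<forall>x. \<forall>t\<in>span B. t \<bullet> g x = 0"
      unfolding g_def inner_sum_right using orthT by (auto intro!: sum.neutral)
    show "M \<inter> U = {x + g x |x. x \<in> span B} \<inter> U"
    proof (intro set_eqI iffI)
      fix y assume y: "y \<in> M \<inter> U"
      define x where "x = (\<Sum>b\<in>B. (y \<bullet> b) *\<^sub>R b)"
      have xb: "x \<bullet> b = y \<bullet> b" if "b \<in> B" for b unfolding x_def by (rule orthonormal_sum_inner[OF OB(1) that])
      have xB: "x \<in> span B" unfolding x_def by (intro span_sum span_mul span_base)
      have "g x = (\<Sum>a\<in>O' - B. (y \<bullet> a) *\<^sub>R a)" unfolding g_def
        using y M inv[of _ x y] xb by (intro sum.cong) auto
      then have "x + g x = (\<Sum>a\<in>O'. (y \<bullet> a) *\<^sub>R a)"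
        unfolding x_def using fin B(1) by (simp add: sum.subset_diff[of B O'] add.commute)
      also have "\<dots> = y" using orthonormal_span_UNIV[OF O] by (intro orthonormal_span_expansion[OF O(1)]) auto
      finally show "y \<in> {x + g x |x. x \<in> span B} \<inter> U" using xB y by force
    next
      fix y assume "y \<in> {x + g x |x. x \<in> span B} \<inter> U"
      then obtain x where x: "x \<in> span B" "y = x + g x" "y \<in> U" by blast
      have "y \<bullet> a = h a y" if a: "a \<in> O' - B" for a
      proof -
        have "y \<bullet> a = h a x" using orthT[OF x(1) a] ga[OF a] by (simp add: x(2) inner_add_left)
        also have "\<dots> = h a y" by (rule inv[OF a]) (simp add: x(2) inner_add_left gB)
        finally show ?thesis .
      qed
      then show "y \<in> M \<inter> U" using M x(3) by blast
    qed
  qed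
qed

lemma C2_map_affine:
  fixes g :: "'a::euclidean_space \<Rightarrow> 'a"
  assumes g: "C2_map g" and s: "s \<noteq> 0"
  shows "C2_map (\<lambda>x. s *\<^sub>R g ((x - c) /\<^sub>R s) + c')"
proof -
  obtain g' g'' where d: "\<And>x. (g has_derivative blinfun_apply (g' x)) (at x)"
    "\<And>x. (g' has_derivative blinfun_apply (g'' x)) (at x)" "continuous_on UNIV g''"
    using g unfolding C2_map_def by blast
  have a: "((\<lambda>x. (x - c) /\<^sub>R s) has_derivative (\<lambda>v. v /\<^sub>R s)) (at x)" for x
    by (auto intro!: derivative_eq_intros)
  show ?thesis unfolding C2_map_def
  proof (intro exI conjI allI)
    show "((\<lambda>x. s *\<^sub>R g ((x - c) /\<^sub>R s) + c') has_derivative blinfun_apply (g' ((x - c) /\<^sub>R s))) (at x)" for x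
      using s by (auto intro!: derivative_eq_intros has_derivative_compose[OF a d(1)] simp: blinfun.scaleR_right)
    show "((\<lambda>x. g' ((x - c) /\<^sub>R s)) has_derivative blinfun_apply (g'' ((x - c) /\<^sub>R s) /\<^sub>R s)) (at x)" for x
      by (rule has_derivative_eq_rhs[OF has_derivative_compose[OF a d(2)]])
         (auto simp: blinfun.scaleR_right blinfun.scaleR_left)
    show "continuous_on UNIV (\<lambda>x. g'' ((x - c) /\<^sub>R s) /\<^sub>R s)"
      by (intro continuous_intros continuous_on_compose2[OF d(3)]) auto
  qed
qed

lemma C2_chart_affine:
  fixes M :: "'a::euclidean_space set"
  assumes "C2_chart d M p" "0 < s"
  shows "C2_chart d ((\<lambda>x. s *\<^sub>R x + c) ` M) (s *\<^sub>R p + c)"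
proof -
  obtain U T g where *: "open U" "p \<in> U" "subspace T" "dim T = d" "C2_map g"
      "\<forall>x. \<forall>t\<in>T. inner t (g x) = 0" "M \<inter> U = {x + g x | x. x \<in> T} \<inter> U"
    using assms(1) unfolding C2_chart_def by blast
  \<comment> \<open>The component of the translation in \<open>T\<close> shifts the parameter of the
    graph, the normal component is added to the graph function.\<close>
  obtain c1 c2 where c: "c1 \<in> T" "\<And>w. w \<in> T \<Longrightarrow> orthogonal c2 w" "c = c1 + c2"
    using orthogonal_subspace_decomp_exists[of T c] *(3) span_eq_iff by metis
  define \<Phi> where "\<Phi> x = s *\<^sub>R x + c" for x
  have \<Phi>: "open (\<Phi> ` U)" unfolding \<Phi>_def
    using open_affinity[OF *(1), of s c] assms(2) by (simp add: add.commute)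
  have inj: "inj \<Phi>" using assms(2) by (auto simp: \<Phi>_def inj_def)
  define G where "G x = s *\<^sub>R g ((x - c1) /\<^sub>R s) + c2" for x
  have "\<Phi> ` M \<inter> \<Phi> ` U = \<Phi> ` (M \<inter> U)" using inj by (simp add: image_Int)
  also have "\<dots> = \<Phi> ` {x + g x | x. x \<in> T} \<inter> \<Phi> ` U" unfolding *(7) using inj by (simp add: image_Int)
  also have "\<Phi> ` {x + g x | x. x \<in> T} = {x + G x | x. x \<in> T}"
  proof (intro set_eqI iffI)
    fix y assume "y \<in> \<Phi> ` {x + g x | x. x \<in> T}"
    then obtain x where x: "x \<in> T" "y = \<Phi> (x + g x)" by blast
    have "s *\<^sub>R x + c1 \<in> T" using *(3) x c by (simp add: subspace_add subspace_scale)
    moreover have "y = (s *\<^sub>R x + c1) + G (s *\<^sub>R x + c1)"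
      using assms(2) by (simp add: x(2) G_def \<Phi>_def c(3) algebra_simps)
    ultimately show "y \<in> {x + G x | x. x \<in> T}" by blast
  next
    fix y assume "y \<in> {x + G x | x. x \<in> T}"
    then obtain x where x: "x \<in> T" "y = x + G x" by blast
    have "(x - c1) /\<^sub>R s \<in> T" using *(3) x c by (simp add: subspace_diff subspace_scale)
    moreover have "y = \<Phi> ((x - c1) /\<^sub>R s + g ((x - c1) /\<^sub>R s))"
      using assms(2) by (simp add: x(2) G_def \<Phi>_def c(3) scaleR_add_right)
    ultimately show "y \<in> \<Phi> ` {x + g x | x. x \<in> T}" by blast
  qed
  finally have eq: "\<Phi> ` M \<inter> \<Phi> ` U = {x + G x | x. x \<in> T} \<inter> \<Phi> ` U" .
  have "C2_map G" unfolding G_def using assms(2) by (intro C2_map_affine *(5)) simp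
  moreover have "\<forall>x. \<forall>t\<in>T. t \<bullet> G x = 0"
    using *(6) c(2) by (auto simp: G_def inner_add_right orthogonal_def inner_commute)
  ultimately have "C2_chart d (\<Phi> ` M) (\<Phi> p)"
    unfolding C2_chart_def using \<Phi> * eq by (intro exI[of _ "\<Phi> ` U"] exI[of _ T] exI[of _ G]) auto
  then show ?thesis by (simp add: \<Phi>_def[abs_def])
qed

text \<open>The orthogonal projection to the parameter space of a chart is 1-Lipschitz, and the
  projected neighbourhood contains a flat ball. This makes the whole manifold the support of its
  uniform distribution.\<close>

lemma C2_chart_measure_pos:
  fixes M :: "'a::euclidean_space set"
  assumes d: "1 \<le> d" and M: "C2_chart d M p" "p \<in> M" and e: "0 < e"
  shows "0 < hausdorff_outer d (M \<inter> ball p e)"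
proof -
  obtain U T g where *: "open U" "p \<in> U" "subspace T" "dim T = d" "C2_map g"
      "\<forall>x. \<forall>t\<in>T. inner t (g x) = 0" "M \<inter> U = {x + g x | x. x \<in> T} \<inter> U"
    using M(1) unfolding C2_chart_def by blast
  obtain x0 where x0: "x0 \<in> T" "p = x0 + g x0" using *(2,7) M(2) by blast
  obtain Z where Z0: "Z \<subseteq> T" "pairwise orthogonal Z" "\<And>x. x \<in> Z \<Longrightarrow> norm x = 1" "independent Z" "card Z = dim T" "span Z = T"
    using orthonormal_basis_subspace[OF *(3)] by metis
  have Z: "orthonormal Z"
    using Z0(2,3,4) by (auto simp: orthonormal_def pairwise_def orthogonal_def norm_eq_1 independent_imp_finite)
  have dZ: "card Z = d" using Z0(5) *(4) by simp
  have contg: "continuous_on UNIV g"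
    using *(5) by (auto simp: C2_map_def continuous_on_eq_continuous_at intro: has_derivative_continuous)
  have "open ((\<lambda>x. x + g x) -` (U \<inter> ball p e))"
    by (intro open_vimage continuous_intros contg open_Int *(1)) auto
  moreover have "x0 \<in> (\<lambda>x. x + g x) -` (U \<inter> ball p e)" using x0 *(2) e by auto
  ultimately obtain \<delta> where \<delta>: "0 < \<delta>" "cball x0 \<delta> \<subseteq> (\<lambda>x. x + g x) -` (U \<inter> ball p e)"
    using open_contains_cball by blast
  define \<pi> where "\<pi> = frame_map id Z"
  have "(+) x0 ` flat_ball Z \<delta> \<subseteq> \<pi> ` (M \<inter> ball p e)"
  proof
    fix y assume "y \<in> (+) x0 ` flat_ball Z \<delta>"
    then obtain w where w: "w \<in> T" "norm w \<le> \<delta>" "y = x0 + w" by (auto simp: flat_ball_def Z0(6))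
    have y: "y \<in> T" "y \<in> cball x0 \<delta>" using w x0 *(3) by (auto simp: subspace_add dist_norm)
    then have "y + g y \<in> M \<inter> ball p e" using \<delta>(2) *(7) by blast
    moreover have "\<pi> (y + g y) = y"
    proof -
      have "\<pi> (y + g y) = (\<Sum>a\<in>Z. (y \<bullet> a) *\<^sub>R a)"
        unfolding \<pi>_def frame_map_def using *(6) Z0(1)
        by (intro sum.cong refl) (auto simp: inner_add_left inner_commute[of "g y"])
      then show ?thesis using orthonormal_span_expansion[OF Z] y Z0(6) by simp
    qed
    ultimately show "y \<in> \<pi> ` (M \<inter> ball p e)" by (metis image_eqI)
  qed
  then have "hausdorff_outer d ((+) x0 ` flat_ball Z \<delta>) \<le> hausdorff_outer d (\<pi> ` (M \<inter> ball p e))"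
    by (rule hausdorff_outer_mono)
  also have "\<dots> \<le> ennreal (1 ^ d) * hausdorff_outer d (M \<inter> ball p e)"
    unfolding \<pi>_def by (rule hausdorff_outer_lipschitz_image) (use frame_map_dist_le[OF Z, of id] Z in auto)
  finally have "ennreal (flat_vol Z * \<delta> ^ d) \<le> hausdorff_outer d (M \<inter> ball p e)"
    using flat_ball_measure[OF Z _ \<delta>(1)] d dZ by (simp add: hausdorff_outer_translation)
  moreover have "0 < ennreal (flat_vol Z * \<delta> ^ d)" using flat_vol_pos[OF Z] d dZ \<delta>(1) by simp
  ultimately show ?thesis by (rule less_le_trans[rotated])
qed

subsection \<open>A lower bound for the reach\<close>

text \<open>Federer's condition: for every v in \<open>N\<close> no point of \<open>M\<close> lies
  in either of the two open balls of radius \<open>\<rho>\<close> that touch \<open>p\<close> with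
  centre in direction v or -v. Asking for some \<open>N\<close> of dimension at least n - d saves
  identifying the tangent space of each piece.\<close>

definition osculates :: "nat \<Rightarrow> 'a::euclidean_space set \<Rightarrow> 'a \<Rightarrow> real \<Rightarrow> 'a set \<Rightarrow> bool" where
  "osculates d M p \<rho> N \<longleftrightarrow> subspace N \<and> DIM('a) \<le> dim N + d \<and>
     (\<forall>v\<in>N. \<forall>q\<in>M. \<bar>(q - p) \<bullet> v\<bar> \<le> norm v * (norm (q - p))\<^sup>2 / (2 * \<rho>))"

text \<open>The inequality forces \<open>N\<close> to be the normal space; if two nearest points \<open>p, q\<close> of \<open>z\<close> exist,
  then \<open>z - p\<close> is normal and \<open>|q - p|\<^sup>2 = 2 (q - p) \<bullet> (z - p)\<close>.\<close>
lemma reach_lower_bound: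
  fixes M :: "'a::euclidean_space set"
  assumes M: "C2_submanifold d M" and \<rho>: "0 < \<rho>"
    and osc: "\<And>p. p \<in> M \<Longrightarrow> \<exists>N. osculates d M p \<rho> N"
  shows "ereal \<rho> \<le> reach M"
  unfolding reach_def
proof (rule INF_greatest)
  fix z assume "z \<in> medial_axis M"
  then obtain p q where pq: "p \<in> M" "q \<in> M" "p \<noteq> q" "dist p z = infdist z M" "dist q z = infdist z M"
    unfolding medial_axis_def by blast
  obtain N where N: "subspace N" "DIM('a) \<le> dim N + d"
    "\<And>v q. v \<in> N \<Longrightarrow> q \<in> M \<Longrightarrow> \<bar>(q - p) \<bullet> v\<bar> \<le> norm v * (norm (q - p))\<^sup>2 / (2 * \<rho>)"
    using osc[OF pq(1)] unfolding osculates_def by blast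
  have "C2_chart d M p" using M pq(1) by (simp add: C2_submanifold_iff_chart)
  then obtain U T g where *: "open U" "p \<in> U" "subspace T" "dim T = d" "C2_map g"
      "\<forall>x. \<forall>t\<in>T. inner t (g x) = 0" "M \<inter> U = {x + g x | x. x \<in> T} \<inter> U"
    unfolding C2_chart_def by blast
  obtain x0 where x0: "x0 \<in> T" "p = x0 + g x0" using *(2,7) pq(1) by blast
  obtain D where D: "(g has_derivative D) (at x0)" using *(5) unfolding C2_map_def by blast
  have linD: "linear D" using D by (rule has_derivative_linear)
  have Dorth: "t \<bullet> D v = 0" if "t \<in> T" for t v
  proof -
    have "((\<lambda>x. t \<bullet> g x) has_derivative (\<lambda>v. t \<bullet> D v)) (at x0)"
      by (rule has_derivative_inner_right[OF D])
    moreover have "(\<lambda>x. t \<bullet> g x) = (\<lambda>x. 0)" using *(6) that by auto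
    ultimately have "(\<lambda>v. t \<bullet> D v) = (\<lambda>v. 0)" by (metis has_derivative_const has_derivative_unique)
    then show ?thesis by metis
  qed
  \<comment> \<open>\<open>W\<close> is the tangent space at p, the image of \<open>T\<close> under
    the derivative of the graph map; its dimension is d because the values of \<open>D\<close> are
    orthogonal to \<open>T\<close>.\<close>
  define W where "W = (\<lambda>t. t + D t) ` T"
  have linW: "linear (\<lambda>t. t + D t)" by (intro linear_compose_add linear_ident linD)
  have inj: "inj_on (\<lambda>t. t + D t) T"
  proof (rule inj_onI)
    fix s t assume st: "s \<in> T" "t \<in> T" "s + D s = t + D t"
    have m: "s - t \<in> T" using st *(3) by (simp add: subspace_diff)
    have "(s - t) = D t - D s" using st(3) by (simp add: algebra_simps)
    then have "(s - t) \<bullet> (s - t) = 0" using Dorth[OF m] by (simp add: inner_diff_right)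
    then show "s = t" by simp
  qed
  have dimW: "dim W = d" unfolding W_def
    using dim_image_eq[OF linW, of T] inj *(3,4) by (simp add: span_eq_iff[THEN iffD2])
  have subW: "subspace W" unfolding W_def by (rule linear_subspace_image[OF linW *(3)])
  \<comment> \<open>Both claims come from a curve in the graph with velocity w: along it the
    osculation inequality is quadratic in c s - p, and p minimises the distance to z. Right-hand
    limits are enough, since -w is tangent as well.\<close>
  have curve: "(\<forall>v\<in>N. v \<bullet> w = 0) \<and> (z - p) \<bullet> w \<le> 0" if wW: "w \<in> W" for w
  proof -
    obtain t where t: "t \<in> T" "w = t + D t" using wW by (auto simp: W_def)
    define c where "c s = (x0 + s *\<^sub>R t) + g (x0 + s *\<^sub>R t)" for s :: real
    have c0: "c 0 = p" by (simp add: c_def x0)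
    have dc: "(c has_vector_derivative w) (at 0)"
    proof -
      have 1: "((\<lambda>s. x0 + s *\<^sub>R t) has_derivative (\<lambda>s. s *\<^sub>R t)) (at 0)" by (auto intro!: derivative_eq_intros)
      have 2: "((\<lambda>s. g (x0 + s *\<^sub>R t)) has_derivative (\<lambda>s. D (s *\<^sub>R t))) (at 0)"
        using has_derivative_compose[OF 1, of g D] D by simp
      show ?thesis unfolding c_def has_vector_derivative_def
        by (rule has_derivative_eq_rhs[OF has_derivative_add[OF 1 2]])
           (simp add: t(2) linear_cmul[OF linD] scaleR_add_right)
    qed
    have quot: "((\<lambda>s. (c s - p) /\<^sub>R s) \<longlongrightarrow> w) (at_right 0)"
    proof -
      have "((\<lambda>s. norm (c s - c 0 - (s - 0) *\<^sub>R w) / norm (s - 0)) \<longlongrightarrow> 0) (at 0)"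
        using dc unfolding has_vector_derivative_def has_derivative_iff_norm by simp
      moreover have "\<forall>\<^sub>F s in at 0. norm (c s - c 0 - (s - 0) *\<^sub>R w) / norm (s - 0) = norm ((c s - p) /\<^sub>R s - w)"
      proof (rule eventually_at_filter[THEN iffD2], rule always_eventually, intro allI impI)
        fix s :: real assume s: "s \<noteq> 0"
        then have "(c s - p) /\<^sub>R s - w = (c s - p - s *\<^sub>R w) /\<^sub>R s" by (simp add: scaleR_diff_right)
        then show "norm (c s - c 0 - (s - 0) *\<^sub>R w) / norm (s - 0) = norm ((c s - p) /\<^sub>R s - w)"
          by (simp add: c0 divide_inverse mult.commute)
      qed
      ultimately have "((\<lambda>s. norm ((c s - p) /\<^sub>R s - w)) \<longlongrightarrow> 0) (at 0)"
        by (rule Lim_transform_eventually)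
      then have "((\<lambda>s. (c s - p) /\<^sub>R s) \<longlongrightarrow> w) (at 0)"
        by (rule LIM_zero_cancel[OF tendsto_norm_zero_cancel])
      then show ?thesis by (simp add: filterlim_at_split)
    qed
    have contc: "isCont c 0" using dc by (rule has_vector_derivative_continuous)
    then have ct: "(c \<longlongrightarrow> p) (at_right 0)" by (simp add: c0 isCont_def filterlim_at_split)
    have inM: "\<forall>\<^sub>F s in at_right 0. c s \<in> M"
    proof -
      have "\<forall>\<^sub>F s in at_right 0. c s \<in> U" using ct *(1,2) by (rule topological_tendstoD)
      then show ?thesis
      proof eventually_elim
        case (elim s)
        have "x0 + s *\<^sub>R t \<in> T" using x0 t *(3) by (simp add: subspace_add subspace_scale)
        then show ?case using elim *(7) unfolding c_def by blast
      qed
    qed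
    have n0: "((\<lambda>s. norm ((c s - p) /\<^sub>R s) * norm (c s - p)) \<longlongrightarrow> norm w * norm (p - p)) (at_right 0)"
      by (rule tendsto_mult[OF tendsto_norm[OF quot] tendsto_norm[OF tendsto_diff[OF ct tendsto_const]]])
    have "v \<bullet> w = 0" if v: "v \<in> N" for v
    proof -
      have "((\<lambda>s. v \<bullet> ((c s - p) /\<^sub>R s)) \<longlongrightarrow> 0) (at_right 0)"
      proof (rule Lim_null_comparison)
        show "\<forall>\<^sub>F s in at_right 0. norm (v \<bullet> ((c s - p) /\<^sub>R s)) \<le> norm v / (2 * \<rho>) * (norm ((c s - p) /\<^sub>R s) * norm (c s - p))"
          using inM eventually_at_right_less[of 0]
        proof eventually_elim
          case (elim s)
          have "norm (v \<bullet> ((c s - p) /\<^sub>R s)) = \<bar>(c s - p) \<bullet> v\<bar> / s"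
            using elim by (simp add: abs_mult inner_commute divide_inverse)
          also have "\<dots> \<le> (norm v * (norm (c s - p))\<^sup>2 / (2 * \<rho>)) / s"
            using elim by (intro divide_right_mono N(3)[OF v]) auto
          also have "\<dots> = norm v / (2 * \<rho>) * (norm ((c s - p) /\<^sub>R s) * norm (c s - p))"
          proof -
            have "norm ((c s - p) /\<^sub>R s) = norm (c s - p) / s" using elim by (simp add: divide_inverse)
            then show ?thesis by (simp only: power2_eq_square times_divide_eq_right times_divide_eq_left divide_divide_eq_left mult_ac)
          qed
          finally show ?case .
        qed
        show "((\<lambda>s. norm v / (2 * \<rho>) * (norm ((c s - p) /\<^sub>R s) * norm (c s - p))) \<longlongrightarrow> 0) (at_right 0)"
          using tendsto_mult_left[OF n0, of "norm v / (2 * \<rho>)"] by simp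
      qed
      moreover have "((\<lambda>s. v \<bullet> ((c s - p) /\<^sub>R s)) \<longlongrightarrow> v \<bullet> w) (at_right 0)"
        by (rule tendsto_inner[OF tendsto_const quot])
      ultimately show ?thesis using tendsto_unique[OF trivial_limit_at_right_real] by blast
    qed
    moreover have "(z - p) \<bullet> w \<le> 0"
    proof -
      have 1: "\<forall>\<^sub>F s in at_right 0. (z - p) \<bullet> ((c s - p) /\<^sub>R s) \<le> 1/2 * (norm ((c s - p) /\<^sub>R s) * norm (c s - p))"
        using inM eventually_at_right_less[of 0]
      proof eventually_elim
        case (elim s)
        have "infdist z M \<le> dist z (c s)" using elim by (intro infdist_le)
        then have "norm (z - p) \<le> norm (z - c s)" using pq(4) by (simp add: dist_norm norm_minus_commute)
        then have X: "(norm (z - p))\<^sup>2 \<le> (norm ((z - p) - (c s - p)))\<^sup>2" by (intro power_mono) auto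
        have "(norm ((z - p) - (c s - p)))\<^sup>2 = (norm (z - p))\<^sup>2 + (norm (c s - p))\<^sup>2 - 2 * ((z - p) \<bullet> (c s - p))"
          using norm_sq_diff_scaled[of 1 "z - p" 1 "c s - p"] by simp
        with X have "2 * ((z - p) \<bullet> (c s - p)) \<le> (norm (c s - p))\<^sup>2" by linarith
        then have "(z - p) \<bullet> (c s - p) / s \<le> (1/2 * (norm (c s - p))\<^sup>2) / s" using elim by (intro divide_right_mono) auto
        moreover have "(z - p) \<bullet> (c s - p) / s = (z - p) \<bullet> ((c s - p) /\<^sub>R s)" by (simp add: divide_inverse)
        moreover have "(1/2 * (norm (c s - p))\<^sup>2) / s = 1/2 * (norm ((c s - p) /\<^sub>R s) * norm (c s - p))"
        proof -
          have "norm ((c s - p) /\<^sub>R s) = norm (c s - p) / s" using elim by (simp add: divide_inverse)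
          then show ?thesis by (simp only: power2_eq_square times_divide_eq_right times_divide_eq_left divide_divide_eq_left mult_ac)
        qed
        ultimately show ?case by simp
      qed
      have 2: "((\<lambda>s. 1/2 * (norm ((c s - p) /\<^sub>R s) * norm (c s - p))) \<longlongrightarrow> 0) (at_right 0)"
        using tendsto_mult_left[OF n0, of "1/2"] by simp
      have 3: "((\<lambda>s. (z - p) \<bullet> ((c s - p) /\<^sub>R s)) \<longlongrightarrow> (z - p) \<bullet> w) (at_right 0)"
        by (rule tendsto_inner[OF tendsto_const quot])
      show ?thesis by (rule tendsto_le[OF trivial_limit_at_right_real 2 3 1])
    qed
    ultimately show ?thesis by blast
  qed
  define C where "C = {y. \<forall>w\<in>W. orthogonal w y}"
  have "dim C + dim W = DIM('a)"
    using dim_subspace_orthogonal_to_vectors[OF subW subspace_UNIV] by (simp add: C_def)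
  then have "dim C \<le> dim N" using N(2) dimW by simp
  moreover have "N \<subseteq> C"
  proof (clarsimp simp: C_def orthogonal_def)
    fix v w assume "v \<in> N" "w \<in> W"
    then show "w \<bullet> v = 0" using curve[of w] inner_commute[of w v] by simp
  qed
  moreover have "subspace C" unfolding C_def by (rule subspace_orthogonal_to_vectors)
  \<comment> \<open>\<open>N\<close> lies in the normal space \<open>C\<close> and has at least its
    dimension.\<close>
  ultimately have "N = C" using subspace_dim_equal[OF N(1)] by blast
  moreover have "z - p \<in> C"
  proof (clarsimp simp: C_def orthogonal_def)
    fix w assume w: "w \<in> W"
    then have "- w \<in> W" using subW by (simp add: subspace_neg)
    then show "w \<bullet> (z - p) = 0" using curve[OF w] curve[of "-w"] by (simp add: inner_commute)
  qed
  ultimately have "\<bar>(q - p) \<bullet> (z - p)\<bar> \<le> norm (z - p) * (norm (q - p))\<^sup>2 / (2 * \<rho>)" using N(3) pq(2) by blast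
  moreover have "2 * ((q - p) \<bullet> (z - p)) = (norm (q - p))\<^sup>2"
  proof -
    have "norm ((z - p) - (q - p)) = norm (z - p)" using pq(4,5) by (simp add: dist_norm norm_minus_commute)
    then show ?thesis using norm_sq_diff_scaled[of 1 "z - p" 1 "q - p"] by (simp add: inner_commute)
  qed
  ultimately have "(norm (q - p))\<^sup>2 \<le> 2 * (norm (z - p) * (norm (q - p))\<^sup>2 / (2 * \<rho>))" by linarith
  also have "\<dots> = (norm (q - p))\<^sup>2 * (norm (z - p) / \<rho>)" using \<rho> by (simp add: field_simps)
  finally have "(norm (q - p))\<^sup>2 * 1 \<le> (norm (q - p))\<^sup>2 * (norm (z - p) / \<rho>)" by simp
  moreover have "0 < (norm (q - p))\<^sup>2" using pq(3) by simp
  ultimately have "1 \<le> norm (z - p) / \<rho>" by (simp only: mult_le_cancel_left_pos)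
  then show "ereal \<rho> \<le> ereal (infdist z M)" using \<rho> pq(4) by (simp add: dist_norm norm_minus_commute le_divide_eq)
qed

subsection \<open>Bent tubes\<close>

text \<open>A \<open>C\<^sup>2\<close> spline equal to \<open>|t|\<close> for \<open>|t| \<ge> 6\<close>; its second derivative is a hat function of height \<open>1/3\<close>.\<close>
definition bend :: "real \<Rightarrow> real" where
  "bend t = 2 * (max (t/6 + 1) 0 ^ 3 - 2 * max (t/6) 0 ^ 3 + max (t/6 - 1) 0 ^ 3) - t"

definition bend' :: "real \<Rightarrow> real" where
  "bend' t = max (t/6 + 1) 0 ^ 2 - 2 * max (t/6) 0 ^ 2 + max (t/6 - 1) 0 ^ 2 - 1"

definition bend'' :: "real \<Rightarrow> real" where
  "bend'' t = (max (t/6 + 1) 0 - 2 * max (t/6) 0 + max (t/6 - 1) 0) / 3"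

lemma DERIV_bend: "(bend has_real_derivative bend' t) (at t)"
proof -
  have d: "((\<lambda>t. max (t/6 + c) 0 ^ 3) has_real_derivative (max (t/6 + c) 0 ^ 2 / 2)) (at t)" for c t :: real
  proof -
    have "((\<lambda>t. t/6 + c) has_real_derivative 1/6) (at t)" by (auto intro!: derivative_eq_intros)
    from DERIV_chain2[OF DERIV_pos_part_power[of 1 "t/6 + c"] this] show ?thesis by (simp add: eval_nat_numeral)
  qed
  show ?thesis unfolding bend_def[abs_def] bend'_def
    by (rule DERIV_cong[OF DERIV_diff[OF DERIV_cmult[OF DERIV_add[OF DERIV_diff[OF d[of 1] DERIV_cmult[OF d[of 0, simplified]]] d[of "-1", simplified]]] DERIV_ident]])
       (simp add: field_simps)
qed

lemma DERIV_bend': "(bend' has_real_derivative bend'' t) (at t)"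
proof -
  have d: "((\<lambda>t. max (t/6 + c) 0 ^ 2) has_real_derivative (max (t/6 + c) 0 / 3)) (at t)" for c t :: real
  proof -
    have "((\<lambda>t. t/6 + c) has_real_derivative 1/6) (at t)" by (auto intro!: derivative_eq_intros)
    from DERIV_chain2[OF DERIV_pos_part_power[of 0 "t/6 + c"] this] show ?thesis by (simp add: eval_nat_numeral)
  qed
  show ?thesis unfolding bend'_def[abs_def] bend''_def
    by (rule DERIV_cong[OF DERIV_diff[OF DERIV_add[OF DERIV_diff[OF d[of 1] DERIV_cmult[OF d[of 0, simplified]]] d[of "-1", simplified]] DERIV_const]])
       (simp add: field_simps)
qed

lemma continuous_bend'': "continuous_on UNIV bend''"
  unfolding bend''_def[abs_def] by (intro continuous_intros) auto

lemma bend''_bounds: "0 \<le> bend'' t" "bend'' t \<le> 1/3"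
  by (auto simp: bend''_def max_def)

lemma C2_fun_bend: "C2_fun bend"
  unfolding C2_fun_def using DERIV_bend DERIV_bend' continuous_bend'' by blast

lemma bend_abs: "6 \<le> \<bar>t\<bar> \<Longrightarrow> bend t = \<bar>t\<bar>"
  by (auto simp: bend_def max_def abs_if field_simps power3_eq_cube split: if_splits)

lemma bend'_bounds: "\<bar>bend' t\<bar> \<le> 1"
proof -
  have mono: "bend' s \<le> bend' t" if "s \<le> t" for s t
    by (rule DERIV_nonneg_imp_nondecreasing[OF that]) (use DERIV_bend' bend''_bounds in blast)
  have "bend' (min t (-6)) \<le> bend' t" "bend' t \<le> bend' (max t 6)" by (auto intro: mono)
  moreover have "bend' (min t (-6)) = -1" by (simp add: bend'_def max_def)
  moreover have "bend' (max t 6) = 1"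
  proof -
    have "bend' s = 1" if "6 \<le> s" for s using that by (simp add: bend'_def max_def power2_eq_square field_simps)
    then show ?thesis by simp
  qed
  ultimately show ?thesis by simp
qed

lemma bend_lipschitz: "\<bar>bend s - bend t\<bar> \<le> \<bar>s - t\<bar>"
proof -
  have "norm (bend s - bend t) \<le> 1 * norm (s - t)"
    by (rule field_differentiable_bound[of UNIV bend bend' 1])
       (use DERIV_bend bend'_bounds in \<open>auto intro: has_field_derivative_at_within\<close>)
  then show ?thesis by simp
qed

lemma bend_taylor: "\<bar>bend s - bend t - bend' t * (s - t)\<bar> \<le> 1/6 * (s - t)\<^sup>2"
proof (cases "s = t")
  case False
  define diff where "diff m = (if m = 0 then bend else if m = 1 then bend' else bend'')" for m :: nat
  have "\<exists>x. (if s < t then s < x \<and> x < t else t < x \<and> x < s) \<and>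
      bend s = (\<Sum>m<2. diff m t / fact m * (s - t) ^ m) + diff 2 x / fact 2 * (s - t) ^ 2"
  proof (rule Taylor[of 2 diff bend "min s t" "max s t"])
    show "\<forall>m x. m < 2 \<and> min s t \<le> x \<and> x \<le> max s t \<longrightarrow> (diff m has_real_derivative diff (Suc m) x) (at x)"
      using DERIV_bend DERIV_bend' by (auto simp: diff_def less_Suc_eq numeral_2_eq_2)
  qed (use False in \<open>auto simp: diff_def\<close>)
  then obtain x where "bend s = (\<Sum>m<2. diff m t / fact m * (s - t) ^ m) + diff 2 x / fact 2 * (s - t) ^ 2" by blast
  then have "bend s - bend t - bend' t * (s - t) = bend'' x / 2 * (s - t)\<^sup>2"
    by (simp add: diff_def numeral_2_eq_2)
  moreover have "\<bar>bend'' x / 2 * (s - t)\<^sup>2\<bar> \<le> 1/6 * (s - t)\<^sup>2"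
    using bend''_bounds[of x] mult_right_mono[of "bend'' x / 2" "1/6" "(s - t)\<^sup>2"] by (simp add: abs_mult)
  ultimately show ?thesis by (simp only:)
qed auto

text \<open>The family \<open>F\<close> collects the orthonormal coordinates; \<open>u\<close> runs along the axis, which is the
  curve \<open>v = \<theta>(u)\<close>. The weight \<open>\<omega> = 1/2\<close> makes the bent tube round where \<open>\<theta>\<close> has slope \<open>\<plusminus>1\<close>.\<close>
locale bent_tube =
  fixes F :: "'a::euclidean_space set" and u v :: 'a and Z :: "'a set" and \<theta> \<theta>' :: "real \<Rightarrow> real" and \<omega> :: real and d :: nat
  assumes F: "orthonormal F" "card F = DIM('a)" and u: "u \<in> F" and v: "v \<in> F" "u \<noteq> v"
    and Z: "Z \<subseteq> F" "u \<notin> Z" "card Z = d" and d: "1 \<le> d"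
    and C2: "C2_fun \<theta>" and slope: "\<And>t. \<bar>\<theta>' t\<bar> \<le> 1" and lip: "\<And>s t. \<bar>\<theta> s - \<theta> t\<bar> \<le> \<bar>s - t\<bar>"
    and taylor: "\<And>s t. \<bar>\<theta> s - \<theta> t - \<theta>' t * (s - t)\<bar> \<le> 1/6 * (s - t)\<^sup>2"
    and \<omega>: "\<omega> = 1/2 \<or> \<omega> = 1" "v \<in> Z \<Longrightarrow> \<omega> = 1 \<Longrightarrow> \<theta> t = 0"
begin

definition psi :: "'a \<Rightarrow> real \<Rightarrow> real" where "psi a t = (if a = v then \<theta> t else 0)"

definition wt :: "'a \<Rightarrow> real" where "wt a = (if a = v then \<omega> else 1)"

definition coord :: "'a \<Rightarrow> 'a \<Rightarrow> real" where "coord a x = x \<bullet> a - psi a (x \<bullet> u)"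

text \<open>Two modes. If \<open>v\<close> belongs to \<open>Z\<close>, the tube bends inside the
  space spanned by axis and cross-section, and its slices at fixed x . u are ellipsoids given by
  \<open>wt\<close>. Otherwise \<open>v\<close> is a constrained coordinate, and the equation coord
  v x = 0 bends the whole tube out of its span.\<close>

definition S :: "'a set" where
  "S = {x. (\<Sum>a\<in>Z. wt a * (coord a x)\<^sup>2) = 16 \<and> (\<forall>b\<in>F - Z - {u}. coord b x = 0)}"

lemma finF: "finite F" using F(1) by (rule orthonormal_finite)
lemma finZ: "finite Z" using finF Z(1) finite_subset by blast
lemma inn: "a \<in> F \<Longrightarrow> b \<in> F \<Longrightarrow> a \<bullet> b = (if a = b then 1 else 0)" using F(1) by (rule orthonormal_inner)
lemma wt_bounds: "1/2 \<le> wt a" "wt a \<le> 1" "0 < wt a" using \<omega>(1) by (auto simp: wt_def)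
lemma span_F: "span F = UNIV" using orthonormal_span_UNIV[OF F] .
lemma C2_real_coord: "C2_real (coord a)"
  unfolding coord_def[abs_def] psi_def
  by (cases "a = v") (auto intro!: C2_real_intros C2_real_compose[OF C2])

lemma continuous_coord: "continuous_on X (coord a)"
  using C2_real_continuous[OF C2_real_coord] continuous_on_subset by blast

lemma closed_S: "closed S"
proof -
  have "S = {x. (\<Sum>a\<in>Z. wt a * (coord a x)\<^sup>2) = 16} \<inter> (\<Inter>b\<in>F - Z - {u}. {x. coord b x = 0})"
    by (auto simp: S_def)
  also have "closed \<dots>"
    by (intro closed_Int closed_INT ballI closed_Collect_eq continuous_intros continuous_coord)
  finally show ?thesis .
qed

lemma coord_bound:
  assumes "x \<in> S" "a \<in> Z" shows "wt a * (coord a x)\<^sup>2 \<le> 16" "\<bar>wt a * coord a x\<bar> \<le> 4"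
proof -
  have "wt a * (coord a x)\<^sup>2 \<le> (\<Sum>a\<in>Z. wt a * (coord a x)\<^sup>2)"
    using wt_bounds by (intro member_le_sum finZ assms) (auto simp: less_imp_le)
  then show 1: "wt a * (coord a x)\<^sup>2 \<le> 16" using assms by (simp add: S_def)
  have "(wt a * coord a x)\<^sup>2 = wt a * (wt a * (coord a x)\<^sup>2)" by (simp add: power2_eq_square)
  also have "\<dots> \<le> 1 * 16" using wt_bounds[of a] 1 by (intro mult_mono) auto
  finally show "\<bar>wt a * coord a x\<bar> \<le> 4" by (intro abs_le_square_iff[THEN iffD2, of _ 4, simplified]) simp
qed

lemma S_chart:
  assumes p: "p \<in> S" shows "C2_chart d S p"
proof -
  have "\<exists>a\<in>Z. coord a p \<noteq> 0"
  proof (rule ccontr)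
    assume "\<not> ?thesis"
    then have "(\<Sum>a\<in>Z. wt a * (coord a p)\<^sup>2) = 0" by (intro sum.neutral) auto
    then show False using p by (simp add: S_def)
  qed
  then obtain a where a: "a \<in> Z" "coord a p \<noteq> 0" by blast
  define sg where "sg = sgn (coord a p)"
  have sg: "sg * sg = 1" "sg \<noteq> 0" using a(2) by (auto simp: sg_def sgn_if)
  define m where "m = \<bar>coord a p\<bar> / 2"
  have m: "0 < m" "sg * coord a p = 2 * m" using a(2) by (auto simp: m_def sg_def sgn_if)
  define arg where "arg x = (16 - (\<Sum>c\<in>Z - {a}. wt c * (coord c x)\<^sup>2)) / wt a" for x
  have argS: "(coord a x)\<^sup>2 = arg x \<longleftrightarrow> (\<Sum>c\<in>Z. wt c * (coord c x)\<^sup>2) = 16" for x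
    using wt_bounds[of a] by (auto simp: arg_def sum.remove[OF finZ a(1)] field_simps)
  have C2arg: "C2_real arg"
    unfolding arg_def[abs_def] divide_inverse by (intro C2_real_intros C2_real_coord)
  have contarg: "continuous_on UNIV arg" by (rule C2_real_continuous[OF C2arg])
  \<comment> \<open>On \<open>U\<close> the radicand exceeds m^2, where the extended root is the
    true one, so \<open>h\<close> can be defined everywhere. At p the coordinate solved for has size
    2 m and the radicand is 4 m^2, which leaves room for an open set.\<close>
  obtain \<sigma> where \<sigma>: "C2_fun \<sigma>" "\<And>t. m\<^sup>2 \<le> t \<Longrightarrow> \<sigma> t = sqrt t"
    using C2_fun_sqrt_extension[of "m\<^sup>2"] m by auto
  define h where "h b x = (if b = a then psi a (x \<bullet> u) + sg * \<sigma> (arg x) else psi b (x \<bullet> u))" for b x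
  have FB: "F - insert u (Z - {a}) = insert a (F - Z - {u})" using a Z by auto
  define U where "U = {x. m < sg * coord a x} \<inter> {x. m\<^sup>2 < arg x}"
  show ?thesis
  proof (rule C2_chart_graph[where O' = F and B = "insert u (Z - {a})" and U = U and h = h])
    show "orthonormal F" "card F = DIM('a)" "insert u (Z - {a}) \<subseteq> F" using F Z u by auto
    show "card (insert u (Z - {a})) = d" using finZ Z a d by (simp add: card_insert_if)
    show "open U" unfolding U_def by (intro open_Int open_Collect_less continuous_intros continuous_coord contarg)
    have "arg p = (2 * m)\<^sup>2"
    proof -
      have "(sg * coord a p)\<^sup>2 = (coord a p)\<^sup>2" using sg by (simp add: power2_eq_square algebra_simps)
      then have "(coord a p)\<^sup>2 = (2 * m)\<^sup>2" using m(2) by simp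
      then show ?thesis using argS[of p] p by (simp add: S_def)
    qed
    then show "p \<in> U" using m by (auto simp: U_def power_mult_distrib)
    show "C2_real (h b)" for b
    proof -
      have "C2_real (\<lambda>x. psi b (x \<bullet> u))" for b
        unfolding psi_def by (cases "b = v") (auto intro!: C2_real_intros C2_real_compose[OF C2])
      then show ?thesis unfolding h_def
        by (cases "b = a") (auto intro!: C2_real_intros C2_real_compose[OF \<sigma>(1)] C2arg)
    qed
    show "h b x = h b y" if "\<And>c. c \<in> insert u (Z - {a}) \<Longrightarrow> x \<bullet> c = y \<bullet> c" for b x y
    proof -
      have "arg x = arg y" unfolding arg_def
        using that by (intro arg_cong2[where f = "(/)"] arg_cong2[where f = "(-)"] refl sum.cong) (auto simp: coord_def)
      then show ?thesis using that by (auto simp: h_def)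
    qed
    fix x assume x: "x \<in> U"
    have s: "\<sigma> (arg x) = sqrt (arg x)" using x by (intro \<sigma>(2)) (auto simp: U_def)
    have eq: "x \<bullet> a = psi a (x \<bullet> u) + sg * \<sigma> (arg x) \<longleftrightarrow> (coord a x)\<^sup>2 = arg x"
    proof
      assume "x \<bullet> a = psi a (x \<bullet> u) + sg * \<sigma> (arg x)"
      then have "coord a x = sg * sqrt (arg x)" by (simp add: coord_def s)
      then have "(coord a x)\<^sup>2 = (sg * sg) * (sqrt (arg x))\<^sup>2" by (simp add: power2_eq_square)
      also have "\<dots> = arg x" using x by (simp add: sg U_def) (metis less_le_trans less_imp_le real_sqrt_pow2 zero_le_power2 order_trans)
      finally show "(coord a x)\<^sup>2 = arg x" .
    next
      assume "(coord a x)\<^sup>2 = arg x"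
      then have "(sg * coord a x)\<^sup>2 = arg x" using sg by (simp add: power2_eq_square algebra_simps)
      then have "sg * coord a x = sqrt (arg x)" using x m by (intro real_sqrt_unique[symmetric]) (auto simp: U_def)
      then have "sg * (sg * coord a x) = sg * sqrt (arg x)" by simp
      then have "coord a x = sg * sqrt (arg x)" using sg by (simp add: mult.assoc[symmetric])
      then show "x \<bullet> a = psi a (x \<bullet> u) + sg * \<sigma> (arg x)" by (simp add: coord_def s)
    qed
    have "(\<forall>b\<in>F - insert u (Z - {a}). x \<bullet> b = h b x) \<longleftrightarrow> x \<bullet> a = h a x \<and> (\<forall>b\<in>F - Z - {u}. x \<bullet> b = h b x)"
      unfolding FB by simp
    also have "\<dots> \<longleftrightarrow> (coord a x)\<^sup>2 = arg x \<and> (\<forall>b\<in>F - Z - {u}. coord b x = 0)"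
      using eq a(1) by (auto simp: h_def coord_def)
    also have "\<dots> \<longleftrightarrow> x \<in> S" by (simp add: S_def argS)
    finally show "x \<in> S \<longleftrightarrow> (\<forall>b\<in>F - insert u (Z - {a}). x \<bullet> b = h b x)" by simp
  qed
qed

text \<open>The normal space is spanned by the gradients of the linear constraints and by
  \<open>n0\<close>, half the gradient of the quadratic one. Taylor's formula for
  \<open>\<theta>\<close> leaves a remainder of at most |\<Delta>|^2 / 6, amplified by the radius 4
  along \<open>n0\<close>. The total 4/6 + 1/2 = 7/6 is small against |n0| \<ge> sqrt 8, as
  curvature at most 1 requires.\<close>

lemma S_osculates:
  assumes p: "p \<in> S" shows "\<exists>N. osculates d S p 1 N"
proof -
  define grad where "grad a = a - (if a = v then \<theta>' (p \<bullet> u) else 0) *\<^sub>R u" for a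
  define B where "B = F - Z - {u}"
  define n0 where "n0 = (\<Sum>a\<in>Z. (wt a * coord a p) *\<^sub>R grad a)"
  define Ns where "Ns = insert n0 (grad ` B)"
  have finB: "finite B" using finF by (simp add: B_def)
  have BF: "b \<in> F" "b \<noteq> u" "b \<notin> Z" if "b \<in> B" for b using that by (auto simp: B_def)
  have ZF: "a \<in> F" "a \<noteq> u" if "a \<in> Z" for a using that Z by auto
  have gin: "grad a \<bullet> b = (if a = b then 1 else 0)" if "a \<in> F" "b \<in> F" "b \<noteq> u" for a b
    using that u by (simp add: grad_def inner_diff_left inn)
  \<comment> \<open>Only the gradient belonging to \<open>v\<close> has a component along
    \<open>u\<close>, so distinct gradients remain orthogonal.\<close>
  have gg: "grad a \<bullet> grad b = 0" if "a \<in> F" "b \<in> F" "a \<noteq> b" "a \<noteq> u" "b \<noteq> u" for a b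
    using that u by (auto simp: grad_def inner_diff_left inner_diff_right inn)
  have n0a: "n0 \<bullet> a = wt a * coord a p" if "a \<in> Z" for a
  proof -
    have "n0 \<bullet> a = (\<Sum>c\<in>Z. if c = a then wt c * coord c p else 0)"
      unfolding n0_def inner_sum_left using that ZF by (intro sum.cong) (auto simp: gin)
    then show ?thesis using that finZ by simp
  qed
  have n0b: "n0 \<bullet> grad b = 0" if "b \<in> B" for b
  proof -
    have "grad a \<bullet> grad b = 0" if "a \<in> Z" for a using gg[of a b] BF[OF \<open>b \<in> B\<close>] ZF[OF that] that by metis
    then show ?thesis unfolding n0_def inner_sum_left by (intro sum.neutral ballI) simp
  qed
  \<comment> \<open>The squared weights reduce the weighted sum 16 by a factor 1/2 at worst.\<close>
  have norm_n0: "8 \<le> (norm n0)\<^sup>2"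
  proof -
    have "8 = (\<Sum>a\<in>Z. wt a * (coord a p)\<^sup>2) / 2" using p by (simp add: S_def)
    also have "\<dots> \<le> (\<Sum>a\<in>Z. (n0 \<bullet> a)\<^sup>2)" unfolding sum_divide_distrib
    proof (rule sum_mono)
      fix a assume a: "a \<in> Z"
      have "1/2 * (wt a * (coord a p)\<^sup>2) \<le> wt a * (wt a * (coord a p)\<^sup>2)"
        using wt_bounds[of a] by (intro mult_right_mono) auto
      then show "wt a * (coord a p)\<^sup>2 / 2 \<le> (n0 \<bullet> a)\<^sup>2" by (simp add: n0a[OF a] power2_eq_square mult_ac)
    qed
    also have "\<dots> \<le> (norm n0)\<^sup>2" by (rule orthonormal_bessel[OF orthonormal_subset[OF F(1) Z(1)]])
    finally show ?thesis .
  qed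
  have norm_g: "1 \<le> (norm (grad b))\<^sup>2" if "b \<in> B" for b
  proof -
    have "(norm (grad b))\<^sup>2 = ((if b = v then \<theta>' (p \<bullet> u) else 0))\<^sup>2 + 1"
      using BF[OF that] u by (simp add: grad_def power2_norm_eq_inner inner_diff_left inner_diff_right inn)
        (simp add: power2_eq_square)
    then show ?thesis by simp
  qed
  have injg: "inj_on grad B"
  proof (rule inj_onI, rule ccontr)
    fix b c assume bc: "b \<in> B" "c \<in> B" "grad b = grad c" "b \<noteq> c"
    then have "grad b \<bullet> grad b = 0" using gg[of b c] BF by metis
    then show False using norm_g[OF bc(1)] by (simp add: power2_norm_eq_inner)
  qed
  have n0notin: "n0 \<notin> grad ` B"
  proof
    assume "n0 \<in> grad ` B"
    then obtain b where "b \<in> B" "n0 = grad b" by blast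
    then have "n0 \<bullet> n0 = 0" using n0b[of b] by simp
    then show False using norm_n0 by (simp add: power2_norm_eq_inner)
  qed
  have ind: "independent Ns"
  proof (rule pairwise_orthogonal_independent)
    have "orthogonal (grad b) (grad c)" if "b \<in> B" "c \<in> B" "grad b \<noteq> grad c" for b c
      unfolding orthogonal_def using that BF[of b] BF[of c] by (intro gg) auto
    moreover have "orthogonal n0 (grad b)" "orthogonal (grad b) n0" if "b \<in> B" for b
      unfolding orthogonal_def using n0b[OF that] by (simp_all add: inner_commute)
    ultimately show "pairwise orthogonal Ns" unfolding Ns_def pairwise_def by blast
    have "n0 \<noteq> 0" using norm_n0 by auto
    moreover have "grad b \<noteq> 0" if "b \<in> B" for b using norm_g[OF that] by auto
    ultimately show "0 \<notin> Ns" unfolding Ns_def by (metis imageE insertE)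
  qed
  have "card B = DIM('a) - d - 1"
  proof -
    have "card (F - Z - {u}) = card (F - Z) - 1" using u Z by (simp add: card_Diff_singleton_if)
    also have "card (F - Z) = card F - card Z" by (rule card_Diff_subset[OF finZ Z(1)])
    finally show ?thesis using F Z by (simp add: B_def)
  qed
  moreover have "d < DIM('a)"
  proof -
    have "Z \<subset> F" using Z u by blast
    then show ?thesis using psubset_card_mono[OF finF, of Z] F Z by simp
  qed
  ultimately have cardN: "card Ns + d = DIM('a)" unfolding Ns_def
    using n0notin finB injg by (simp add: card_image)
  have "osculates d S p 1 (span Ns)"
    unfolding osculates_def
  proof (intro conjI ballI)
    show "subspace (span Ns)" by simp
    show "DIM('a) \<le> dim (span Ns) + d" using ind cardN by (simp add: dim_span dim_eq_card_independent)
    fix w q assume w: "w \<in> span Ns" and q: "q \<in> S"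
    define \<Delta> where "\<Delta> = q - p"
    define rem where "rem = \<theta> (q \<bullet> u) - \<theta> (p \<bullet> u) - \<theta>' (p \<bullet> u) * (\<Delta> \<bullet> u)"
    have rem: "\<bar>rem\<bar> \<le> 1/6 * (\<Delta> \<bullet> u)\<^sup>2" using taylor[of "q \<bullet> u" "p \<bullet> u"] by (simp add: rem_def \<Delta>_def inner_diff_left)
    have bess: "(\<Delta> \<bullet> u)\<^sup>2 + (\<Sum>a\<in>Z. (\<Delta> \<bullet> a)\<^sup>2) \<le> (norm \<Delta>)\<^sup>2"
      using orthonormal_bessel[OF orthonormal_subset[OF F(1)], of "insert u Z" \<Delta>] u Z finZ by simp
    have u2: "(\<Delta> \<bullet> u)\<^sup>2 \<le> (norm \<Delta>)\<^sup>2" using bess sum_nonneg[of Z "\<lambda>a. (\<Delta> \<bullet> a)\<^sup>2"] by auto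
    define \<delta> where "\<delta> a = coord a q - coord a p" for a
    have \<delta>: "\<Delta> \<bullet> grad a = \<delta> a + (if a = v then rem else 0)" for a
      by (simp add: \<delta>_def coord_def psi_def grad_def rem_def \<Delta>_def inner_diff_left inner_diff_right algebra_simps)
    have db: "\<Delta> \<bullet> grad b = (if b = v then rem else 0)" if "b \<in> B" for b
      using that p q by (simp add: \<delta> \<delta>_def S_def B_def)
    \<comment> \<open>For a = v the difference of coordinates also contains the change of
      \<open>\<theta>\<close>, at most the step along the axis. With weight 1/2 the square of this
      difference costs no more than the sum of the two squares, and Bessel's inequality has room for
      the axis direction.\<close>
    have sumd: "(\<Sum>a\<in>Z. wt a * (\<delta> a)\<^sup>2) \<le> (norm \<Delta>)\<^sup>2"
    proof -
      have "(\<Sum>a\<in>Z. wt a * (\<delta> a)\<^sup>2) \<le> (\<Sum>a\<in>Z. (\<Delta> \<bullet> a)\<^sup>2 + (if a = v then (\<Delta> \<bullet> u)\<^sup>2 else 0))"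
      proof (rule sum_mono)
        fix a assume a: "a \<in> Z"
        show "wt a * (\<delta> a)\<^sup>2 \<le> (\<Delta> \<bullet> a)\<^sup>2 + (if a = v then (\<Delta> \<bullet> u)\<^sup>2 else 0)"
        proof (cases "a = v")
          case False
          then show ?thesis by (simp add: wt_def \<delta>_def coord_def psi_def \<Delta>_def inner_diff_left)
        next
          case True
          define e where "e = \<theta> (q \<bullet> u) - \<theta> (p \<bullet> u)"
          have da: "\<delta> a = \<Delta> \<bullet> a - e" using True by (simp add: \<delta>_def coord_def psi_def \<Delta>_def inner_diff_left e_def)
          have e: "e\<^sup>2 \<le> (\<Delta> \<bullet> u)\<^sup>2" using lip[of "q \<bullet> u" "p \<bullet> u"]
            by (simp add: e_def \<Delta>_def inner_diff_left abs_le_square_iff)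
          show ?thesis
          proof (cases "\<omega> = 1")
            case w1: True
            then have "e = 0" using \<omega>(2) a True by (simp add: e_def)
            moreover have "wt a = 1" unfolding wt_def using w1 by simp
            ultimately show ?thesis by (simp add: da)
          next
            case w1: False
            have "(\<Delta> \<bullet> a - e)\<^sup>2 + (\<Delta> \<bullet> a + e)\<^sup>2 = 2 * (\<Delta> \<bullet> a)\<^sup>2 + 2 * e\<^sup>2" by (simp add: power2_eq_square algebra_simps)
            moreover have "0 \<le> (\<Delta> \<bullet> a + e)\<^sup>2" by simp
            ultimately have X: "1/2 * (\<Delta> \<bullet> a - e)\<^sup>2 \<le> (\<Delta> \<bullet> a)\<^sup>2 + (\<Delta> \<bullet> u)\<^sup>2" using e by linarith
            have W: "wt a = 1/2" unfolding wt_def using w1 \<omega>(1) True by simp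
            show ?thesis unfolding W da if_P[OF True] by (rule X)
          qed
        qed
      qed
      also have "\<dots> \<le> (\<Sum>a\<in>Z. (\<Delta> \<bullet> a)\<^sup>2) + (\<Delta> \<bullet> u)\<^sup>2"
        using finZ by (simp add: sum.distrib)
      finally show ?thesis using bess by simp
    qed
    have n0D: "\<Delta> \<bullet> n0 = (if v \<in> Z then wt v * coord v p * rem else 0) - 1/2 * (\<Sum>a\<in>Z. wt a * (\<delta> a)\<^sup>2)"
    proof -
      have "\<Delta> \<bullet> n0 = (\<Sum>a\<in>Z. wt a * coord a p * \<delta> a + (if a = v then wt a * coord a p * rem else 0))"
        unfolding n0_def inner_sum_right by (intro sum.cong) (auto simp: \<delta> algebra_simps)
      also have "\<dots> = (\<Sum>a\<in>Z. wt a * coord a p * \<delta> a) + (if v \<in> Z then wt v * coord v p * rem else 0)"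
        using finZ by (simp add: sum.distrib)
      also have "(\<Sum>a\<in>Z. wt a * coord a p * \<delta> a) = - 1/2 * (\<Sum>a\<in>Z. wt a * (\<delta> a)\<^sup>2)"
      proof -
        have "(\<Sum>a\<in>Z. wt a * (coord a q)\<^sup>2) - (\<Sum>a\<in>Z. wt a * (coord a p)\<^sup>2) = 0" using p q by (simp add: S_def)
        also have "(\<Sum>a\<in>Z. wt a * (coord a q)\<^sup>2) - (\<Sum>a\<in>Z. wt a * (coord a p)\<^sup>2)
            = (\<Sum>a\<in>Z. 2 * (wt a * coord a p * \<delta> a) + wt a * (\<delta> a)\<^sup>2)"
          unfolding sum_subtractf[symmetric] by (intro sum.cong) (auto simp: \<delta>_def power2_eq_square algebra_simps)
        also have "\<dots> = 2 * (\<Sum>a\<in>Z. wt a * coord a p * \<delta> a) + (\<Sum>a\<in>Z. wt a * (\<delta> a)\<^sup>2)"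
          by (simp add: sum.distrib sum_distrib_left)
        finally show ?thesis by simp
      qed
      finally show ?thesis by simp
    qed
    have sum0: "0 \<le> (\<Sum>a\<in>Z. wt a * (\<delta> a)\<^sup>2)" using wt_bounds by (intro sum_nonneg) (auto simp: less_imp_le)
    obtain \<alpha> where \<alpha>: "w - \<alpha> *\<^sub>R n0 \<in> span (grad ` B)" using w by (auto simp: Ns_def span_breakdown_eq)
    obtain \<beta> where \<beta>: "w - \<alpha> *\<^sub>R n0 = (\<Sum>b\<in>B. \<beta> b *\<^sub>R grad b)"
    proof -
      obtain r where "w - \<alpha> *\<^sub>R n0 = (\<Sum>g\<in>grad ` B. r g *\<^sub>R g)"
        using \<alpha> finB by (auto simp: span_finite)
      then show thesis using that[of "\<lambda>b. r (grad b)"] by (simp add: sum.reindex[OF injg])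
    qed
    define y where "y = (\<Sum>b\<in>B. \<beta> b *\<^sub>R grad b)"
    have w: "w = \<alpha> *\<^sub>R n0 + y" using \<beta> by (simp add: y_def algebra_simps)
    have n0y: "n0 \<bullet> y = 0" unfolding y_def inner_sum_right using n0b by simp
    define bv where "bv = (if v \<in> B then \<beta> v else 0)"
    have yb: "bv\<^sup>2 \<le> (norm y)\<^sup>2"
    proof (cases "v \<in> B")
      case True
      have "y \<bullet> v = (\<Sum>b\<in>B. if b = v then \<beta> b else 0)" unfolding y_def inner_sum_left
        using True BF by (intro sum.cong) (auto simp: gin)
      then have "y \<bullet> v = bv" using True finB by (simp add: bv_def)
      moreover have "norm v = 1" using orthonormal_norm[OF F(1) v(1)] .
      ultimately show ?thesis using Cauchy_Schwarz_ineq2[of y v] by (simp add: abs_le_square_iff[symmetric])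
    qed (simp add: bv_def)
    have Dy: "\<Delta> \<bullet> y = bv * rem"
    proof -
      have "\<Delta> \<bullet> y = (\<Sum>b\<in>B. if b = v then \<beta> b * rem else 0)" unfolding y_def inner_sum_right
        by (intro sum.cong) (auto simp: db)
      then show ?thesis using finB by (simp add: bv_def)
    qed
    have nw: "8 * \<alpha>\<^sup>2 + bv\<^sup>2 \<le> (norm w)\<^sup>2"
    proof -
      have "(norm w)\<^sup>2 = \<alpha>\<^sup>2 * (norm n0)\<^sup>2 + (norm y)\<^sup>2"
        using n0y by (simp add: w power2_norm_eq_inner inner_add_left inner_add_right inner_commute[of y n0])
          (simp add: power2_eq_square)
      moreover have "\<alpha>\<^sup>2 * 8 \<le> \<alpha>\<^sup>2 * (norm n0)\<^sup>2" using norm_n0 by (intro mult_left_mono) auto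
      ultimately show ?thesis using yb by linarith
    qed
    have r6: "\<bar>rem\<bar> \<le> 1/6 * (norm \<Delta>)\<^sup>2" using rem u2 by linarith
    have Dn0: "\<bar>\<Delta> \<bullet> n0\<bar> \<le> 7/6 * (norm \<Delta>)\<^sup>2"
    proof -
      have "\<bar>if v \<in> Z then wt v * coord v p * rem else 0\<bar> \<le> 4 * (1/6 * (norm \<Delta>)\<^sup>2)"
      proof (cases "v \<in> Z")
        case True
        have "\<bar>wt v * coord v p\<bar> * \<bar>rem\<bar> \<le> 4 * (1/6 * (norm \<Delta>)\<^sup>2)"
          using coord_bound(2)[OF p True] r6 by (intro mult_mono) auto
        then show ?thesis using True by (simp add: abs_mult)
      qed simp
      then show ?thesis unfolding n0D using sumd sum0 by linarith
    qed
    have "\<bar>\<Delta> \<bullet> w\<bar> \<le> \<bar>\<alpha>\<bar> * \<bar>\<Delta> \<bullet> n0\<bar> + \<bar>bv\<bar> * \<bar>rem\<bar>"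
      unfolding w inner_add_right inner_scaleR_right Dy by (metis abs_mult abs_triangle_ineq)
    also have "\<dots> \<le> \<bar>\<alpha>\<bar> * (7/6 * (norm \<Delta>)\<^sup>2) + \<bar>bv\<bar> * (1/6 * (norm \<Delta>)\<^sup>2)"
      using Dn0 r6 by (intro add_mono mult_left_mono) auto
    also have "\<dots> = (7/6 * \<bar>\<alpha>\<bar> + 1/6 * \<bar>bv\<bar>) * (norm \<Delta>)\<^sup>2" by (simp add: algebra_simps)
    also have "\<dots> \<le> (norm w / 2) * (norm \<Delta>)\<^sup>2"
    proof (rule mult_right_mono)
      \<comment> \<open>The components of w along \<open>n0\<close> and y are orthogonal, so two
        quadratic forms are compared: 49/9 + 7/9 \<le> 8 and 1/9 + 7/9 \<le> 1.\<close>
      have "(7/3 * \<bar>\<alpha>\<bar> + 1/3 * \<bar>bv\<bar>)\<^sup>2 \<le> 8 * \<alpha>\<^sup>2 + bv\<^sup>2"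
      proof -
        have "0 \<le> (\<bar>\<alpha>\<bar> - \<bar>bv\<bar>)\<^sup>2" by simp
        then have "2 * (\<bar>\<alpha>\<bar> * \<bar>bv\<bar>) \<le> \<alpha>\<^sup>2 + bv\<^sup>2" by (simp add: power2_eq_square algebra_simps)
        moreover have "(7/3 * \<bar>\<alpha>\<bar> + 1/3 * \<bar>bv\<bar>)\<^sup>2 = 49/9 * \<alpha>\<^sup>2 + 14/9 * (\<bar>\<alpha>\<bar> * \<bar>bv\<bar>) + 1/9 * bv\<^sup>2"
          by (simp add: power2_eq_square algebra_simps)
        moreover have "0 \<le> \<alpha>\<^sup>2" "0 \<le> bv\<^sup>2" by auto
        ultimately show ?thesis by linarith
      qed
      then have "(7/3 * \<bar>\<alpha>\<bar> + 1/3 * \<bar>bv\<bar>)\<^sup>2 \<le> (norm w)\<^sup>2" using nw by linarith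
      then have "7/3 * \<bar>\<alpha>\<bar> + 1/3 * \<bar>bv\<bar> \<le> norm w" by (rule power2_le_imp_le) simp
      then show "7/6 * \<bar>\<alpha>\<bar> + 1/6 * \<bar>bv\<bar> \<le> norm w / 2" by simp
    qed simp
    finally show "\<bar>(q - p) \<bullet> w\<bar> \<le> norm w * (norm (q - p))\<^sup>2 / (2 * 1)" by (simp add: \<Delta>_def)
  qed
  then show ?thesis by blast
qed

text \<open>A stretch along \<open>v\<close> by at most sqrt 2 followed by the shear along
  \<open>\<theta>\<close> has Lipschitz constant 2 and covers the bent tube from a straight one of
  length 44. Its 11 segments of length 4 cost 2 d 4^d each, whence 22, and 2^d 4^d = 8^d.\<close>

lemma S_measure:
  assumes dZ: "d = card Z"
  shows "hausdorff_outer d (S \<inter> {x. \<bar>x \<bullet> u\<bar> < 22}) \<le> ennreal (22 * real d * 8 ^ d * flat_vol Z)"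
proof -
  define T where "T = tube u Z 4 {-22<..-22 + real 11 * 4}"
  define \<mu> where "\<mu> = 1 / sqrt \<omega>"
  have \<mu>: "\<mu>\<^sup>2 * \<omega> = 1" "\<mu>\<^sup>2 \<le> 2" "1 \<le> \<mu>" "\<mu> \<noteq> 0" using \<omega>(1) by (auto simp: \<mu>_def power_divide field_simps)
  define G where "G x = x + ((if v \<in> Z then (\<mu> - 1) * (x \<bullet> v) else 0) + \<theta> (x \<bullet> u)) *\<^sub>R v" for x
  have uv: "u \<bullet> v = 0" "v \<bullet> v = 1" "v \<bullet> u = 0" "u \<bullet> u = 1" using u v by (auto simp: inn)
  have oZ: "orthonormal (insert u Z)" using F u Z by (auto intro: orthonormal_subset)
  have cover: "S \<inter> {x. \<bar>x \<bullet> u\<bar> < 22} \<subseteq> G ` T"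
  proof
    fix x assume x: "x \<in> S \<inter> {x. \<bar>x \<bullet> u\<bar> < 22}"
    define y where "y = (\<Sum>a\<in>insert u Z. (if a = u then x \<bullet> u else if a = v then coord a x / \<mu> else x \<bullet> a) *\<^sub>R a)"
    have ya: "y \<bullet> a = (if a = u then x \<bullet> u else if a = v then coord a x / \<mu> else x \<bullet> a)" if "a \<in> insert u Z" for a
      unfolding y_def by (rule orthonormal_sum_inner[OF oZ that])
    have yb: "y \<bullet> b = 0" if "b \<in> F - Z - {u}" for b
    proof -
      have "a \<bullet> b = 0" if "a \<in> insert u Z" for a using that \<open>b \<in> F - Z - {u}\<close> u Z inn[of a b] by auto
      then show ?thesis unfolding y_def inner_sum_left by (intro sum.neutral ballI) simp
    qed
    have "(\<Sum>a\<in>Z. (y \<bullet> a)\<^sup>2) = (\<Sum>a\<in>Z. wt a * (coord a x)\<^sup>2)"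
    proof (rule sum.cong[OF refl])
      fix a assume a: "a \<in> Z"
      then have "a \<noteq> u" using Z by auto
      show "(y \<bullet> a)\<^sup>2 = wt a * (coord a x)\<^sup>2"
      proof (cases "a = v")
        case True
        have "(coord a x / \<mu>)\<^sup>2 = \<omega> * (coord a x)\<^sup>2" using \<mu> by (simp add: power_divide field_simps)
        then show ?thesis using a True \<open>a \<noteq> u\<close> by (simp add: ya wt_def)
      next
        case False
        then show ?thesis using a \<open>a \<noteq> u\<close> by (simp add: ya wt_def coord_def psi_def)
      qed
    qed
    also have "\<dots> = 4\<^sup>2" using x by (simp add: S_def)
    finally have "(\<Sum>a\<in>Z. (y \<bullet> a)\<^sup>2) = 4\<^sup>2" .
    moreover have "y \<in> span (insert u Z)" unfolding y_def by (intro span_sum span_mul span_base)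
    ultimately have "y \<in> T" using x ya[of u] unfolding T_def tube_def by auto
    moreover have "G y = x"
    proof -
      have "G y \<bullet> c = x \<bullet> c" if c: "c \<in> F" for c
      proof -
        have Gc: "G y \<bullet> c = y \<bullet> c + (if c = v then (if v \<in> Z then (\<mu> - 1) * (y \<bullet> v) else 0) + \<theta> (x \<bullet> u) else 0)"
          using c v ya[of u] by (auto simp: G_def inner_add_left inn)
        consider "c = u" | "c \<in> Z" | "c \<in> F - Z - {u}" using c by blast
        then show ?thesis
        proof cases
          case 1 then show ?thesis using Gc ya[of u] v by simp
        next
          case 2
          then have "c \<noteq> u" using Z by auto
          then show ?thesis using 2 Gc ya[of c] \<mu> by (cases "c = v") (auto simp: coord_def psi_def field_simps)
        next
          case 3
          then have "coord c x = 0" using x by (simp add: S_def)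
          then show ?thesis using 3 Gc yb[OF 3] by (cases "c = v") (auto simp: coord_def psi_def)
        qed
      qed
      then have "(\<Sum>c\<in>F. (G y \<bullet> c) *\<^sub>R c) = (\<Sum>c\<in>F. (x \<bullet> c) *\<^sub>R c)" by simp
      then show ?thesis using orthonormal_span_expansion[OF F(1)] span_F by simp
    qed
    ultimately show "x \<in> G ` T" by (metis image_eqI)
  qed
  have lipG: "dist (G x) (G y) \<le> 2 * dist x y" if xy: "x \<in> T" "y \<in> T" for x y
  proof -
    define \<Delta> where "\<Delta> = x - y"
    define e where "e = \<theta> (x \<bullet> u) - \<theta> (y \<bullet> u)"
    have e: "e\<^sup>2 \<le> (\<Delta> \<bullet> u)\<^sup>2" using lip[of "x \<bullet> u" "y \<bullet> u"]
      by (simp add: e_def \<Delta>_def inner_diff_left abs_le_square_iff)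
    have bess: "(\<Delta> \<bullet> u)\<^sup>2 + (\<Delta> \<bullet> v)\<^sup>2 \<le> (norm \<Delta>)\<^sup>2"
      using orthonormal_bessel[OF orthonormal_subset[OF F(1)], of "{u, v}" \<Delta>] u v by simp
    define k where "k = (if v \<in> Z then \<mu> - 1 else 0)"
    have GG: "G x - G y = \<Delta> + (k * (\<Delta> \<bullet> v) + e) *\<^sub>R v"
      by (simp add: G_def \<Delta>_def e_def k_def inner_diff_left algebra_simps)
    have k: "(1 + k)\<^sup>2 \<le> 2" using \<mu> by (auto simp: k_def)
    have "(norm (G x - G y))\<^sup>2 = (norm \<Delta>)\<^sup>2 - (\<Delta> \<bullet> v)\<^sup>2 + ((1 + k) * (\<Delta> \<bullet> v) + e)\<^sup>2"
    proof -
      have "(norm (\<Delta> + c *\<^sub>R v))\<^sup>2 = (norm \<Delta>)\<^sup>2 - (\<Delta> \<bullet> v)\<^sup>2 + (\<Delta> \<bullet> v + c)\<^sup>2" for c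
        using norm_sq_diff_scaled[of 1 \<Delta> "-c" v] orthonormal_norm[OF F(1) v(1)]
        by (simp add: power2_eq_square algebra_simps)
      from this[of "k * (\<Delta> \<bullet> v) + e"] show ?thesis unfolding GG by (simp add: distrib_right add.assoc)
    qed
    moreover have "((1 + k) * (\<Delta> \<bullet> v) + e)\<^sup>2 \<le> 4 * (\<Delta> \<bullet> v)\<^sup>2 + 2 * (\<Delta> \<bullet> u)\<^sup>2"
    proof -
      have "((1 + k) * (\<Delta> \<bullet> v) + e)\<^sup>2 + ((1 + k) * (\<Delta> \<bullet> v) - e)\<^sup>2 = 2 * ((1 + k)\<^sup>2 * (\<Delta> \<bullet> v)\<^sup>2) + 2 * e\<^sup>2"
        by (simp add: power2_eq_square algebra_simps)
      moreover have "(1 + k)\<^sup>2 * (\<Delta> \<bullet> v)\<^sup>2 \<le> 2 * (\<Delta> \<bullet> v)\<^sup>2" using k by (intro mult_right_mono) auto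
      moreover have "0 \<le> ((1 + k) * (\<Delta> \<bullet> v) - e)\<^sup>2" by simp
      ultimately show ?thesis using e by linarith
    qed
    ultimately have "(norm (G x - G y))\<^sup>2 \<le> 4 * (norm \<Delta>)\<^sup>2" using bess zero_le_power2[of "\<Delta> \<bullet> u"] zero_le_power2[of "\<Delta> \<bullet> v"] by linarith
    then have "(norm (G x - G y))\<^sup>2 \<le> (2 * norm \<Delta>)\<^sup>2" by (simp add: power_mult_distrib)
    then have "norm (G x - G y) \<le> 2 * norm \<Delta>" by (rule power2_le_imp_le) simp
    then show ?thesis by (simp add: dist_norm \<Delta>_def)
  qed
  have "hausdorff_outer d (S \<inter> {x. \<bar>x \<bullet> u\<bar> < 22}) \<le> hausdorff_outer d (G ` T)" by (rule hausdorff_outer_mono[OF cover])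
  also have "\<dots> \<le> ennreal (2 ^ d) * hausdorff_outer d T" by (rule hausdorff_outer_lipschitz_image[OF _ lipG]) simp
  also have "\<dots> \<le> ennreal (2 ^ d) * ennreal (real 11 * (2 * real d * 4 ^ d * flat_vol Z))"
    unfolding T_def using tube_measure_le[OF oZ Z(2), of 4 "-22" 11] d dZ by (intro mult_left_mono) auto
  also have "\<dots> = ennreal (22 * real d * 8 ^ d * flat_vol Z)"
  proof -
    have "(8::real) ^ d = 2 ^ d * 4 ^ d" by (simp flip: power_mult_distrib)
    then show ?thesis by (simp add: ennreal_mult'[symmetric] mult_ac)
  qed
  finally show ?thesis .
qed

end

subsection \<open>Pieces in a cube\<close>

text \<open>A cell has side 42. A bend is complete at 13 from the centre, which leaves a straight
  stretch of length 8 before each face with a port.\<close>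

definition cube :: "'a::euclidean_space set" where
  "cube = {y. \<forall>i\<in>Basis. \<bar>y \<bullet> i\<bar> \<le> 21}"

definition sbasis :: "'a::euclidean_space set" where
  "sbasis = Basis \<union> uminus ` Basis"

text \<open>This replaces connectedness of a piece, which fails for d = 1, where a tube consists of
  two curves: each point is only joined, inside the cube, to the face in direction
  \<open>D\<close>.\<close>

definition strand :: "'a::euclidean_space set \<Rightarrow> 'a \<Rightarrow> bool" where
  "strand E D \<longleftrightarrow> (\<forall>y\<in>E \<inter> cube. \<exists>S. connected S \<and> y \<in> S \<and> S \<subseteq> E \<inter> cube \<and> (\<exists>z\<in>S. z \<bullet> D = 21))"

text \<open>\<open>P\<close> is the set of ports \<open>(D, A)\<close>: through the face in direction \<open>D\<close> the set \<open>E\<close> leaves the cube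
  as a straight tube with axis \<open>D\<close> and cross-section in the span of \<open>A\<close>.\<close>
definition piece :: "nat \<Rightarrow> 'a::euclidean_space set \<Rightarrow> ('a \<times> 'a set) set \<Rightarrow> bool" where
  "piece d E P \<longleftrightarrow> closed E \<and> (\<forall>p\<in>E. C2_chart d E p) \<and> (\<forall>p\<in>E. \<exists>N. osculates d E p 1 N) \<and>
     (\<forall>(D, A)\<in>P. D \<in> sbasis \<and> A \<subseteq> Basis \<and> card A = d \<and> (\<forall>a\<in>A. D \<bullet> a = 0) \<and>
        (\<forall>y. 13 \<le> y \<bullet> D \<longrightarrow> (y \<in> E \<longleftrightarrow> y \<in> tube D A 4 UNIV))) \<and>
     (\<forall>y\<in>E. \<forall>D\<in>sbasis. 13 \<le> y \<bullet> D \<longrightarrow> (\<exists>A. (D, A) \<in> P)) \<and>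
     (\<forall>y\<in>E. \<forall>I\<subseteq>Basis. (\<forall>(D, A)\<in>P. \<forall>i\<in>I. D \<bullet> i = 0) \<longrightarrow> (\<Sum>i\<in>I. (y \<bullet> i)\<^sup>2) \<le> 16) \<and>
     (\<forall>Z::'a set. orthonormal Z \<longrightarrow> card Z = d \<longrightarrow>
        hausdorff_outer d (E \<inter> cube) \<le> ennreal (22 * real d * 8 ^ d * flat_vol Z))"

lemma abs_le_if_square_le: "x\<^sup>2 \<le> c\<^sup>2 \<Longrightarrow> 0 \<le> c \<Longrightarrow> \<bar>x\<bar> \<le> (c::real)"
  by (simp add: power2_le_iff_abs_le)

lemma span_orthonormal_iff:
  fixes F :: "'a::euclidean_space set"
  assumes F: "orthonormal F" "card F = DIM('a)" and Y: "Y \<subseteq> F"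
  shows "x \<in> span Y \<longleftrightarrow> (\<forall>b\<in>F - Y. x \<bullet> b = 0)"
proof
  assume x: "x \<in> span Y"
  show "\<forall>b\<in>F - Y. x \<bullet> b = 0"
  proof
    fix b assume "b \<in> F - Y"
    then show "x \<bullet> b = 0"
      using orthonormal_insert_orth[of b Y x] x F(1) Y by (meson DiffD1 DiffD2 insert_subset orthonormal_subset)
  qed
next
  assume x: "\<forall>b\<in>F - Y. x \<bullet> b = 0"
  have "x = (\<Sum>a\<in>F. (x \<bullet> a) *\<^sub>R a)" using orthonormal_span_expansion[OF F(1), of x] orthonormal_span_UNIV[OF F] by simp
  also have "\<dots> = (\<Sum>a\<in>Y. (x \<bullet> a) *\<^sub>R a)"
    using x by (intro sum.mono_neutral_right orthonormal_finite[OF F(1)] Y) auto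
  finally have "x = (\<Sum>a\<in>Y. (x \<bullet> a) *\<^sub>R a)" .
  moreover have "\<dots> \<in> span Y" by (intro span_sum span_mul span_base)
  ultimately show "x \<in> span Y" by simp
qed

lemma sbasisE:
  assumes "D \<in> sbasis"
  obtains i s where "i \<in> Basis" "D = s *\<^sub>R i" "s = 1 \<or> s = -1"
  using assms unfolding sbasis_def by (metis UnE image_iff scaleR_minus1_left scaleR_one)

lemma sbasis_uminus: "D \<in> sbasis \<Longrightarrow> - D \<in> sbasis"
  unfolding sbasis_def by auto

lemma sbasis_norm: "D \<in> sbasis \<Longrightarrow> norm D = 1"
  unfolding sbasis_def by auto

lemma tube_axis_iff:
  assumes D: "D = s *\<^sub>R i" "s = 1 \<or> s = -1" "i \<in> Basis" and A: "A \<subseteq> Basis" "i \<notin> A"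
  shows "x \<in> tube D A r UNIV \<longleftrightarrow> (\<Sum>a\<in>A. (x \<bullet> a)\<^sup>2) = r\<^sup>2 \<and> (\<forall>b\<in>Basis - A - {i}. x \<bullet> b = 0)"
proof -
  have "span (insert D A) = span (insert i A)"
  proof -
    have "D \<in> span (insert i A)" "i \<in> span (insert D A)"
      using D(1,2) by (auto intro: span_base span_mul simp: span_neg) (metis insertI1 span_base span_neg minus_minus)+
    then show ?thesis by (meson insert_subset span_minimal span_mono span_superset subset_antisym subset_insertI subset_trans subspace_span)
  qed
  then show ?thesis using span_orthonormal_iff[OF orthonormal_Basis, of "insert i A" x] A D(3)
    by (auto simp: tube_def)
qed

lemma flat_vol_card:
  fixes Z Z' :: "'a::euclidean_space set"
  shows "orthonormal Z \<Longrightarrow> orthonormal Z' \<Longrightarrow> card Z = card Z' \<Longrightarrow> flat_vol Z = flat_vol Z'"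
  by (rule flat_vol_eq)

lemma strandI:
  assumes "\<And>y. y \<in> E \<inter> cube \<Longrightarrow> \<exists>S. connected S \<and> y \<in> S \<and> S \<subseteq> E \<inter> cube \<and> (\<exists>z\<in>S. z \<bullet> D = 21)"
  shows "strand E D"
  using assms by (simp add: strand_def)

section \<open>Straight pieces and right-angled bends\<close>

lemma straight_piece:
  fixes A :: "'a::euclidean_space set"
  assumes D: "D \<in> sbasis" and A: "A \<subseteq> Basis" "card A = d" "1 \<le> d" "\<forall>a\<in>A. D \<bullet> a = 0"
  shows "piece d (tube D A 4 UNIV) {(- D, A), (D, A)}" "strand (tube D A 4 UNIV) (- D)"
proof -
  obtain i s where i: "i \<in> Basis" "D = s *\<^sub>R i" "s = 1 \<or> s = -1" using sbasisE[OF D] by metis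
  have iA: "i \<notin> A" using A(1,4) i by (auto simp: inner_Basis)
  obtain v where v: "v \<in> A" using A(2,3) by (metis card.empty ex_in_conv not_one_le_zero)
  have finA: "finite A" by (rule finite_subset[OF A(1) finite_Basis])
  \<comment> \<open>The straight tube is the bent tube with constant \<open>\<theta>\<close> = 0;
    any direction of the cross-section can then act as \<open>v\<close>.\<close>
  interpret bent_tube Basis i v A "\<lambda>_. 0" "\<lambda>_. 0" 1 d
  proof
    show "C2_fun (\<lambda>_. 0)" unfolding C2_fun_def
      by (intro exI[of _ "\<lambda>_. 0"]) (auto intro!: derivative_eq_intros)
  qed (use i iA v A in \<open>auto simp: orthonormal_Basis\<close>)
  let ?T = "tube D A 4 UNIV"
  have coord: "coord a x = x \<bullet> a" for a x by (simp add: coord_def psi_def)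
  have wt: "wt a = 1" for a by (simp add: wt_def)
  have T: "x \<in> ?T \<longleftrightarrow> (\<Sum>a\<in>A. (x \<bullet> a)\<^sup>2) = 4\<^sup>2 \<and> (\<forall>b\<in>Basis - A - {i}. x \<bullet> b = 0)" for x
    by (rule tube_axis_iff[OF i(2,3,1) A(1) iA])
  have TS: "?T = S" by (auto simp: T S_def coord wt)
  have neg: "tube (- D) A 4 UNIV = ?T"
  proof -
    have "- D = (- s) *\<^sub>R i" "- s = 1 \<or> - s = -1" using i by auto
    from tube_axis_iff[OF this i(1) A(1) iA] show ?thesis using T by blast
  qed
  have small: "\<bar>y \<bullet> b\<bar> \<le> 4" if "y \<in> ?T" "b \<in> Basis" "b \<noteq> i" for y b
  proof (cases "b \<in> A")
    case True
    have "(y \<bullet> b)\<^sup>2 \<le> (\<Sum>a\<in>A. (y \<bullet> a)\<^sup>2)" using True finA by (intro member_le_sum) auto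
    then have "(y \<bullet> b)\<^sup>2 \<le> 4\<^sup>2" using T that by simp
    then show ?thesis by (rule abs_le_if_square_le) simp
  next
    case False
    then show ?thesis using that T by auto
  qed
  show "piece d ?T {(- D, A), (D, A)}"
    unfolding piece_def
  proof (intro conjI ballI allI impI)
    show "closed ?T" unfolding TS by (rule closed_S)
    show "C2_chart d ?T p" if "p \<in> ?T" for p using that unfolding TS by (rule S_chart)
    show "\<exists>N. osculates d ?T p 1 N" if "p \<in> ?T" for p using that unfolding TS by (rule S_osculates)
    show "case q of (D', A') \<Rightarrow> D' \<in> sbasis \<and> A' \<subseteq> Basis \<and> card A' = d \<and> (\<forall>a\<in>A'. D' \<bullet> a = 0) \<and>
        (\<forall>y. 13 \<le> y \<bullet> D' \<longrightarrow> (y \<in> ?T) = (y \<in> tube D' A' 4 UNIV))" if "q \<in> {(- D, A), (D, A)}" for q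
      using that D A neg by (auto simp: sbasis_uminus)
    show "\<exists>A'. (D', A') \<in> {(- D, A), (D, A)}" if "y \<in> ?T" "D' \<in> sbasis" "13 \<le> y \<bullet> D'" for y D'
    proof -
      note D' = that(2)
      obtain b r where b: "b \<in> Basis" "D' = r *\<^sub>R b" "r = 1 \<or> r = -1" using sbasisE[OF D'] by metis
      have "b = i" using small[OF that(1) b(1)] that(3) b by (cases "b = i") auto
      then show ?thesis using b i by auto
    qed
    show "(\<Sum>k\<in>I. (y \<bullet> k)\<^sup>2) \<le> 16" if y: "y \<in> ?T" and I: "I \<subseteq> Basis" "\<forall>(D', A')\<in>{(- D, A), (D, A)}. \<forall>k\<in>I. D' \<bullet> k = 0" for y I
    proof -
      have "i \<notin> I" using I(2) i by (auto simp: inner_Basis)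
      have "(\<Sum>k\<in>I. (y \<bullet> k)\<^sup>2) = (\<Sum>k\<in>I \<inter> A. (y \<bullet> k)\<^sup>2)"
        using y I(1) \<open>i \<notin> I\<close> finite_subset[OF I(1)] by (intro sum.mono_neutral_right) (auto simp: T)
      also have "\<dots> \<le> (\<Sum>k\<in>A. (y \<bullet> k)\<^sup>2)" using finA by (intro sum_mono2) auto
      finally show ?thesis using y T by simp
    qed
    show "hausdorff_outer d (?T \<inter> cube) \<le> ennreal (22 * real d * 8 ^ d * flat_vol Z')"
      if "orthonormal Z'" "card Z' = d" for Z' :: "'a set"
    proof -
      have "?T \<inter> cube \<subseteq> S \<inter> {x. \<bar>x \<bullet> i\<bar> < 22}" using i(1) unfolding TS cube_def by force
      then have "hausdorff_outer d (?T \<inter> cube) \<le> hausdorff_outer d (S \<inter> {x. \<bar>x \<bullet> i\<bar> < 22})" by (rule hausdorff_outer_mono)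
      also have "\<dots> \<le> ennreal (22 * real d * 8 ^ d * flat_vol A)" using A by (intro S_measure) auto
      also have "flat_vol A = flat_vol Z'"
        using that A orthonormal_subset[OF orthonormal_Basis A(1)] by (intro flat_vol_card) auto
      finally show ?thesis .
    qed
  qed
  show "strand ?T (- D)"
  proof (rule strandI)
    fix y assume y: "y \<in> ?T \<inter> cube"
    define g where "g t = y + (t - y \<bullet> i) *\<^sub>R i" for t
    have gi: "g t \<bullet> b = (if b = i then t else y \<bullet> b)" if "b \<in> Basis" for t b
      using that i(1) by (auto simp: g_def inner_add_left inner_Basis)
    have sums: "(\<Sum>a\<in>A. (g t \<bullet> a)\<^sup>2) = (\<Sum>a\<in>A. (y \<bullet> a)\<^sup>2)" for t
      using iA A(1) by (intro sum.cong refl) (auto simp: gi subset_iff)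
    have gT: "g t \<in> ?T" for t using y T[of y] T[of "g t"] sums[of t] gi by auto
    have "\<bar>y \<bullet> i\<bar> \<le> 21" using y i(1) by (auto simp: cube_def)
    show "\<exists>S. connected S \<and> y \<in> S \<and> S \<subseteq> ?T \<inter> cube \<and> (\<exists>z\<in>S. z \<bullet> (- D) = 21)"
    proof (intro exI[of _ "g ` {-21..21}"] conjI)
      show "connected (g ` {-21..21})" unfolding g_def
        by (intro connected_continuous_image continuous_intros) auto
      have "y = g (y \<bullet> i)" by (simp add: g_def)
      then show "y \<in> g ` {-21..21}" using \<open>\<bar>y \<bullet> i\<bar> \<le> 21\<close> by (auto simp: abs_le_iff)
      show "g ` {-21..21} \<subseteq> ?T \<inter> cube" using gT y gi by (auto simp: cube_def abs_le_iff)
      have "g (- s * 21) \<bullet> (- D) = 21" using i gi[OF i(1)] by auto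
      moreover have "- s * 21 \<in> {-21..21}" using i by auto
      ultimately show "\<exists>z\<in>g ` {-21..21}. z \<bullet> (- D) = 21" by blast
    qed
  qed
qed

lemma bend_mono: "s \<le> t \<Longrightarrow> s - bend s \<le> t - bend t" "s \<le> t \<Longrightarrow> s + bend s \<le> t + bend t"
  using bend_lipschitz[of s t] by (auto simp: abs_le_iff)

lemma bend_ge: "t - bend t \<le> 0" "0 \<le> t + bend t"
proof -
  have "t - bend t \<le> max t 6 - bend (max t 6)" by (rule bend_mono) simp
  then show "t - bend t \<le> 0" by (simp add: bend_abs)
  have "min t (-6) + bend (min t (-6)) \<le> t + bend t" by (rule bend_mono) simp
  then show "0 \<le> t + bend t" by (simp add: bend_abs)
qed

lemma sqrt2_bounds: "1.414 < sqrt 2" "sqrt 2 < 1.415"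
  by (rule real_less_rsqrt, simp add: power2_eq_square) (rule real_less_lsqrt, simp_all add: power2_eq_square)

text \<open>In the rotated frame u = (D + E) / sqrt 2, v = (E - D) / sqrt 2 the corner formed by the
  rays -D and E is the graph v = |u|, which \<open>bend\<close> rounds off. If the axis j of
  \<open>E\<close> belongs to the cross-section, it is exchanged for the old axis i; then
  \<open>v\<close> is in \<open>Z\<close> and the weight 1/2 applies.\<close>

lemma bend_piece:
  fixes A :: "'a::euclidean_space set"
  assumes D: "D \<in> sbasis" and E: "E \<in> sbasis" and DE: "D \<bullet> E = 0"
    and A: "A \<subseteq> Basis" "card A = d" "1 \<le> d" "\<forall>a\<in>A. D \<bullet> a = 0"
  shows "\<exists>S A'. piece d S {(- D, A), (E, A')} \<and> strand S (- D)"
proof -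
  obtain i s where i: "i \<in> Basis" "D = s *\<^sub>R i" "s = 1 \<or> s = -1" using sbasisE[OF D] by metis
  obtain j r where j: "j \<in> Basis" "E = r *\<^sub>R j" "r = 1 \<or> r = -1" using sbasisE[OF E] by metis
  have ij: "i \<noteq> j" using DE i j by auto
  have iA: "i \<notin> A" using A(1,4) i by (auto simp: inner_Basis)
  have finA: "finite A" by (rule finite_subset[OF A(1) finite_Basis])
  have ss: "s * s = 1" "r * r = 1" using i j by auto
  define u where "u = (1 / sqrt 2) *\<^sub>R (D + E)"
  define v where "v = (1 / sqrt 2) *\<^sub>R (E - D)"
  have DD: "D \<bullet> D = 1" "E \<bullet> E = 1" "E \<bullet> D = 0" using i j ij ss DE by (auto simp: inner_Basis inner_commute)
  have uv: "u \<bullet> u = 1" "v \<bullet> v = 1" "u \<bullet> v = 0" "v \<bullet> u = 0"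
    using DD DE by (auto simp: u_def v_def inner_add_left inner_add_right inner_diff_left inner_diff_right)
  have uvb: "u \<bullet> b = 0" "v \<bullet> b = 0" if "b \<in> Basis - {i, j}" for b
    using that i j by (auto simp: u_def v_def inner_add_left inner_diff_left inner_Basis)
  define F where "F = insert u (insert v (Basis - {i, j}))"
  have nu: "u \<notin> Basis - {i, j}" "v \<notin> Basis - {i, j}" "u \<noteq> v" using uv uvb by (metis zero_neq_one)+
  have oF: "orthonormal F"
    unfolding orthonormal_def
  proof (intro conjI ballI)
    show "finite F" by (simp add: F_def)
    have uvb': "b \<bullet> u = 0" "b \<bullet> v = 0" if "b \<in> Basis - {i, j}" for b
      using uvb[OF that] by (simp_all add: inner_commute)
    have BB: "a \<bullet> b = (if a = b then 1 else 0)" if "a \<in> Basis - {i, j}" "b \<in> Basis - {i, j}" for a b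
      using that by (simp add: inner_Basis)
    fix a b assume "a \<in> F" "b \<in> F"
    then consider "a = u" | "a = v" | "a \<in> Basis - {i, j}" unfolding F_def by blast
    then show "a \<bullet> b = (if a = b then 1 else 0)"
    proof cases
      case 1
      then show ?thesis using \<open>b \<in> F\<close> uv uvb[of b] nu unfolding F_def by (cases "b = u"; cases "b = v") auto
    next
      case 2
      then show ?thesis using \<open>b \<in> F\<close> uv uvb[of b] nu unfolding F_def by (cases "b = u"; cases "b = v") auto
    next
      case 3
      then have ne: "a \<noteq> u" "a \<noteq> v" using nu by auto
      show ?thesis
      proof (cases "b = u \<or> b = v")
        case True then show ?thesis using uvb'[OF 3] ne by auto
      next
        case False
        then have "b \<in> Basis - {i, j}" using \<open>b \<in> F\<close> unfolding F_def by blast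
        then show ?thesis by (rule BB[OF 3])
      qed
    qed
  qed
  have cF: "card F = DIM('a)"
  proof -
    have "card (Basis - {i, j}) = DIM('a) - 2" using i(1) j(1) ij by (subst card_Diff_subset) auto
    moreover have "2 \<le> DIM('a)" using card_mono[of Basis "{i, j}"] i(1) j(1) ij by simp
    ultimately show ?thesis using nu by (simp add: F_def)
  qed
  define Z where "Z = (if j \<in> A then insert v (A - {j}) else A)"
  define A' where "A' = (if j \<in> A then insert i (A - {j}) else A)"
  define \<omega> where "\<omega> = (if j \<in> A then 1/2 else 1 :: real)"
  have Asub: "A - {j} \<subseteq> Basis - {i, j}" using A(1) iA by auto
  have vA: "v \<notin> A - {j}" "u \<notin> A - {j}" using nu Asub by auto
  have ZF: "Z \<subseteq> F" "u \<notin> Z" using Asub vA nu unfolding Z_def F_def by auto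
  have cZ: "card Z = d" using vA finA A(2,3) by (auto simp: Z_def card_insert_if)
  interpret bent_tube F u v Z bend bend' \<omega> d
  proof
    show "orthonormal F" "card F = DIM('a)" "u \<in> F" "v \<in> F" "u \<noteq> v" "Z \<subseteq> F" "u \<notin> Z" "card Z = d" "1 \<le> d"
      using oF cF nu ZF cZ A(3) by (auto simp: F_def)
    show "C2_fun bend" by (rule C2_fun_bend)
    show "\<bar>bend' t\<bar> \<le> 1" for t by (rule bend'_bounds)
    show "\<bar>bend s - bend t\<bar> \<le> \<bar>s - t\<bar>" for s t by (rule bend_lipschitz)
    show "\<bar>bend s - bend t - bend' t * (s - t)\<bar> \<le> 1/6 * (s - t)\<^sup>2" for s t by (rule bend_taylor)
    show "\<omega> = 1/2 \<or> \<omega> = 1" by (simp add: \<omega>_def)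
    show "bend t = 0" if "v \<in> Z" "\<omega> = 1" for t
    proof -
      have "j \<notin> A" using that(2) by (auto simp: \<omega>_def split: if_splits)
      then have "v \<in> A - {j}" using that(1) by (auto simp: Z_def)
      then show ?thesis using vA by simp
    qed
  qed
  define y where "y x = coord v x" for x
  have xu: "x \<bullet> u = (x \<bullet> D + x \<bullet> E) / sqrt 2" "x \<bullet> v = (x \<bullet> E - x \<bullet> D) / sqrt 2" for x
    by (auto simp: u_def v_def inner_add_right inner_diff_right divide_inverse mult.commute)
  have yx: "y x = x \<bullet> v - bend (x \<bullet> u)" for x by (simp add: y_def coord_def psi_def)
  have al: "x \<bullet> D = (x \<bullet> u - bend (x \<bullet> u) - y x) / sqrt 2" "x \<bullet> E = (x \<bullet> u + bend (x \<bullet> u) + y x) / sqrt 2" for x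
    unfolding yx xu(2) by (auto simp: xu(1) field_simps)
  have Fr: "F - Z - {u} = (if j \<in> A then Basis - A - {i, j} else insert v (Basis - A - {i, j}))"
    using nu vA A(1) iA ij by (auto simp: F_def Z_def)
  have crd: "coord b x = x \<bullet> b" if "b \<in> Basis - {i, j}" for b x
    using that nu by (auto simp: coord_def psi_def)
  have S_iff: "x \<in> S \<longleftrightarrow> (if j \<in> A then (y x)\<^sup>2 / 2 + (\<Sum>a\<in>A - {j}. (x \<bullet> a)\<^sup>2) = 16 else y x = 0 \<and> (\<Sum>a\<in>A. (x \<bullet> a)\<^sup>2) = 16)
      \<and> (\<forall>b\<in>Basis - A - {i, j}. x \<bullet> b = 0)" for x
  proof -
    have s: "(\<Sum>a\<in>A - {j}. wt a * (coord a x)\<^sup>2) = (\<Sum>a\<in>A - {j}. (x \<bullet> a)\<^sup>2)"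
    proof (rule sum.cong[OF refl])
      fix a assume "a \<in> A - {j}"
      then have a: "a \<in> Basis - {i, j}" "a \<noteq> v" using Asub vA by blast+
      show "wt a * (coord a x)\<^sup>2 = (x \<bullet> a)\<^sup>2" unfolding crd[OF a(1)] using a(2) by (simp add: wt_def)
    qed
    show ?thesis
    proof (cases "j \<in> A")
      case True
      have wv: "wt v = 1/2" unfolding wt_def using True by (simp add: \<omega>_def)
      have "Z = insert v (A - {j})" using True by (simp add: Z_def)
      then have "(\<Sum>a\<in>Z. wt a * (coord a x)\<^sup>2) = wt v * (coord v x)\<^sup>2 + (\<Sum>a\<in>A - {j}. wt a * (coord a x)\<^sup>2)"
        using vA(1) finA by simp
      then have "(\<Sum>a\<in>Z. wt a * (coord a x)\<^sup>2) = (y x)\<^sup>2 / 2 + (\<Sum>a\<in>A - {j}. (x \<bullet> a)\<^sup>2)"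
        unfolding s wv y_def by simp
      then show ?thesis using True Fr crd by (auto simp: S_def)
    next
      case False
      have "(\<Sum>a\<in>Z. wt a * (coord a x)\<^sup>2) = (\<Sum>a\<in>A. (x \<bullet> a)\<^sup>2)" using False s by (simp add: Z_def)
      then show ?thesis using False Fr crd by (auto simp: S_def y_def)
    qed
  qed
  have sq: "(x \<bullet> j)\<^sup>2 = (x \<bullet> E)\<^sup>2" "(x \<bullet> i)\<^sup>2 = (x \<bullet> D)\<^sup>2" for x using i j by auto
  have z0: "x \<bullet> j = 0 \<longleftrightarrow> x \<bullet> E = 0" "x \<bullet> i = 0 \<longleftrightarrow> x \<bullet> D = 0" for x using i j by auto
  have sumA: "(\<Sum>a\<in>A. (x \<bullet> a)\<^sup>2) = (x \<bullet> E)\<^sup>2 + (\<Sum>a\<in>A - {j}. (x \<bullet> a)\<^sup>2)" if "j \<in> A" for x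
    using sum.remove[OF finA that, of "\<lambda>a. (x \<bullet> a)\<^sup>2"] by (simp add: sq)
  have K1: "x \<in> tube (- D) A 4 UNIV \<longleftrightarrow>
      (if j \<in> A then (x \<bullet> E)\<^sup>2 + (\<Sum>a\<in>A - {j}. (x \<bullet> a)\<^sup>2) = 16 else x \<bullet> E = 0 \<and> (\<Sum>a\<in>A. (x \<bullet> a)\<^sup>2) = 16)
      \<and> (\<forall>b\<in>Basis - A - {i, j}. x \<bullet> b = 0)" for x
  proof -
    have "- D = (- s) *\<^sub>R i" "- s = 1 \<or> - s = -1" using i by auto
    from tube_axis_iff[OF this i(1) A(1) iA, of x 4]
    have "x \<in> tube (- D) A 4 UNIV \<longleftrightarrow> (\<Sum>a\<in>A. (x \<bullet> a)\<^sup>2) = 16 \<and> (\<forall>b\<in>Basis - A - {i}. x \<bullet> b = 0)" by simp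
    moreover have "Basis - A - {i} = (if j \<in> A then Basis - A - {i, j} else insert j (Basis - A - {i, j}))"
      using j(1) ij by auto
    ultimately show ?thesis using sumA[of x] by (simp add: z0) blast
  qed
  have A'sub: "A' \<subseteq> Basis" "j \<notin> A'" "card A' = d" "\<forall>a\<in>A'. E \<bullet> a = 0"
  proof -
    show "A' \<subseteq> Basis" "j \<notin> A'" using A(1) i(1) ij by (auto simp: A'_def)
    then show "\<forall>a\<in>A'. E \<bullet> a = 0" using j by (auto simp: inner_Basis subset_iff)
    show "card A' = d" using iA finA A(2,3) by (auto simp: A'_def card_insert_if)
  qed
  have K2: "x \<in> tube E A' 4 UNIV \<longleftrightarrow>
      (if j \<in> A then (x \<bullet> D)\<^sup>2 + (\<Sum>a\<in>A - {j}. (x \<bullet> a)\<^sup>2) = 16 else x \<bullet> D = 0 \<and> (\<Sum>a\<in>A. (x \<bullet> a)\<^sup>2) = 16)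
      \<and> (\<forall>b\<in>Basis - A - {i, j}. x \<bullet> b = 0)" for x
  proof -
    have k: "x \<in> tube E A' 4 UNIV \<longleftrightarrow> (\<Sum>a\<in>A'. (x \<bullet> a)\<^sup>2) = 16 \<and> (\<forall>b\<in>Basis - A' - {j}. x \<bullet> b = 0)"
      using tube_axis_iff[OF j(2,3,1) A'sub(1,2), of x 4] by simp
    show ?thesis
    proof (cases "j \<in> A")
      case True
      have "(\<Sum>a\<in>A'. (x \<bullet> a)\<^sup>2) = (x \<bullet> D)\<^sup>2 + (\<Sum>a\<in>A - {j}. (x \<bullet> a)\<^sup>2)"
        using True iA finA by (simp add: A'_def sq)
      moreover have "Basis - A' - {j} = Basis - A - {i, j}" using True by (auto simp: A'_def)
      ultimately show ?thesis using k True by simp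
    next
      case False
      then have "A' = A" by (simp add: A'_def)
      moreover have "Basis - A - {j} = insert i (Basis - A - {i, j})" using i(1) ij iA by auto
      ultimately show ?thesis using k False by (simp add: z0) blast
    qed
  qed
  have sq0: "0 \<le> (\<Sum>a\<in>B. (x \<bullet> a)\<^sup>2)" for B x by (intro sum_nonneg) auto
  have yb: "\<bar>y x\<bar> \<le> 4 * sqrt 2" if "x \<in> S" for x
  proof -
    have "(y x)\<^sup>2 \<le> 32" using that sq0[of x "A - {j}"] by (auto simp: S_iff split: if_splits)
    then have "(y x)\<^sup>2 \<le> (4 * sqrt 2)\<^sup>2" by (simp add: power_mult_distrib)
    then show ?thesis by (rule abs_le_if_square_le) simp
  qed
  have aD: "x \<bullet> D \<le> 4" "- 4 \<le> x \<bullet> E" if "x \<in> S" for x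
    unfolding al using bend_ge[of "x \<bullet> u"] yb[OF that] by (auto simp: field_simps abs_le_iff)
  \<comment> \<open>Origin of 13: as long as \<open>bend\<close> is not yet linear, x . D is at
    least -(12 + 4 sqrt 2) / sqrt 2 > -13. So beyond 13 the piece is exactly straight.\<close>
  have low: "x \<bullet> u \<le> - 6" if "x \<in> S" "x \<bullet> D \<le> -13" for x
  proof (rule ccontr)
    assume "\<not> ?thesis"
    then have "- 6 - bend (- 6) \<le> x \<bullet> u - bend (x \<bullet> u)" by (intro bend_mono) simp
    then have "- 12 \<le> x \<bullet> u - bend (x \<bullet> u)" by (simp add: bend_abs)
    then have "(- 12 - 4 * sqrt 2) / sqrt 2 \<le> x \<bullet> D"
      unfolding al using yb[OF that(1)] by (intro divide_right_mono) (auto simp: abs_le_iff)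
    moreover have "(- 12 - 4 * sqrt 2) / sqrt 2 > -13" using sqrt2_bounds by (simp add: field_simps)
    ultimately show False using that(2) by simp
  qed
  have high: "6 \<le> x \<bullet> u" if "x \<in> S" "13 \<le> x \<bullet> E" for x
  proof (rule ccontr)
    assume "\<not> ?thesis"
    then have "x \<bullet> u + bend (x \<bullet> u) \<le> 6 + bend 6" by (intro bend_mono) simp
    then have "x \<bullet> u + bend (x \<bullet> u) \<le> 12" by (simp add: bend_abs)
    then have "x \<bullet> E \<le> (12 + 4 * sqrt 2) / sqrt 2"
      unfolding al using yb[OF that(1)] by (intro divide_right_mono) (auto simp: abs_le_iff)
    moreover have "(12 + 4 * sqrt 2) / sqrt 2 < 13" using sqrt2_bounds by (simp add: field_simps)
    ultimately show False using that(2) by simp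
  qed
  have yE: "y x = sqrt 2 * (x \<bullet> E)" if "x \<bullet> u \<le> - 6" for x
    using al(2)[of x] that bend_abs[of "x \<bullet> u"] by simp
  have yD: "y x = - sqrt 2 * (x \<bullet> D)" if "6 \<le> x \<bullet> u" for x
    using al(1)[of x] that bend_abs[of "x \<bullet> u"] by simp
  have eqlow: "x \<in> S \<longleftrightarrow> x \<in> tube (- D) A 4 UNIV" if "x \<bullet> u \<le> - 6" for x
    unfolding S_iff K1 yE[OF that] by (simp add: power_mult_distrib)
  have eqhigh: "x \<in> S \<longleftrightarrow> x \<in> tube E A' 4 UNIV" if "6 \<le> x \<bullet> u" for x
    unfolding S_iff K2 yD[OF that] by (simp add: power_mult_distrib)
  have port1: "x \<in> S \<longleftrightarrow> x \<in> tube (- D) A 4 UNIV" if "13 \<le> x \<bullet> (- D)" for x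
  proof (cases "x \<bullet> u \<le> - 6")
    case True then show ?thesis by (rule eqlow)
  next
    case False
    have "x \<notin> S" using low[of x] False that by auto
    moreover have "x \<notin> tube (- D) A 4 UNIV"
    proof
      assume "x \<in> tube (- D) A 4 UNIV"
      then have "(x \<bullet> E)\<^sup>2 \<le> 4\<^sup>2" using sq0[of x "A - {j}"] by (auto simp: K1 split: if_splits)
      then have "\<bar>x \<bullet> E\<bar> \<le> 4" by (rule abs_le_if_square_le) simp
      then have "x \<bullet> u \<le> (-9) / sqrt 2" unfolding xu using that by (intro divide_right_mono) auto
      also have "\<dots> \<le> - 6" using sqrt2_bounds by (simp add: field_simps)
      finally show False using False by simp
    qed
    ultimately show ?thesis by simp
  qed
  have port2: "x \<in> S \<longleftrightarrow> x \<in> tube E A' 4 UNIV" if "13 \<le> x \<bullet> E" for x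
  proof (cases "6 \<le> x \<bullet> u")
    case True then show ?thesis by (rule eqhigh)
  next
    case False
    have "x \<notin> S" using high[of x] False that by auto
    moreover have "x \<notin> tube E A' 4 UNIV"
    proof
      assume "x \<in> tube E A' 4 UNIV"
      then have "(x \<bullet> D)\<^sup>2 \<le> 4\<^sup>2" using sq0[of x "A - {j}"] by (auto simp: K2 split: if_splits)
      then have "\<bar>x \<bullet> D\<bar> \<le> 4" by (rule abs_le_if_square_le) simp
      then have "9 / sqrt 2 \<le> x \<bullet> u" unfolding xu using that by (intro divide_right_mono) auto
      moreover have "6 \<le> 9 / sqrt 2" using sqrt2_bounds by (simp add: field_simps)
      ultimately show False using False by simp
    qed
    ultimately show ?thesis by simp
  qed
  have oth: "(\<Sum>k\<in>I. (x \<bullet> k)\<^sup>2) \<le> 16" if x: "x \<in> S" and I: "I \<subseteq> Basis - {i, j}" for x I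
  proof -
    have "(\<Sum>k\<in>I. (x \<bullet> k)\<^sup>2) = (\<Sum>k\<in>I \<inter> A. (x \<bullet> k)\<^sup>2)"
      using x I finite_subset[OF I] by (intro sum.mono_neutral_right) (auto simp: S_iff)
    also have "\<dots> \<le> (\<Sum>k\<in>A - {j}. (x \<bullet> k)\<^sup>2)" using finA I by (intro sum_mono2) auto
    also have "\<dots> \<le> 16"
    proof (cases "j \<in> A")
      case True
      then have "(y x)\<^sup>2 / 2 + (\<Sum>a\<in>A - {j}. (x \<bullet> a)\<^sup>2) = 16" using x by (simp add: S_iff)
      moreover have "0 \<le> (y x)\<^sup>2 / 2" by simp
      ultimately show ?thesis by linarith
    next
      case False
      then show ?thesis using x by (simp add: S_iff)
    qed
    finally show ?thesis .
  qed
  have small: "\<bar>x \<bullet> b\<bar> \<le> 4" if "x \<in> S" "b \<in> Basis - {i, j}" for x b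
  proof -
    have "(x \<bullet> b)\<^sup>2 \<le> 4\<^sup>2" using oth[OF that(1), of "{b}"] that(2) by simp
    then show ?thesis by (rule abs_le_if_square_le) simp
  qed
  have "piece d S {(- D, A), (E, A')}"
    unfolding piece_def
  proof (intro conjI ballI allI impI)
    show "closed S" by (rule closed_S)
    show "C2_chart d S p" if "p \<in> S" for p using that by (rule S_chart)
    show "\<exists>N. osculates d S p 1 N" if "p \<in> S" for p using that by (rule S_osculates)
    show "case q of (D', A'') \<Rightarrow> D' \<in> sbasis \<and> A'' \<subseteq> Basis \<and> card A'' = d \<and> (\<forall>a\<in>A''. D' \<bullet> a = 0) \<and>
        (\<forall>y. 13 \<le> y \<bullet> D' \<longrightarrow> (y \<in> S) = (y \<in> tube D' A'' 4 UNIV))" if "q \<in> {(- D, A), (E, A')}" for q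
      using that D E A A'sub port1 port2 by (auto simp: sbasis_uminus)
    show "\<exists>A''. (D', A'') \<in> {(- D, A), (E, A')}" if "x \<in> S" "D' \<in> sbasis" "13 \<le> x \<bullet> D'" for x D'
    proof -
      note D' = that(2)
      obtain b t where b: "b \<in> Basis" "D' = t *\<^sub>R b" "t = 1 \<or> t = -1" using sbasisE[OF D'] by metis
      have "b = i \<or> b = j"
      proof (rule ccontr)
        assume "\<not> ?thesis"
        then have "\<bar>x \<bullet> b\<bar> \<le> 4" using small[OF that(1)] b(1) by blast
        then show False using that(3) b by auto
      qed
      then have "D' = D \<or> D' = - D \<or> D' = E \<or> D' = - E" using b i j by auto
      then show ?thesis using aD[OF that(1)] that(3) by auto
    qed
    show "(\<Sum>k\<in>I. (x \<bullet> k)\<^sup>2) \<le> 16" if "x \<in> S" and I: "I \<subseteq> Basis" "\<forall>(D', A'')\<in>{(- D, A), (E, A')}. \<forall>k\<in>I. D' \<bullet> k = 0" for x I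
    proof (rule oth[OF that(1)])
      show "I \<subseteq> Basis - {i, j}" using I i j by (auto simp: inner_Basis)
    qed
    show "hausdorff_outer d (S \<inter> cube) \<le> ennreal (22 * real d * 8 ^ d * flat_vol Z')"
      if "orthonormal Z'" "card Z' = d" for Z' :: "'a set"
    proof -
      have "\<bar>x \<bullet> u\<bar> < 22" if x: "x \<in> S" "x \<in> cube" for x
      proof -
        have c: "\<bar>x \<bullet> D\<bar> \<le> 21" "\<bar>x \<bullet> E\<bar> \<le> 21" using x(2) i j by (auto simp: cube_def)
        have b: "25 / sqrt 2 < 22" using sqrt2_bounds by (simp add: field_simps)
        have "\<bar>y x\<bar> / sqrt 2 \<le> 4" using yb[OF x(1)] by (simp add: field_simps)
        then have yy: "\<bar>y x / sqrt 2\<bar> \<le> 4" by (simp add: abs_divide)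
        consider "x \<bullet> u \<le> - 6" | "\<bar>x \<bullet> u\<bar> < 6" | "6 \<le> x \<bullet> u" by linarith
        then show ?thesis
        proof cases
          case 1
          have "x \<bullet> E = y x / sqrt 2" using yE[OF 1] by simp
          then have "- 25 \<le> x \<bullet> D + x \<bullet> E" using yy c by linarith
          then have "- 25 / sqrt 2 \<le> x \<bullet> u" unfolding xu by (intro divide_right_mono) auto
          then show ?thesis using 1 b by auto
        next
          case 3
          have "x \<bullet> D = - (y x / sqrt 2)" using yD[OF 3] by simp
          then have "x \<bullet> D + x \<bullet> E \<le> 25" using yy c by linarith
          then have "x \<bullet> u \<le> 25 / sqrt 2" unfolding xu by (intro divide_right_mono) auto
          then show ?thesis using 3 b by auto
        qed auto
      qed
      then have "S \<inter> cube \<subseteq> S \<inter> {x. \<bar>x \<bullet> u\<bar> < 22}" by blast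
      then have "hausdorff_outer d (S \<inter> cube) \<le> hausdorff_outer d (S \<inter> {x. \<bar>x \<bullet> u\<bar> < 22})" by (rule hausdorff_outer_mono)
      also have "\<dots> \<le> ennreal (22 * real d * 8 ^ d * flat_vol Z)" using cZ by (intro S_measure) auto
      also have "flat_vol Z = flat_vol Z'"
        using that cZ orthonormal_subset[OF oF ZF(1)] by (intro flat_vol_card) auto
      finally show ?thesis .
    qed
  qed
  moreover have "strand S (- D)"
  proof (rule strandI)
    fix x assume x: "x \<in> S \<inter> cube"
    define t0 where "t0 = x \<bullet> u"
    \<comment> \<open>\<open>g\<close> slides x along the bent axis with its position in the
      cross-section fixed. Both x . D and x . E are nondecreasing in t because \<open>bend\<close>
      is 1-Lipschitz, and x . E stays above -4; so running backwards to the face in direction -D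
      never leaves the cube.\<close>
    define g where "g t = x + (t - t0) *\<^sub>R u + (bend t - bend t0) *\<^sub>R v" for t
    have gu: "g t \<bullet> u = t" "g t \<bullet> v = x \<bullet> v + (bend t - bend t0)" for t
      by (auto simp: g_def inner_add_left uv t0_def)
    have gb: "g t \<bullet> b = x \<bullet> b" if "b \<in> Basis - {i, j}" for t b
      using uvb[OF that] by (simp add: g_def inner_add_left)
    have gy: "y (g t) = y x" for t by (simp add: yx gu t0_def)
    have gS: "g t \<in> S" for t
    proof -
      have "(\<Sum>a\<in>A - {j}. (g t \<bullet> a)\<^sup>2) = (\<Sum>a\<in>A - {j}. (x \<bullet> a)\<^sup>2)"
        using Asub gb by (intro sum.cong refl) auto
      then show ?thesis using x gb[of _ t] by (cases "j \<in> A") (auto simp: S_iff gy)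
    qed
    have gD: "g t \<bullet> D = (t - bend t - y x) / sqrt 2" "g t \<bullet> E = (t + bend t + y x) / sqrt 2" for t
      by (auto simp: al gy gu)
    have gt0: "g t0 = x" by (simp add: g_def)
    have c: "\<bar>x \<bullet> D\<bar> \<le> 21" "\<bar>x \<bullet> E\<bar> \<le> 21" using x i j by (auto simp: cube_def)
    have contb: "continuous_on X bend" for X
      using DERIV_bend by (meson DERIV_isCont continuous_at_imp_continuous_on)
    have contg: "continuous_on X (\<lambda>t. g t \<bullet> D)" for X unfolding gD by (intro continuous_intros contb) auto
    obtain t1 where t1: "t1 \<le> t0" "g t1 \<bullet> D = - 21"
    proof -
      \<comment> \<open>25 = 21 + 4: the offset y x / sqrt 2 within the cross-section shifts x . D
        by at most 4.\<close>
      define m where "m = min t0 (- 25)"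
      have "bend m = - m" using bend_abs[of m] by (simp add: m_def)
      then have "g m \<bullet> D = sqrt 2 * m - y x / sqrt 2" by (simp add: gD field_simps)
      also have "\<dots> \<le> 1 * m + 4"
      proof -
        have "sqrt 2 * m \<le> 1 * m" using sqrt2_bounds by (intro mult_right_mono_neg) (auto simp: m_def)
        moreover have "- (y x / sqrt 2) \<le> 4" using yb[of x] x by (simp add: field_simps abs_le_iff)
        ultimately show ?thesis by linarith
      qed
      also have "\<dots> \<le> - 21" by (simp add: m_def)
      finally have "g m \<bullet> D \<le> - 21" .
      moreover have "- 21 \<le> g t0 \<bullet> D" using c gt0 by (auto simp: abs_le_iff)
      moreover have "m \<le> t0" by (simp add: m_def)
      ultimately obtain t1 where "m \<le> t1" "t1 \<le> t0" "g t1 \<bullet> D = - 21"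
        using IVT'[of "\<lambda>t. g t \<bullet> D" m "-21" t0] contg by blast
      then show thesis using that by blast
    qed
    show "\<exists>S'. connected S' \<and> x \<in> S' \<and> S' \<subseteq> S \<inter> cube \<and> (\<exists>z\<in>S'. z \<bullet> (- D) = 21)"
    proof (intro exI[of _ "g ` {t1..t0}"] conjI)
      show "connected (g ` {t1..t0})" unfolding g_def
        by (intro connected_continuous_image continuous_intros contb) auto
      show "x \<in> g ` {t1..t0}" using gt0 t1(1) by (metis atLeastAtMost_iff image_eqI order_refl)
      show "\<exists>z\<in>g ` {t1..t0}. z \<bullet> (- D) = 21" using t1 by (intro bexI[of _ "g t1"]) auto
      show "g ` {t1..t0} \<subseteq> S \<inter> cube"
      proof (safe, rule gS)
        fix t assume t: "t \<in> {t1..t0}"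
        have "g t1 \<bullet> D \<le> g t \<bullet> D" "g t \<bullet> D \<le> g t0 \<bullet> D" "g t \<bullet> E \<le> g t0 \<bullet> E"
          unfolding gD using bend_mono[of t1 t] bend_mono[of t t0] t by (auto intro!: divide_right_mono)
        then have gDE: "\<bar>g t \<bullet> D\<bar> \<le> 21" "\<bar>g t \<bullet> E\<bar> \<le> 21" using t1(2) gt0 c aD(2)[OF gS[of t]] by (auto simp: abs_le_iff)
        have "\<bar>g t \<bullet> b\<bar> \<le> 21" if bB: "b \<in> Basis" for b
        proof -
          consider "b = i" | "b = j" | "b \<in> Basis - {i, j}" using bB by blast
          then show ?thesis
          proof cases
            case 1 then show ?thesis using gDE i by auto
          next
            case 2 then show ?thesis using gDE j by auto
          next
            case 3 then show ?thesis using gb[OF 3] x by (auto simp: cube_def)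
          qed
        qed
        then show "g t \<in> cube" by (simp add: cube_def)
      qed
    qed
  qed
  ultimately show ?thesis by blast
qed

subsection \<open>Caps\<close>

text \<open>Convexity gives the sign. Up to 4 the second derivative, 12 times the squared positive
  part, is at most 192, and half of that is 96.\<close>

lemma pos_part_quartic_taylor:
  fixes x y :: real
  assumes "x \<le> 4" "y \<le> 4"
  shows "0 \<le> max y 0 ^ 4 - max x 0 ^ 4 - 4 * max x 0 ^ 3 * (y - x)"
    and "max y 0 ^ 4 - max x 0 ^ 4 - 4 * max x 0 ^ 3 * (y - x) \<le> 96 * (y - x)\<^sup>2"
proof -
  let ?R = "max y 0 ^ 4 - max x 0 ^ 4 - 4 * max x 0 ^ 3 * (y - x)"
  have "0 \<le> ?R \<and> ?R \<le> 96 * (y - x)\<^sup>2"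
  proof (cases "0 \<le> x")
    case x: True
    show ?thesis
    proof (cases "0 \<le> y")
      case y: True
      have R: "?R = (y - x)\<^sup>2 * (y\<^sup>2 + 2 * x * y + 3 * x\<^sup>2)"
        using x y by (simp add: max_absorb1 power2_eq_square power4_eq_xxxx power3_eq_cube algebra_simps)
      have "y\<^sup>2 \<le> 4\<^sup>2" "x\<^sup>2 \<le> 4\<^sup>2" "x * y \<le> 4 * 4"
        using x y assms power_mono[of y 4 2] power_mono[of x 4 2] mult_mono[of x 4 y 4] by auto
      then have "y\<^sup>2 + 2 * x * y + 3 * x\<^sup>2 \<le> 96" by simp
      then have "(y - x)\<^sup>2 * (y\<^sup>2 + 2 * x * y + 3 * x\<^sup>2) \<le> (y - x)\<^sup>2 * 96" by (rule mult_left_mono) simp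
      moreover have "0 \<le> (y - x)\<^sup>2 * (y\<^sup>2 + 2 * x * y + 3 * x\<^sup>2)" using x y by simp
      ultimately show ?thesis unfolding R by simp
    next
      case y: False
      have R: "?R = 3 * x^4 + 4 * x^3 * (- y)"
        using x y by (simp add: max_absorb1 max_absorb2 power4_eq_xxxx power3_eq_cube algebra_simps)
      have x2: "x\<^sup>2 \<le> 16" using power_mono[of x 4 2] x assms by simp
      have "x^4 = x\<^sup>2 * x\<^sup>2" "x^3 = x\<^sup>2 * x" by (simp_all add: power4_eq_xxxx power2_eq_square power3_eq_cube)
      then have "x^4 \<le> 16 * x\<^sup>2" "x^3 * (- y) \<le> 16 * x * (- y)" using x2 x y mult_right_mono[OF x2, of "x\<^sup>2"]
          mult_right_mono[OF x2, of x] mult_right_mono[of "x^3" "16 * x" "- y"] by auto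
      moreover have "(y - x)\<^sup>2 = x\<^sup>2 + 2 * x * (- y) + y\<^sup>2" by (simp add: power2_eq_square algebra_simps)
      moreover have "0 \<le> x * (- y)" "0 \<le> x^3 * (- y)" by (rule mult_nonneg_nonneg; use x y in simp)+
      moreover have "0 \<le> y\<^sup>2" "0 \<le> x\<^sup>2" "0 \<le> x^4" by auto
      ultimately show ?thesis unfolding R by linarith
    qed
  next
    case x: False
    have R: "?R = max y 0 ^ 4" using x by (simp add: max_absorb2)
    have m: "0 \<le> max y 0" "max y 0 \<le> 4" "max y 0 \<le> \<bar>y - x\<bar>" using x assms by auto
    have "max y 0 ^ 4 = (max y 0)\<^sup>2 * (max y 0)\<^sup>2" by (simp add: power4_eq_xxxx power2_eq_square)
    also have "\<dots> \<le> 4\<^sup>2 * \<bar>y - x\<bar>\<^sup>2"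
      by (rule mult_mono[OF power_mono[OF m(2) m(1)] power_mono[OF m(3) m(1)]]) auto
    finally have "max y 0 ^ 4 \<le> 16 * (y - x)\<^sup>2" by simp
    moreover have "0 \<le> (y - x)\<^sup>2" "0 \<le> max y 0 ^ 4" by auto
    ultimately show ?thesis unfolding R by linarith
  qed
  then show "0 \<le> ?R" "?R \<le> 96 * (y - x)\<^sup>2" by auto
qed

text \<open>The bump is a convex function of the squared radius, so it is expanded in the squared
  radius; the error is measured in the radius itself, which distances control. The constants are
  those of unit width and height, to be rescaled by \<delta> and \<eta>.\<close>

lemma bump_taylor:
  fixes \<rho> \<sigma> :: real
  assumes "0 \<le> \<rho>" "0 \<le> \<sigma>"
  defines "a \<equiv> max (1 - \<rho>\<^sup>2) 0" and "b \<equiv> max (1 - \<sigma>\<^sup>2) 0"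
  shows "0 \<le> b^3 - a^3 + 3 * a\<^sup>2 * (\<sigma>\<^sup>2 - \<rho>\<^sup>2)" "b^3 - a^3 + 3 * a\<^sup>2 * (\<sigma>\<^sup>2 - \<rho>\<^sup>2) \<le> 15 * (\<sigma> - \<rho>)\<^sup>2"
    and "\<bar>b^3 - a^3\<bar> \<le> 6 * \<bar>\<sigma> - \<rho>\<bar>"
proof -
  have ab: "0 \<le> a" "a \<le> 1" "0 \<le> b" "b \<le> 1" by (auto simp: a_def b_def)
  let ?R = "b^3 - a^3 + 3 * a\<^sup>2 * (\<sigma>\<^sup>2 - \<rho>\<^sup>2)"
  have fac: "1 - \<rho>\<^sup>2 = (1 - \<rho>) * (1 + \<rho>)" "1 - \<sigma>\<^sup>2 = (1 - \<sigma>) * (1 + \<sigma>)" by (auto simp: power2_eq_square algebra_simps)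
  have "0 \<le> ?R \<and> ?R \<le> 15 * (\<sigma> - \<rho>)\<^sup>2"
  proof (cases "1 \<le> \<rho>")
    case r: True
    then have "1 \<le> \<rho>\<^sup>2" by simp
    then have a0: "a = 0" by (simp add: a_def)
    have b2: "b \<le> 2 * \<bar>\<sigma> - \<rho>\<bar>"
    proof (cases "1 \<le> \<sigma>")
      case True
      then have "1 \<le> \<sigma>\<^sup>2" by simp
      then show ?thesis by (simp add: b_def)
    next
      case False
      then have "(1 - \<sigma>) * (1 + \<sigma>) \<le> (1 - \<sigma>) * 2" by (intro mult_left_mono) auto
      then show ?thesis using False r unfolding b_def fac by auto
    qed
    have "b^3 \<le> b\<^sup>2" using ab power_decreasing[of 2 3 b] by simp
    also have "\<dots> \<le> (2 * \<bar>\<sigma> - \<rho>\<bar>)\<^sup>2" using b2 ab by (intro power_mono) auto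
    also have "\<dots> = 4 * (\<sigma> - \<rho>)\<^sup>2" by (simp add: power_mult_distrib)
    finally have "b^3 \<le> 4 * (\<sigma> - \<rho>)\<^sup>2" .
    moreover have "0 \<le> (\<sigma> - \<rho>)\<^sup>2" "0 \<le> b^3" using ab by auto
    moreover have "?R = b^3" by (simp add: a0)
    ultimately show ?thesis by linarith
  next
    case r: False
    then have "\<rho>\<^sup>2 \<le> 1" using assms by (simp add: power_le_one)
    then have a: "a = 1 - \<rho>\<^sup>2" by (simp add: a_def)
    show ?thesis
    proof (cases "1 \<le> \<sigma>")
      case s: True
      then have s1: "1 \<le> \<sigma>\<^sup>2" by simp
      then have b0: "b = 0" by (simp add: b_def)
      define x where "x = \<sigma> - \<rho>"
      have x: "0 < x" "1 - \<rho> \<le> x" using r s by (auto simp: x_def)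
      have a2x: "a \<le> 2 * x"
      proof -
        have "a \<le> (1 - \<rho>) * 2" unfolding a fac using r assms by (intro mult_left_mono) auto
        then show ?thesis using x by simp
      qed
      have "?R = - (a * a\<^sup>2) + 3 * a\<^sup>2 * (\<sigma>\<^sup>2 - \<rho>\<^sup>2)" by (simp add: b0 power3_eq_cube power2_eq_square)
      moreover have "a\<^sup>2 * a \<le> a\<^sup>2 * (\<sigma>\<^sup>2 - \<rho>\<^sup>2)" using s1 by (intro mult_left_mono) (auto simp: a)
      moreover have "0 \<le> a\<^sup>2 * a" using ab by simp
      moreover have "a\<^sup>2 * (\<sigma>\<^sup>2 - \<rho>\<^sup>2) \<le> 5 * x\<^sup>2"
      proof -
        have eq: "\<sigma>\<^sup>2 - \<rho>\<^sup>2 = x\<^sup>2 + 2 * \<rho> * x" by (simp add: x_def power2_eq_square algebra_simps)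
        have "a\<^sup>2 * (\<sigma>\<^sup>2 - \<rho>\<^sup>2) = a\<^sup>2 * x\<^sup>2 + a\<^sup>2 * (2 * \<rho> * x)" by (simp only: eq distrib_left)
        moreover have "a\<^sup>2 * x\<^sup>2 \<le> 1 * x\<^sup>2" using ab by (intro mult_right_mono) (auto simp: power_le_one)
        moreover have "a\<^sup>2 * (2 * \<rho> * x) \<le> 4 * x\<^sup>2"
        proof -
          have "a\<^sup>2 \<le> a" using ab power_decreasing[of 1 2 a] by simp
          then have "a\<^sup>2 * (2 * \<rho> * x) \<le> (2 * x) * (2 * 1 * x)" using a2x x r assms
            by (intro mult_mono) auto
          then show ?thesis by (simp add: power2_eq_square)
        qed
        ultimately show ?thesis by linarith
      qed
      ultimately show ?thesis unfolding x_def by (simp add: mult.commute mult.left_commute)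
    next
      case s: False
      then have "\<sigma>\<^sup>2 \<le> 1" using assms by (simp add: power_le_one)
      then have b: "b = 1 - \<sigma>\<^sup>2" by (simp add: b_def)
      have R: "?R = (a - b)\<^sup>2 * (2 * a + b)" by (simp add: a b power2_eq_square power3_eq_cube algebra_simps)
      have "(a - b)\<^sup>2 = (\<sigma> - \<rho>)\<^sup>2 * (\<sigma> + \<rho>)\<^sup>2" by (simp add: a b power2_eq_square algebra_simps)
      also have "\<dots> \<le> (\<sigma> - \<rho>)\<^sup>2 * 2\<^sup>2" using r s assms by (intro mult_left_mono power_mono) auto
      finally have "(a - b)\<^sup>2 * (2 * a + b) \<le> ((\<sigma> - \<rho>)\<^sup>2 * 4) * 3" using ab by (intro mult_mono) auto
      moreover have "0 \<le> (\<sigma> - \<rho>)\<^sup>2" "0 \<le> (a - b)\<^sup>2 * (2 * a + b)" using ab by auto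
      ultimately show ?thesis unfolding R by linarith
    qed
  qed
  then show "0 \<le> ?R" "?R \<le> 15 * (\<sigma> - \<rho>)\<^sup>2" by auto
  have "\<bar>b^3 - a^3\<bar> = \<bar>b - a\<bar> * (b\<^sup>2 + b * a + a\<^sup>2)"
  proof -
    have "b^3 - a^3 = (b - a) * (b\<^sup>2 + b * a + a\<^sup>2)" by (simp add: power2_eq_square power3_eq_cube algebra_simps)
    moreover have "0 \<le> b\<^sup>2 + b * a + a\<^sup>2" using ab by simp
    ultimately show ?thesis by (simp add: abs_mult)
  qed
  also have "\<dots> \<le> \<bar>b - a\<bar> * 3"
    using ab power_le_one[of b 2] power_le_one[of a 2] mult_le_one[of b a] by (intro mult_left_mono) auto
  also have "\<bar>b - a\<bar> \<le> 2 * \<bar>\<sigma> - \<rho>\<bar>"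
  proof -
    define r s where "r = min \<rho> 1" and "s = min \<sigma> 1"
    have rs: "0 \<le> r" "r \<le> 1" "0 \<le> s" "s \<le> 1" "\<bar>s - r\<bar> \<le> \<bar>\<sigma> - \<rho>\<bar>" using assms by (auto simp: r_def s_def)
    have mx: "max (1 - x\<^sup>2) 0 = 1 - (min x 1)\<^sup>2" if "0 \<le> x" for x :: real
    proof (cases "x \<le> 1")
      case True then show ?thesis using power_le_one[OF that True, of 2] by simp
    next
      case False then have "1 \<le> x\<^sup>2" by simp
      then show ?thesis using False by simp
    qed
    have "b - a = - ((s - r) * (s + r))" using assms by (simp add: a_def b_def mx r_def[symmetric] s_def[symmetric]) (simp add: power2_eq_square algebra_simps)
    then have "\<bar>b - a\<bar> = \<bar>s - r\<bar> * (s + r)" using rs by (simp add: abs_mult)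
    also have "\<dots> \<le> \<bar>\<sigma> - \<rho>\<bar> * 2" using rs by (intro mult_mono) auto
    finally show ?thesis by simp
  qed
  finally show "\<bar>b^3 - a^3\<bar> \<le> 6 * \<bar>\<sigma> - \<rho>\<bar>" by simp
qed

text \<open>On the curve x^4 + S^4 = 256 the slope is -(x/S)^3, of size at most 1 where x \<le> S.
  Factoring a^4 - b^4 gives the same for finite differences.\<close>

lemma quartic_lipschitz:
  fixes x y S T :: real
  assumes "0 \<le> x" "0 \<le> y" "0 \<le> S" "0 \<le> T" "x \<le> S" "y \<le> T" "x^4 + S^4 = 256" "y^4 + T^4 = 256"
  shows "\<bar>S - T\<bar> \<le> \<bar>x - y\<bar>"
proof -
  have f: "a^4 - b^4 = (a - b) * ((a + b) * (a\<^sup>2 + b\<^sup>2))" for a b :: real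
    by (simp add: power2_eq_square power4_eq_xxxx algebra_simps)
  define X Y where "X = (S + T) * (S\<^sup>2 + T\<^sup>2)" and "Y = (x + y) * (x\<^sup>2 + y\<^sup>2)"
  have XY: "0 \<le> X" "0 \<le> Y" using assms by (auto simp: X_def Y_def)
  have "(S - T) * X = - ((x - y) * Y)"
    unfolding X_def Y_def f[symmetric] using assms(7,8) by simp
  then have "\<bar>(S - T) * X\<bar> = \<bar>(x - y) * Y\<bar>" by simp
  then have "\<bar>S - T\<bar> * ((S + T) * (S\<^sup>2 + T\<^sup>2)) = \<bar>x - y\<bar> * ((x + y) * (x\<^sup>2 + y\<^sup>2))"
    using XY unfolding abs_mult by (simp add: X_def Y_def)
  also have "\<dots> \<le> \<bar>x - y\<bar> * ((S + T) * (S\<^sup>2 + T\<^sup>2))"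
    using assms by (intro mult_left_mono mult_mono add_mono power_mono) auto
  finally have le: "\<bar>S - T\<bar> * ((S + T) * (S\<^sup>2 + T\<^sup>2)) \<le> \<bar>x - y\<bar> * ((S + T) * (S\<^sup>2 + T\<^sup>2))" .
  have "S \<noteq> 0" using assms by auto
  then have "0 < (S + T) * (S\<^sup>2 + T\<^sup>2)" using assms by (intro mult_pos_pos add_pos_nonneg) auto
  then show ?thesis using le by (simp only: mult_le_cancel_right_pos)
qed

text \<open>\<open>\<delta>\<close> is the radius and \<open>\<eta>\<close> the height of the bump.
  Its second derivatives are of order \<eta> / \<delta>^2; the bound \<delta>^2 / 800 confines them
  to the slack that the cap leaves in \<open>C_osculates\<close>. Height 0 gives the cap without
  bump.\<close>

locale cap =
  fixes i :: "'a::euclidean_space" and s :: real and A :: "'a set" and d :: nat and \<delta> \<eta> :: real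
  assumes i: "i \<in> Basis" and s: "s = 1 \<or> s = -1" and A: "A \<subseteq> Basis" "i \<notin> A" "card A = d" and d: "1 \<le> d"
    and \<delta>: "0 < \<delta>" "\<delta> \<le> 1" and \<eta>: "0 \<le> \<eta>" "\<eta> \<le> \<delta>\<^sup>2 / 800"
begin

text \<open>The tip points in direction \<open>e\<close>, the port is in direction \<open>-e\<close>.\<close>
definition e :: 'a where "e = s *\<^sub>R i"
definition q :: "'a \<Rightarrow> real" where "q x = (\<Sum>a\<in>A. (x \<bullet> a)\<^sup>2)"
definition bump :: "real \<Rightarrow> real" where "bump w = \<eta> * max (1 - w / \<delta>\<^sup>2) 0 ^ 3"
definition tau :: "'a \<Rightarrow> real" where "tau x = x \<bullet> e - bump (q x)"
text \<open>Without the bump, and with z the projection of x to the cross-section, the upper part is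
  |z|^4 + (x . e)^4 = 4^4. Where \<open>tau\<close> is not positive the set is the tube of radius 4,
  and the fourth power of the positive part makes second derivatives match at the junction. The bump
  lifts the cap along the axis where q < \<delta>^2 \<le> 1, far from the junction at q =
  16.\<close>

definition C :: "'a set" where
  "C = {x. (q x)\<^sup>2 + max (tau x) 0 ^ 4 = 256 \<and> (\<forall>b\<in>Basis - A - {i}. x \<bullet> b = 0)}"

lemma finA: "finite A" by (rule finite_subset[OF A(1) finite_Basis])
lemma oA: "orthonormal A" by (rule orthonormal_subset[OF orthonormal_Basis A(1)])
lemma oeA: "orthonormal (insert e A)" "e \<notin> A"
proof -
  have ee: "e \<bullet> e = 1" using i s by (auto simp: e_def)
  have ea: "e \<bullet> a = 0" "a \<bullet> e = 0" if "a \<in> A" for a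
  proof -
    have "a \<in> Basis" "a \<noteq> i" using that A by auto
    then show "e \<bullet> a = 0" "a \<bullet> e = 0" using i by (auto simp: e_def inner_Basis)
  qed
  show "e \<notin> A" using ee ea by force
  then show "orthonormal (insert e A)" using oA ee ea by (auto simp: orthonormal_def)
qed
lemma ee: "e \<bullet> e = 1" using i s by (auto simp: e_def)
lemma esb: "e \<in> sbasis" "- e \<in> sbasis" using i s by (auto simp: e_def sbasis_def)
lemma ea: "a \<in> A \<Longrightarrow> e \<bullet> a = 0" "a \<in> A \<Longrightarrow> a \<bullet> e = 0"
  using orthonormal_inner[OF oeA(1), of e a] orthonormal_inner[OF oeA(1), of a e] oeA(2) by auto
lemma xi: "x \<bullet> i = s * (x \<bullet> e)" "x \<bullet> e = s * (x \<bullet> i)" using s by (auto simp: e_def)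
lemma q_nonneg: "0 \<le> q x" unfolding q_def by (intro sum_nonneg) auto
lemma bump_nonneg: "0 \<le> bump w" using \<eta> by (simp add: bump_def)
lemma bump_zero: "\<delta>\<^sup>2 \<le> w \<Longrightarrow> bump w = 0" using \<delta> by (simp add: bump_def)
lemma bump_le: "0 \<le> w \<Longrightarrow> bump w \<le> \<eta>"
  using \<eta> \<delta> power_le_one[of "max (1 - w / \<delta>\<^sup>2) 0" 3] mult_left_mono[of "max (1 - w / \<delta>\<^sup>2) 0 ^ 3" 1 \<eta>] by (simp add: bump_def)
lemma eta_le: "\<eta> \<le> 1/800" using \<eta> \<delta> power_le_one[of \<delta> 2] by simp
lemma delta_sq: "\<delta>\<^sup>2 \<le> 1" using \<delta> power_le_one[of \<delta> 2] by simp

lemma C2_real_q: "C2_real q" unfolding q_def[abs_def] by (intro C2_real_intros)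
lemma C2_fun_bump: "C2_real (\<lambda>x. bump (q x))"
proof -
  have "C2_real (\<lambda>x. 1 - q x * inverse (\<delta>\<^sup>2))" by (intro C2_real_intros C2_real_q)
  from C2_real_compose[OF C2_fun_pos_part[of 0] this] show ?thesis
    unfolding bump_def divide_inverse by (intro C2_real_mult[OF C2_real_const]) simp
qed
lemma C2_real_tau: "C2_real tau" unfolding tau_def[abs_def] by (intro C2_real_intros C2_fun_bump)
lemma cont_q: "continuous_on X q" and cont_tau: "continuous_on X tau"
  using C2_real_continuous[OF C2_real_q] C2_real_continuous[OF C2_real_tau] continuous_on_subset by blast+
lemma cont_bump: "continuous_on X bump" unfolding bump_def[abs_def] using \<delta> by (intro continuous_intros) auto

lemma closed_C: "closed C"
proof -
  have "C = {x. (q x)\<^sup>2 + max (tau x) 0 ^ 4 = 256} \<inter> (\<Inter>b\<in>Basis - A - {i}. {x. x \<bullet> b = 0})"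
    by (auto simp: C_def)
  also have "closed \<dots>"
    by (intro closed_Int closed_INT ballI closed_Collect_eq continuous_intros cont_q cont_tau)
  finally show ?thesis .
qed

lemma C_bounds:
  assumes "x \<in> C" shows "q x \<le> 16" "tau x \<le> 4" "x \<bullet> e \<le> 5"
proof -
  have "0 \<le> max (tau x) 0 ^ 4" by simp
  moreover have "(q x)\<^sup>2 + max (tau x) 0 ^ 4 = 256" using assms by (simp add: C_def)
  ultimately have "(q x)\<^sup>2 \<le> 256" by linarith
  then have "(q x)\<^sup>2 \<le> 16\<^sup>2" by simp
  then show "q x \<le> 16" by (rule power2_le_imp_le) simp
  have "max (tau x) 0 ^ 4 \<le> 256" using \<open>(q x)\<^sup>2 + max (tau x) 0 ^ 4 = 256\<close> zero_le_power2[of "q x"] by linarith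
  then have "max (tau x) 0 ^ Suc 3 \<le> 4 ^ Suc 3" by simp
  then have "max (tau x) 0 \<le> 4" by (rule power_le_imp_le_base) simp
  then show t: "tau x \<le> 4" by simp
  show "x \<bullet> e \<le> 5" using t bump_le[OF q_nonneg, of x] eta_le by (simp add: tau_def)
qed

lemma tau_nonpos:
  assumes "x \<in> C" "tau x \<le> 0" shows "q x = 16" "x \<bullet> e = tau x"
proof -
  have "(q x)\<^sup>2 = 16\<^sup>2" using assms by (simp add: C_def max_absorb2)
  then show q: "q x = 16" using q_nonneg[of x] power2_eq_iff_nonneg[of "q x" 16] by simp
  show "x \<bullet> e = tau x" using bump_zero[of "q x"] q delta_sq by (simp add: tau_def)
qed

lemma C_coord: "x \<in> C \<Longrightarrow> b \<in> Basis \<Longrightarrow> b \<noteq> i \<Longrightarrow> \<bar>x \<bullet> b\<bar> \<le> 4"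
proof -
  assume x: "x \<in> C" "b \<in> Basis" "b \<noteq> i"
  show ?thesis
  proof (cases "b \<in> A")
    case True
    have "(x \<bullet> b)\<^sup>2 \<le> q x" unfolding q_def using True finA by (intro member_le_sum) auto
    then have "(x \<bullet> b)\<^sup>2 \<le> 4\<^sup>2" using C_bounds(1)[OF x(1)] by simp
    then show ?thesis by (rule abs_le_if_square_le) simp
  next
    case False
    then show ?thesis using x by (auto simp: C_def)
  qed
qed

lemma C_chart:
  assumes p: "p \<in> C" shows "C2_chart d C p"
proof (cases "0 < tau p")
  case True
  \<comment> \<open>On the cap proper x . i is a function of the cross-section coordinates, with a
    fourth root taken as two extended square roots; c0 is half of the radicand at p.\<close>
  define c0 where "c0 = (256 - (q p)\<^sup>2) / 2"
  have c0: "0 < c0" "c0 < 256 - (q p)\<^sup>2" using p True by (auto simp: c0_def C_def) (metis add.commute diff_add_cancel less_add_same_cancel2 max.absorb1 less_imp_le zero_less_power add_diff_cancel_left')+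
  obtain \<sigma>1 where s1: "C2_fun \<sigma>1" "\<And>t. c0 \<le> t \<Longrightarrow> \<sigma>1 t = sqrt t" using C2_fun_sqrt_extension[OF c0(1)] by metis
  obtain \<sigma>2 where s2: "C2_fun \<sigma>2" "\<And>t. sqrt c0 \<le> t \<Longrightarrow> \<sigma>2 t = sqrt t"
    using C2_fun_sqrt_extension[of "sqrt c0"] c0 by (metis real_sqrt_gt_0_iff)
  define h where "h b x = (if b = i then s * (bump (q x) + \<sigma>2 (\<sigma>1 (256 - (q x)\<^sup>2))) else 0)" for b x
  define U where "U = {x. 0 < tau x} \<inter> {x. c0 < 256 - (q x)\<^sup>2}"
  have BA: "Basis - A = insert i (Basis - A - {i})" using i A by auto
  show ?thesis
  proof (rule C2_chart_graph[OF orthonormal_Basis _ A(1,3), where U = U and h = h])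
    show "open U" unfolding U_def by (intro open_Int open_Collect_less continuous_intros cont_q cont_tau)
    show "p \<in> U" using True c0 by (simp add: U_def)
    show "C2_real (h b)" for b
      unfolding h_def by (cases "b = i") (auto intro!: C2_real_intros C2_fun_bump C2_real_q C2_real_compose[OF s1(1)] C2_real_compose[OF s2(1)])
    show "h b x = h b y" if "\<And>c. c \<in> A \<Longrightarrow> x \<bullet> c = y \<bullet> c" for b x y
    proof -
      have "q x = q y" using that by (simp add: q_def)
      then show ?thesis by (simp add: h_def)
    qed
    fix x assume x: "x \<in> U"
    define w where "w = 256 - (q x)\<^sup>2"
    have w: "c0 < w" using x by (simp add: U_def w_def)
    have sw: "\<sigma>2 (\<sigma>1 w) = sqrt (sqrt w)" using s1(2)[of w] s2(2)[of "sqrt w"] w by simp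
    have "x \<bullet> i = h i x \<longleftrightarrow> tau x = sqrt (sqrt w)"
    proof -
      have "x \<bullet> i = h i x \<longleftrightarrow> s * (x \<bullet> e) = s * (bump (q x) + sqrt (sqrt w))"
        by (simp add: h_def xi(1) w_def[symmetric] sw)
      also have "\<dots> \<longleftrightarrow> tau x = sqrt (sqrt w)" using s by (auto simp: tau_def)
      finally show ?thesis .
    qed
    also have "\<dots> \<longleftrightarrow> tau x ^ 4 = w"
    proof
      assume "tau x = sqrt (sqrt w)"
      then have "tau x ^ 4 = ((sqrt (sqrt w))\<^sup>2)\<^sup>2" by (simp flip: power_mult)
      then show "tau x ^ 4 = w" using w c0 by simp
    next
      assume "tau x ^ 4 = w"
      then have "((tau x)\<^sup>2)\<^sup>2 = w" by (simp flip: power_mult)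
      then have "(tau x)\<^sup>2 = sqrt w" by (metis real_sqrt_unique zero_le_power2)
      then show "tau x = sqrt (sqrt w)" using x by (metis (no_types, lifting) U_def IntD1 less_imp_le mem_Collect_eq real_sqrt_unique)
    qed
    also have "\<dots> \<longleftrightarrow> (q x)\<^sup>2 + max (tau x) 0 ^ 4 = 256" using x by (auto simp: U_def w_def)
    finally have "x \<bullet> i = h i x \<longleftrightarrow> (q x)\<^sup>2 + max (tau x) 0 ^ 4 = 256" .
    then show "x \<in> C \<longleftrightarrow> (\<forall>a\<in>Basis - A. x \<bullet> a = h a x)" by (subst BA) (auto simp: C_def h_def)
  qed simp
next
  \<comment> \<open>On the tube and at the junction one cross-section coordinate is solved for
    instead. There q > 1 \<ge> \<delta>^2, so the bump vanishes and \<open>tau\<close> is x . e, a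
    coordinate of the parameter space.\<close>
  case False
  then have t: "tau p \<le> 0" by simp
  note qp = tau_nonpos[OF p t]
  have "\<exists>a\<in>A. p \<bullet> a \<noteq> 0"
  proof (rule ccontr)
    assume "\<not> ?thesis"
    then have "q p = 0" unfolding q_def by (intro sum.neutral) auto
    then show False using qp by simp
  qed
  then obtain a where a: "a \<in> A" "p \<bullet> a \<noteq> 0" by blast
  define sg where "sg = sgn (p \<bullet> a)"
  have sg: "sg * sg = 1" "sg \<noteq> 0" using a(2) by (auto simp: sg_def sgn_if)
  define m where "m = \<bar>p \<bullet> a\<bar> / 2"
  have m: "0 < m" "sg * (p \<bullet> a) = 2 * m" using a(2) by (auto simp: m_def sg_def sgn_if)
  obtain \<sigma>1 where s1: "C2_fun \<sigma>1" "\<And>t. 128 \<le> t \<Longrightarrow> \<sigma>1 t = sqrt t" using C2_fun_sqrt_extension[of 128] by auto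
  obtain \<sigma>2 where s2: "C2_fun \<sigma>2" "\<And>t. m\<^sup>2 \<le> t \<Longrightarrow> \<sigma>2 t = sqrt t"
    using C2_fun_sqrt_extension[of "m\<^sup>2"] m by auto
  define w where "w x = 256 - max (x \<bullet> e) 0 ^ 4" for x
  define arg where "arg x = \<sigma>1 (w x) - (\<Sum>c\<in>A - {a}. (x \<bullet> c)\<^sup>2)" for x
  define h where "h b x = (if b = a then sg * \<sigma>2 (arg x) else 0)" for b x
  have C2w: "C2_real w" unfolding w_def[abs_def]
    using C2_real_compose[OF C2_fun_pos_part[of 1] C2_real_inner[of e]] by (intro C2_real_diff[OF C2_real_const]) simp
  have C2arg: "C2_real arg" unfolding arg_def[abs_def] by (intro C2_real_intros C2_real_compose[OF s1(1)] C2w)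
  define U where "U = {x. 1 < q x} \<inter> {x. 128 < w x} \<inter> {x. m < sg * (x \<bullet> a)} \<inter> {x. m\<^sup>2 < arg x}"
  have FB: "Basis - insert i (A - {a}) = insert a (Basis - A - {i})" using a A i by auto
  have qa: "q x = (x \<bullet> a)\<^sup>2 + (\<Sum>c\<in>A - {a}. (x \<bullet> c)\<^sup>2)" for x unfolding q_def by (rule sum.remove[OF finA a(1)])
  show ?thesis
  proof (rule C2_chart_graph[OF orthonormal_Basis, where B = "insert i (A - {a})" and U = U and h = h])
    show "insert i (A - {a}) \<subseteq> Basis" using i A by auto
    show "card (insert i (A - {a})) = d" using finA A a d by (simp add: card_insert_if)
    show "open U" unfolding U_def
      by (intro open_Int open_Collect_less continuous_intros cont_q C2_real_continuous[OF C2w] C2_real_continuous[OF C2arg])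
    show "p \<in> U"
    proof -
      have wp: "w p = 256" using qp t by (simp add: w_def max_absorb2)
      have "sqrt (256::real) = 16" by (rule real_sqrt_unique) auto
      then have "arg p = q p - (\<Sum>c\<in>A - {a}. (p \<bullet> c)\<^sup>2)" using wp s1(2)[of 256] qp by (simp add: arg_def)
      also have "\<dots> = (sg * (p \<bullet> a))\<^sup>2" unfolding qa using sg by (simp add: power2_eq_square algebra_simps)
      finally have "arg p = 4 * m\<^sup>2" unfolding m(2) by (simp add: power_mult_distrib)
      then show ?thesis using wp qp m by (simp add: U_def)
    qed
    show "C2_real (h b)" for b
      unfolding h_def by (cases "b = a") (auto intro!: C2_real_intros C2_real_compose[OF s2(1)] C2arg)
    show "h b x = h b y" if that: "\<And>c. c \<in> insert i (A - {a}) \<Longrightarrow> x \<bullet> c = y \<bullet> c" for b x y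
    proof -
      have "w x = w y" using that[of i] by (simp add: w_def xi(2))
      moreover have "(\<Sum>c\<in>A - {a}. (x \<bullet> c)\<^sup>2) = (\<Sum>c\<in>A - {a}. (y \<bullet> c)\<^sup>2)" using that by simp
      ultimately show ?thesis by (simp add: h_def arg_def)
    qed
    fix x assume x: "x \<in> U"
    have tx: "tau x = x \<bullet> e" using x bump_zero[of "q x"] delta_sq by (simp add: tau_def U_def)
    have "0 < m\<^sup>2" "m\<^sup>2 < arg x" using x m by (auto simp: U_def)
    then have "0 < arg x" by (rule less_trans)
    moreover have "arg x = sqrt (w x) - (\<Sum>c\<in>A - {a}. (x \<bullet> c)\<^sup>2)" using x s1(2)[of "w x"] by (simp add: U_def arg_def)
    moreover have "\<sigma>2 (arg x) = sqrt (arg x)" using \<open>m\<^sup>2 < arg x\<close> by (intro s2(2)) simp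
    ultimately have ax: "arg x = sqrt (w x) - (\<Sum>c\<in>A - {a}. (x \<bullet> c)\<^sup>2)" "\<sigma>2 (arg x) = sqrt (arg x)" "0 < arg x" by auto
    have "x \<bullet> a = h a x \<longleftrightarrow> (x \<bullet> a)\<^sup>2 = arg x"
    proof
      assume "x \<bullet> a = h a x"
      then have "x \<bullet> a = sg * sqrt (arg x)" by (simp add: h_def ax(2))
      then have "(x \<bullet> a)\<^sup>2 = (sg * sg) * (sqrt (arg x))\<^sup>2" by (simp add: power2_eq_square)
      then show "(x \<bullet> a)\<^sup>2 = arg x" using ax(3) by (simp add: sg)
    next
      assume "(x \<bullet> a)\<^sup>2 = arg x"
      then have "(sg * (x \<bullet> a))\<^sup>2 = arg x" using sg by (simp add: power2_eq_square algebra_simps)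
      then have "sg * (x \<bullet> a) = sqrt (arg x)" using x m by (intro real_sqrt_unique[symmetric]) (auto simp: U_def)
      then have "sg * (sg * (x \<bullet> a)) = sg * sqrt (arg x)" by simp
      then have "x \<bullet> a = sg * sqrt (arg x)" using sg by (simp add: mult.assoc[symmetric])
      then show "x \<bullet> a = h a x" by (simp add: h_def ax(2))
    qed
    also have "\<dots> \<longleftrightarrow> q x = sqrt (w x)" unfolding qa ax(1) by auto
    also have "\<dots> \<longleftrightarrow> (q x)\<^sup>2 = w x"
    proof
      assume "q x = sqrt (w x)"
      then show "(q x)\<^sup>2 = w x" using x by (simp add: U_def)
    next
      assume "(q x)\<^sup>2 = w x"
      then show "q x = sqrt (w x)" using q_nonneg[of x] by (metis real_sqrt_unique)
    qed
    also have "\<dots> \<longleftrightarrow> (q x)\<^sup>2 + max (tau x) 0 ^ 4 = 256" by (auto simp: w_def tx)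
    finally have "x \<bullet> a = h a x \<longleftrightarrow> (q x)\<^sup>2 + max (tau x) 0 ^ 4 = 256" .
    moreover have "h b x = 0" if "b \<in> Basis - A - {i}" for b using that a by (auto simp: h_def)
    ultimately show "x \<in> C \<longleftrightarrow> (\<forall>b\<in>Basis - insert i (A - {a}). x \<bullet> b = h b x)" unfolding FB by (auto simp: C_def)
  qed simp
qed

text \<open>Orthogonal projection onto the cross-section \<open>span A\<close>; \<open>q\<close> is
  its squared norm.\<close>

definition zz :: "'a \<Rightarrow> 'a" where "zz x = (\<Sum>a\<in>A. (x \<bullet> a) *\<^sub>R a)"

lemma norm_zz: "(norm (zz x))\<^sup>2 = q x"
  unfolding zz_def q_def by (rule orthonormal_norm_sum[OF oA])

lemma zz_diff: "zz x - zz y = zz (x - y)"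
  by (simp add: zz_def inner_diff_left scaleR_diff_left sum_subtractf)

lemma zz_inner: "x \<bullet> zz y = (\<Sum>a\<in>A. (x \<bullet> a) * (y \<bullet> a))"
  by (simp add: zz_def inner_sum_right mult.commute)

lemma zz_in: "zz x \<bullet> y = x \<bullet> zz y" "zz x \<bullet> zz y = x \<bullet> zz y"
proof -
  have 1: "zz a \<bullet> b = a \<bullet> zz b" for a b
    unfolding inner_commute[of "zz a" b] zz_inner by (simp only: mult.commute)
  then show "zz x \<bullet> y = x \<bullet> zz y" .
  have "zz (zz y) = zz y"
    unfolding zz_def by (intro sum.cong refl) (simp only: orthonormal_sum_inner[OF oA])
  then show "zz x \<bullet> zz y = x \<bullet> zz y" unfolding 1 by simp
qed

lemma zz_e: "zz x \<bullet> e = 0" "e \<bullet> zz x = 0"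
  by (auto simp: zz_def inner_sum_left inner_sum_right ea)

lemma zz_span: "zz x \<in> span A" unfolding zz_def by (intro span_sum span_mul span_base)

lemma C_decomp: assumes "x \<in> C" shows "x = zz x + (x \<bullet> e) *\<^sub>R e"
proof -
  have "x \<in> span (insert i A)"
    using assms A i by (subst span_orthonormal_iff[OF orthonormal_Basis]) (auto simp: C_def)
  then have "x = (\<Sum>a\<in>insert i A. (x \<bullet> a) *\<^sub>R a)"
    using orthonormal_span_expansion[OF orthonormal_subset[OF orthonormal_Basis]] A i by (metis insert_subset)
  also have "\<dots> = (x \<bullet> i) *\<^sub>R i + zz x" using finA A by (simp add: zz_def)
  also have "(x \<bullet> i) *\<^sub>R i = (x \<bullet> e) *\<^sub>R e" using s by (auto simp: e_def)
  also have "(x \<bullet> e) *\<^sub>R e + zz x = zz x + (x \<bullet> e) *\<^sub>R e" by (rule add.commute)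
  finally show ?thesis .
qed

text \<open>At unit width and height the Lipschitz constant is 6, so the bump has slope at most 6
  \<eta> / \<delta> \<le> 6/800.\<close>

lemma bump_lip:
  "\<bar>bump (q x) - bump (q y)\<bar> \<le> 1/100 * norm (zz x - zz y)"
proof -
  define r where "r x = norm (zz x) / \<delta>" for x
  have qr: "q x / \<delta>\<^sup>2 = (r x)\<^sup>2" for x by (simp add: r_def power_divide norm_zz)
  have r0: "0 \<le> r x" for x using \<delta> by (simp add: r_def)
  have "\<bar>r x - r y\<bar> \<le> norm (zz x - zz y) / \<delta>"
  proof -
    have "\<bar>r x - r y\<bar> = \<bar>norm (zz x) - norm (zz y)\<bar> / \<delta>" using \<delta> by (simp add: r_def abs_divide flip: diff_divide_distrib)
    then show ?thesis using norm_triangle_ineq3[of "zz x" "zz y"] \<delta> by (simp only:) (rule divide_right_mono, auto)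
  qed
  then have "6 * \<bar>r x - r y\<bar> \<le> 6 * (norm (zz x - zz y) / \<delta>)" by simp
  then have "\<bar>max (1 - (r x)\<^sup>2) 0 ^ 3 - max (1 - (r y)\<^sup>2) 0 ^ 3\<bar> \<le> 6 * (norm (zz x - zz y) / \<delta>)"
    by (rule order_trans[OF bump_taylor(3)[OF r0[of y] r0[of x]]])
  then have "\<eta> * \<bar>max (1 - (r x)\<^sup>2) 0 ^ 3 - max (1 - (r y)\<^sup>2) 0 ^ 3\<bar> \<le> (\<delta>\<^sup>2 / 800) * (6 * (norm (zz x - zz y) / \<delta>))"
    using \<eta> by (intro mult_mono) auto
  also have "\<dots> = \<delta> * (6/800) * norm (zz x - zz y)" using \<delta> by (simp add: power2_eq_square)
  also have "\<dots> \<le> 1/100 * norm (zz x - zz y)" using \<delta> by (intro mult_right_mono) auto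
  finally show ?thesis using \<eta> unfolding bump_def qr by (simp add: abs_mult flip: right_diff_distrib)
qed

text \<open>The tangent hyperplane of the level function \<open>q\<^sup>2 + \<tau>\<^sub>+\<^sup>4\<close> has slope at least
  \<open>4 * sqrt 2893 > 206\<close>, its quadratic error is at most \<open>103\<close>.\<close>
lemma C_osculates:
  assumes p: "p \<in> C" shows "\<exists>N. osculates d C p 1 N"
proof -
  define t where "t = max (tau p) 0"
  \<comment> \<open>\<open>b'\<close> is the derivative of \<open>bump\<close> at
    \<open>q p\<close>, and \<open>n0\<close> is the gradient at p of the level function that
    defines \<open>C\<close>.\<close>
  define b' where "b' = - 3 * \<eta> / \<delta>\<^sup>2 * (max (1 - q p / \<delta>\<^sup>2) 0)\<^sup>2"
  define c where "c = 4 * q p - 8 * t^3 * b'"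
  define n0 where "n0 = c *\<^sub>R zz p + (4 * t^3) *\<^sub>R e"
  define B where "B = Basis - A - {i}"
  define Ns where "Ns = insert n0 B"
  have t0: "0 \<le> t" by (simp add: t_def)
  have t4: "t \<le> 4" using C_bounds(2)[OF p] by (simp add: t_def)
  have b'0: "b' \<le> 0" using \<eta> \<delta> by (simp add: b'_def)
  have c4: "4 * q p \<le> c" using b'0 t0 by (simp add: c_def mult_nonneg_nonpos)
  have n0b: "n0 \<bullet> b = 0" if "b \<in> B" for b
  proof -
    have "zz p \<bullet> b = 0" unfolding zz_def inner_sum_left using that A(1)
      by (intro sum.neutral ballI) (auto simp: B_def inner_Basis subset_iff)
    moreover have "e \<bullet> b = 0" using that i by (auto simp: B_def e_def inner_Basis)
    ultimately show ?thesis by (simp add: n0_def inner_add_left)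
  qed
  have norm_n0: "206\<^sup>2 \<le> (norm n0)\<^sup>2"
  proof -
    have "(norm n0)\<^sup>2 = (4 * t^3)\<^sup>2 + (norm (c *\<^sub>R zz p))\<^sup>2"
      using norm_sq_orth[OF ee, of "c *\<^sub>R zz p" "4 * t^3"] zz_e by (simp add: n0_def add.commute)
    also have "(norm (c *\<^sub>R zz p))\<^sup>2 = c\<^sup>2 * q p" by (simp add: power_mult_distrib norm_zz)
    finally have n: "(norm n0)\<^sup>2 = 16 * (t\<^sup>2)^3 + c\<^sup>2 * q p" by (simp add: power_mult_distrib flip: power_mult)
    have "(4 * q p)\<^sup>2 * q p \<le> c\<^sup>2 * q p" using c4 q_nonneg[of p] by (intro mult_right_mono power_mono) auto
    then have c3: "16 * (q p)^3 \<le> c\<^sup>2 * q p" by (simp add: power_mult_distrib power3_eq_cube power2_eq_square)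
    \<comment> \<open>Tangent of x^3 as a function of x^2, taken at x = 11. Under q^2 + (t^2)^2 =
      256 the sum of the cubes of q and t^2 is least at q = t^2 = sqrt 128, and 11 is a nearby
      integer. The outcome is (33 times 256 - 2662) / 2 = 2893.\<close>
    have tan: "2 * x^3 \<ge> 33 * x\<^sup>2 - 1331" if "0 \<le> x" for x :: real
    proof -
      have "0 \<le> (x - 11)\<^sup>2 * (2 * x + 11)" using that by simp
      then show ?thesis by (simp add: power2_eq_square power3_eq_cube algebra_simps)
    qed
    have "(q p)\<^sup>2 + (t\<^sup>2)\<^sup>2 = 256" using p by (simp add: C_def t_def flip: power_mult)
    then have "2893 \<le> (t\<^sup>2)^3 + (q p)^3" using tan[of "q p"] tan[of "t\<^sup>2"] q_nonneg[of p] by simp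
    then show ?thesis using n c3 by simp
  qed
  have n0nB: "n0 \<notin> B"
  proof
    assume "n0 \<in> B"
    then have "n0 \<bullet> n0 = 0" by (rule n0b)
    then show False using norm_n0 by simp
  qed
  have ind: "independent Ns"
  proof (rule pairwise_orthogonal_independent)
    have "orthogonal n0 b" "orthogonal b n0" if "b \<in> B" for b using n0b[OF that] by (auto simp: orthogonal_def inner_commute)
    moreover have "orthogonal a b" if "a \<in> B" "b \<in> B" "a \<noteq> b" for a b using that by (auto simp: B_def orthogonal_def inner_Basis)
    ultimately show "pairwise orthogonal Ns" unfolding Ns_def pairwise_def by blast
    have "n0 \<noteq> 0" using norm_n0 by auto
    then show "0 \<notin> Ns" by (auto simp: Ns_def B_def)
  qed
  have dn: "d < DIM('a)"
  proof -
    have "A \<subset> Basis" using A i by blast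
    then show ?thesis using psubset_card_mono[OF finite_Basis, of A] A by simp
  qed
  have "card B = DIM('a) - d - 1"
  proof -
    have "card (Basis - A - {i}) = card (Basis - A) - 1" using i A by (simp add: card_Diff_singleton_if)
    also have "card (Basis - A) = DIM('a) - card A" by (rule card_Diff_subset[OF finA A(1)])
    finally show ?thesis using A by (simp add: B_def)
  qed
  then have cardN: "card Ns + d = DIM('a)" unfolding Ns_def using n0nB dn by (simp add: B_def)
  have main: "\<bar>(x - p) \<bullet> n0\<bar> \<le> 103 * (norm (x - p))\<^sup>2" if x: "x \<in> C" for x
  proof -
    define \<Delta> where "\<Delta> = x - p"
    define S where "S = q x - q p"
    have zd: "zz x - zz p = zz \<Delta>" by (simp add: zz_diff \<Delta>_def)
    have SS: "S = 2 * (\<Delta> \<bullet> zz p) + q \<Delta>"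
    proof -
      have "q x = (norm (zz p + zz \<Delta>))\<^sup>2" by (simp add: norm_zz[symmetric] zd[symmetric])
      also have "\<dots> = q p + 2 * (\<Delta> \<bullet> zz p) + q \<Delta>"
        using norm_sq_diff_scaled[of 1 "zz p" "-1" "zz \<Delta>"] zz_inner[of p \<Delta>] zz_inner[of \<Delta> p]
        by (simp add: norm_zz zz_in(2) mult.commute)
      finally show ?thesis by (simp add: S_def)
    qed
    have dec: "q \<Delta> + (\<Delta> \<bullet> e)\<^sup>2 \<le> (norm \<Delta>)\<^sup>2"
      using orthonormal_bessel[OF oeA(1), of \<Delta>] finA oeA(2) by (simp add: q_def add.commute)
    have nz: "norm (zz y) \<le> 4" if "y \<in> C" for y
    proof -
      have "(norm (zz y))\<^sup>2 \<le> 4\<^sup>2" using C_bounds(1)[OF that] by (simp add: norm_zz)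
      then show ?thesis by (rule power2_le_imp_le) simp
    qed
    have S8: "S\<^sup>2 \<le> 64 * q \<Delta>"
    proof -
      have "S = (norm (zz x) - norm (zz p)) * (norm (zz x) + norm (zz p))"
        by (simp add: S_def norm_zz[symmetric] power2_eq_square algebra_simps)
      then have "S\<^sup>2 = (norm (zz x) - norm (zz p))\<^sup>2 * (norm (zz x) + norm (zz p))\<^sup>2" by (simp add: power_mult_distrib)
      also have "\<dots> \<le> (norm (zz \<Delta>))\<^sup>2 * 8\<^sup>2"
      proof (intro mult_mono)
        have "\<bar>norm (zz x) - norm (zz p)\<bar> \<le> norm (zz \<Delta>)" unfolding zd[symmetric] by (rule norm_triangle_ineq3)
        then show "(norm (zz x) - norm (zz p))\<^sup>2 \<le> (norm (zz \<Delta>))\<^sup>2" by (metis abs_le_square_iff abs_norm_cancel)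
        show "(norm (zz x) + norm (zz p))\<^sup>2 \<le> 8\<^sup>2" using nz[OF x] nz[OF p] by (intro power_mono) auto
      qed auto
      finally show ?thesis by (simp add: norm_zz)
    qed
    \<comment> \<open>\<open>R1\<close>, \<open>R2\<close> and \<open>remb\<close> are the second
      order remainders of q^2, of the quartic term and of the bump. As both points lie on the level
      set, \<Delta> . n0 is made up of these remainders alone.\<close>
    define R1 where "R1 = S\<^sup>2 + 2 * q p * q \<Delta>"
    have R1: "0 \<le> R1" "R1 \<le> 96 * q \<Delta>"
    proof -
      show "0 \<le> R1" using q_nonneg by (simp add: R1_def)
      have "q p * q \<Delta> \<le> 16 * q \<Delta>" using C_bounds(1)[OF p] q_nonneg by (intro mult_right_mono)
      then show "R1 \<le> 96 * q \<Delta>" using S8 by (simp add: R1_def)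
    qed
    have e1: "4 * q p * (\<Delta> \<bullet> zz p) = (q x)\<^sup>2 - (q p)\<^sup>2 - R1"
    proof -
      have "(q x)\<^sup>2 - (q p)\<^sup>2 = 2 * q p * S + S\<^sup>2" by (simp add: S_def power2_eq_square algebra_simps)
      then show ?thesis by (simp add: R1_def SS algebra_simps)
    qed
    define d\<tau> where "d\<tau> = tau x - tau p"
    define remb where "remb = bump (q x) - bump (q p) - b' * (2 * (\<Delta> \<bullet> zz p))"
    define R2 where "R2 = max (tau x) 0 ^ 4 - t ^ 4 - 4 * t^3 * d\<tau>"
    have R2: "0 \<le> R2" "R2 \<le> 96 * d\<tau>\<^sup>2"
      using pos_part_quartic_taylor[OF C_bounds(2)[OF p] C_bounds(2)[OF x]] by (auto simp: R2_def t_def d\<tau>_def)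
    have e2: "\<Delta> \<bullet> e - b' * (2 * (\<Delta> \<bullet> zz p)) = d\<tau> + remb"
      by (simp add: d\<tau>_def remb_def tau_def \<Delta>_def inner_diff_left)
    have "\<Delta> \<bullet> n0 = 4 * q p * (\<Delta> \<bullet> zz p) + 4 * t^3 * (\<Delta> \<bullet> e - b' * (2 * (\<Delta> \<bullet> zz p)))"
      by (simp add: n0_def inner_add_right c_def algebra_simps)
    also have "\<dots> = - R1 - R2 + 4 * t^3 * remb"
    proof -
      have "(q x)\<^sup>2 + max (tau x) 0 ^ 4 = 256" "(q p)\<^sup>2 + t ^ 4 = 256" using x p by (auto simp: C_def t_def)
      then show ?thesis unfolding e1 e2 by (simp add: R2_def algebra_simps)
    qed
    finally have Dn: "\<Delta> \<bullet> n0 = - R1 - R2 + 4 * t^3 * remb" .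
    \<comment> \<open>Passing from the linear term in \<Delta> to the difference of q leaves a term
      between 0 and 3 q \<Delta> / \<delta>^2 that is subtracted from \<open>Br\<close>; the
      absolute value is still governed by 15. The powers of \<delta> cancel against the bound for
      \<eta>.\<close>
    have remb: "\<bar>remb\<bar> \<le> 15/800 * q \<Delta>"
    proof -
      define r where "r y = norm (zz y) / \<delta>" for y
      have qr: "q y / \<delta>\<^sup>2 = (r y)\<^sup>2" for y by (simp add: r_def power_divide norm_zz)
      have r0: "0 \<le> r y" for y using \<delta> by (simp add: r_def)
      define a where "a = max (1 - (r p)\<^sup>2) 0"
      have a1: "a\<^sup>2 \<le> 1" "0 \<le> a\<^sup>2" by (auto simp: a_def power_le_one)
      define Br where "Br = max (1 - (r x)\<^sup>2) 0 ^ 3 - a^3 + 3 * a\<^sup>2 * ((r x)\<^sup>2 - (r p)\<^sup>2)"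
      have "\<bar>r x - r p\<bar> \<le> norm (zz \<Delta>) / \<delta>"
      proof -
        have "\<bar>r x - r p\<bar> = \<bar>norm (zz x) - norm (zz p)\<bar> / \<delta>" using \<delta> by (simp add: r_def abs_divide flip: diff_divide_distrib)
        then show ?thesis using norm_triangle_ineq3[of "zz x" "zz p"] \<delta> unfolding zd[symmetric] by (simp only:) (rule divide_right_mono, auto)
      qed
      then have "(r x - r p)\<^sup>2 \<le> (norm (zz \<Delta>) / \<delta>)\<^sup>2" by (metis abs_le_square_iff abs_of_nonneg divide_nonneg_pos norm_ge_zero \<delta>(1))
      then have rr: "(r x - r p)\<^sup>2 \<le> q \<Delta> / \<delta>\<^sup>2" by (simp add: power_divide norm_zz)
      have Br: "0 \<le> Br" "Br \<le> 15 * (q \<Delta> / \<delta>\<^sup>2)"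
        using bump_taylor(1,2)[OF r0[of p] r0[of x]] rr by (auto simp: Br_def a_def)
      have "remb = \<eta> * (Br - 3 * a\<^sup>2 * (q \<Delta> / \<delta>\<^sup>2))"
      proof -
        have "2 * (\<Delta> \<bullet> zz p) = S - q \<Delta>" using SS by simp
        then have "remb = \<eta> * max (1 - (r x)\<^sup>2) 0 ^ 3 - \<eta> * a^3 + 3 * \<eta> * a\<^sup>2 * ((S - q \<Delta>) / \<delta>\<^sup>2)"
          by (simp add: remb_def bump_def b'_def qr a_def)
        moreover have "(S - q \<Delta>) / \<delta>\<^sup>2 = (r x)\<^sup>2 - (r p)\<^sup>2 - q \<Delta> / \<delta>\<^sup>2" by (simp add: S_def diff_divide_distrib qr)
        ultimately have "remb = \<eta> * max (1 - (r x)\<^sup>2) 0 ^ 3 - \<eta> * a^3 + 3 * \<eta> * a\<^sup>2 * ((r x)\<^sup>2 - (r p)\<^sup>2 - q \<Delta> / \<delta>\<^sup>2)"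
          by (simp only:)
        then show ?thesis unfolding Br_def by (simp add: algebra_simps)
      qed
      then have "\<bar>remb\<bar> = \<eta> * \<bar>Br - 3 * a\<^sup>2 * (q \<Delta> / \<delta>\<^sup>2)\<bar>" using \<eta> by (simp add: abs_mult)
      also have "\<dots> \<le> (\<delta>\<^sup>2 / 800) * (15 * (q \<Delta> / \<delta>\<^sup>2))"
      proof (rule mult_mono)
        have "0 \<le> a\<^sup>2 * (q \<Delta> / \<delta>\<^sup>2)" "a\<^sup>2 * (q \<Delta> / \<delta>\<^sup>2) \<le> 1 * (q \<Delta> / \<delta>\<^sup>2)"
          using a1 q_nonneg[of \<Delta>] mult_right_mono[of "a\<^sup>2" 1 "q \<Delta> / \<delta>\<^sup>2"] by auto
        then show "\<bar>Br - 3 * a\<^sup>2 * (q \<Delta> / \<delta>\<^sup>2)\<bar> \<le> 15 * (q \<Delta> / \<delta>\<^sup>2)"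
          using Br by (simp only: abs_le_iff mult.assoc) linarith
      qed (use \<eta> in auto)
      also have "\<dots> = 15/800 * q \<Delta>" using \<delta> by simp
      finally show ?thesis .
    qed
    have "t^3 \<le> 4^3" using t0 t4 by (rule power_mono[rotated])
    then have g: "\<bar>4 * t^3 * remb\<bar> \<le> 256 * (15/800 * q \<Delta>)"
      using remb t0 unfolding abs_mult by (intro mult_mono) auto
    have dt2: "d\<tau>\<^sup>2 \<le> 101/100 * (\<Delta> \<bullet> e)\<^sup>2 + 2/100 * q \<Delta>"
    proof -
      define f where "f = bump (q x) - bump (q p)"
      have f: "\<bar>f\<bar> \<le> 1/100 * norm (zz \<Delta>)" using bump_lip[of x p] zd by (simp add: f_def)
      have dt: "d\<tau> = \<Delta> \<bullet> e - f" by (simp add: d\<tau>_def f_def tau_def \<Delta>_def inner_diff_left)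
      have "\<bar>d\<tau>\<bar> \<le> \<bar>\<Delta> \<bullet> e\<bar> + 1/100 * norm (zz \<Delta>)" using f dt by linarith
      then have "d\<tau>\<^sup>2 \<le> (\<bar>\<Delta> \<bullet> e\<bar> + 1/100 * norm (zz \<Delta>))\<^sup>2" by (metis abs_ge_zero abs_le_square_iff abs_of_nonneg order_trans)
      also have "\<dots> = (\<Delta> \<bullet> e)\<^sup>2 + 2/100 * (\<bar>\<Delta> \<bullet> e\<bar> * norm (zz \<Delta>)) + 1/10000 * q \<Delta>"
        by (simp add: norm_zz[symmetric] power2_eq_square algebra_simps)
      also have "\<dots> \<le> 101/100 * (\<Delta> \<bullet> e)\<^sup>2 + 2/100 * q \<Delta>"
      proof -
        have "0 \<le> (\<bar>\<Delta> \<bullet> e\<bar> - norm (zz \<Delta>))\<^sup>2" by simp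
        then have "2 * (\<bar>\<Delta> \<bullet> e\<bar> * norm (zz \<Delta>)) \<le> (\<Delta> \<bullet> e)\<^sup>2 + q \<Delta>"
          by (simp add: norm_zz[symmetric] power2_eq_square algebra_simps)
        then show ?thesis using q_nonneg[of \<Delta>] by linarith
      qed
      finally show ?thesis .
    qed
    have "\<bar>\<Delta> \<bullet> n0\<bar> \<le> R1 + R2 + \<bar>4 * t^3 * remb\<bar>" using R1(1) R2(1) unfolding Dn by linarith
    also have "\<dots> \<le> 96 * q \<Delta> + 96 * d\<tau>\<^sup>2 + 256 * (15/800 * q \<Delta>)" using R1(2) R2(2) g by linarith
    also have "\<dots> \<le> 96 * q \<Delta> + 96 * (101/100 * (\<Delta> \<bullet> e)\<^sup>2 + 2/100 * q \<Delta>) + 256 * (15/800 * q \<Delta>)" using dt2 by simp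
    \<comment> \<open>96 + 1.92 + 4.8 = 102.72 for the cross-section and 96.96 for the axis; 103 is
      half of the gradient bound 206.\<close>
    also have "\<dots> \<le> 103 * (q \<Delta> + (\<Delta> \<bullet> e)\<^sup>2)"
      using q_nonneg[of \<Delta>] zero_le_power2[of "\<Delta> \<bullet> e"] unfolding distrib_left by linarith
    also have "\<dots> \<le> 103 * (norm \<Delta>)\<^sup>2" using dec by (intro mult_left_mono) auto
    finally show ?thesis by (simp add: \<Delta>_def)
  qed
  have n206: "206 \<le> norm n0" using norm_n0 by (rule power2_le_imp_le) simp
  have "osculates d C p 1 (span Ns)"
    unfolding osculates_def
  proof (intro conjI ballI)
    show "subspace (span Ns)" by simp
    show "DIM('a) \<le> dim (span Ns) + d" using ind cardN by (simp add: dim_span dim_eq_card_independent)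
    fix w x assume w: "w \<in> span Ns" and x: "x \<in> C"
    obtain \<alpha> where \<alpha>: "w - \<alpha> *\<^sub>R n0 \<in> span B" using w by (auto simp: Ns_def span_breakdown_eq)
    define y where "y = w - \<alpha> *\<^sub>R n0"
    have w: "w = \<alpha> *\<^sub>R n0 + y" by (simp add: y_def)
    have n0y: "orthogonal n0 y"
      by (rule orthogonal_to_span[OF \<alpha>[folded y_def]]) (use n0b in \<open>auto simp: orthogonal_def\<close>)
    have xpy: "orthogonal (x - p) y"
      by (rule orthogonal_to_span[OF \<alpha>[folded y_def]]) (use x p in \<open>auto simp: orthogonal_def inner_diff_left C_def B_def\<close>)
    have "(\<alpha> * norm n0)\<^sup>2 \<le> (norm w)\<^sup>2"
      using norm_add_Pythagorean[of "\<alpha> *\<^sub>R n0" y] n0y by (simp add: w orthogonal_def power_mult_distrib)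
    then have "\<bar>\<alpha> * norm n0\<bar> \<le> norm w" by (rule abs_le_if_square_le) simp
    then have aw: "\<bar>\<alpha>\<bar> * norm n0 \<le> norm w" by (simp add: abs_mult)
    have "\<bar>(x - p) \<bullet> w\<bar> = \<bar>\<alpha>\<bar> * \<bar>(x - p) \<bullet> n0\<bar>"
      using xpy by (simp add: w inner_add_right orthogonal_def abs_mult)
    also have "\<dots> \<le> \<bar>\<alpha>\<bar> * (103 * (norm (x - p))\<^sup>2)" by (intro mult_left_mono main[OF x]) simp
    also have "\<dots> \<le> (norm w / 2) * (norm (x - p))\<^sup>2"
    proof -
      have "\<bar>\<alpha>\<bar> * 206 \<le> \<bar>\<alpha>\<bar> * norm n0" using n206 by (intro mult_left_mono) auto
      then have "\<bar>\<alpha>\<bar> * 103 \<le> norm w / 2" using aw by simp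
      then have "(\<bar>\<alpha>\<bar> * 103) * (norm (x - p))\<^sup>2 \<le> (norm w / 2) * (norm (x - p))\<^sup>2" by (rule mult_right_mono) simp
      then show ?thesis by (simp only: mult.assoc)
    qed
    finally show "\<bar>(x - p) \<bullet> w\<bar> \<le> norm w * (norm (x - p))\<^sup>2 / (2 * 1)" by simp
  qed
  then show ?thesis by blast
qed

end

section \<open>Volume and connectedness of the cap\<close>

context cap
begin

text \<open>Parametrisation of the part of the cap where \<open>tau\<close> is nonnegative, as a
  graph over the disc of radius 4 in the cross-section.\<close>

definition top :: "'a \<Rightarrow> 'a" where
  "top z = z + (bump ((norm z)\<^sup>2) + sqrt (sqrt (256 - norm z ^ 4))) *\<^sub>R e"

lemma fourth_root:
  assumes "0 \<le> w" shows "sqrt (sqrt w) ^ 4 = w" "0 \<le> sqrt (sqrt w)"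
proof -
  have "sqrt (sqrt w) ^ 4 = ((sqrt (sqrt w))\<^sup>2)\<^sup>2" by (simp flip: power_mult)
  then show "sqrt (sqrt w) ^ 4 = w" using assms by simp
qed (use assms in simp)

lemma fourth_root_unique:
  assumes "0 \<le> t" "t ^ 4 = w" shows "t = sqrt (sqrt w)"
proof -
  have "(t\<^sup>2)\<^sup>2 = w" using assms(2) by (simp flip: power_mult)
  then have "t\<^sup>2 = sqrt w" by (metis real_sqrt_unique zero_le_power2)
  then show ?thesis using assms(1) by (metis real_sqrt_unique)
qed

lemma norm_zz4: "norm (zz x) ^ 4 = (q x)\<^sup>2"
  by (simp add: norm_zz[symmetric] flip: power_mult)

lemma top_zz:
  assumes "x \<in> C" "0 \<le> tau x" shows "x = top (zz x)"
proof -
  have "tau x ^ 4 = 256 - norm (zz x) ^ 4" using assms by (simp add: C_def norm_zz4)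
  then have "tau x = sqrt (sqrt (256 - norm (zz x) ^ 4))" by (rule fourth_root_unique[OF assms(2)])
  then have "x \<bullet> e = bump ((norm (zz x))\<^sup>2) + sqrt (sqrt (256 - norm (zz x) ^ 4))"
    by (simp add: tau_def norm_zz)
  then show ?thesis using C_decomp[OF assms(1)] by (simp add: top_def)
qed

lemma span_A:
  assumes "z \<in> span A" shows "zz z = z" "q z = (norm z)\<^sup>2" "z \<bullet> e = 0"
proof -
  show 1: "zz z = z" unfolding zz_def by (rule orthonormal_span_expansion[OF oA assms])
  show "q z = (norm z)\<^sup>2" using norm_zz[of z] 1 by simp
  show "z \<bullet> e = 0" using zz_e[of z] 1 by simp
qed

lemma pow4_le_256: "0 \<le> w \<Longrightarrow> w \<le> 4 \<Longrightarrow> w ^ 4 \<le> (256::real)"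
  using power_mono[of w 4 4] by simp

lemma pow4_le_imp_le: "(a::real) ^ 4 \<le> b ^ 4 \<Longrightarrow> 0 \<le> b \<Longrightarrow> a \<le> b"
  using power_le_imp_le_base[of a 3 b] by simp

lemma top_in_C:
  assumes "z \<in> span A" "norm z \<le> 4" shows "top z \<in> C"
proof -
  define T where "T = sqrt (sqrt (256 - norm z ^ 4))"
  have w: "0 \<le> 256 - norm z ^ 4" using pow4_le_256[of "norm z"] assms by simp
  have T: "T ^ 4 = 256 - norm z ^ 4" "0 \<le> T" using fourth_root[OF w] by (auto simp: T_def)
  have ta: "top z \<bullet> a = z \<bullet> a" if "a \<in> A" for a using that by (simp add: top_def inner_add_left ea)
  have qt: "q (top z) = (norm z)\<^sup>2"
  proof -
    have "q (top z) = q z" unfolding q_def using ta by simp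
    then show ?thesis using span_A(2)[OF assms(1)] by simp
  qed
  have "top z \<bullet> e = bump ((norm z)\<^sup>2) + T" using span_A(3)[OF assms(1)] by (simp add: top_def inner_add_left ee T_def)
  then have "tau (top z) = T" by (simp add: tau_def qt)
  then have "(q (top z))\<^sup>2 + max (tau (top z)) 0 ^ 4 = 256" using T by (simp add: qt flip: power_mult)
  moreover have "top z \<bullet> b = 0" if "b \<in> Basis - A - {i}" for b
  proof -
    have "z \<bullet> b = 0" using assms(1) that span_orthonormal_iff[OF orthonormal_Basis _ A(1), of z] by auto
    moreover have "e \<bullet> b = 0" using that i by (auto simp: e_def inner_Basis)
    ultimately show ?thesis by (simp add: top_def inner_add_left)
  qed
  ultimately show ?thesis by (simp add: C_def)
qed

text \<open>|z|^4 \<le> 128 singles out the crown, where the height of the quartic is at least the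
  radius and its slope at most 1. The bump adds 1/100, and 1 + (101/100)^2 \<le> (3/2)^2.\<close>

lemma top_lipschitz:
  assumes z: "z \<in> span A" "norm z ^ 4 \<le> 128" and y: "y \<in> span A" "norm y ^ 4 \<le> 128"
  shows "dist (top z) (top y) \<le> 3/2 * dist z y"
proof -
  define S T where "S = sqrt (sqrt (256 - norm z ^ 4))" and "T = sqrt (sqrt (256 - norm y ^ 4))"
  have ST: "S ^ 4 = 256 - norm z ^ 4" "0 \<le> S" "T ^ 4 = 256 - norm y ^ 4" "0 \<le> T"
    using fourth_root[of "256 - norm z ^ 4"] fourth_root[of "256 - norm y ^ 4"] z y by (auto simp: S_def T_def)
  have "norm z \<le> S" "norm y \<le> T" by (rule pow4_le_imp_le; use ST z y in simp)+
  then have "\<bar>S - T\<bar> \<le> \<bar>norm z - norm y\<bar>" using ST by (intro quartic_lipschitz) auto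
  also have "\<dots> \<le> norm (z - y)" by (rule norm_triangle_ineq3)
  finally have 1: "\<bar>S - T\<bar> \<le> norm (z - y)" .
  have 2: "\<bar>bump ((norm z)\<^sup>2) - bump ((norm y)\<^sup>2)\<bar> \<le> 1/100 * norm (z - y)"
    using bump_lip[of z y] span_A[OF z(1)] span_A[OF y(1)] by simp
  define k where "k = (bump ((norm z)\<^sup>2) + S) - (bump ((norm y)\<^sup>2) + T)"
  have k: "\<bar>k\<bar> \<le> 101/100 * norm (z - y)" using 1 2 unfolding k_def by linarith
  have "top z - top y = k *\<^sub>R e + (z - y)" by (simp add: top_def k_def S_def T_def algebra_simps)
  moreover have "(z - y) \<bullet> e = 0" using span_A(3)[OF z(1)] span_A(3)[OF y(1)] by (simp add: inner_diff_left)
  ultimately have "(dist (top z) (top y))\<^sup>2 = k\<^sup>2 + (norm (z - y))\<^sup>2" by (simp only: dist_norm norm_sq_orth[OF ee])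
  also have "k\<^sup>2 \<le> (101/100 * norm (z - y))\<^sup>2" using k by (metis abs_ge_zero abs_le_square_iff abs_of_nonneg order_trans)
  also have "(101/100 * norm (z - y))\<^sup>2 + (norm (z - y))\<^sup>2 \<le> (3/2 * norm (z - y))\<^sup>2"
    by (simp add: power_mult_distrib power2_eq_square)
  finally have "(dist (top z) (top y))\<^sup>2 \<le> (3/2 * norm (z - y))\<^sup>2" by simp
  then show ?thesis unfolding dist_norm[of z y] by (rule power2_le_imp_le) simp
qed

text \<open>Beyond this region the cap does not depend on \<eta>; its volume makes the total
  variation distance of the two hypotheses of order \<delta>^d.\<close>

lemma bump_region_measure:
  "hausdorff_outer d (C \<inter> {x. q x < \<delta>\<^sup>2}) \<le> ennreal ((3/2) ^ d * (flat_vol A * \<delta> ^ d))"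
proof -
  have sm: "z \<in> span A" "norm z ^ 4 \<le> 128" if "z \<in> flat_ball A \<delta>" for z
    using that \<delta> power_le_one[of "norm z" 4] by (auto simp: flat_ball_def)
  have "C \<inter> {x. q x < \<delta>\<^sup>2} \<subseteq> top ` flat_ball A \<delta>"
  proof
    fix x assume x: "x \<in> C \<inter> {x. q x < \<delta>\<^sup>2}"
    have "0 < tau x"
    proof (rule ccontr)
      assume "\<not> ?thesis"
      then have "q x = 16" using tau_nonpos[of x] x by auto
      then show False using x delta_sq by simp
    qed
    then have "x = top (zz x)" using x by (intro top_zz) auto
    moreover have "zz x \<in> flat_ball A \<delta>"
    proof -
      have "(norm (zz x))\<^sup>2 \<le> \<delta>\<^sup>2" using x by (simp add: norm_zz)
      then have "norm (zz x) \<le> \<delta>" by (rule power2_le_imp_le) (use \<delta> in simp)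
      then show ?thesis using zz_span by (simp add: flat_ball_def)
    qed
    ultimately show "x \<in> top ` flat_ball A \<delta>" by (metis image_eqI)
  qed
  then have "hausdorff_outer d (C \<inter> {x. q x < \<delta>\<^sup>2}) \<le> hausdorff_outer d (top ` flat_ball A \<delta>)"
    by (rule hausdorff_outer_mono)
  also have "\<dots> \<le> ennreal ((3/2) ^ d) * hausdorff_outer d (flat_ball A \<delta>)"
    by (rule hausdorff_outer_lipschitz_image) (use top_lipschitz sm in auto)
  also have "hausdorff_outer d (flat_ball A \<delta>) = ennreal (flat_vol A * \<delta> ^ d)"
    using flat_ball_measure[OF oA _ \<delta>(1)] A d by simp
  finally show ?thesis by (simp add: ennreal_mult'[symmetric])
qed

lemma C_cube_cover:
  assumes x: "x \<in> C" "x \<in> cube"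
  shows "x \<bullet> e \<in> {-21..5}"
proof -
  have "\<bar>x \<bullet> e\<bar> \<le> 21" using x(2) i s by (auto simp: cube_def xi(2))
  then show ?thesis using C_bounds(3)[OF x(1)] by auto
qed

text \<open>Three parts: the straight tube, the flank of the cap as an image of a tube, and the
  crown as an image of a disc under \<open>top\<close>. Flank and crown are separated where radius
  and height agree, so that each profile has slope at most 1. The constant 9 is smaller than the 22
  allowed for a general piece because of manifolds made of two caps: 2 times 9 is half of the 36 in
  the theorem.\<close>

lemma C_measure: "hausdorff_outer d (C \<inter> cube) \<le> ennreal (9 * real d * 8 ^ d * flat_vol A)"
proof -
  define G where "G p = (p \<bullet> e) *\<^sub>R e + (sqrt (sqrt (256 - (p \<bullet> e) ^ 4)) / 4) *\<^sub>R zz p" for p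
  \<comment> \<open>The cube ends at -21; the tube is prolonged to -24 so that it consists of six
    full segments of length 4.\<close>
  define T1 where "T1 = tube e A 4 {-24<..-24 + real 6 * 4}"
  define T2 where "T2 = tube e A 4 {0<..0 + real 1 * 4} \<inter> {p. (p \<bullet> e) ^ 4 \<le> 128}"
  define T3 where "T3 = flat_ball A 4 \<inter> {z. norm z ^ 4 \<le> 128}"
  have v0: "0 < flat_vol A" using flat_vol_pos[OF oA] A d by simp
  have Cspan: "x \<in> span (insert e A)" if "x \<in> C" for x
  proof -
    have "zz x + (x \<bullet> e) *\<^sub>R e \<in> span (insert e A)"
      using zz_span[of x] span_mono[of A "insert e A"] by (intro span_add span_mul) (auto intro: span_base)
    then show ?thesis using C_decomp[OF that] by simp
  qed
  have cover: "C \<inter> cube \<subseteq> T1 \<union> (G ` T2 \<union> top ` T3)"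
  proof
    fix x assume x: "x \<in> C \<inter> cube"
    have xe: "-21 \<le> x \<bullet> e" using C_cube_cover[of x] x by auto
    consider "tau x \<le> 0" | "0 < tau x" "128 \<le> (q x)\<^sup>2" | "0 < tau x" "(q x)\<^sup>2 < 128" by linarith
    then show "x \<in> T1 \<union> (G ` T2 \<union> top ` T3)"
    proof cases
      case 1
      have "q x = 16" "x \<bullet> e \<le> 0" using tau_nonpos[of x] x 1 by auto
      then have "x \<in> T1" using xe x Cspan[of x] by (simp add: T1_def tube_def q_def)
      then show ?thesis by blast
    next
      case 2
      have q11: "1 \<le> q x"
      proof (rule ccontr)
        assume "\<not> ?thesis"
        then have "(q x)\<^sup>2 \<le> 1" using q_nonneg[of x] by (intro power_le_one) auto
        then show False using 2 by simp
      qed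
      then have xt: "x \<bullet> e = tau x" using bump_zero[of "q x"] delta_sq by (simp add: tau_def)
      have t4: "tau x ^ 4 = 256 - (q x)\<^sup>2" using x 2 by (simp add: C_def)
      define n where "n = norm (zz x)"
      have n: "0 < n" "n\<^sup>2 = q x" using q11 norm_zz[of x] by (auto simp: n_def)
      define p where "p = tau x *\<^sub>R e + (4 / n) *\<^sub>R zz x"
      have "p \<in> tube e A 4 {0<..0 + real 1 * 4}"
        unfolding tube_iff[OF oeA, of 4, simplified]
        by (rule bexI[of _ "tau x"], rule bexI[of _ "(4 / n) *\<^sub>R zz x"])
           (use n 2 C_bounds(2)[of x] x zz_span[of x] in \<open>auto simp: p_def n_def span_mul\<close>)
      moreover have pe: "p \<bullet> e = tau x" using zz_e[of x] by (simp add: p_def inner_add_left ee)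
      ultimately have "p \<in> T2" using t4 2 by (simp add: T2_def)
      moreover have "G p = x"
      proof -
        have "zz p = (4 / n) *\<^sub>R zz x"
        proof -
          have "p \<bullet> a = (4 / n) * (x \<bullet> a)" if "a \<in> A" for a
          proof -
            have "zz x \<bullet> a = x \<bullet> a" unfolding zz_def by (rule orthonormal_sum_inner[OF oA that])
            then show ?thesis using ea(1)[OF that] by (simp add: p_def inner_add_left)
          qed
          then show ?thesis by (simp add: zz_def scaleR_sum_right)
        qed
        moreover have "n = sqrt (sqrt (256 - (p \<bullet> e) ^ 4))"
          by (rule fourth_root_unique) (use n pe t4 norm_zz4[of x] in \<open>auto simp: n_def\<close>)
        ultimately have "G p = tau x *\<^sub>R e + (n / 4) *\<^sub>R (4 / n) *\<^sub>R zz x" by (simp add: G_def pe)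
        also have "\<dots> = tau x *\<^sub>R e + zz x" using n by simp
        also have "\<dots> = x" using C_decomp[of x] x xt by (simp add: add.commute)
        finally show ?thesis .
      qed
      ultimately have "x \<in> G ` T2" by (metis image_eqI)
      then show ?thesis by blast
    next
      case 3
      have "(norm (zz x))\<^sup>2 \<le> 4\<^sup>2" using C_bounds(1)[of x] x by (simp add: norm_zz)
      then have "norm (zz x) \<le> 4" by (rule power2_le_imp_le) simp
      then have "zz x \<in> T3" using 3 zz_span[of x] by (simp add: T3_def flat_ball_def norm_zz4)
      moreover have "x = top (zz x)" using top_zz[of x] x 3 by simp
      ultimately have "x \<in> top ` T3" by (metis image_eqI)
      then show ?thesis by blast
    qed
  qed
  have lipG: "dist (G p) (G p') \<le> 2 * dist p p'" if pp: "p \<in> T2" "p' \<in> T2" for p p'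
  proof -
    define t t' where "t = p \<bullet> e" and "t' = p' \<bullet> e"
    define R R' where "R = sqrt (sqrt (256 - t ^ 4))" and "R' = sqrt (sqrt (256 - t' ^ 4))"
    have t: "0 \<le> t" "t ^ 4 \<le> 128" "0 \<le> t'" "t' ^ 4 \<le> 128" using pp by (auto simp: T2_def tube_def t_def t'_def)
    have R: "R ^ 4 = 256 - t ^ 4" "0 \<le> R" "R' ^ 4 = 256 - t' ^ 4" "0 \<le> R'"
      using fourth_root[of "256 - t ^ 4"] fourth_root[of "256 - t' ^ 4"] t by (auto simp: R_def R'_def)
    have tR: "t \<le> R" "t' \<le> R'" by (rule pow4_le_imp_le; use R t in simp)+
    have R4: "R \<le> 4" by (rule pow4_le_imp_le) (use R t in simp_all)
    have RR: "\<bar>R - R'\<bar> \<le> \<bar>t - t'\<bar>" using R t tR by (intro quartic_lipschitz) auto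
    have nz: "norm (zz p') = 4"
    proof -
      have "(norm (zz p'))\<^sup>2 = 4\<^sup>2" using pp(2) unfolding norm_zz by (simp add: T2_def tube_def q_def)
      then show ?thesis using power2_eq_iff_nonneg[of "norm (zz p')" 4] by simp
    qed
    define w where "w = (R / 4) *\<^sub>R zz p - (R' / 4) *\<^sub>R zz p'"
    have "w = (R / 4) *\<^sub>R (zz p - zz p') + ((R - R') / 4) *\<^sub>R zz p'" by (simp add: w_def algebra_simps diff_divide_distrib)
    then have "norm w \<le> norm ((R / 4) *\<^sub>R (zz p - zz p')) + norm (((R - R') / 4) *\<^sub>R zz p')" by (simp only: norm_triangle_ineq)
    also have "\<dots> = R / 4 * norm (zz p - zz p') + \<bar>R - R'\<bar>" using R nz by simp
    also have "\<dots> \<le> 1 * norm (zz p - zz p') + \<bar>t - t'\<bar>" using R4 RR by (intro add_mono mult_right_mono) auto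
    finally have "norm w \<le> norm (zz p - zz p') + \<bar>t - t'\<bar>" by simp
    then have "(norm w)\<^sup>2 \<le> (norm (zz p - zz p') + \<bar>t - t'\<bar>)\<^sup>2" by (rule power_mono) simp
    moreover have "(norm (zz p - zz p') + \<bar>t - t'\<bar>)\<^sup>2 + (norm (zz p - zz p') - \<bar>t - t'\<bar>)\<^sup>2 = 2 * (norm (zz p - zz p'))\<^sup>2 + 2 * (t - t')\<^sup>2"
      by (simp add: power2_eq_square algebra_simps)
    moreover have "0 \<le> (norm (zz p - zz p') - \<bar>t - t'\<bar>)\<^sup>2" by simp
    ultimately have w2: "(norm w)\<^sup>2 \<le> 2 * (norm (zz p - zz p'))\<^sup>2 + 2 * (t - t')\<^sup>2" by linarith
    have "G p - G p' = (t - t') *\<^sub>R e + w" by (simp add: G_def w_def R_def R'_def t_def t'_def algebra_simps)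
    moreover have "w \<bullet> e = 0" by (simp add: w_def inner_diff_left zz_e)
    ultimately have "(dist (G p) (G p'))\<^sup>2 = (t - t')\<^sup>2 + (norm w)\<^sup>2" by (simp only: dist_norm norm_sq_orth[OF ee])
    also have "\<dots> \<le> 4 * ((norm (zz p - zz p'))\<^sup>2 + (t - t')\<^sup>2)"
      using w2 zero_le_power2[of "t - t'"] zero_le_power2[of "norm (zz p - zz p')"] unfolding distrib_left by linarith
    also have "\<dots> \<le> 4 * (dist p p')\<^sup>2"
    proof -
      have "q (p - p') + ((p - p') \<bullet> e)\<^sup>2 \<le> (norm (p - p'))\<^sup>2"
        using orthonormal_bessel[OF oeA(1), of "p - p'"] finA oeA(2) by (simp add: q_def add.commute)
      then show ?thesis by (simp add: zz_diff norm_zz t_def t'_def inner_diff_left dist_norm)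
    qed
    finally have "(dist (G p) (G p'))\<^sup>2 \<le> (2 * dist p p')\<^sup>2" by (simp add: power_mult_distrib)
    then show ?thesis by (rule power2_le_imp_le) simp
  qed
  have cd: "card A = d" "1 \<le> card A" using A d by auto
  have m1: "hausdorff_outer d T1 \<le> ennreal (6 * (2 * real d * 4 ^ d * flat_vol A))"
    unfolding T1_def using tube_measure_le[OF oeA cd(2), of 4 "-24" 6] cd by simp
  have m2: "hausdorff_outer d (G ` T2) \<le> ennreal (2 ^ d * (2 * real d * 4 ^ d * flat_vol A))"
  proof -
    have "hausdorff_outer d (G ` T2) \<le> ennreal (2 ^ d) * hausdorff_outer d T2"
      by (rule hausdorff_outer_lipschitz_image[OF _ lipG]) simp
    also have "hausdorff_outer d T2 \<le> hausdorff_outer d (tube e A 4 {0<..0 + real 1 * 4})"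
      by (rule hausdorff_outer_mono) (auto simp: T2_def)
    also have "\<dots> \<le> ennreal (2 * real d * 4 ^ d * flat_vol A)"
      using tube_measure_le[OF oeA cd(2), of 4 0 1] cd by simp
    finally show ?thesis by (simp add: ennreal_mult'[symmetric] mult_left_mono)
  qed
  have m3: "hausdorff_outer d (top ` T3) \<le> ennreal (6 ^ d * flat_vol A)"
  proof -
    have "hausdorff_outer d (top ` T3) \<le> ennreal ((3/2) ^ d) * hausdorff_outer d T3"
      by (rule hausdorff_outer_lipschitz_image) (use top_lipschitz in \<open>auto simp: T3_def flat_ball_def\<close>)
    also have "hausdorff_outer d T3 \<le> hausdorff_outer d (flat_ball A 4)"
      by (rule hausdorff_outer_mono) (auto simp: T3_def)
    also have "\<dots> = ennreal (flat_vol A * 4 ^ d)" using flat_ball_measure[OF oA cd(2), of 4] cd by simp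
    finally have "hausdorff_outer d (top ` T3) \<le> ennreal ((3/2) ^ d) * ennreal (flat_vol A * 4 ^ d)" by (simp add: mult_left_mono)
    moreover have "(3/2) ^ d * (flat_vol A * 4 ^ d) = 6 ^ d * flat_vol A"
    proof -
      have "(3/2::real) ^ d * 4 ^ d = 6 ^ d" by (simp flip: power_mult_distrib)
      then show ?thesis by (simp add: mult.left_commute mult.commute)
    qed
    ultimately show ?thesis by (simp add: ennreal_mult'[symmetric])
  qed
  have "hausdorff_outer d (C \<inter> cube) \<le> hausdorff_outer d (T1 \<union> (G ` T2 \<union> top ` T3))" by (rule hausdorff_outer_mono[OF cover])
  also have "\<dots> \<le> hausdorff_outer d T1 + (hausdorff_outer d (G ` T2) + hausdorff_outer d (top ` T3))"
    by (rule order_trans[OF hausdorff_outer_Un[OF d] add_left_mono[OF hausdorff_outer_Un[OF d]]])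
  also have "\<dots> \<le> ennreal (6 * (2 * real d * 4 ^ d * flat_vol A)) + (ennreal (2 ^ d * (2 * real d * 4 ^ d * flat_vol A)) + ennreal (6 ^ d * flat_vol A))"
    by (intro add_mono m1 m2 m3)
  also have "\<dots> = ennreal (6 * (2 * real d * 4 ^ d * flat_vol A) + (2 ^ d * (2 * real d * 4 ^ d * flat_vol A) + 6 ^ d * flat_vol A))"
    using v0 by simp
  also have "\<dots> \<le> ennreal (9 * real d * 8 ^ d * flat_vol A)"
  proof (rule ennreal_leI)
    have p1: "2 * (4::real) ^ d \<le> 8 ^ d"
    proof -
      have "(2::real) ^ 1 \<le> 2 ^ d" using d by (intro power_increasing) auto
      then have "2 * (4::real) ^ d \<le> 2 ^ d * 4 ^ d" by (intro mult_right_mono) auto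
      then show ?thesis by (simp flip: power_mult_distrib)
    qed
    have p2: "(2::real) ^ d * 4 ^ d = 8 ^ d" by (simp flip: power_mult_distrib)
    have p3: "(6::real) ^ d \<le> 8 ^ d" by (intro power_mono) auto
    have p4: "(8::real) ^ d \<le> real d * 8 ^ d" using d by simp
    have "12 * real d * 4 ^ d + 2 * real d * (2 ^ d * 4 ^ d) + 6 ^ d \<le> 9 * real d * 8 ^ d"
    proof -
      have "6 * real d * (2 * 4 ^ d) \<le> 6 * real d * 8 ^ d" by (rule mult_left_mono[OF p1]) simp
      then show ?thesis unfolding p2 using p3 p4 by linarith
    qed
    from mult_right_mono[OF this, of "flat_vol A"]
    show "6 * (2 * real d * 4 ^ d * flat_vol A) + (2 ^ d * (2 * real d * 4 ^ d * flat_vol A) + 6 ^ d * flat_vol A) \<le> 9 * real d * 8 ^ d * flat_vol A"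
      using v0 by (simp add: algebra_simps)
  qed
  finally show ?thesis .
qed

lemma C_port: "13 \<le> y \<bullet> (- e) \<Longrightarrow> y \<in> C \<longleftrightarrow> y \<in> tube (- e) A 4 UNIV"
proof -
  assume y: "13 \<le> y \<bullet> (- e)"
  have t: "tau y \<le> 0" using y bump_nonneg[of "q y"] by (simp add: tau_def)
  have me: "- e = (- s) *\<^sub>R i" "- s = 1 \<or> - s = - 1" using s by (auto simp: e_def)
  have "y \<in> C \<longleftrightarrow> (q y)\<^sup>2 = 16\<^sup>2 \<and> (\<forall>b\<in>Basis - A - {i}. y \<bullet> b = 0)" using t by (simp add: C_def max_absorb2)
  also have "(q y)\<^sup>2 = 16\<^sup>2 \<longleftrightarrow> q y = 16" using q_nonneg[of y] power2_eq_iff_nonneg[of "q y" 16] by simp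
  finally show ?thesis unfolding tube_axis_iff[OF me i A(1,2)] by (simp add: q_def)
qed

lemma C_piece: "piece d C {(- e, A)}"
  unfolding piece_def
proof (intro conjI ballI allI impI)
  show "closed C" by (rule closed_C)
  show "C2_chart d C p" if "p \<in> C" for p using that by (rule C_chart)
  show "\<exists>N. osculates d C p 1 N" if "p \<in> C" for p using that by (rule C_osculates)
  show "case r of (D', A') \<Rightarrow> D' \<in> sbasis \<and> A' \<subseteq> Basis \<and> card A' = d \<and> (\<forall>a\<in>A'. D' \<bullet> a = 0) \<and>
      (\<forall>y. 13 \<le> y \<bullet> D' \<longrightarrow> (y \<in> C) = (y \<in> tube D' A' 4 UNIV))" if "r \<in> {(- e, A)}" for r
    using that esb A ea C_port by auto
  show "\<exists>A'. (D', A') \<in> {(- e, A)}" if "y \<in> C" "D' \<in> sbasis" "13 \<le> y \<bullet> D'" for y D'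
  proof -
    note D' = that(2)
    obtain b r where b: "b \<in> Basis" "D' = r *\<^sub>R b" "r = 1 \<or> r = -1" using sbasisE[OF D'] by metis
    have "b = i"
    proof (rule ccontr)
      assume "b \<noteq> i"
      then have "\<bar>y \<bullet> b\<bar> \<le> 4" using C_coord[OF that(1) b(1)] by blast
      then show False using that(3) b by auto
    qed
    then have "D' = e \<or> D' = - e" using b s by (auto simp: e_def)
    then show ?thesis using C_bounds(3)[OF that(1)] that(3) by auto
  qed
  show "(\<Sum>k\<in>I. (y \<bullet> k)\<^sup>2) \<le> 16" if y: "y \<in> C" and I: "I \<subseteq> Basis" "\<forall>(D', A')\<in>{(- e, A)}. \<forall>k\<in>I. D' \<bullet> k = 0" for y I
  proof -
    have "i \<notin> I" using I(2) i s by (auto simp: e_def inner_Basis)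
    have "(\<Sum>k\<in>I. (y \<bullet> k)\<^sup>2) = (\<Sum>k\<in>I \<inter> A. (y \<bullet> k)\<^sup>2)"
      using y I(1) \<open>i \<notin> I\<close> finite_subset[OF I(1)] by (intro sum.mono_neutral_right) (auto simp: C_def)
    also have "\<dots> \<le> q y" unfolding q_def using finA by (intro sum_mono2) auto
    finally show ?thesis using C_bounds(1)[OF y] by simp
  qed
  show "hausdorff_outer d (C \<inter> cube) \<le> ennreal (22 * real d * 8 ^ d * flat_vol Z')"
    if "orthonormal Z'" "card Z' = d" for Z' :: "'a set"
  proof -
    have "flat_vol A = flat_vol Z'" using that A oA by (intro flat_vol_card) auto
    then have "hausdorff_outer d (C \<inter> cube) \<le> ennreal (9 * real d * 8 ^ d * flat_vol Z')" using C_measure by simp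
    also have "\<dots> \<le> ennreal (22 * real d * 8 ^ d * flat_vol Z')"
      using flat_vol_pos[OF that(1)] that d by (intro ennreal_leI mult_right_mono) auto
    finally show ?thesis .
  qed
qed

text \<open>A curve on the cap from the tip along the radius z and then down the tube to the face of
  the port. All meridians share the tip, which yields connectedness for every d, including d =
  1.\<close>

definition meridian :: "'a \<Rightarrow> 'a set" where
  "meridian z = (\<lambda>r. top (r *\<^sub>R z)) ` {0..4} \<union> (\<lambda>t. 4 *\<^sub>R z + t *\<^sub>R e) ` {-21..0}"

lemma top_zero: "top 0 = (4 + \<eta>) *\<^sub>R e"
proof -
  have "sqrt (256::real) = 16" "sqrt (16::real) = 4" by (rule real_sqrt_unique; simp)+
  then show ?thesis using \<delta> by (simp add: top_def bump_def)
qed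

lemma meridian:
  assumes z: "z \<in> span A" "norm z = 1"
  shows "connected (meridian z)" "meridian z \<subseteq> C \<inter> cube" "top 0 \<in> meridian z" "\<exists>x\<in>meridian z. x \<bullet> (- e) = 21"
proof -
  have top4: "top (4 *\<^sub>R z) = 4 *\<^sub>R z + 0 *\<^sub>R e"
    using z bump_zero[of 16] delta_sq by (simp add: top_def)
  have contt: "continuous_on X (\<lambda>r. top (r *\<^sub>R z))" for X
    unfolding top_def using cont_bump by (intro continuous_intros continuous_on_compose2[OF cont_bump[of UNIV]]) auto
  have "top (4 *\<^sub>R z) \<in> (\<lambda>r. top (r *\<^sub>R z)) ` {0..4}" by (rule image_eqI[of _ _ 4]) auto
  moreover have "top (4 *\<^sub>R z) \<in> (\<lambda>t. 4 *\<^sub>R z + t *\<^sub>R e) ` {-21..0}" unfolding top4 by (rule image_eqI[of _ _ 0]) auto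
  ultimately have "(\<lambda>r. top (r *\<^sub>R z)) ` {0..4} \<inter> (\<lambda>t. 4 *\<^sub>R z + t *\<^sub>R e) ` {-21..0} \<noteq> {}" by blast
  then show "connected (meridian z)" unfolding meridian_def
    by (intro connected_Un connected_continuous_image contt continuous_intros) auto
  show "top 0 \<in> meridian z" unfolding meridian_def by (auto intro!: image_eqI[of _ _ 0])
  have ze: "z \<bullet> e = 0" by (rule span_A(3)[OF z(1)])
  show "\<exists>x\<in>meridian z. x \<bullet> (- e) = 21"
  proof (rule bexI)
    show "(4 *\<^sub>R z + (-21) *\<^sub>R e) \<bullet> (- e) = 21" by (simp add: inner_diff_left ze ee)
    show "4 *\<^sub>R z + (-21) *\<^sub>R e \<in> meridian z" unfolding meridian_def by (intro UnI2 image_eqI[of _ _ "-21"]) auto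
  qed
  have inC: "meridian z \<subseteq> C"
  proof
    fix x assume "x \<in> meridian z"
    then consider r where "r \<in> {0..4}" "x = top (r *\<^sub>R z)" | t where "t \<in> {-21..0}" "x = 4 *\<^sub>R z + t *\<^sub>R e"
      by (auto simp: meridian_def)
    then show "x \<in> C"
    proof cases
      case 1
      then show ?thesis using z by (auto intro!: top_in_C span_mul)
    next
      case 2
      have qx: "q x = 16"
      proof -
        have "q x = q (4 *\<^sub>R z)" unfolding q_def by (intro sum.cong refl) (simp add: 2 inner_add_left ea)
        also have "\<dots> = (norm (4 *\<^sub>R z))\<^sup>2" by (rule span_A(2)) (use z in \<open>simp add: span_mul\<close>)
        finally show ?thesis using z by simp
      qed
      have "tau x = t" using bump_zero[of 16] delta_sq ze by (simp add: tau_def qx) (simp add: 2 inner_add_left ee)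
      moreover have "x \<bullet> b = 0" if "b \<in> Basis - A - {i}" for b
      proof -
        have "z \<bullet> b = 0" using z(1) that span_orthonormal_iff[OF orthonormal_Basis _ A(1), of z] by auto
        moreover have "e \<bullet> b = 0" using that i by (auto simp: e_def inner_Basis)
        ultimately show ?thesis by (simp add: 2 inner_add_left)
      qed
      ultimately show ?thesis using 2 qx by (simp add: C_def max_absorb2)
    qed
  qed
  have "x \<in> cube" if x: "x \<in> meridian z" for x
  proof -
    have "-21 \<le> x \<bullet> e"
    proof -
      have "0 \<le> top (r *\<^sub>R z) \<bullet> e" if "0 \<le> r" "r \<le> 4" for r
        using pow4_le_256[of r] that z bump_nonneg ze by (simp add: top_def inner_add_left ee)
      then show ?thesis using x by (force simp: meridian_def inner_add_left ze ee)
    qed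
    then have "\<bar>x \<bullet> e\<bar> \<le> 21" using C_bounds(3)[of x] inC x by auto
    then have "\<bar>x \<bullet> i\<bar> \<le> 21" using s by (auto simp: xi(1))
    then show ?thesis using C_coord[of x] inC x unfolding cube_def by force
  qed
  then show "meridian z \<subseteq> C \<inter> cube" using inC by blast
qed

lemma meridian_cover:
  assumes x: "x \<in> C \<inter> cube" shows "\<exists>z\<in>span A. norm z = 1 \<and> x \<in> meridian z"
proof (cases "zz x = 0")
  case True
  obtain a where a: "a \<in> A" using A d by (metis card.empty ex_in_conv not_one_le_zero)
  have "0 < tau x"
  proof (rule ccontr)
    assume "\<not> ?thesis"
    then have "q x = 16" using tau_nonpos[of x] x by auto
    then show False using norm_zz[of x] True by simp
  qed
  then have "x = top (0 *\<^sub>R a)" using top_zz[of x] x True by simp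
  then have "x \<in> meridian a" unfolding meridian_def by (auto intro!: image_eqI[of _ _ 0])
  then show ?thesis using a orthonormal_norm[OF oA a] span_base by blast
next
  case False
  define n where "n = norm (zz x)"
  define z where "z = (1 / n) *\<^sub>R zz x"
  have n: "0 < n" "zz x = n *\<^sub>R z" using False by (auto simp: n_def z_def)
  have z: "z \<in> span A" "norm z = 1" using zz_span[of x] False by (auto simp: z_def n_def span_mul)
  have "n\<^sup>2 \<le> 4\<^sup>2" using C_bounds(1)[of x] x norm_zz[of x] by (simp add: n_def)
  then have n4: "n \<le> 4" by (rule power2_le_imp_le) simp
  have "x \<in> meridian z"
  proof (cases "tau x \<le> 0")
    case True
    have "q x = 16" "x \<bullet> e \<le> 0" using tau_nonpos[of x] x True by auto
    then have "n\<^sup>2 = 4\<^sup>2" using norm_zz[of x] by (simp add: n_def)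
    then have "n = 4" using power2_eq_iff_nonneg[of n 4] n by simp
    then have "x = 4 *\<^sub>R z + (x \<bullet> e) *\<^sub>R e" using C_decomp[of x] x n by simp
    moreover have "x \<bullet> e \<in> {-21..0}" using C_cube_cover[of x] x \<open>x \<bullet> e \<le> 0\<close> by auto
    ultimately show ?thesis unfolding meridian_def by blast
  next
    case False
    then have "x = top (n *\<^sub>R z)" using top_zz[of x] x n by simp
    moreover have "n \<in> {0..4}" using n n4 by auto
    ultimately show ?thesis unfolding meridian_def by blast
  qed
  then show ?thesis using z by blast
qed

lemma C_strand: "strand C (- e)"
  by (rule strandI) (use meridian_cover meridian in meson)

lemma C_connected: "connected (C \<inter> cube)"
proof -
  have "C \<inter> cube = \<Union> (meridian ` {z \<in> span A. norm z = 1})" using meridian_cover meridian(2) by blast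
  moreover have "connected (\<Union> (meridian ` {z \<in> span A. norm z = 1}))"
    by (rule connected_Union) (use meridian(1,3) in blast)+
  ultimately show ?thesis by simp
qed

lemma tip: "(4 + \<eta>) *\<^sub>R e \<in> C \<inter> cube"
proof -
  obtain a where a: "a \<in> A" using A d by (metis card.empty ex_in_conv not_one_le_zero)
  have "top 0 \<in> meridian a" "meridian a \<subseteq> C \<inter> cube"
    using meridian[OF span_base[OF a] orthonormal_norm[OF oA a]] by auto
  then show ?thesis unfolding top_zero by blast
qed

end

subsection \<open>Assembling pieces along a path of cells\<close>

lemma tube_coord_le:
  assumes y: "y \<in> tube D A 4 UNIV" and D: "D \<in> sbasis" and A: "A \<subseteq> Basis" "\<forall>a\<in>A. D \<bullet> a = 0"
    and j: "j \<in> Basis" "D \<bullet> j = 0"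
  shows "\<bar>y \<bullet> j\<bar> \<le> 4"
proof -
  obtain i s where i: "i \<in> Basis" "D = s *\<^sub>R i" "s = 1 \<or> s = -1" using sbasisE[OF D] by metis
  have iA: "i \<notin> A" using A i by (auto simp: inner_Basis)
  have yy: "(\<Sum>a\<in>A. (y \<bullet> a)\<^sup>2) = 4\<^sup>2" "\<forall>b\<in>Basis - A - {i}. y \<bullet> b = 0"
    using y tube_axis_iff[OF i(2,3,1) A(1) iA] by auto
  have ji: "j \<noteq> i" using j i by (auto simp: inner_Basis)
  show ?thesis
  proof (cases "j \<in> A")
    case True
    have "(y \<bullet> j)\<^sup>2 \<le> (\<Sum>a\<in>A. (y \<bullet> a)\<^sup>2)"
      using True finite_subset[OF A(1) finite_Basis] by (intro member_le_sum) auto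
    then have "(y \<bullet> j)\<^sup>2 \<le> 4\<^sup>2" using yy by simp
    then show ?thesis by (rule abs_le_if_square_le) simp
  next
    case False
    then show ?thesis using yy(2) j ji by auto
  qed
qed

lemma tube_shift:
  assumes y: "y \<in> tube D A 4 UNIV" and D: "D \<in> sbasis" and A: "A \<subseteq> Basis" "\<forall>a\<in>A. D \<bullet> a = 0"
  shows "y + t *\<^sub>R D \<in> tube D A 4 UNIV" "y + t *\<^sub>R D \<in> tube (- D) A 4 UNIV"
proof -
  obtain i s where i: "i \<in> Basis" "D = s *\<^sub>R i" "s = 1 \<or> s = -1" using sbasisE[OF D] by metis
  have iA: "i \<notin> A" using A i by (auto simp: inner_Basis)
  have m: "- D = (- s) *\<^sub>R i" "- s = 1 \<or> - s = -1" using i by auto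
  have yy: "(\<Sum>a\<in>A. (y \<bullet> a)\<^sup>2) = 4\<^sup>2" "\<forall>b\<in>Basis - A - {i}. y \<bullet> b = 0"
    using y tube_axis_iff[OF i(2,3,1) A(1) iA] by auto
  have s: "(\<Sum>a\<in>A. ((y + t *\<^sub>R D) \<bullet> a)\<^sup>2) = (\<Sum>a\<in>A. (y \<bullet> a)\<^sup>2)"
    using A(2) by (intro sum.cong refl) (simp add: inner_add_left)
  have b: "\<forall>b\<in>Basis - A - {i}. (y + t *\<^sub>R D) \<bullet> b = 0"
  proof
    fix b assume b: "b \<in> Basis - A - {i}"
    then have "i \<bullet> b = 0" using i(1) by (auto simp: inner_Basis)
    then show "(y + t *\<^sub>R D) \<bullet> b = 0" using yy(2) b by (simp add: inner_add_left i(2))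
  qed
  note * = trans[OF s yy(1)] b
  show "y + t *\<^sub>R D \<in> tube D A 4 UNIV"
    unfolding tube_axis_iff[OF i(2,3,1) A(1) iA] using * by (rule conjI)
  show "y + t *\<^sub>R D \<in> tube (- D) A 4 UNIV"
    unfolding tube_axis_iff[OF m i(1) A(1) iA] using * by (rule conjI)
qed

lemma pieceD:
  fixes E Z :: "'a::euclidean_space set"
  assumes "piece d E P"
  shows "closed E" "p \<in> E \<Longrightarrow> C2_chart d E p" "p \<in> E \<Longrightarrow> \<exists>N. osculates d E p 1 N"
    "(D, A) \<in> P \<Longrightarrow> D \<in> sbasis" "(D, A) \<in> P \<Longrightarrow> A \<subseteq> Basis" "(D, A) \<in> P \<Longrightarrow> card A = d" "(D, A) \<in> P \<Longrightarrow> \<forall>a\<in>A. D \<bullet> a = 0"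
    "(D, A) \<in> P \<Longrightarrow> 13 \<le> y \<bullet> D \<Longrightarrow> y \<in> E \<longleftrightarrow> y \<in> tube D A 4 UNIV"
    "y \<in> E \<Longrightarrow> D \<in> sbasis \<Longrightarrow> 13 \<le> y \<bullet> D \<Longrightarrow> \<exists>A. (D, A) \<in> P"
    "y \<in> E \<Longrightarrow> I \<subseteq> Basis \<Longrightarrow> (\<And>D A i. (D, A) \<in> P \<Longrightarrow> i \<in> I \<Longrightarrow> D \<bullet> i = 0) \<Longrightarrow> (\<Sum>i\<in>I. (y \<bullet> i)\<^sup>2) \<le> 16"
    "orthonormal Z \<Longrightarrow> card Z = d \<Longrightarrow> hausdorff_outer d (E \<inter> cube) \<le> ennreal (22 * real d * 8 ^ d * flat_vol Z)"
proof -
  note a = assms[unfolded piece_def]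
  note a1 = conjunct1[OF a] and r1 = conjunct2[OF a]
  note a2 = conjunct1[OF r1] and r2 = conjunct2[OF r1]
  note a3 = conjunct1[OF r2] and r3 = conjunct2[OF r2]
  note a4 = conjunct1[OF r3] and r4 = conjunct2[OF r3]
  note a5 = conjunct1[OF r4] and r5 = conjunct2[OF r4]
  note a6 = conjunct1[OF r5] and a7 = conjunct2[OF r5]
  show "closed E" by (rule a1)
  show "p \<in> E \<Longrightarrow> C2_chart d E p" using a2 by (rule bspec)
  show "p \<in> E \<Longrightarrow> \<exists>N. osculates d E p 1 N" using a3 by (rule bspec)
  note port = bspec[OF a4, of "(D, A)", simplified]
  show "(D, A) \<in> P \<Longrightarrow> D \<in> sbasis" "(D, A) \<in> P \<Longrightarrow> A \<subseteq> Basis" "(D, A) \<in> P \<Longrightarrow> card A = d"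
    "(D, A) \<in> P \<Longrightarrow> \<forall>a\<in>A. D \<bullet> a = 0" using port by simp_all
  show "(D, A) \<in> P \<Longrightarrow> 13 \<le> y \<bullet> D \<Longrightarrow> y \<in> E \<longleftrightarrow> y \<in> tube D A 4 UNIV" using port by simp
  show "y \<in> E \<Longrightarrow> D \<in> sbasis \<Longrightarrow> 13 \<le> y \<bullet> D \<Longrightarrow> \<exists>A. (D, A) \<in> P" using a5 by simp
  show "(\<Sum>i\<in>I. (y \<bullet> i)\<^sup>2) \<le> 16"
    if "y \<in> E" "I \<subseteq> Basis" and p: "\<And>D A i. (D, A) \<in> P \<Longrightarrow> i \<in> I \<Longrightarrow> D \<bullet> i = 0"
  proof -
    have "\<forall>(D, A)\<in>P. \<forall>i\<in>I. D \<bullet> i = 0" using p by auto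
    then show ?thesis using a6 that(1,2) by simp
  qed
  show "orthonormal Z \<Longrightarrow> card Z = d \<Longrightarrow> hausdorff_outer d (E \<inter> cube) \<le> ennreal (22 * real d * 8 ^ d * flat_vol Z)"
    using a7 by simp
qed

lemma closed_cube: "closed cube"
proof -
  have "cube = (\<Inter>i\<in>Basis. {y::'a::euclidean_space. \<bar>y \<bullet> i\<bar> \<le> 21})" by (auto simp: cube_def)
  also have "closed \<dots>" by (intro closed_INT ballI closed_Collect_le continuous_intros)
  finally show ?thesis .
qed

lemma bounded_cube: "bounded (cube :: 'a::euclidean_space set)"
proof (rule boundedI)
  fix x :: 'a assume x: "x \<in> cube"
  have "norm x \<le> (\<Sum>i\<in>Basis. \<bar>x \<bullet> i\<bar>)" by (rule norm_le_l1)
  also have "\<dots> \<le> (\<Sum>i\<in>(Basis::'a set). 21)" using x by (intro sum_mono) (simp add: cube_def)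
  finally show "norm x \<le> (\<Sum>i\<in>(Basis::'a set). 21)" .
qed

lemma cubeD: "y \<in> cube \<Longrightarrow> D \<in> sbasis \<Longrightarrow> y \<bullet> D \<le> 21"
  by (auto simp: cube_def sbasis_def abs_le_iff)

lemma sbasis_dir:
  fixes x :: "'a::euclidean_space"
  assumes "i \<in> Basis" "x \<bullet> i \<noteq> 0"
  obtains D where "D \<in> sbasis" "x \<bullet> D = \<bar>x \<bullet> i\<bar>" "D = i \<or> D = - i"
  using assms that[of i] that[of "- i"] by (cases "0 \<le> x \<bullet> i") (auto simp: sbasis_def)

text \<open>\<open>E l\<close> is unbounded; only its part in the cube is placed, at 42 times the
  lattice point \<open>c l\<close>. Adjacent cells without a common port do not interfere, since a
  piece comes near a face of its cube only through a port.\<close>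

locale assembly =
  fixes d :: nat and N :: nat and c :: "nat \<Rightarrow> 'a::euclidean_space" and E :: "nat \<Rightarrow> 'a set" and P :: "nat \<Rightarrow> ('a \<times> 'a set) set"
  assumes d: "1 \<le> d"
    and pc: "\<And>l. l < N \<Longrightarrow> piece d (E l) (P l)"
    and lat: "\<And>l i. l < N \<Longrightarrow> i \<in> Basis \<Longrightarrow> c l \<bullet> i \<in> \<int>"
    and inj: "inj_on c {..<N}"
    and match: "\<And>l D A. l < N \<Longrightarrow> (D, A) \<in> P l \<Longrightarrow> \<exists>l'<N. c l' = c l + D \<and> (- D, A) \<in> P l'"
    and ports: "\<And>l. l < N \<Longrightarrow> P l \<noteq> {}"
begin

definition Q :: "nat \<Rightarrow> 'a set" where "Q l = (+) (42 *\<^sub>R c l) ` (E l \<inter> cube)"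
definition M :: "'a set" where "M = (\<Union>l<N. Q l)"

lemma Q_iff: "x \<in> Q l \<longleftrightarrow> x - 42 *\<^sub>R c l \<in> E l \<inter> cube"
proof
  assume "x - 42 *\<^sub>R c l \<in> E l \<inter> cube"
  then have "42 *\<^sub>R c l + (x - 42 *\<^sub>R c l) \<in> Q l" unfolding Q_def by blast
  then show "x \<in> Q l" by simp
qed (auto simp: Q_def)

text \<open>Moving the origin by 42 D turns the coordinate z . D into 42 - z . D in direction -D.
  Between 13 and 29 = 42 - 13 both neighbours therefore see the same straight tube.\<close>

lemma cross:
  assumes l: "l < N" and DA: "(D, A) \<in> P l" and z: "z \<in> E l" "13 \<le> z \<bullet> D" "z \<bullet> D \<le> 29"
  shows "\<exists>l'<N. c l' = c l + D \<and> (- D, A) \<in> P l' \<and> z - 42 *\<^sub>R D \<in> E l'"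
proof -
  obtain l' where l': "l' < N" "c l' = c l + D" "(- D, A) \<in> P l'" using match[OF l DA] by blast
  note D = pieceD(4,5,7)[OF pc[OF l] DA]
  have "z \<in> tube D A 4 UNIV" using z pieceD(8)[OF pc[OF l] DA] by simp
  then have t: "z + (- 42) *\<^sub>R D \<in> tube (- D) A 4 UNIV" by (rule tube_shift(2)[OF _ D])
  have "D \<bullet> D = 1" using sbasis_norm[OF D(1)] by (simp add: norm_eq_1)
  then have "13 \<le> (z + (- 42) *\<^sub>R D) \<bullet> (- D)" using z(3) by (simp add: inner_diff_left)
  then have "z + (- 42) *\<^sub>R D \<in> E l'" using t pieceD(8)[OF pc[OF l'(1)] l'(3)] by blast
  then show ?thesis using l' by auto
qed

text \<open>Points of two cells within distance 2 are close to a common face, hence in the straight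
  tube behind a port, and \<open>cross\<close> recognises the foreign point as a point of
  \<open>E l\<close>. Charts and osculation are thus inherited from the unbounded pieces. From
  distance 2 on, the osculation inequality with radius 1 is just Cauchy-Schwarz; this is the reason
  for the radius 2.\<close>

lemma local_structure:
  assumes l: "l < N" and p: "p - 42 *\<^sub>R c l \<in> E l \<inter> cube"
  shows "M \<inter> ball p 2 = (+) (42 *\<^sub>R c l) ` E l \<inter> ball p 2"
proof (intro set_eqI iffI)
  define y where "y = p - 42 *\<^sub>R c l"
  have y: "y \<in> E l" "y \<in> cube" using p by (auto simp: y_def)
  fix x assume x: "x \<in> M \<inter> ball p 2"
  then obtain l' where l': "l' < N" "x - 42 *\<^sub>R c l' \<in> E l' \<inter> cube" by (auto simp: M_def Q_iff)
  define y' where "y' = x - 42 *\<^sub>R c l'"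
  have y': "y' \<in> E l'" "y' \<in> cube" using l' by (auto simp: y'_def)
  have dxp: "norm (x - p) < 2" using x by (simp add: dist_norm norm_minus_commute)
  have close: "\<bar>(x - p) \<bullet> D\<bar> < 2" if "D \<in> sbasis" for D
    using Cauchy_Schwarz_ineq2[of "x - p" D] sbasis_norm[OF that] dxp by simp
  have eqn: "x - p = 42 *\<^sub>R (c l' - c l) + (y' - y)" by (simp add: y_def y'_def algebra_simps)
  \<comment> \<open>If the lattice points differ by m in direction D, then 42 m - 42 \<le> (x - p) .
    D < 2. Integrality leaves m = 1, and both points are within 2 of the face.\<close>
  have step: "(c l' - c l) \<bullet> D = 1 \<and> 19 \<le> y \<bullet> D \<and> y' \<bullet> D \<le> - 19"
    if i: "i \<in> Basis" "(c l' - c l) \<bullet> i \<noteq> 0" and D: "D \<in> sbasis" "(c l' - c l) \<bullet> D = \<bar>(c l' - c l) \<bullet> i\<bar>" for i D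
  proof -
    have "(c l' - c l) \<bullet> i \<in> \<int>" using lat[OF l i(1)] lat[OF l'(1) i(1)] by (simp add: inner_diff_left)
    then obtain k :: int where k: "(c l' - c l) \<bullet> i = k" by (auto elim: Ints_cases)
    define m where "m = \<bar>k\<bar>"
    have m: "1 \<le> m" "(c l' - c l) \<bullet> D = real_of_int m" using i(2) D(2) k by (auto simp: m_def)
    have "(x - p) \<bullet> D = 42 * real_of_int m + (y' \<bullet> D - y \<bullet> D)"
      unfolding eqn by (simp only: inner_add_left inner_diff_left inner_scaleR_left m(2)[unfolded inner_diff_left])
    moreover have "y \<bullet> D \<le> 21" by (rule cubeD[OF y(2) D(1)])
    moreover have "- (y' \<bullet> D) \<le> 21" using cubeD[OF y'(2) sbasis_uminus[OF D(1)]] by simp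
    ultimately have "42 * real_of_int m < 44" "42 * real_of_int m - 23 < y \<bullet> D" "y' \<bullet> D < 23 - 42 * real_of_int m" using close[OF D(1)] by auto
    moreover from this(1) have "m = 1" using m(1) by linarith
    ultimately show ?thesis using m(2) by simp
  qed
  have "x - 42 *\<^sub>R c l \<in> E l"
  proof (cases "c l = c l'")
    case True
    then have "l = l'" by (rule inj_onD[OF inj]) (use l l'(1) in auto)
    then show ?thesis using y' by (simp add: y'_def)
  next
    case False
    then obtain i where i: "i \<in> Basis" "(c l' - c l) \<bullet> i \<noteq> 0"
      using euclidean_eqI[of "c l' - c l" 0] by auto
    obtain D where D: "D \<in> sbasis" "(c l' - c l) \<bullet> D = \<bar>(c l' - c l) \<bullet> i\<bar>" "D = i \<or> D = - i"
      using sbasis_dir[OF i] by metis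
    note s = step[OF i D(1,2)]
    obtain A where A: "(D, A) \<in> P l" using pieceD(9)[OF pc[OF l] y(1) D(1)] s by auto
    note DA = pieceD(4,5,7)[OF pc[OF l] A]
    have yt: "y \<in> tube D A 4 UNIV" by (rule iffD1[OF pieceD(8)[OF pc[OF l] A] y(1)]) (use s in linarith)
    have "c l' - c l = D"
    proof (rule euclidean_eqI)
      fix j :: 'a assume j: "j \<in> Basis"
      show "(c l' - c l) \<bullet> j = D \<bullet> j"
      proof (cases "j = i")
        case True
        then show ?thesis using s D(2,3) i(1) by (auto simp: inner_Basis)
      next
        case False
        have Dj: "D \<bullet> j = 0" using False D(3) i(1) j by (auto simp: inner_Basis)
        \<comment> \<open>Diagonal neighbours are excluded: coordinate j would have to reach 19 as
          well, but the tube through the port has radius 4.\<close>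
        have "(c l' - c l) \<bullet> j = 0"
        proof (rule ccontr)
          assume nz: "(c l' - c l) \<bullet> j \<noteq> 0"
          obtain D' where D': "D' \<in> sbasis" "(c l' - c l) \<bullet> D' = \<bar>(c l' - c l) \<bullet> j\<bar>" "D' = j \<or> D' = - j"
            using sbasis_dir[OF j nz] by metis
          have "19 \<le> y \<bullet> D'" using step[OF j nz D'(1,2)] by simp
          moreover have "\<bar>y \<bullet> j\<bar> \<le> 4" by (rule tube_coord_le[OF yt DA j Dj])
          ultimately show False using D'(3) by auto
        qed
        then show ?thesis using Dj by simp
      qed
    qed
    then have cl': "c l' = c l + D" by (simp add: algebra_simps)
    obtain l'' where l'': "l'' < N" "c l'' = c l + D" "(- D, A) \<in> P l''" using match[OF l A] by blast
    have "l'' = l'" by (rule inj_onD[OF inj]) (use l'' l'(1) cl' in auto)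
    then have A': "(- D, A) \<in> P l'" using l'' by simp
    have "13 \<le> y' \<bullet> (- D)" "y' \<bullet> (- D) \<le> 29" using s cubeD[OF y'(2) sbasis_uminus[OF D(1)]] by auto
    then obtain l3 where l3: "l3 < N" "c l3 = c l' + (- D)" "y' - 42 *\<^sub>R (- D) \<in> E l3"
      using cross[OF l'(1) A' y'(1)] by blast
    have "l3 = l" by (rule inj_onD[OF inj]) (use l3 l cl' in auto)
    moreover have "y' - 42 *\<^sub>R (- D) = x - 42 *\<^sub>R c l" by (simp add: y'_def cl' algebra_simps)
    ultimately show ?thesis using l3(3) by simp
  qed
  then have "42 *\<^sub>R c l + (x - 42 *\<^sub>R c l) \<in> (+) (42 *\<^sub>R c l) ` E l" by blast
  then show "x \<in> (+) (42 *\<^sub>R c l) ` E l \<inter> ball p 2" using x by simp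
next
  define y where "y = p - 42 *\<^sub>R c l"
  have y: "y \<in> E l" "y \<in> cube" using p by (auto simp: y_def)
  fix x assume x: "x \<in> (+) (42 *\<^sub>R c l) ` E l \<inter> ball p 2"
  then obtain z where z: "z \<in> E l" "x = 42 *\<^sub>R c l + z" by blast
  have xp: "x - p = z - y" by (simp add: z(2) y_def)
  have dxp: "norm (x - p) < 2" using x by (simp add: dist_norm norm_minus_commute)
  have "x \<in> M"
  proof (cases "z \<in> cube")
    case True
    then have "x \<in> Q l" using z by (simp add: Q_iff)
    then show ?thesis using l by (auto simp: M_def)
  next
    case False
    then obtain i where i: "i \<in> Basis" "21 < \<bar>z \<bullet> i\<bar>" by (auto simp: cube_def not_le)
    then have "z \<bullet> i \<noteq> 0" by auto
    from sbasis_dir[OF i(1) this] obtain D where D: "D \<in> sbasis" "z \<bullet> D = \<bar>z \<bullet> i\<bar>" "D = i \<or> D = - i" by metis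
    have zD: "21 < z \<bullet> D" using D i by simp
    obtain A where A: "(D, A) \<in> P l" using pieceD(9)[OF pc[OF l] z(1) D(1)] zD by auto
    note DA = pieceD(4,5,7)[OF pc[OF l] A]
    have "(z - y) \<bullet> D < 2" using Cauchy_Schwarz_ineq2[of "z - y" D] sbasis_norm[OF D(1)] dxp xp by simp
    then have z23: "z \<bullet> D < 23" using cubeD[OF y(2) D(1)] by (simp add: inner_diff_left)
    obtain l' where l': "l' < N" "c l' = c l + D" "z - 42 *\<^sub>R D \<in> E l'"
      using cross[OF l A z(1)] zD z23 by auto
    have zt: "z \<in> tube D A 4 UNIV" by (rule iffD1[OF pieceD(8)[OF pc[OF l] A] z(1)]) (use zD in linarith)
    have "z - 42 *\<^sub>R D \<in> cube" unfolding cube_def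
    proof (intro CollectI ballI)
      fix j :: 'a assume j: "j \<in> Basis"
      show "\<bar>(z - 42 *\<^sub>R D) \<bullet> j\<bar> \<le> 21"
      proof (cases "j = i")
        case True
        then have "(z - 42 *\<^sub>R D) \<bullet> j = z \<bullet> i - 42 * (D \<bullet> i)" by (simp add: inner_diff_left)
        moreover have "D \<bullet> i = 1 \<and> z \<bullet> i = z \<bullet> D \<or> D \<bullet> i = -1 \<and> z \<bullet> i = - (z \<bullet> D)" using D(3) i(1) by auto
        ultimately show ?thesis using zD z23 by linarith
      next
        case False
        then have Dj: "D \<bullet> j = 0" using D(3) i(1) j by (auto simp: inner_Basis)
        then show ?thesis using tube_coord_le[OF zt DA j Dj] by (simp add: inner_diff_left)
      qed
    qed
    moreover have "x - 42 *\<^sub>R c l' = z - 42 *\<^sub>R D" by (simp add: z(2) l'(2) algebra_simps)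
    ultimately have "x \<in> Q l'" using l' by (simp add: Q_iff)
    then show ?thesis using l' by (auto simp: M_def)
  qed
  then show "x \<in> M \<inter> ball p 2" using x by simp
qed

lemma compact_Q: "l < N \<Longrightarrow> compact (Q l)"
proof -
  assume l: "l < N"
  have "compact (E l \<inter> cube)"
    using pieceD(1)[OF pc[OF l]] closed_cube bounded_cube by (auto simp: compact_eq_bounded_closed intro: bounded_subset)
  then show ?thesis unfolding Q_def by (rule compact_translation)
qed

lemma compact_M: "compact M" unfolding M_def by (intro compact_UN finite_lessThan compact_Q) auto

lemma M_chart: assumes "p \<in> M" shows "C2_chart d M p"
proof -
  obtain l where l: "l < N" "p - 42 *\<^sub>R c l \<in> E l \<inter> cube" using assms by (auto simp: M_def Q_iff)
  have "C2_chart d (E l) (p - 42 *\<^sub>R c l)" using pieceD(2)[OF pc[OF l(1)]] l(2) by blast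
  from C2_chart_affine[OF this, of 1 "42 *\<^sub>R c l"]
  have "C2_chart d ((+) (42 *\<^sub>R c l) ` E l) p" by (simp add: add.commute[of _ "42 *\<^sub>R c l"])
  then show ?thesis using local_structure[OF l] by (intro C2_chart_local[of "ball p 2" p M]) auto
qed

text \<open>A local bound becomes global: points at distance less than 2 belong to the same
  unbounded piece, for all others the inequality is Cauchy-Schwarz.\<close>

lemma M_osculates: assumes "p \<in> M" shows "\<exists>N. osculates d M p 1 N"
proof -
  obtain l where l: "l < N" "p - 42 *\<^sub>R c l \<in> E l \<inter> cube" using assms by (auto simp: M_def Q_iff)
  define y where "y = p - 42 *\<^sub>R c l"
  have "\<exists>N. osculates d (E l) y 1 N" using pieceD(3)[OF pc[OF l(1)]] l(2) by (auto simp: y_def)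
  then obtain W where W: "subspace W" "DIM('a) \<le> dim W + d"
    "\<And>v q. v \<in> W \<Longrightarrow> q \<in> E l \<Longrightarrow> \<bar>(q - y) \<bullet> v\<bar> \<le> norm v * (norm (q - y))\<^sup>2 / (2 * 1)"
    unfolding osculates_def by blast
  have "\<bar>(q - p) \<bullet> v\<bar> \<le> norm v * (norm (q - p))\<^sup>2 / (2 * 1)" if v: "v \<in> W" and q: "q \<in> M" for v q
  proof (cases "norm (q - p) < 2")
    case True
    then have "q \<in> M \<inter> ball p 2" using q by (simp add: dist_norm norm_minus_commute)
    then obtain z where z: "z \<in> E l" "q = 42 *\<^sub>R c l + z" unfolding local_structure[OF l] by blast
    have eq: "q - p = z - y" by (simp add: y_def z(2))
    show ?thesis unfolding eq by (rule W(3)[OF v z(1)])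
  next
    case False
    have "\<bar>(q - p) \<bullet> v\<bar> \<le> norm v * norm (q - p)" using Cauchy_Schwarz_ineq2[of "q - p" v] by (simp add: mult.commute)
    also have "norm v * norm (q - p) \<le> norm v * ((norm (q - p))\<^sup>2 / 2)"
      using mult_left_mono[of 2 "norm (q - p)" "norm (q - p)"] False by (intro mult_left_mono) (simp_all add: power2_eq_square)
    finally show ?thesis by simp
  qed
  then have "osculates d M p 1 W" using W(1,2) by (simp add: osculates_def)
  then show ?thesis by blast
qed

lemma M_measure_le:
  assumes "\<And>l. l < N \<Longrightarrow> hausdorff_outer d (E l \<inter> cube) \<le> ennreal b" "0 \<le> b"
  shows "hausdorff_outer d M \<le> ennreal (real N * b)"
proof -
  have "hausdorff_outer d M \<le> (\<Sum>l<N. hausdorff_outer d (Q l))" unfolding M_def by (rule hausdorff_outer_finite_UN[OF d]) simp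
  also have "\<dots> \<le> (\<Sum>l<N. ennreal b)" by (intro sum_mono) (auto simp: Q_def hausdorff_outer_translation assms)
  also have "\<dots> = ennreal (real N * b)" using assms(2) by (simp add: ennreal_of_nat_eq_real_of_nat ennreal_mult')
  finally show ?thesis .
qed

text \<open>7/8 = 7/4 times 1/2, a stretch of length 7 against the lower bound for length 4. Every
  piece contains this stretch behind a port; it ends at 20, before the face at 21, so that stretches
  of different cells are disjoint.\<close>

lemma tube_seven:
  assumes Z: "orthonormal (insert e Z)" "e \<notin> Z" "card Z = d"
  shows "ennreal (7/8 * real d * 4 ^ d * flat_vol Z) \<le> hausdorff_outer d (tube e Z 4 {13<..13 + real 7 * 1})"
proof -
  define t where "t = hausdorff_outer d (tube e Z 4 {0<..1})"
  have "ennreal (real 1 * (1/2 * card Z * 4 ^ card Z * flat_vol Z)) \<le> hausdorff_outer (card Z) (tube e Z 4 {0<..0 + real 1 * 4})"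
    using d Z by (intro tube_measure_ge) auto
  also have "\<dots> = of_nat 4 * t" unfolding t_def
    using tube_measure_multiple[OF Z(1,2) d, of 4 1 0 4] Z(3) by simp
  finally have "ennreal (1/2 * d * 4 ^ d * flat_vol Z) \<le> of_nat 4 * t" using Z(3) by simp
  then have "ennreal (7/4) * ennreal (1/2 * d * 4 ^ d * flat_vol Z) \<le> ennreal (7/4) * (of_nat 4 * t)" by (rule mult_left_mono) simp
  moreover have "ennreal (7/4) * (of_nat 4 * t) = of_nat 7 * t"
  proof -
    have "ennreal (7/4) * of_nat 4 = of_nat 7"
      unfolding ennreal_of_nat_eq_real_of_nat by (subst ennreal_mult'[symmetric]) auto
    then show ?thesis by (simp only: mult.assoc[symmetric])
  qed
  moreover have "ennreal (7/4) * ennreal (1/2 * d * 4 ^ d * flat_vol Z) = ennreal (7/8 * real d * 4 ^ d * flat_vol Z)"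
    by (subst ennreal_mult'[symmetric]) (auto simp: mult_ac)
  moreover have "hausdorff_outer d (tube e Z 4 {13<..13 + real 7 * 1}) = of_nat 7 * t"
    unfolding t_def by (rule tube_measure_multiple[OF Z(1,2) d]) auto
  ultimately show ?thesis by simp
qed

lemma M_measure_ge:
  assumes Z: "orthonormal (Z :: 'a set)" "card Z = d"
  shows "ennreal (real N * (7/8 * real d * 4 ^ d * flat_vol Z)) \<le> hausdorff_outer d M"
proof -
  have "\<exists>D A. (D, A) \<in> P l" if "l < N" for l using ports[OF that] by auto
  then obtain D A where DA: "\<And>l. l < N \<Longrightarrow> (D l, A l) \<in> P l" by metis
  define L where "L l = (+) (42 *\<^sub>R c l) ` tube (D l) (A l) 4 {13<..13 + real 7 * 1}" for l
  have small: "y \<in> E l" "\<And>j. j \<in> Basis \<Longrightarrow> \<bar>y \<bullet> j\<bar> \<le> 20"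
    if l: "l < N" and y: "y \<in> tube (D l) (A l) 4 {13<..13 + real 7 * 1}" for l y
  proof -
    note Dl = pieceD(4,5,7)[OF pc[OF l] DA[OF l]]
    have yD: "13 < y \<bullet> D l" "y \<bullet> D l \<le> 20" and yt: "y \<in> tube (D l) (A l) 4 UNIV" using y by (auto simp: tube_def)
    show "y \<in> E l" using yD yt pieceD(8)[OF pc[OF l] DA[OF l]] by simp
    fix j :: 'a assume j: "j \<in> Basis"
    obtain i s where i: "i \<in> Basis" "D l = s *\<^sub>R i" "s = 1 \<or> s = -1" using sbasisE[OF Dl(1)] by metis
    show "\<bar>y \<bullet> j\<bar> \<le> 20"
    proof (cases "j = i")
      case True then show ?thesis using yD i by auto
    next
      case False
      then have "D l \<bullet> j = 0" using i j by (auto simp: inner_Basis)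
      then show ?thesis using tube_coord_le[OF yt Dl j] by simp
    qed
  qed
  have "disjoint_family_on L {..<N}"
    unfolding disjoint_family_on_def
  proof (intro ballI impI)
    fix l l' assume l: "l \<in> {..<N}" "l' \<in> {..<N}" "l \<noteq> l'"
    show "L l \<inter> L l' = {}"
    proof (rule ccontr)
      assume "L l \<inter> L l' \<noteq> {}"
      then obtain x where "x \<in> L l" "x \<in> L l'" by blast
      then obtain y y' where y: "y \<in> tube (D l) (A l) 4 {13<..13 + real 7 * 1}" "y' \<in> tube (D l') (A l') 4 {13<..13 + real 7 * 1}"
        "42 *\<^sub>R c l + y = 42 *\<^sub>R c l' + y'" unfolding L_def by auto
      have "c l \<noteq> c l'" using inj_on_eq_iff[OF inj, of l l'] l by auto
      then obtain i where i: "i \<in> Basis" "(c l' - c l) \<bullet> i \<noteq> 0" using euclidean_eqI[of "c l' - c l" 0] by auto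
      have "(c l' - c l) \<bullet> i \<in> \<int>" using lat[of l i] lat[of l' i] l i by (simp add: inner_diff_left)
      then have "1 \<le> \<bar>(c l' - c l) \<bullet> i\<bar>" using i(2) by (auto elim!: Ints_cases simp del: inner_diff_left)
      moreover have "42 * ((c l' - c l) \<bullet> i) = y \<bullet> i - y' \<bullet> i"
      proof -
        have "42 *\<^sub>R (c l' - c l) = y - y'" using y(3) by (simp add: algebra_simps)
        then have "(42 *\<^sub>R (c l' - c l)) \<bullet> i = (y - y') \<bullet> i" by simp
        then show ?thesis by (simp only: inner_scaleR_left inner_diff_left)
      qed
      moreover have "\<bar>y \<bullet> i\<bar> \<le> 20" "\<bar>y' \<bullet> i\<bar> \<le> 20" using small(2)[OF _ y(1) i(1)] small(2)[OF _ y(2) i(1)] l by auto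
      ultimately show False by linarith
    qed
  qed
  moreover have bL: "L l \<in> sets borel" for l
  proof -
    have "L l = (\<lambda>x. x - 42 *\<^sub>R c l) -` tube (D l) (A l) 4 {13<..13 + real 7 * 1} \<inter> space borel"
      unfolding L_def by (auto intro!: image_eqI[of _ _ "_ - 42 *\<^sub>R c l"])
    also have "\<dots> \<in> sets borel" by (rule measurable_sets[of "\<lambda>x. x - 42 *\<^sub>R c l" borel borel]) (auto intro!: borel_tube)
    finally show ?thesis .
  qed
  ultimately have "(\<Sum>l<N. hausdorff_outer d (L l)) = hausdorff_outer d (\<Union>l<N. L l)"
    by (intro hausdorff_outer_UN_disjoint[OF d, symmetric]) auto
  also have "\<dots> \<le> hausdorff_outer d M"
  proof (rule hausdorff_outer_mono, safe)
    fix x l assume l: "l < N" "x \<in> L l"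
    then obtain y where y: "y \<in> tube (D l) (A l) 4 {13<..13 + real 7 * 1}" "x = 42 *\<^sub>R c l + y" unfolding L_def by blast
    have "y \<in> E l \<inter> cube" using small[OF l(1) y(1)] by (force simp: cube_def)
    then have "x \<in> Q l" by (simp add: Q_iff y(2))
    then show "x \<in> M" using l by (auto simp: M_def)
  qed
  finally have "(\<Sum>l<N. hausdorff_outer d (L l)) \<le> hausdorff_outer d M" .
  moreover have "(\<Sum>l<N. ennreal (7/8 * real d * 4 ^ d * flat_vol Z)) \<le> (\<Sum>l<N. hausdorff_outer d (L l))"
  proof (rule sum_mono)
    fix l assume l: "l \<in> {..<N}"
    then have l': "l < N" by simp
    note Dl = pieceD(4,5,6,7)[OF pc[OF l'] DA[OF l']]
    have oA: "orthonormal (A l)" by (rule orthonormal_subset[OF orthonormal_Basis Dl(2)])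
    have DD: "D l \<bullet> D l = 1" using sbasis_norm[OF Dl(1)] by (simp add: norm_eq_1)
    have nA: "D l \<notin> A l" using Dl(4) DD by force
    have "orthonormal (insert (D l) (A l))"
    proof -
      have "\<forall>a\<in>A l. a \<bullet> D l = 0" using Dl(4) by (simp only: inner_commute[of _ "D l"])
      then show ?thesis unfolding orthonormal_def
        using oA[unfolded orthonormal_def] DD Dl(4) nA by auto
    qed
    from tube_seven[OF this nA Dl(3)]
    show "ennreal (7/8 * real d * 4 ^ d * flat_vol Z) \<le> hausdorff_outer d (L l)"
      using flat_vol_card[OF oA Z(1)] Dl(3) Z(2) by (simp add: L_def hausdorff_outer_translation)
  qed
  moreover have "(\<Sum>l<N. ennreal (7/8 * real d * 4 ^ d * flat_vol Z)) = ennreal (real N * (7/8 * real d * 4 ^ d * flat_vol Z))"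
    unfolding sum_constant card_lessThan ennreal_of_nat_eq_real_of_nat by (rule ennreal_mult'[symmetric]) simp
  ultimately show ?thesis by simp
qed

text \<open>Only the first cell is connected by itself. Each point of a later cell is joined by a
  strand to a face shared with its predecessor, so the union of the first cells grows by connected
  sets that meet it.\<close>

lemma M_connected:
  assumes start: "connected (E 0 \<inter> cube)" "E 0 \<inter> cube \<noteq> {}"
    and str: "\<And>l. Suc l < N \<Longrightarrow> \<exists>D A. (D, A) \<in> P (Suc l) \<and> c l = c (Suc l) + D \<and> strand (E (Suc l)) D"
  shows "connected M"
proof -
  have "connected (\<Union>l<k. Q l) \<and> (0 < k \<longrightarrow> (\<Union>l<k. Q l) \<noteq> {})" if "k \<le> N" for k
    using that
  proof (induction k)
    case (Suc k)
    show ?case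
    proof (cases k)
      case 0
      have "connected (Q 0)" unfolding Q_def by (intro connected_continuous_image start(1) continuous_intros)
      moreover have "Q 0 \<noteq> {}" using start(2) by (simp add: Q_def)
      moreover have "(\<Union>l<Suc k. Q l) = Q 0" using 0 by auto
      ultimately show ?thesis by simp
    next
      case (Suc m)
      define U where "U = (\<Union>l<k. Q l)"
      have U: "connected U" "U \<noteq> {}" using Suc.IH Suc.prems Suc by (auto simp: U_def)
      obtain D A where DA: "(D, A) \<in> P k" "c m = c k + D" "strand (E k) D" using str[of m] Suc Suc.prems by auto
      have kN: "k < N" "m < N" using Suc.prems Suc by auto
      have "\<exists>S. connected S \<and> x \<in> S \<and> S \<subseteq> Q k \<and> S \<inter> U \<noteq> {}" if x: "x \<in> Q k" for x
      proof -
        have "x - 42 *\<^sub>R c k \<in> E k \<inter> cube" using x by (simp add: Q_iff)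
        then obtain S z where S: "connected S" "x - 42 *\<^sub>R c k \<in> S" "S \<subseteq> E k \<inter> cube" "z \<in> S" "z \<bullet> D = 21"
          using DA(3) unfolding strand_def by blast
        note Dl = pieceD(4,5,7)[OF pc[OF kN(1)] DA(1)]
        have zE: "z \<in> E k" "z \<in> cube" using S by auto
        obtain l' where l': "l' < N" "c l' = c k + D" "z - 42 *\<^sub>R D \<in> E l'" using cross[OF kN(1) DA(1) zE(1)] S(5) by auto
        have "l' = m" by (rule inj_onD[OF inj]) (use l' DA(2) kN in auto)
        have zt: "z \<in> tube D A 4 UNIV" by (rule iffD1[OF pieceD(8)[OF pc[OF kN(1)] DA(1)] zE(1)]) (use S(5) in linarith)
        obtain i s where i: "i \<in> Basis" "D = s *\<^sub>R i" "s = 1 \<or> s = -1" using sbasisE[OF Dl(1)] by metis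
        have "z - 42 *\<^sub>R D \<in> cube" unfolding cube_def
        proof (intro CollectI ballI)
          fix j :: 'a assume j: "j \<in> Basis"
          show "\<bar>(z - 42 *\<^sub>R D) \<bullet> j\<bar> \<le> 21"
          proof (cases "j = i")
            case True
            then have "(z - 42 *\<^sub>R D) \<bullet> j = z \<bullet> i - 42 * (D \<bullet> i)" by (simp add: inner_diff_left)
            moreover have "D \<bullet> i = s" "s * (z \<bullet> i) = 21" using S(5) i(1,2) by auto
            ultimately show ?thesis using i(3) by auto
          next
            case False
            then have Dj: "D \<bullet> j = 0" using i j by (auto simp: inner_Basis)
            then show ?thesis using tube_coord_le[OF zt Dl j Dj] by (simp add: inner_diff_left)
          qed
        qed
        moreover have eq: "(42 *\<^sub>R c k + z) - 42 *\<^sub>R c m = z - 42 *\<^sub>R D" by (simp add: DA(2) algebra_simps)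
        ultimately have "42 *\<^sub>R c k + z \<in> Q m" unfolding Q_iff eq using l'(3) \<open>l' = m\<close> by simp
        then have "42 *\<^sub>R c k + z \<in> U" using Suc by (auto simp: U_def)
        moreover have "42 *\<^sub>R c k + z \<in> (+) (42 *\<^sub>R c k) ` S" using S(4) by blast
        moreover have "x \<in> (+) (42 *\<^sub>R c k) ` S" using S(2) by (metis add.commute diff_add_cancel image_eqI)
        moreover have "(+) (42 *\<^sub>R c k) ` S \<subseteq> Q k" using S(3) unfolding Q_def by blast
        moreover have "connected ((+) (42 *\<^sub>R c k) ` S)" by (intro connected_continuous_image S(1) continuous_intros)
        ultimately show ?thesis
          by (intro exI[of _ "(+) (42 *\<^sub>R c k) ` S"]) blast
      qed
      then obtain S where S: "\<And>x. x \<in> Q k \<Longrightarrow> connected (S x) \<and> x \<in> S x \<and> S x \<subseteq> Q k \<and> S x \<inter> U \<noteq> {}" by metis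
      have "connected (\<Union> (insert U ((\<lambda>x. U \<union> S x) ` Q k)))"
      proof (rule connected_Union)
        fix T assume "T \<in> insert U ((\<lambda>x. U \<union> S x) ` Q k)"
        then show "connected T"
        proof
          assume "T = U" then show ?thesis using U by simp
        next
          assume "T \<in> (\<lambda>x. U \<union> S x) ` Q k"
          then obtain x where x: "x \<in> Q k" "T = U \<union> S x" by blast
          have "U \<inter> S x \<noteq> {}" using S[OF x(1)] by blast
          then show ?thesis unfolding x(2) using S[OF x(1)] U by (intro connected_Un) auto
        qed
      next
        show "\<Inter> (insert U ((\<lambda>x. U \<union> S x) ` Q k)) \<noteq> {}" using U(2) by auto
      qed
      moreover have "\<Union> (insert U ((\<lambda>x. U \<union> S x) ` Q k)) = (\<Union>l<Suc k. Q l)"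
      proof -
        have "\<Union> (insert U ((\<lambda>x. U \<union> S x) ` Q k)) = U \<union> Q k" using S by blast
        also have "\<dots> = (\<Union>l<Suc k. Q l)" by (auto simp: U_def less_Suc_eq)
        finally show ?thesis .
      qed
      moreover have "(\<Union>l<Suc k. Q l) \<noteq> {}" using U(2) by (auto simp: U_def less_Suc_eq)
      ultimately show ?thesis by simp
    qed
  qed simp
  then show ?thesis unfolding M_def by blast
qed

text \<open>In the coordinates of \<open>J\<close> the block of cells is a cube of half side 21 m
  centred at 21 (m - 1). In the others the pieces stay within the tube radius 4, by the clause on
  \<open>I\<close> in \<open>piece\<close>.\<close>

lemma M_norm:
  assumes x: "x \<in> M" and J: "J \<subseteq> Basis" "\<And>l D A i. l < N \<Longrightarrow> (D, A) \<in> P l \<Longrightarrow> i \<in> Basis - J \<Longrightarrow> D \<bullet> i = 0"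
    and c: "\<And>l i. l < N \<Longrightarrow> i \<in> Basis - J \<Longrightarrow> c l \<bullet> i = 0" "\<And>l i. l < N \<Longrightarrow> i \<in> J \<Longrightarrow> 0 \<le> c l \<bullet> i \<and> c l \<bullet> i \<le> real m - 1"
  shows "norm (x - (\<Sum>i\<in>J. (21 * (real m - 1)) *\<^sub>R i)) \<le> 21 * real m * sqrt (real (card J)) + 4"
proof -
  obtain l where l: "l < N" "x - 42 *\<^sub>R c l \<in> E l \<inter> cube" using x by (auto simp: M_def Q_iff)
  define y where "y = x - 42 *\<^sub>R c l"
  define w where "w = x - (\<Sum>i\<in>J. (21 * (real m - 1)) *\<^sub>R i)"
  have oJ: "orthonormal J" by (rule orthonormal_subset[OF orthonormal_Basis J(1)])
  have finJ: "finite J" by (rule orthonormal_finite[OF oJ])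
  have wj: "w \<bullet> j = 42 * (c l \<bullet> j) + y \<bullet> j - 21 * (real m - 1)" if "j \<in> J" for j
    using orthonormal_sum_inner[OF oJ that, of "\<lambda>_. 21 * (real m - 1)"] by (simp add: w_def y_def inner_diff_left)
  have wi: "w \<bullet> i = y \<bullet> i" if "i \<in> Basis - J" for i
  proof -
    have "(\<Sum>j\<in>J. (21 * (real m - 1)) *\<^sub>R j) \<bullet> i = 0"
      unfolding inner_sum_left using that J(1) by (intro sum.neutral ballI) (auto simp: inner_Basis subset_iff)
    then show ?thesis using c(1)[OF l(1) that] by (simp add: w_def y_def inner_diff_left)
  qed
  have "(norm w)\<^sup>2 = (\<Sum>i\<in>Basis. (w \<bullet> i)\<^sup>2)" using orthonormal_span_norm[OF orthonormal_Basis, of w] by simp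
  also have "\<dots> = (\<Sum>i\<in>J. (w \<bullet> i)\<^sup>2) + (\<Sum>i\<in>Basis - J. (w \<bullet> i)\<^sup>2)"
    using J(1) by (simp add: sum.subset_diff[of J Basis] add.commute)
  also have "(\<Sum>i\<in>Basis - J. (w \<bullet> i)\<^sup>2) = (\<Sum>i\<in>Basis - J. (y \<bullet> i)\<^sup>2)" by (intro sum.cong refl) (simp only: wi)
  also have "\<dots> \<le> 16" by (rule pieceD(10)[OF pc[OF l(1)]]) (use l J(2) in \<open>auto simp: y_def\<close>)
  also have "(\<Sum>i\<in>J. (w \<bullet> i)\<^sup>2) \<le> (\<Sum>i\<in>J. (21 * real m)\<^sup>2)"
  proof (rule sum_mono)
    fix j assume j: "j \<in> J"
    have "\<bar>y \<bullet> j\<bar> \<le> 21" using l(2) j J(1) by (auto simp: y_def cube_def)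
    then have "\<bar>w \<bullet> j\<bar> \<le> 21 * real m" using wj[OF j] c(2)[OF l(1) j] by (auto simp: abs_le_iff)
    then show "(w \<bullet> j)\<^sup>2 \<le> (21 * real m)\<^sup>2" by (metis abs_ge_zero abs_le_square_iff abs_of_nonneg order_trans)
  qed
  finally have "(norm w)\<^sup>2 \<le> real (card J) * (21 * real m)\<^sup>2 + 16" by simp
  also have "\<dots> \<le> (21 * real m * sqrt (real (card J)) + 4)\<^sup>2"
    by (simp add: power2_sum power_mult_distrib)
  finally have "norm w \<le> 21 * real m * sqrt (real (card J)) + 4" by (rule power2_le_imp_le) simp
  then show ?thesis by (simp add: w_def)
qed

end

subsection \<open>Lattice paths\<close>

text \<open>Layers in the new direction are traversed alternately forwards and backwards, so that
  the end of one layer is next to the start of the following one. The path fills the whole grid;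
  initial segments of it provide every smaller number of cells.\<close>

lemma snake_path:
  fixes J :: "'a::euclidean_space set"
  assumes "finite J" "J \<subseteq> Basis" "1 \<le> m"
  shows "\<exists>xs :: 'a list. length xs = m ^ card J \<and> distinct xs \<and>
    successively (\<lambda>x y. \<exists>j\<in>J. y - x = j \<or> y - x = - j) xs \<and>
    (\<forall>x\<in>set xs. (\<forall>i\<in>Basis - J. x \<bullet> i = 0) \<and> (\<forall>i\<in>J. \<exists>n<m. x \<bullet> i = real n))"
  using assms(1,2)
proof (induction J rule: finite_induct)
  case empty
  show ?case by (intro exI[of _ "[0]"]) auto
next
  case (insert j J)
  define st where "st J x y \<longleftrightarrow> (\<exists>j\<in>J. y - x = j \<or> y - x = - j)" for J and x y :: 'a
  have st_sym: "st J x y = st J y x" for J x y unfolding st_def by (metis minus_diff_eq minus_minus)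
  have st_mono: "st J x y \<Longrightarrow> st (insert j J) x y" for x y by (auto simp: st_def)
  obtain xs where xs: "length xs = m ^ card J" "distinct xs" "successively (st J) xs"
    "\<And>x i. x \<in> set xs \<Longrightarrow> i \<in> Basis - J \<Longrightarrow> x \<bullet> i = 0" "\<And>x i. x \<in> set xs \<Longrightarrow> i \<in> J \<Longrightarrow> \<exists>n<m. x \<bullet> i = real n"
    using insert unfolding st_def by auto
  have xs0: "xs \<noteq> []" using xs(1) assms(3) by auto
  have jB: "j \<in> Basis" "j \<notin> J" using insert by auto
  define ys where "ys k = (if even k then xs else rev xs)" for k :: nat
  have ys: "length (ys k) = m ^ card J" "distinct (ys k)" "set (ys k) = set xs" "ys k \<noteq> []" "hd (ys (Suc k)) = last (ys k)"
    "successively (st J) (ys k)" for k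
    using xs xs0 by (auto simp: ys_def hd_rev last_rev st_sym)
  define B where "B k = map (\<lambda>x. x + real k *\<^sub>R j) (ys k)" for k
  have Bj: "x \<bullet> j = real k" if "x \<in> set (B k)" for x k
    using that xs(4)[of _ j] jB by (auto simp: B_def ys(3) inner_add_left)
  have Bi: "\<exists>y\<in>set xs. x \<bullet> i = y \<bullet> i" if "x \<in> set (B k)" "i \<in> Basis" "i \<noteq> j" for x k i
    using that jB by (auto simp: B_def ys(3) inner_add_left inner_Basis)
  have sB: "successively (st (insert j J)) (B k)" for k
    using successively_mono[OF ys(6)[of k] st_mono] by (simp add: B_def successively_map st_def)
  have "length (concat (map B [0..<t])) = t * m ^ card J \<and> distinct (concat (map B [0..<t])) \<and>
    successively (st (insert j J)) (concat (map B [0..<t])) \<and>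
    (\<forall>k. t = Suc k \<longrightarrow> concat (map B [0..<t]) \<noteq> [] \<and> last (concat (map B [0..<t])) = last (B k))" for t
  proof (induction t)
    case (Suc t)
    have ap: "concat (map B [0..<Suc t]) = concat (map B [0..<t]) @ B t" by simp
    have nB: "B t \<noteq> []" using ys(4) by (simp add: B_def)
    have dB: "distinct (B t)" using ys(2) by (simp add: B_def distinct_map inj_on_def)
    have "set (concat (map B [0..<t])) \<inter> set (B t) = {}"
    proof -
      have "x \<bullet> j \<noteq> real t" if "x \<in> set (concat (map B [0..<t]))" for x
        using that Bj by force
      then show ?thesis using Bj by blast
    qed
    moreover have "concat (map B [0..<t]) = [] \<or> st (insert j J) (last (concat (map B [0..<t]))) (hd (B t))"
    proof (cases t)
      case (Suc k)
      have "last (concat (map B [0..<t])) = last (ys k) + real k *\<^sub>R j" using Suc.IH Suc ys(4)[of k] by (simp add: B_def last_map)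
      moreover have "hd (B t) = last (ys k) + real t *\<^sub>R j" using Suc ys(4,5) by (simp add: B_def hd_map)
      ultimately have "hd (B t) - last (concat (map B [0..<t])) = j" using Suc by (simp add: algebra_simps)
      then show ?thesis by (auto simp: st_def)
    qed simp
    moreover have "length (B t) = m ^ card J" by (simp add: B_def ys(1))
    moreover define X where "X = concat (map B [0..<t])"
    ultimately show ?case using Suc.IH nB dB sB[of t] unfolding ap X_def[symmetric]
      by (auto simp: successively_append_iff)
  qed simp
  note main = this[of m]
  show ?case
  proof (intro exI conjI)
    show "length (concat (map B [0..<m])) = m ^ card (insert j J)" using main insert by simp
    show "distinct (concat (map B [0..<m]))" using main by blast
    show "successively (\<lambda>x y. \<exists>j\<in>insert j J. y - x = j \<or> y - x = - j) (concat (map B [0..<m]))"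
      using main unfolding st_def by blast
    show "\<forall>x\<in>set (concat (map B [0..<m])). (\<forall>i\<in>Basis - insert j J. x \<bullet> i = 0) \<and> (\<forall>i\<in>insert j J. \<exists>n<m. x \<bullet> i = real n)"
    proof (intro ballI conjI)
      fix x assume "x \<in> set (concat (map B [0..<m]))"
      then obtain k where k: "k < m" "x \<in> set (B k)" by auto
      show "x \<bullet> i = 0" if "i \<in> Basis - insert j J" for i using Bi[OF k(2), of i] that xs(4)[of _ i] by auto
      show "\<exists>n<m. x \<bullet> i = real n" if "i \<in> insert j J" for i
      proof (cases "i = j")
        case True then show ?thesis using Bj[OF k(2)] k(1) by auto
      next
        case False
        then have i: "i \<in> J" "i \<in> Basis" using that insert by auto
        then obtain y where "y \<in> set xs" "x \<bullet> i = y \<bullet> i" using Bi[OF k(2), of i] False by blast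
        then show ?thesis using xs(5)[OF _ i(1), of y] by simp
      qed
    qed
  qed
qed

lemma sbasis_inner_cases:
  assumes "D \<in> sbasis" "E \<in> sbasis"
  shows "E = D \<or> E = - D \<or> D \<bullet> E = 0"
proof -
  obtain i s where i: "i \<in> Basis" "D = s *\<^sub>R i" "s = 1 \<or> s = -1" using sbasisE[OF assms(1)] by metis
  obtain j r where j: "j \<in> Basis" "E = r *\<^sub>R j" "r = 1 \<or> r = -1" using sbasisE[OF assms(2)] by metis
  show ?thesis
  proof (cases "i = j")
    case True then show ?thesis using i j by auto
  next
    case False then show ?thesis using i j by (simp add: inner_Basis)
  qed
qed

text \<open>Cross-sections are transported along the path: a bend may exchange a direction of
  \<open>A\<close>, so each cross-section depends on all earlier turns and is found by dependent
  choice.\<close>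

lemma route_pieces:
  fixes D :: "nat \<Rightarrow> 'a::euclidean_space"
  assumes d: "1 \<le> d" "d < DIM('a)" and D: "\<And>l. D l \<in> sbasis" "\<And>l. D (Suc l) \<noteq> - D l"
  shows "\<exists>A S. \<forall>l. A l \<subseteq> Basis \<and> card (A l) = d \<and> (\<forall>a\<in>A l. D l \<bullet> a = 0) \<and>
    piece d (S l) {(- D l, A l), (D (Suc l), A (Suc l))} \<and> strand (S l) (- D l)"
proof -
  define V where "V l A \<longleftrightarrow> A \<subseteq> Basis \<and> card A = d \<and> (\<forall>a\<in>A. D l \<bullet> a = 0)" for l A
  define T where "T l A A' \<longleftrightarrow> (\<exists>S. piece d S {(- D l, A), (D (Suc l), A')} \<and> strand S (- D l))" for l A A'
  have "\<exists>f. \<forall>l. V l (f l) \<and> T l (f l) (f (Suc l))"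
  proof (rule dependent_nat_choice)
    obtain i s where i: "i \<in> Basis" "D 0 = s *\<^sub>R i" "s = 1 \<or> s = -1" using sbasisE[OF D(1)] by metis
    have "d \<le> card (Basis - {i})" using d i(1) by simp
    then obtain A where A: "A \<subseteq> Basis - {i}" "card A = d" using obtain_subset_with_card_n by metis
    have "D 0 \<bullet> a = 0" if "a \<in> A" for a
    proof -
      have "a \<in> Basis" "a \<noteq> i" using that A(1) by auto
      then have "i \<bullet> a = 0" using i(1) by (simp add: inner_Basis)
      then show ?thesis by (simp add: i(2))
    qed
    then show "\<exists>A. V 0 A" using A by (auto simp: V_def)
  next
    fix A l assume V: "V l A"
    note v = V[unfolded V_def]
    consider "D (Suc l) = D l" | "D l \<bullet> D (Suc l) = 0" using sbasis_inner_cases[OF D(1)[of l] D(1)[of "Suc l"]] D(2)[of l] by blast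
    then show "\<exists>A'. V (Suc l) A' \<and> T l A A'"
    proof cases
      case 1
      have "T l A A" unfolding T_def 1 using straight_piece[OF D(1), of A d l] v d(1) by blast
      moreover have "V (Suc l) A" using V 1 by (simp add: V_def)
      ultimately show ?thesis by blast
    next
      case 2
      obtain S A' where S: "piece d S {(- D l, A), (D (Suc l), A')}" "strand S (- D l)"
        using bend_piece[OF D(1) D(1) 2, of A d] v d(1) by blast
      have "V (Suc l) A'" unfolding V_def using pieceD(5-7)[OF S(1), of "D (Suc l)" A'] by simp
      then show ?thesis using S by (auto simp: T_def)
    qed
  qed
  then obtain A where A: "\<And>l. V l (A l)" "\<And>l. T l (A l) (A (Suc l))" by blast
  obtain S where "\<And>l. piece d (S l) {(- D l, A l), (D (Suc l), A (Suc l))} \<and> strand (S l) (- D l)"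
    using A(2) unfolding T_def by metis
  then show ?thesis using A(1) unfolding V_def by blast
qed

text \<open>Osculation stands in for the reach because it is carried along by translations and
  dilations point by point; the reach is read off after rescaling.\<close>

definition tame :: "nat \<Rightarrow> 'a::euclidean_space set \<Rightarrow> bool" where
  "tame d M \<longleftrightarrow> compact M \<and> connected M \<and> M \<noteq> {} \<and> (\<forall>p\<in>M. C2_chart d M p) \<and> (\<forall>p\<in>M. \<exists>N. osculates d M p 1 N)"

text \<open>The two manifolds are boundaries of thickened lattice paths of \<open>N\<close> cells; they differ only in a bump of height
  \<open>\<delta>\<^sup>2 / 800\<close> at the tip \<open>t\<close> of the first cell.\<close>
lemma cell_manifolds:
  fixes c :: "nat \<Rightarrow> 'a::euclidean_space" and Z :: "'a set"
  assumes d: "1 \<le> d" "d < DIM('a)" and J: "J \<subseteq> Basis" and N: "2 \<le> N"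
    and step: "\<And>l. Suc l < N \<Longrightarrow> \<exists>j\<in>J. c (Suc l) - c l = j \<or> c (Suc l) - c l = - j"
    and inj: "inj_on c {..<N}"
    and c0: "\<And>l i. l < N \<Longrightarrow> i \<in> Basis - J \<Longrightarrow> c l \<bullet> i = 0"
    and cJ: "\<And>l i. l < N \<Longrightarrow> i \<in> J \<Longrightarrow> \<exists>n<m. c l \<bullet> i = real n"
    and \<delta>: "0 < \<delta>" "\<delta> \<le> 1" and Z: "orthonormal Z" "card Z = d"
  shows "\<exists>M0 M1 K t. closed K \<and> t \<in> M1 \<and> (\<forall>y\<in>M0. \<delta>\<^sup>2 / 800 \<le> dist t y) \<and>
    (\<forall>M\<in>{M0, M1}. tame d M \<and> K \<subseteq> M \<and>
      hausdorff_outer d (M - K) \<le> ennreal ((3/2) ^ d * (flat_vol Z * \<delta> ^ d)) \<and>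
      ennreal (real N * (7/8 * real d * 4 ^ d * flat_vol Z)) \<le> hausdorff_outer d M \<and>
      hausdorff_outer d M \<le> ennreal (real N * ((if N = 2 then 9 else 22) * (real d * 8 ^ d * flat_vol Z))) \<and>
      (\<forall>x\<in>M. norm (x - (\<Sum>i\<in>J. (21 * (real m - 1)) *\<^sub>R i)) \<le> 21 * real m * sqrt (real (card J)) + 4))"
proof -
  \<comment> \<open>The last step is repeated for ever, so that \<open>D\<close> is defined for all
    l and never turns back, as \<open>route_pieces\<close> demands.\<close>
  define D where "D l = c (Suc (min l (N - 2))) - c (min l (N - 2))" for l
  have Dl: "D l = c (Suc l) - c l" if "Suc l < N" for l
  proof -
    have "min l (N - 2) = l" using that by simp
    then show ?thesis by (simp add: D_def)
  qed
  have DJ: "\<exists>j\<in>J. D l = j \<or> D l = - j" for l unfolding D_def using N by (intro step) auto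
  have Dsb: "D l \<in> sbasis" for l using DJ[of l] J by (auto simp: sbasis_def)
  have DD: "D (Suc l) \<noteq> - D l" for l
  proof (cases "Suc (Suc l) < N")
    case True
    have "c (Suc (Suc l)) \<noteq> c l" using inj_on_eq_iff[OF inj, of "Suc (Suc l)" l] True by simp
    then show ?thesis using True by (simp add: Dl eq_neg_iff_add_eq_0)
  next
    case False
    then have "min (Suc l) (N - 2) = N - 2" "min l (N - 2) = N - 2" by auto
    then have "D (Suc l) = D l" by (simp add: D_def)
    moreover have "D l \<noteq> 0" using sbasis_norm[OF Dsb[of l]] by force
    ultimately show ?thesis by (metis add_eq_0_iff2 eq_neg_iff_add_eq_0 scaleR_2 scaleR_eq_0_iff zero_neq_numeral)
  qed
  obtain A S where AS: "\<And>l. A l \<subseteq> Basis" "\<And>l. card (A l) = d" "\<And>l. \<forall>a\<in>A l. D l \<bullet> a = 0"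
    "\<And>l. piece d (S l) {(- D l, A l), (D (Suc l), A (Suc l))}" "\<And>l. strand (S l) (- D l)"
    using route_pieces[where D = D, OF d Dsb DD] by blast
  obtain i s where i: "i \<in> Basis" "- D 0 = s *\<^sub>R i" "s = 1 \<or> s = -1" using sbasisE[OF sbasis_uminus[OF Dsb[of 0]]] by metis
  obtain i' s' where i': "i' \<in> Basis" "D (N - 2) = s' *\<^sub>R i'" "s' = 1 \<or> s' = -1" using sbasisE[OF Dsb[of "N - 2"]] by metis
  have nA: "i \<notin> A 0"
  proof
    assume "i \<in> A 0"
    then have "(- D 0) \<bullet> i = 0" using AS(3) by simp
    then show False unfolding i(2) using i(1,3) by auto
  qed
  have nA': "i' \<notin> A (N - 2)"
  proof
    assume "i' \<in> A (N - 2)"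
    then have "D (N - 2) \<bullet> i' = 0" using AS(3) by blast
    then show False unfolding i'(2) using i'(1,3) by auto
  qed
  have capI: "cap i s (A 0) d \<delta> \<eta>" if \<eta>: "\<eta> = 0 \<or> \<eta> = \<delta>\<^sup>2 / 800" for \<eta>
  proof -
    have "0 \<le> \<delta>\<^sup>2 / 800" by simp
    then have "0 \<le> \<eta>" "\<eta> \<le> \<delta>\<^sup>2 / 800" using \<eta> by linarith+
    then show ?thesis by (unfold_locales) (rule i(1) i(3) AS(1,2) nA d(1) \<delta> | assumption)+
  qed
  define CC where "CC \<eta> = cap.C i s (A 0) \<delta> \<eta>" for \<eta>
  \<comment> \<open>The far end of the path is closed by a cap of bump height 0, the same for both
    manifolds.\<close>
  interpret K': cap i' s' "A (N - 2)" d 1 0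
    by (unfold_locales) (rule i'(1) i'(3) AS(1,2) nA' d(1) order_refl zero_less_one | simp)+
  define P where "P l = (if Suc l < N then {(D l, A l)} else {}) \<union> (if 0 < l then {(- D (l - 1), A (l - 1))} else {})" for l
  \<comment> \<open>\<open>S l\<close> leads from step \<open>D l\<close> to step
    \<open>D (Suc l)\<close> and so sits in cell l + 1; hence the index l - 1.\<close>
  define E where "E \<eta> l = (if l = 0 then CC \<eta> else if l = N - 1 then K'.C else S (l - 1))" for \<eta> l
  have Ee: "cap.e i s = - D 0" "K'.e = D (N - 2)"
    using cap.e_def[OF capI[of 0]] i i'(2) by (auto simp: K'.e_def)
  have P0: "P 0 = {(D 0, A 0)}" and PN: "P (N - 1) = {(- D (N - 2), A (N - 2))}"
    and PS: "l \<noteq> 0 \<Longrightarrow> l < N \<Longrightarrow> l \<noteq> N - 1 \<Longrightarrow> P l = {(- D (l - 1), A (l - 1)), (D (Suc (l - 1)), A (Suc (l - 1)))}" for l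
    using N by (auto simp: P_def numeral_2_eq_2)
  have asm: "assembly d N c (E \<eta>) P" if \<eta>: "\<eta> = 0 \<or> \<eta> = \<delta>\<^sup>2 / 800" for \<eta>
  proof
    show "1 \<le> d" by fact
    fix l assume l: "l < N"
    show "piece d (E \<eta> l) (P l)"
    proof -
      consider "l = 0" | "l \<noteq> 0" "l = N - 1" | "l \<noteq> 0" "l \<noteq> N - 1" by blast
      then show ?thesis
      proof cases
        case 1
        then show ?thesis using cap.C_piece[OF capI[OF \<eta>]] by (simp add: E_def P0 CC_def Ee)
      next
        case 2
        have El: "E \<eta> l = K'.C" using 2 by (simp add: E_def)
        show ?thesis unfolding El unfolding 2(2) PN Ee(2)[symmetric] by (rule K'.C_piece)
      next
        case 3
        show ?thesis unfolding PS[OF 3(1) l 3(2)] using AS(4)[of "l - 1"] 3 by (simp add: E_def)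
      qed
    qed
    show "c l \<bullet> j \<in> \<int>" if "j \<in> Basis" for j
      using c0[OF l, of j] cJ[OF l, of j] that by (cases "j \<in> J") auto
    show "P l \<noteq> {}" using l N by (auto simp: P_def)
    fix D' A' assume "(D', A') \<in> P l"
    then consider "Suc l < N" "D' = D l" "A' = A l" | "0 < l" "D' = - D (l - 1)" "A' = A (l - 1)"
      unfolding P_def by (auto split: if_splits)
    then show "\<exists>l'<N. c l' = c l + D' \<and> (- D', A') \<in> P l'"
    proof cases
      case 1
      then show ?thesis by (intro exI[of _ "Suc l"]) (auto simp: Dl P_def)
    next
      case 2
      then show ?thesis using l Dl[of "l - 1"] by (intro exI[of _ "l - 1"]) (auto simp: P_def)
    qed
  next
    show "inj_on c {..<N}" by fact
  qed
  have hZ: "flat_vol (A l) = flat_vol Z" for l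
    by (rule flat_vol_card) (use AS(1,2) Z in \<open>auto intro: orthonormal_subset[OF orthonormal_Basis]\<close>)
  have hp: "0 < flat_vol Z" using flat_vol_pos[OF Z(1)] Z(2) d by simp
  define F where "F \<eta> = (\<Union>l<N. (+) (42 *\<^sub>R c l) ` (E \<eta> l \<inter> cube))" for \<eta>
  have FM: "F \<eta> = assembly.M N c (E \<eta>)" if "\<eta> = 0 \<or> \<eta> = \<delta>\<^sup>2 / 800" for \<eta>
    by (simp add: F_def assembly.M_def[OF asm[OF that]] assembly.Q_def[OF asm[OF that]])
  \<comment> \<open>The part common to both manifolds: all cells but the first, and in the first the
    points where the bump vanishes. The weak inequality keeps \<open>K\<close> closed.\<close>
  define K where "K = (\<Union>l\<in>{1..<N}. (+) (42 *\<^sub>R c l) ` (E 0 l \<inter> cube)) \<union>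
    (+) (42 *\<^sub>R c 0) ` (CC 0 \<inter> {x. \<delta>\<^sup>2 \<le> cap.q (A 0) x} \<inter> cube)"
  have Cout: "CC \<eta> \<inter> {x. \<delta>\<^sup>2 \<le> cap.q (A 0) x} = CC 0 \<inter> {x. \<delta>\<^sup>2 \<le> cap.q (A 0) x}" if \<eta>: "\<eta> = 0 \<or> \<eta> = \<delta>\<^sup>2 / 800" for \<eta>
  proof -
    interpret k: cap i s "A 0" d \<delta> \<eta> by (rule capI[OF \<eta>])
    interpret k0: cap i s "A 0" d \<delta> 0 by (rule capI) simp
    have "x \<in> k.C \<longleftrightarrow> x \<in> k0.C" if "\<delta>\<^sup>2 \<le> k.q x" for x
    proof -
      have "k.tau x = k0.tau x" unfolding k.tau_def k0.tau_def k.bump_zero[OF that] k0.bump_zero[OF that] ..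
      then show ?thesis unfolding k.C_def k0.C_def mem_Collect_eq by simp
    qed
    then show ?thesis unfolding CC_def by blast
  qed
  have Esame: "E \<eta> l = E 0 l" if "l \<noteq> 0" for \<eta> l using that by (simp add: E_def)
  have Fsplit: "F \<eta> = (\<Union>l\<in>{1..<N}. (+) (42 *\<^sub>R c l) ` (E 0 l \<inter> cube)) \<union> (+) (42 *\<^sub>R c 0) ` (CC \<eta> \<inter> cube)" for \<eta>
  proof -
    have 1: "{..<N} = insert 0 {1..<N}" using N by auto
    have 2: "E \<eta> 0 = CC \<eta>" by (simp add: E_def)
    have 3: "(\<Union>l\<in>{1..<N}. (+) (42 *\<^sub>R c l) ` (E \<eta> l \<inter> cube)) = (\<Union>l\<in>{1..<N}. (+) (42 *\<^sub>R c l) ` (E 0 l \<inter> cube))"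
    proof (rule SUP_cong[OF refl])
      fix l assume "l \<in> {1..<N}"
      then have "l \<noteq> 0" by simp
      then have "E \<eta> l = E 0 l" by (rule Esame)
      then show "(+) (42 *\<^sub>R c l) ` (E \<eta> l \<inter> cube) = (+) (42 *\<^sub>R c l) ` (E 0 l \<inter> cube)" by (rule arg_cong)
    qed
    show ?thesis unfolding F_def 1 UN_insert 2 3 by (rule Un_commute)
  qed
  have cE: "closed (E 0 l)" if "l < N" for l by (rule pieceD(1)[OF assembly.pc[OF asm[OF disjI1[OF refl]] that]])
  have clK: "closed K"
  proof -
    have "closed ((+) (42 *\<^sub>R c l) ` (E 0 l \<inter> cube))" if "l \<in> {1..<N}" for l
      by (intro closed_translation closed_Int closed_cube cE) (use that in simp)
    moreover have "closed {x. \<delta>\<^sup>2 \<le> cap.q (A 0) x}"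
      using cap.cont_q[OF capI[of 0], of UNIV] by (intro closed_Collect_le continuous_intros) auto
    moreover have "closed (CC 0)" unfolding CC_def by (rule cap.closed_C[OF capI]) simp
    ultimately show ?thesis unfolding K_def
      by (intro closed_Un closed_UN closed_translation closed_Int closed_cube finite_atLeastLessThan ballI cE) auto
  qed
  have good: "tame d (F \<eta>) \<and> K \<subseteq> F \<eta> \<and>
      hausdorff_outer d (F \<eta> - K) \<le> ennreal ((3/2) ^ d * (flat_vol Z * \<delta> ^ d)) \<and>
      ennreal (real N * (7/8 * real d * 4 ^ d * flat_vol Z)) \<le> hausdorff_outer d (F \<eta>) \<and>
      hausdorff_outer d (F \<eta>) \<le> ennreal (real N * ((if N = 2 then 9 else 22) * (real d * 8 ^ d * flat_vol Z))) \<and>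
      (\<forall>x\<in>F \<eta>. norm (x - (\<Sum>i\<in>J. (21 * (real m - 1)) *\<^sub>R i)) \<le> 21 * real m * sqrt (real (card J)) + 4)"
    if \<eta>: "\<eta> = 0 \<or> \<eta> = \<delta>\<^sup>2 / 800" for \<eta>
  proof (intro conjI)
    interpret a: assembly d N c "E \<eta>" P by (rule asm[OF \<eta>])
    interpret k: cap i s "A 0" d \<delta> \<eta> by (rule capI[OF \<eta>])
    have FM: "F \<eta> = a.M" by (rule FM[OF \<eta>])
    have E0: "E \<eta> 0 = k.C" by (simp add: E_def CC_def)
    have "connected a.M"
    proof (rule a.M_connected)
      show "connected (E \<eta> 0 \<inter> cube)" unfolding E0 by (rule k.C_connected)
      show "E \<eta> 0 \<inter> cube \<noteq> {}" unfolding E0 using k.tip by blast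
      fix l assume l: "Suc l < N"
      have "strand (E \<eta> (Suc l)) (- D l)"
      proof (cases "Suc l = N - 1")
        case True
        then have "l = N - 2" by simp
        moreover have "E \<eta> (Suc l) = K'.C" unfolding E_def using True N by simp
        ultimately show ?thesis using K'.C_strand by (simp only: Ee)
      next
        case False
        then show ?thesis using AS(5)[of l] by (simp add: E_def)
      qed
      moreover have "(- D l, A l) \<in> P (Suc l)" "c l = c (Suc l) + - D l" using l by (auto simp: P_def Dl)
      ultimately show "\<exists>D A. (D, A) \<in> P (Suc l) \<and> c l = c (Suc l) + D \<and> strand (E \<eta> (Suc l)) D" by blast
    qed
    moreover have "a.M \<noteq> {}" using k.tip N unfolding FM[symmetric] Fsplit CC_def by blast
    ultimately show "tame d (F \<eta>)" unfolding tame_def FM by (simp add: a.compact_M a.M_chart a.M_osculates)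
    show "K \<subseteq> F \<eta>" unfolding K_def Fsplit using Cout[OF \<eta>] by blast
    have "F \<eta> - K \<subseteq> (+) (42 *\<^sub>R c 0) ` (k.C \<inter> {x. k.q x < \<delta>\<^sup>2})"
    proof
      fix x assume x: "x \<in> F \<eta> - K"
      then obtain y where y: "y \<in> CC \<eta>" "y \<in> cube" "x = 42 *\<^sub>R c 0 + y" unfolding Fsplit K_def by blast
      have "\<not> \<delta>\<^sup>2 \<le> k.q y"
      proof
        assume "\<delta>\<^sup>2 \<le> k.q y"
        then have "y \<in> CC 0 \<inter> {x. \<delta>\<^sup>2 \<le> k.q x} \<inter> cube" using Cout[OF \<eta>] y by blast
        then have "x \<in> K" unfolding K_def y(3) by blast
        then show False using x by blast
      qed
      then show "x \<in> (+) (42 *\<^sub>R c 0) ` (k.C \<inter> {x. k.q x < \<delta>\<^sup>2})" using y by (auto simp: CC_def)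
    qed
    then have "hausdorff_outer d (F \<eta> - K) \<le> hausdorff_outer d (k.C \<inter> {x. k.q x < \<delta>\<^sup>2})"
      using hausdorff_outer_mono by (metis hausdorff_outer_translation)
    also have "\<dots> \<le> ennreal ((3/2) ^ d * (flat_vol Z * \<delta> ^ d))" using k.bump_region_measure by (simp add: hZ)
    finally show "hausdorff_outer d (F \<eta> - K) \<le> ennreal ((3/2) ^ d * (flat_vol Z * \<delta> ^ d))" .
    show "ennreal (real N * (7/8 * real d * 4 ^ d * flat_vol Z)) \<le> hausdorff_outer d (F \<eta>)"
      unfolding FM by (rule a.M_measure_ge[OF Z])
    show "hausdorff_outer d (F \<eta>) \<le> ennreal (real N * ((if N = 2 then 9 else 22) * (real d * 8 ^ d * flat_vol Z)))"
      unfolding FM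
    proof (rule a.M_measure_le)
      fix l assume l: "l < N"
      show "hausdorff_outer d (E \<eta> l \<inter> cube) \<le> ennreal ((if N = 2 then 9 else 22) * (real d * 8 ^ d * flat_vol Z))"
      proof (cases "N = 2")
        case True
        then have "l = 0 \<or> l = N - 1" using l by auto
        then have "hausdorff_outer d (E \<eta> l \<inter> cube) \<le> ennreal (9 * real d * 8 ^ d * flat_vol Z)"
          using k.C_measure K'.C_measure by (auto simp: E_def CC_def hZ)
        then show ?thesis using True by (simp add: mult.assoc)
      next
        case False
        then show ?thesis using pieceD(11)[OF a.pc[OF l] Z] by (simp add: mult.assoc)
      qed
    qed (use hp in auto)
    show "\<forall>x\<in>F \<eta>. norm (x - (\<Sum>i\<in>J. (21 * (real m - 1)) *\<^sub>R i)) \<le> 21 * real m * sqrt (real (card J)) + 4"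
      unfolding FM
    proof
      fix x assume x: "x \<in> a.M"
      show "norm (x - (\<Sum>i\<in>J. (21 * (real m - 1)) *\<^sub>R i)) \<le> 21 * real m * sqrt (real (card J)) + 4"
      proof (rule a.M_norm[OF x J])
        fix l D' A' j assume l: "l < N" and p: "(D', A') \<in> P l" and j: "j \<in> Basis - J"
        have "D k \<bullet> j = 0" for k using DJ[of k] j J by (auto simp: inner_Basis)
        then show "D' \<bullet> j = 0" using p by (auto simp: P_def split: if_splits)
      next
        fix l j assume "l < N" "j \<in> Basis - J" then show "c l \<bullet> j = 0" by (rule c0)
      next
        fix l j assume "l < N" "j \<in> J"
        then obtain n where "n < m" "c l \<bullet> j = real n" using cJ by blast
        then show "0 \<le> c l \<bullet> j \<and> c l \<bullet> j \<le> real m - 1" by auto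
      qed
    qed
  qed
  define \<eta> where "\<eta> = \<delta>\<^sup>2 / 800"
  interpret k: cap i s "A 0" d \<delta> \<eta> by (rule capI) (simp add: \<eta>_def)
  interpret k0: cap i s "A 0" d \<delta> 0 by (rule capI) simp
  \<comment> \<open>The raised tip exceeds by \<eta> the greatest height 4 of the cap without bump.
    Points of other cells differ from it by at least 42 - 21 - 5 in some coordinate.\<close>
  define t where "t = 42 *\<^sub>R c 0 + (4 + \<eta>) *\<^sub>R k.e"
  have ke: "norm k.e = 1" using i(1,3) by (auto simp: k.e_def)
  have \<eta>b: "0 \<le> \<eta>" "\<eta> \<le> 1" using k.\<eta> k.eta_le by auto
  have "t \<in> F \<eta>" unfolding Fsplit t_def CC_def using k.tip by blast
  moreover have "\<eta> \<le> dist t y" if y: "y \<in> F 0" for y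
  proof -
    consider z where "z \<in> k0.C" "y = 42 *\<^sub>R c 0 + z" | l z where "l \<in> {1..<N}" "z \<in> cube" "y = 42 *\<^sub>R c l + z"
      using y unfolding Fsplit CC_def by blast
    then show ?thesis
    proof cases
      case 1
      have "k0.tau z = z \<bullet> k.e" by (simp add: k0.tau_def k0.bump_def)
      then have "z \<bullet> k.e \<le> 4" using k0.C_bounds(2)[OF 1(1)] by simp
      moreover have "k.e \<bullet> k.e = 1" using ke by (simp add: norm_eq_1)
      moreover have ty: "t - y = (4 + \<eta>) *\<^sub>R k.e - z" by (simp add: t_def 1(2))
      ultimately have "\<eta> \<le> (t - y) \<bullet> k.e" unfolding ty inner_diff_left inner_scaleR_left by simp
      also have "\<dots> \<le> norm (t - y)" using Cauchy_Schwarz_ineq2[of "t - y" k.e] ke by simp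
      finally show ?thesis by (simp add: dist_norm)
    next
      case 2
      have "c l \<noteq> c 0" using inj_on_eq_iff[OF inj, of l 0] 2(1) by auto
      then obtain j where j: "j \<in> Basis" "c l \<bullet> j \<noteq> c 0 \<bullet> j" using euclidean_eqI by blast
      have "c l \<bullet> j \<in> \<int>" "c 0 \<bullet> j \<in> \<int>" using assembly.lat[OF asm[of 0]] j(1) 2(1) N by auto
      then have "1 \<le> \<bar>c l \<bullet> j - c 0 \<bullet> j\<bar>" using j(2) by (auto elim!: Ints_cases)
      moreover have "\<bar>z \<bullet> j\<bar> \<le> 21" using 2(2) j(1) by (simp add: cube_def)
      moreover have "\<bar>k.e \<bullet> j\<bar> \<le> 1" using Cauchy_Schwarz_ineq2[of k.e j] ke j(1) by simp
      then have "\<bar>(4 + \<eta>) * (k.e \<bullet> j)\<bar> \<le> 5" using mult_mono[of "4 + \<eta>" 5 "\<bar>k.e \<bullet> j\<bar>" 1] \<eta>b by (simp add: abs_mult)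
      moreover have "(t - y) \<bullet> j = (4 + \<eta>) * (k.e \<bullet> j) - 42 * (c l \<bullet> j - c 0 \<bullet> j) - z \<bullet> j"
        unfolding t_def 2(3) by (simp add: inner_diff_left inner_add_left algebra_simps)
      moreover have "1 \<le> \<bar>r\<bar>" if "1 \<le> \<bar>u\<bar>" "\<bar>w\<bar> \<le> 21" "\<bar>v\<bar> \<le> 5" "r = v - 42 * u - w" for r u v w :: real
        using that by linarith
      ultimately have "1 \<le> \<bar>(t - y) \<bullet> j\<bar>" by blast
      also have "\<dots> \<le> norm (t - y)" using Cauchy_Schwarz_ineq2[of "t - y" j] j(1) by simp
      finally show ?thesis using \<eta>b by (simp add: dist_norm)
    qed
  qed
  ultimately show ?thesis using clK good[of 0] good[of \<eta>]
    by (intro exI[of _ "F 0"] exI[of _ "F \<eta>"] exI[of _ K] exI[of _ t]) (simp add: \<eta>_def)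
qed

subsection \<open>Uniform distributions on rescaled manifolds\<close>

text \<open>A dilation by \<open>a\<close> multiplies the left side of the osculation inequality by
  a and the squared distance by a^2, so the radius 1 becomes a.\<close>

lemma tame_affine_image:
  fixes M :: "'a::euclidean_space set"
  assumes d: "1 \<le> d" and M: "tame d M" and a: "0 < a"
  shows "(\<lambda>x. a *\<^sub>R x + b) ` M \<in> manifold_class d a" "\<And>p. p \<in> (\<lambda>x. a *\<^sub>R x + b) ` M \<Longrightarrow> C2_chart d ((\<lambda>x. a *\<^sub>R x + b) ` M) p"
proof -
  define g where "g x = a *\<^sub>R x + b" for x :: 'a
  have cont: "continuous_on M g" unfolding g_def by (intro continuous_intros)
  have chart: "C2_chart d (g ` M) p" if p: "p \<in> g ` M" for p
  proof -
    obtain x where x: "x \<in> M" "p = g x" using p by blast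
    then show ?thesis using C2_chart_affine[OF _ a, of d M x b] M unfolding tame_def g_def by blast
  qed
  then have C2: "C2_submanifold d (g ` M)" by (simp add: C2_submanifold_iff_chart)
  have "\<exists>N. osculates d (g ` M) p a N" if p: "p \<in> g ` M" for p
  proof -
    obtain x where x: "x \<in> M" "p = g x" using p by blast
    obtain N where N: "subspace N" "DIM('a) \<le> dim N + d"
      "\<And>v q. v \<in> N \<Longrightarrow> q \<in> M \<Longrightarrow> \<bar>(q - x) \<bullet> v\<bar> \<le> norm v * (norm (q - x))\<^sup>2 / (2 * 1)"
      using M x(1) unfolding tame_def osculates_def by blast
    have "\<bar>(q - p) \<bullet> v\<bar> \<le> norm v * (norm (q - p))\<^sup>2 / (2 * a)" if v: "v \<in> N" and q: "q \<in> g ` M" for v q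
    proof -
      obtain y where y: "y \<in> M" "q = g y" using q by blast
      have qp: "q - p = a *\<^sub>R (y - x)" by (simp add: x(2) y(2) g_def algebra_simps)
      have "\<bar>(q - p) \<bullet> v\<bar> = a * \<bar>(y - x) \<bullet> v\<bar>" unfolding qp inner_scaleR_left using a by (simp only: abs_mult abs_of_pos)
      also have "\<dots> \<le> a * (norm v * (norm (y - x))\<^sup>2 / (2 * 1))" using N(3)[OF v y(1)] a by (intro mult_left_mono) auto
      also have "\<dots> = norm v * (norm (q - p))\<^sup>2 / (2 * a)" unfolding qp norm_scaleR using a by (simp add: power_mult_distrib power2_eq_square)
      finally show ?thesis .
    qed
    then have "osculates d (g ` M) p a N" using N(1,2) by (simp add: osculates_def)
    then show ?thesis by blast
  qed
  then have "ereal a \<le> reach (g ` M)" using reach_lower_bound[OF C2 a] by blast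
  moreover have "compact (g ` M)" "connected (g ` M)" "g ` M \<noteq> {}"
    using M cont unfolding tame_def by (auto intro: compact_continuous_image connected_continuous_image)
  ultimately have "g ` M \<in> manifold_class d a" using C2 by (simp add: manifold_class_def)
  then show "(\<lambda>x. a *\<^sub>R x + b) ` M \<in> manifold_class d a"
    "\<And>p. p \<in> (\<lambda>x. a *\<^sub>R x + b) ` M \<Longrightarrow> C2_chart d ((\<lambda>x. a *\<^sub>R x + b) ` M) p"
    using chart unfolding g_def by auto
qed

lemma hausdorff_outer_affine:
  fixes S :: "'a::euclidean_space set"
  assumes "0 < a"
  shows "hausdorff_outer d ((\<lambda>x. a *\<^sub>R x + b) ` S) = ennreal (a ^ d) * hausdorff_outer d S"
proof -
  have "(\<lambda>x. a *\<^sub>R x + b) ` S = (+) b ` (\<lambda>x. a *\<^sub>R x) ` S" by (simp add: image_image add.commute)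
  then show ?thesis using assms by (simp add: hausdorff_outer_translation hausdorff_outer_scale)
qed

definition uniform_on :: "nat \<Rightarrow> 'a::euclidean_space set \<Rightarrow> real \<Rightarrow> 'a measure" where
  "uniform_on d X f = density (hausdorff_measure d) (\<lambda>x. ennreal (f * indicator X x))"

lemma emeasure_uniform_on:
  assumes d: "1 \<le> d" and X: "X \<in> sets borel" and B: "B \<in> sets borel" and f: "0 \<le> f"
  shows "emeasure (uniform_on d X f) B = ennreal f * hausdorff_outer d (X \<inter> B)"
proof -
  have XB: "X \<inter> B \<in> sets borel" using X B by simp
  have "emeasure (uniform_on d X f) B = (\<integral>\<^sup>+ x. ennreal (f * indicator X x) * indicator B x \<partial>hausdorff_measure d)"
    unfolding uniform_on_def using X B by (intro emeasure_density) auto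
  also have "\<dots> = (\<integral>\<^sup>+ x. ennreal f * indicator (X \<inter> B) x \<partial>hausdorff_measure d)"
    by (intro nn_integral_cong) (auto simp: indicator_def)
  also have "\<dots> = ennreal f * emeasure (hausdorff_measure d) (X \<inter> B)"
    by (rule nn_integral_cmult_indicator) (simp add: XB)
  finally show ?thesis using emeasure_hausdorff_measure[OF d XB] by simp
qed

lemma support_uniform_on:
  fixes X :: "'a::euclidean_space set"
  assumes d: "1 \<le> d" and X: "closed X" and chart: "\<And>p. p \<in> X \<Longrightarrow> C2_chart d X p" and f: "0 < f"
  shows "support (uniform_on d X f) = X"
proof (intro set_eqI iffI)
  have bX: "X \<in> sets borel" using X by simp
  have em: "emeasure (uniform_on d X f) (ball x r) = ennreal f * hausdorff_outer d (X \<inter> ball x r)" for x r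
    using f by (intro emeasure_uniform_on d bX) auto
  fix x
  {
    assume x: "x \<in> support (uniform_on d X f)"
    show "x \<in> X"
    proof (rule ccontr)
      assume "x \<notin> X"
      then have "open (- X)" "x \<in> - X" using X by auto
      then obtain r where r: "0 < r" "ball x r \<subseteq> - X" by (rule openE) blast
      then have "X \<inter> ball x r = {}" by blast
      then have "emeasure (uniform_on d X f) (ball x r) = 0" using em[of x r] hausdorff_outer_empty[OF d, where ?'a = 'a] by simp
      then show False using x r(1) by (auto simp: support_def)
    qed
  }
  assume x: "x \<in> X"
  have "0 < emeasure (uniform_on d X f) (ball x r)" if "0 < r" for r
    unfolding em using C2_chart_measure_pos[OF d chart[OF x] x that] f by (simp add: ennreal_zero_less_mult_iff)
  then show "x \<in> support (uniform_on d X f)" by (simp add: support_def)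
qed

text \<open>A constant density is Lipschitz with every constant L \<ge> 0, so membership comes down
  to the manifold class, the ball and the size of the total volume.\<close>

lemma uniform_on_in_model:
  fixes X :: "'a::euclidean_space set"
  assumes d: "1 \<le> d" and X: "X \<in> manifold_class d \<rho>" "\<rho>' \<le> \<rho>" "X \<subseteq> cball 0 R" and chart: "\<And>p. p \<in> X \<Longrightarrow> C2_chart d X p"
    and H: "hausdorff_outer d X = ennreal H" "0 < H" and f: "fmin \<le> 1 / H" "1 / H \<le> fmax" and L: "0 \<le> L"
  shows "uniform_on d X (1 / H) \<in> model d \<rho>' fmin fmax L R"
proof -
  define f where "f = 1 / H"
  have f0: "0 < f" using H(2) by (simp add: f_def)
  have clX: "closed X" using X(1) by (simp add: manifold_class_def compact_imp_closed)
  have bX: "X \<in> sets borel" using clX by simp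
  note sup = support_uniform_on[OF d clX chart f0]
  have em: "emeasure (uniform_on d X f) B = ennreal f * hausdorff_outer d (X \<inter> B)" if "B \<in> sets borel" for B
    using f0 by (intro emeasure_uniform_on d bX that) simp
  have "emeasure (uniform_on d X f) UNIV = ennreal f * ennreal H" using em[of UNIV] H(1) by simp
  also have "\<dots> = 1" using H(2) by (simp add: f_def ennreal_mult'[symmetric])
  finally have "emeasure (uniform_on d X f) UNIV = 1" .
  moreover have sp: "space (uniform_on d X f) = UNIV" "sets (uniform_on d X f) = sets borel" by (simp_all add: uniform_on_def)
  ultimately have "prob_space (uniform_on d X f)" by (intro prob_spaceI) simp
  moreover have "X \<in> manifold_class d \<rho>'" using X(1,2) by (auto simp: manifold_class_def intro: order_trans[of "ereal \<rho>'" "ereal \<rho>"])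
  moreover have "emeasure (uniform_on d X f) B = (\<integral>\<^sup>+ x \<in> B \<inter> X. ennreal f \<partial>hausdorff_measure d)" if B: "B \<in> sets borel" for B
  proof -
    have XB: "X \<inter> B \<in> sets borel" using bX B by simp
    have "(\<integral>\<^sup>+ x \<in> B \<inter> X. ennreal f \<partial>hausdorff_measure d) = ennreal f * emeasure (hausdorff_measure d) (B \<inter> X)"
      by (rule nn_integral_cmult_indicator) (use XB in \<open>simp add: Int_commute\<close>)
    then show ?thesis using em[OF B] emeasure_hausdorff_measure[OF d XB] by (simp add: Int_commute)
  qed
  moreover have "L-lipschitz_on X (\<lambda>_. f)" using L by (auto simp: lipschitz_on_def)
  ultimately show ?thesis unfolding model_def f_def[symmetric] mem_Collect_eq sup
    using sp(2) X(3) f unfolding f_def[symmetric] by (intro conjI exI[of _ "\<lambda>_. f"]) (simp_all add: sup)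
qed

text \<open>The bump changes the total volume, so the two densities also differ on the common part
  \<open>K\<close>. That contribution is at most vol K times |1/H0 - 1/H1|, again bounded by the
  relative volumes of the two complements; adding the integrals over the complements doubles the
  bound.\<close>

lemma uniform_on_integral_diff:
  fixes X0 X1 K :: "'a::euclidean_space set"
  assumes d: "1 \<le> d" and cl: "closed X0" "closed X1" "closed K" and K: "K \<subseteq> X0" "K \<subseteq> X1"
    and H: "hausdorff_outer d X0 = ennreal H0" "0 < H0" "hausdorff_outer d X1 = ennreal H1" "0 < H1"
    and b: "hausdorff_outer d (X0 - K) \<le> ennreal b" "hausdorff_outer d (X1 - K) \<le> ennreal b" "0 \<le> b"
    and r: "valid_query r"
  shows "\<bar>integral\<^sup>L (uniform_on d X0 (1 / H0)) r - integral\<^sup>L (uniform_on d X1 (1 / H1)) r\<bar> \<le> 2 * (b / H0 + b / H1)"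
proof -
  let ?h = "hausdorff_measure d :: 'a measure"
  have rm: "r \<in> borel_measurable ?h" and r1: "\<bar>r x\<bar> \<le> 1" for x
    using r measurable_cong_sets[OF sets_hausdorff_measure refl, of d borel] by (auto simp: valid_query_def)
  have main: "\<exists>k c. \<bar>c\<bar> \<le> b / H \<and> integral\<^sup>L (uniform_on d X (1 / H)) r = set_lebesgue_integral ?h K r / H + c \<and>
      0 \<le> k \<and> k \<le> b \<and> measure ?h K + k = H"
    if X: "closed X" "K \<subseteq> X" "hausdorff_outer d X = ennreal H" "0 < H" "hausdorff_outer d (X - K) \<le> ennreal b" for X H
  proof -
    have bs: "X \<in> sets borel" "K \<in> sets borel" "X - K \<in> sets borel" using X(1) cl(3) by auto
    have emX: "emeasure ?h X = ennreal H" using emeasure_hausdorff_measure[OF d bs(1)] X(3) by simp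
    have fin: "S \<in> sets borel \<Longrightarrow> S \<subseteq> X \<Longrightarrow> emeasure ?h S < \<infinity>" for S
      using emeasure_mono[of S X ?h] bs(1) emX by (auto simp: less_top[symmetric] top_unique)
    have int1: "set_integrable ?h S (\<lambda>_. 1 :: real)" if "S \<in> sets borel" "S \<subseteq> X" for S
      using fin[OF that] that by (simp add: set_integrable_def)
    have int: "set_integrable ?h S r" if "S \<in> sets borel" "S \<subseteq> X" for S
      unfolding set_integrable_def
      by (rule Bochner_Integration.integrable_bound[OF int1[OF that, unfolded set_integrable_def]])
         (use that rm r1 in \<open>auto simp: indicator_def\<close>)
    have abs: "\<bar>set_lebesgue_integral ?h S r\<bar> \<le> measure ?h S" if "S \<in> sets borel" "S \<subseteq> X" for S
    proof -
      have "\<bar>set_lebesgue_integral ?h S r\<bar> \<le> (\<integral>x. \<bar>indicator S x * r x\<bar> \<partial>?h)"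
        unfolding set_lebesgue_integral_def by (simp add: integral_abs_bound)
      also have "\<dots> \<le> (\<integral>x. indicator S x \<partial>?h)"
        using int[OF that] int1[OF that] r1 unfolding set_integrable_def
        by (intro integral_mono) (auto simp: indicator_def)
      also have "\<dots> = measure ?h S" using that by simp
      finally show ?thesis .
    qed
    have "integral\<^sup>L (uniform_on d X (1 / H)) r = (\<integral>x. (1 / H * indicator X x) *\<^sub>R r x \<partial>?h)"
      unfolding uniform_on_def using X(4) bs(1) rm by (intro integral_density) auto
    also have "\<dots> = 1 / H * set_lebesgue_integral ?h X r"
      unfolding set_lebesgue_integral_def by (subst integral_mult_right_zero[symmetric]) (simp add: mult.assoc)
    also have "set_lebesgue_integral ?h X r = set_lebesgue_integral ?h K r + set_lebesgue_integral ?h (X - K) r"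
    proof -
      have "set_lebesgue_integral ?h (K \<union> (X - K)) r = set_lebesgue_integral ?h K r + set_lebesgue_integral ?h (X - K) r"
        by (rule set_integral_Un) (use int bs X(2) in auto)
      then show ?thesis using X(2) by (simp add: Un_absorb1)
    qed
    finally have eq: "integral\<^sup>L (uniform_on d X (1 / H)) r = set_lebesgue_integral ?h K r / H + set_lebesgue_integral ?h (X - K) r / H"
      by (simp add: add_divide_distrib)
    have mk: "measure ?h (X - K) \<le> b"
      using X(5) emeasure_hausdorff_measure[OF d bs(3)] b(3) by (simp add: measure_def enn2real_leI)
    have "measure ?h (X - K) = measure ?h X - measure ?h K"
      by (rule measure_Diff) (use fin[OF bs(1)] bs X(2) in auto)
    moreover have "measure ?h X = H" using emX X(4) by (simp add: measure_def)
    ultimately have "measure ?h K + measure ?h (X - K) = H" by simp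
    moreover have "\<bar>set_lebesgue_integral ?h (X - K) r / H\<bar> \<le> b / H"
      using abs[OF bs(3)] mk X(4) by (simp add: abs_divide divide_right_mono)
    ultimately show ?thesis using eq mk
      by (intro exI[of _ "measure ?h (X - K)"] exI[of _ "set_lebesgue_integral ?h (X - K) r / H"]) simp
  qed
  have absK: "\<bar>set_lebesgue_integral ?h K r\<bar> \<le> measure ?h K"
  proof -
    have bs: "K \<in> sets borel" using cl by auto
    have "emeasure ?h K \<le> emeasure ?h X0" using K cl by (intro emeasure_mono) auto
    then have fin: "emeasure ?h K < \<infinity>" using emeasure_hausdorff_measure[OF d, of X0] H(1) cl(1) by (auto simp: less_top[symmetric] top_unique)
    have i1: "integrable ?h (\<lambda>x. indicator K x :: real)" using fin bs by simp
    have "\<bar>set_lebesgue_integral ?h K r\<bar> \<le> (\<integral>x. \<bar>indicator K x * r x\<bar> \<partial>?h)"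
      unfolding set_lebesgue_integral_def by (simp add: integral_abs_bound)
    also have "\<dots> \<le> (\<integral>x. indicator K x \<partial>?h)"
      by (intro integral_mono Bochner_Integration.integrable_bound[OF i1]) (use i1 bs rm r1 in \<open>auto simp: indicator_def\<close>)
    also have "\<dots> = measure ?h K" using bs by simp
    finally show ?thesis .
  qed
  obtain k0 c0 where 0: "\<bar>c0\<bar> \<le> b / H0" "integral\<^sup>L (uniform_on d X0 (1 / H0)) r = set_lebesgue_integral ?h K r / H0 + c0"
    "0 \<le> k0" "k0 \<le> b" "measure ?h K + k0 = H0" using main[OF cl(1) K(1) H(1,2) b(1)] by auto
  obtain k1 c1 where 1: "\<bar>c1\<bar> \<le> b / H1" "integral\<^sup>L (uniform_on d X1 (1 / H1)) r = set_lebesgue_integral ?h K r / H1 + c1"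
    "0 \<le> k1" "k1 \<le> b" "measure ?h K + k1 = H1" using main[OF cl(2) K(2) H(3,4) b(2)] by auto
  define I where "I = set_lebesgue_integral ?h K r"
  define k where "k = measure ?h K"
  have k: "\<bar>I\<bar> \<le> k" using absK by (simp add: I_def k_def)
  have "\<bar>I / H0 - I / H1\<bar> = \<bar>I\<bar> * \<bar>1 / H0 - 1 / H1\<bar>"
    by (simp add: abs_mult[symmetric] right_diff_distrib)
  also have "\<dots> \<le> k * \<bar>1 / H0 - 1 / H1\<bar>" by (intro mult_right_mono k) simp
  also have "\<dots> = \<bar>k * (1 / H0 - 1 / H1)\<bar>" using k by (simp only: abs_mult abs_of_nonneg[OF order_trans[OF abs_ge_zero k]])
  also have "k * (1 / H0 - 1 / H1) = k / H0 - k / H1" by (simp add: right_diff_distrib)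
  also have "k / H0 = 1 - k0 / H0" using 0(5) H(2) by (simp add: k_def field_simps)
  also have "k / H1 = 1 - k1 / H1" using 1(5) H(4) by (simp add: k_def field_simps)
  also have "\<bar>(1 - k0 / H0) - (1 - k1 / H1)\<bar> \<le> b / H0 + b / H1"
  proof -
    have "0 \<le> k0 / H0" "k0 / H0 \<le> b / H0" "0 \<le> k1 / H1" "k1 / H1 \<le> b / H1"
      using 0(3,4) 1(3,4) H(2,4) by (auto intro: divide_right_mono)
    then show ?thesis by linarith
  qed
  finally have "\<bar>I / H0 - I / H1\<bar> \<le> b / H0 + b / H1" .
  moreover have "\<bar>(x + c) - (y + c')\<bar> \<le> 2 * (u + v)"
    if "\<bar>x - y\<bar> \<le> u + v" "\<bar>c\<bar> \<le> u" "\<bar>c'\<bar> \<le> v" for x y c c' u v :: real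
    using that unfolding abs_le_iff by argo
  ultimately show ?thesis unfolding 0(2) 1(2) I_def[symmetric] using 0(1) 1(1) by blast
qed

subsection \<open>Indistinguishable hypotheses\<close>

text \<open>The oracle answering every query with the mean of the two expectations is valid for both distributions, so a
  randomized algorithm succeeding with probability more than \<open>1/2\<close> on each of them has a run close to both supports.\<close>
lemma two_point_bound:
  fixes D0 D1 :: "'a::euclidean_space measure" and A :: "'w \<Rightarrow> 'a sq_alg"
  assumes D: "D0 \<in> Dset" "D1 \<in> Dset" and close: "\<And>r. valid_query r \<Longrightarrow> \<bar>integral\<^sup>L D0 r - integral\<^sup>L D1 r\<bar> \<le> 2 * \<tau>"
    and far: "2 * \<epsilon> < \<bar>infdist x (support D0) - infdist x (support D1)\<bar>" and \<alpha>: "\<alpha> < 1/2"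
  shows "\<not> estimates P A Dset \<tau> \<epsilon> \<alpha>"
proof
  assume est: "estimates P A Dset \<tau> \<epsilon> \<alpha>"
  then interpret prob_space P by (simp add: estimates_def)
  define Orc where "Orc qs = (integral\<^sup>L D0 (last qs) + integral\<^sup>L D1 (last qs)) / 2" for qs :: "('a \<Rightarrow> real) list"
  define W where "W D = {w \<in> space P. dH (support D) (run (A w) Orc) \<le> ereal \<epsilon>}" for D
  have "valid_oracle D \<tau> Orc" if "D \<in> {D0, D1}" for D
    unfolding valid_oracle_def
  proof (intro allI impI)
    fix qs and r :: "'a \<Rightarrow> real" assume "valid_query r"
    from close[OF this] show "\<bar>Orc (qs @ [r]) - integral\<^sup>L D r\<bar> \<le> \<tau>"
      using that by (auto simp: Orc_def abs_le_iff field_simps)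
  qed
  then have W: "1 - \<alpha> \<le> measure P (W D)" if "D \<in> {D0, D1}" for D
    using est that D unfolding estimates_def W_def by blast
  \<comment> \<open>The success event is not assumed measurable, but \<open>measure\<close> is 0
    outside the sigma-algebra, and here it is at least 1 - \<alpha> > 0.\<close>
  have ev: "W D \<in> events" if "D \<in> {D0, D1}" for D
    using W[OF that] \<alpha> measure_notin_sets[of "W D" P] by force
  have "W D0 \<inter> W D1 \<noteq> {}"
  proof
    assume "W D0 \<inter> W D1 = {}"
    then have "measure P (W D0 \<union> W D1) = measure P (W D0) + measure P (W D1)"
      using ev by (intro finite_measure_Union) auto
    then show False using W[of D0] W[of D1] \<alpha> prob_le_1[of "W D0 \<union> W D1"] by simp
  qed
  then obtain w where w: "w \<in> W D0" "w \<in> W D1" by blast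
  have "\<bar>infdist x (support D) - infdist x (run (A w) Orc)\<bar> \<le> \<epsilon>" if "w \<in> W D" for D
  proof -
    have "ereal \<bar>infdist x (support D) - infdist x (run (A w) Orc)\<bar> \<le> dH (support D) (run (A w) Orc)"
      unfolding dH_def by (rule SUP_upper) simp
    also have "\<dots> \<le> ereal \<epsilon>" using that by (simp add: W_def)
    finally show ?thesis by simp
  qed
  from this[OF w(1)] this[OF w(2)] far show False by linarith
qed

text \<open>Dilation by \<open>a\<close> multiplies all volumes by a^d, so the ratios b / v0 and b /
  v1 that control the total variation do not change, while reach, extent and Hausdorff distance are
  multiplied by \<open>a\<close>.\<close>

lemma hypothesis_pair:
  fixes M0 M1 K :: "'a::euclidean_space set" and A :: "'w \<Rightarrow> 'a sq_alg"
  assumes d: "1 \<le> d" and M: "tame d M0" "tame d M1" and K: "closed K" "K \<subseteq> M0" "K \<subseteq> M1" and a: "0 < a" "\<rho> \<le> a"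
    and v: "hausdorff_outer d M0 = ennreal v0" "0 < v0" "hausdorff_outer d M1 = ennreal v1" "0 < v1"
    and b: "hausdorff_outer d (M0 - K) \<le> ennreal b" "hausdorff_outer d (M1 - K) \<le> ennreal b" "0 \<le> b"
    and R: "\<And>x. x \<in> M0 \<union> M1 \<Longrightarrow> a * norm (x - z) \<le> R"
    and f: "fmin \<le> 1 / (a ^ d * v0)" "1 / (a ^ d * v0) \<le> fmax" "fmin \<le> 1 / (a ^ d * v1)" "1 / (a ^ d * v1) \<le> fmax"
    and L: "0 \<le> L" and t: "t \<in> M1" "\<And>y. y \<in> M0 \<Longrightarrow> \<eta> \<le> dist t y" "2 * \<epsilon> < a * \<eta>"
    and \<tau>: "b / v0 + b / v1 \<le> \<tau>" and \<alpha>: "\<alpha> < 1/2"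
  shows "\<not> estimates P A (model d \<rho> fmin fmax L R) \<tau> \<epsilon> \<alpha>"
proof -
  define g where "g x = a *\<^sub>R x + (- (a *\<^sub>R z))" for x :: 'a
  have ginj: "inj g" using a(1) by (auto simp: g_def inj_def)
  have outer: "hausdorff_outer d (g ` S) = ennreal (a ^ d) * hausdorff_outer d S" for S
    unfolding g_def using a(1) by (rule hausdorff_outer_affine)
  have ad: "0 < a ^ d" using a(1) by simp
  define H where "H v = a ^ d * v" for v
  have gM: "g ` M0 \<in> manifold_class d a" "g ` M1 \<in> manifold_class d a"
    and gchart: "\<And>p. p \<in> g ` M0 \<Longrightarrow> C2_chart d (g ` M0) p" "\<And>p. p \<in> g ` M1 \<Longrightarrow> C2_chart d (g ` M1) p"
    unfolding g_def by (fact tame_affine_image[OF d M(1) a(1)] tame_affine_image[OF d M(2) a(1)])+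
  have gcl: "closed (g ` M0)" "closed (g ` M1)" using gM by (auto simp: manifold_class_def compact_imp_closed)
  have gK: "closed (g ` K)"
  proof -
    have "g ` K = (+) (- (a *\<^sub>R z)) ` (\<lambda>x. a *\<^sub>R x) ` K" by (simp add: g_def image_image)
    then show ?thesis using closed_translation[OF closed_scaling[OF K(1)]] by metis
  qed
  have ball: "g x \<in> cball 0 R" if "x \<in> M0 \<union> M1" for x
  proof -
    have "g x = a *\<^sub>R (x - z)" by (simp add: g_def algebra_simps)
    then show ?thesis using R[OF that] a(1) by simp
  qed
  have vH: "hausdorff_outer d (g ` M0) = ennreal (H v0)" "0 < H v0" "hausdorff_outer d (g ` M1) = ennreal (H v1)" "0 < H v1"
    using v ad by (auto simp: outer H_def ennreal_mult')
  have bH: "hausdorff_outer d (g ` M0 - g ` K) \<le> ennreal (H b)" "hausdorff_outer d (g ` M1 - g ` K) \<le> ennreal (H b)" "0 \<le> H b"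
    using b ad unfolding image_set_diff[OF ginj, symmetric] outer H_def by (auto simp: ennreal_mult' intro: mult_left_mono)
  define D0 where "D0 = uniform_on d (g ` M0) (1 / H v0)"
  define D1 where "D1 = uniform_on d (g ` M1) (1 / H v1)"
  have D: "D0 \<in> model d \<rho> fmin fmax L R" "D1 \<in> model d \<rho> fmin fmax L R"
  proof -
    show "D0 \<in> model d \<rho> fmin fmax L R" unfolding D0_def
      by (rule uniform_on_in_model[OF d gM(1) a(2) _ gchart(1) vH(1,2) _ _ L]) (use ball f in \<open>auto simp: H_def\<close>)
    show "D1 \<in> model d \<rho> fmin fmax L R" unfolding D1_def
      by (rule uniform_on_in_model[OF d gM(2) a(2) _ gchart(2) vH(3,4) _ _ L]) (use ball f in \<open>auto simp: H_def\<close>)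
  qed
  have S: "support D0 = g ` M0" "support D1 = g ` M1"
    unfolding D0_def D1_def using vH(2,4)
    by (auto intro!: support_uniform_on[OF d gcl(1) gchart(1)] support_uniform_on[OF d gcl(2) gchart(2)])
  have close: "\<bar>integral\<^sup>L D0 r - integral\<^sup>L D1 r\<bar> \<le> 2 * \<tau>" if "valid_query r" for r
  proof -
    have "\<bar>integral\<^sup>L D0 r - integral\<^sup>L D1 r\<bar> \<le> 2 * (H b / H v0 + H b / H v1)"
      unfolding D0_def D1_def by (rule uniform_on_integral_diff[OF d gcl gK _ _ vH bH that]) (use K in auto)
    also have "H b / H v0 + H b / H v1 = b / v0 + b / v1" using a(1) by (simp add: H_def)
    also have "2 * (b / v0 + b / v1) \<le> 2 * \<tau>" using \<tau> by simp
    finally show ?thesis .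
  qed
  have "infdist (g t) (g ` M1) = 0" using t(1) by simp
  moreover have "a * \<eta> \<le> infdist (g t) (g ` M0)"
  proof -
    have ne: "g ` M0 \<noteq> {}" using M(1) by (simp add: tame_def)
    have "a * \<eta> \<le> dist (g t) y" if "y \<in> g ` M0" for y
    proof -
      obtain x where x: "x \<in> M0" "y = g x" using \<open>y \<in> g ` M0\<close> by blast
      have "dist (g t) (g x) = a * dist t x" using a(1) by (simp add: g_def dist_norm flip: scaleR_diff_right)
      then show ?thesis using t(2)[OF x(1)] a(1) x(2) by simp
    qed
    then show ?thesis using ne by (simp add: infdist_notempty cINF_greatest)
  qed
  ultimately have "2 * \<epsilon> < \<bar>infdist (g t) (support D0) - infdist (g t) (support D1)\<bar>" using t(3) by (simp add: S)
  then show ?thesis using two_point_bound[OF D close _ \<alpha>] by blast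
qed

subsection \<open>Choice of the parameters\<close>

text \<open>N is taken maximal for the upper bound. Either all T cells are used and the assumption
  on V applies, or one more cell would be too much, and then V \<le> 66 N 8^d u \<le> 33 N 16^d u.
  Both times V is at most 42 N 16^d u, and 42 = 48 times 7/8.\<close>

lemma cell_count:
  fixes u V :: real
  assumes u: "0 < u" and d: "1 \<le> d" and T: "2 \<le> T" and V: "36 * 8 ^ d * u \<le> V" "V \<le> 42 * 16 ^ d * u * real T"
  shows "\<exists>N. 2 \<le> N \<and> N \<le> T \<and> real N * ((if N = 2 then 9 else 22) * (8 ^ d * u)) \<le> V / 2 \<and>
    V / 48 \<le> 4 ^ d * (real N * (7/8 * (4 ^ d * u)))"
proof -
  define S where "S = {N \<in> {2..T}. real N * ((if N = 2 then 9 else 22) * (8 ^ d * u)) \<le> V / 2}"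
  have "finite S" "2 \<in> S" using T V by (auto simp: S_def)
  define N where "N = Max S"
  have "S \<noteq> {}" using \<open>2 \<in> S\<close> by blast
  then have NS1: "N \<in> S" unfolding N_def by (rule Max_in[OF \<open>finite S\<close>])
  have NS2: "n \<le> N" if "n \<in> S" for n unfolding N_def by (rule Max_ge[OF \<open>finite S\<close> that])
  note NS = NS1 NS2
  then have N: "2 \<le> N" "N \<le> T" "real N * ((if N = 2 then 9 else 22) * (8 ^ d * u)) \<le> V / 2" by (auto simp: S_def)
  have p: "4 ^ d * (4::real) ^ d = 16 ^ d" by (simp add: power_mult_distrib[symmetric])
  have "V \<le> 42 * 16 ^ d * u * real N"
  proof (cases "N = T")
    case False
    then have "Suc N \<notin> S" using NS(2)[of "Suc N"] by auto
    then have "V / 2 < real (Suc N) * (22 * (8 ^ d * u))" using False N by (auto simp: S_def)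
    also have "\<dots> \<le> (3/2 * real N) * (22 * (8 ^ d * u))" using N(1) u by (intro mult_right_mono) auto
    finally have "V \<le> 66 * (real N * (8 ^ d * u))" by linarith
    moreover have "2 * 8 ^ d \<le> (16::real) ^ d"
    proof -
      have "(2::real) ^ 1 \<le> 2 ^ d" using d by (intro power_increasing) auto
      then have "2 * (8::real) ^ d \<le> 2 ^ d * 8 ^ d" by (intro mult_right_mono) auto
      then show ?thesis by (simp add: power_mult_distrib[symmetric])
    qed
    then have "(2 * 8 ^ d) * (u * real N) \<le> 16 ^ d * (u * real N)" using u by (intro mult_right_mono) auto
    moreover have "0 \<le> 16 ^ d * (u * real N)" using u by simp
    ultimately show ?thesis by (simp add: mult_ac)
  qed (use V in simp)
  then have "V / 48 \<le> 4 ^ d * (real N * (7/8 * (4 ^ d * u)))" using p by (simp add: mult_ac)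
  then show ?thesis using N by blast
qed

text \<open>If the factor 4 does not overshoot V/2 it serves; otherwise a d-th root hits the volume
  V/2 exactly.\<close>

lemma scale_exists:
  fixes V w :: real
  assumes "1 \<le> d" "0 < w" "w \<le> V / 2" "V / 48 \<le> 4 ^ d * w"
  shows "\<exists>a. 1 \<le> a \<and> a \<le> 4 \<and> V / 48 \<le> a ^ d * w \<and> a ^ d * w \<le> V / 2"
proof (cases "4 ^ d * w \<le> V / 2")
  case True
  then show ?thesis using assms by (intro exI[of _ 4]) simp
next
  case False
  define a where "a = root d (V / (2 * w))"
  have d0: "0 < d" using assms(1) by simp
  have V: "0 < V" using assms by simp
  have pw: "a ^ d = V / (2 * w)" unfolding a_def by (rule real_root_pow_pos2[OF d0]) (use V assms in simp)
  have "1 \<le> V / (2 * w)" "V / (2 * w) \<le> 4 ^ d" using assms False by (auto simp: field_simps)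
  then have "1 \<le> a" "a \<le> root d (4 ^ d)" unfolding a_def using d0 by simp_all
  moreover have "root d (4 ^ d) = (4::real)" using d0 by (simp add: real_root_power_cancel)
  moreover have "a ^ d * w = V / 2" using pw assms(2) by simp
  ultimately show ?thesis using V by (intro exI[of _ a]) simp
qed

text \<open>144 = 48 + 96 adds the bounds of the two densities in units of fmin, and 6 = 4 times 3/2
  combines the dilation with the Lipschitz constant of the crown. Dividing the width by 1024 absorbs
  both, since 144 times 6 is less than 1024.\<close>

lemma bump_width:
  fixes Y \<tau> :: real
  assumes "1 \<le> d" "0 < \<tau>" "0 < Y" and X: "X = min (1 / (2 ^ 10 * real d ^ 2)) ((\<tau> / Y) powr (2 / real d))"
  shows "0 < X" "sqrt X / 1024 \<le> 1" "144 * 6 ^ d * (Y * (sqrt X / 1024) ^ d) \<le> \<tau>"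
proof -
  have q: "0 < \<tau> / Y" using assms by simp
  show X0: "0 < X" using assms q by simp
  have "1 * 1 \<le> 2 ^ 10 * real d ^ 2" using assms(1) by (intro mult_mono) auto
  then have "1 / (2 ^ 10 * real d ^ 2) \<le> 1" using assms(1) by (simp add: divide_le_eq)
  then have "X \<le> 1" by (simp add: X)
  then have "sqrt X \<le> 1" by (rule real_sqrt_le_1_iff[THEN iffD2])
  then show "sqrt X / 1024 \<le> 1" by linarith
  have "sqrt X ^ d = X powr (real d / 2)" using X0 by (simp add: powr_half_sqrt[symmetric] powr_realpow[symmetric] powr_powr)
  also have "\<dots> \<le> ((\<tau> / Y) powr (2 / real d)) powr (real d / 2)" using X0 by (intro powr_mono2) (auto simp: X)
  also have "\<dots> = \<tau> / Y" using assms(1-3) by (simp add: powr_powr)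
  finally have s: "Y * sqrt X ^ d \<le> \<tau>" using assms(3) by (simp add: field_simps)
  have c: "144 * (6 / 1024) ^ d \<le> (1::real)"
  proof -
    have "(6 / 1024) ^ d \<le> (6 / 1024 :: real) ^ 1" using assms(1) by (intro power_decreasing) auto
    then show ?thesis by simp
  qed
  have "144 * 6 ^ d * (Y * (sqrt X / 1024) ^ d) = (144 * (6 / 1024) ^ d) * (Y * sqrt X ^ d)" unfolding power_divide by simp
  also have "\<dots> \<le> 1 * \<tau>" using c s assms X0 by (intro mult_mono) auto
  finally show "144 * 6 ^ d * (Y * (sqrt X / 1024) ^ d) \<le> \<tau>" by simp
qed

theorem theorem5p5:
  fixes d :: nat and rchmin R fmin fmax L \<tau> \<alpha> \<epsilon> :: real
  assumes "1 \<le> d" and "d < DIM('a::euclidean_space)"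
    and "rchmin > 0" and "R \<ge> 144 * rchmin"
    and "0 < fmin" and "fmin \<le> fmax / 96"
    and "L \<ge> 0" and "\<tau> > 0" and "\<alpha> < 1/2"
    and "(MIN k \<in> {1..DIM('a)}. (192 * rchmin * sqrt (real k) / R) ^ k)
           \<le> 36 * 8 ^ d * sigma_sph d * fmin * rchmin ^ d"
    and "36 * 8 ^ d * sigma_sph d * fmin * rchmin ^ d \<le> 1"
    and "\<epsilon> < rchmin / 2 ^ 31 *
           min (1 / (2 ^ 10 * real d ^ 2)) ((\<tau> / (omega d * fmin * rchmin ^ d)) powr (2 / real d))"
  shows "\<not> (\<exists>(P :: 'w measure) (A :: 'w \<Rightarrow> 'a sq_alg).
            estimates P A (model d rchmin fmin fmax L R) \<tau> \<epsilon> \<alpha>)"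
proof (intro notI, elim exE)
  fix P :: "'w measure" and A :: "'w \<Rightarrow> 'a sq_alg"
  note d = assms(1) and dn = assms(2) and rch = assms(3) and fmin = assms(5)
  define V where "V = 1 / fmin"
  have V0: "0 < V" using fmin by (simp add: V_def)
  have \<omega>: "0 < omega d" by (rule omega_pos)
  define Y where "Y = omega d * fmin * rchmin ^ d"
  have Y0: "0 < Y" using \<omega> fmin rch by (simp add: Y_def)
  define X where "X = min (1 / (2 ^ 10 * real d ^ 2)) ((\<tau> / Y) powr (2 / real d))"
  define \<delta> where "\<delta> = sqrt X / 1024"
  note bw = bump_width[OF d assms(8) Y0 X_def]
  have \<delta>: "0 < \<delta>" "\<delta> \<le> 1" "\<delta>\<^sup>2 = X / 2 ^ 20" using bw by (auto simp: \<delta>_def power_divide)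
  have R0: "0 < R" using assms(3,4) by simp

  obtain Z :: "'a set" where Z: "Z \<subseteq> Basis" "card Z = d" using obtain_subset_with_card_n[of d "Basis :: 'a set"] dn by auto
  have oZ: "orthonormal Z" by (rule orthonormal_subset[OF orthonormal_Basis Z(1)])
  define h where "h = flat_vol Z"
  have h: "0 < h" "h \<le> omega d" "omega d \<le> 2 ^ d * h"
    using flat_vol_pos[OF oZ] flat_vol_le[OF oZ] flat_vol_ge[OF oZ] Z(2) d by (auto simp: h_def divide_le_eq mult.commute)
  define u where "u = rchmin ^ d * (real d * h)"
  have u: "0 < u" using h rch d by (simp add: u_def)

  define q where "q k = (192 * rchmin * sqrt (real k) / R) ^ k" for k
  have "Min (q ` {1..DIM('a)}) \<in> q ` {1..DIM('a)}" by (rule Min_in) auto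
  then obtain k where k': "k \<in> {1..DIM('a)}" "Min (q ` {1..DIM('a)}) = q k" by blast
  have "Min (q ` {1..DIM('a)}) \<le> 36 * 8 ^ d * sigma_sph d * fmin * rchmin ^ d" using assms(10) unfolding q_def .
  then have k: "1 \<le> k" "k \<le> DIM('a)" "q k \<le> 36 * 8 ^ d * sigma_sph d * fmin * rchmin ^ d" using k' by auto
  \<comment> \<open>Up to 2 y cells per direction fit into the ball (see \<open>fits\<close>), and
    the hypothesis on the minimum says that y^k cells provide enough volume; m is an integer between
    y and 2 y. The bound by 1 gives y \<ge> 1, hence at least two cells per direction.\<close>
  define y where "y = R / (192 * rchmin * sqrt (real k))"
  have sk: "0 < sqrt (real k)" using k(1) by simp
  have y0: "0 < y" using R0 rch sk by (simp add: y_def)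
  have qy: "q k = 1 / y ^ k" by (simp add: q_def y_def power_divide)
  have "1 / y ^ k \<le> 1" using k(3) assms(11) qy by simp
  then have "1 ^ k \<le> y ^ k" using y0 by (simp add: divide_le_eq)
  then have y1: "1 \<le> y" using k(1) y0 power_mono_iff[of 1 y k] by simp
  define m where "m = nat \<lfloor>2 * y\<rfloor>"
  have m: "y \<le> real m" "real m \<le> 2 * y" "2 \<le> m" unfolding m_def using y1 by linarith+
  define T where "T = m ^ k"
  have T2: "2 \<le> T"
  proof -
    have "2 ^ 1 \<le> (2::nat) ^ k" using k(1) by (intro power_increasing) auto
    also have "\<dots> \<le> m ^ k" using m(3) by (intro power_mono) auto
    finally show ?thesis by (simp add: T_def)
  qed
  have Vle: "36 * 8 ^ d * u \<le> V"
  proof -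
    have "36 * 8 ^ d * u \<le> 36 * 8 ^ d * (rchmin ^ d * (real d * omega d))"
      unfolding u_def using h rch by (intro mult_left_mono) auto
    also have "\<dots> \<le> V" using assms(11) fmin by (simp add: V_def sigma_sph_def le_divide_eq mult_ac)
    finally show ?thesis .
  qed
  \<comment> \<open>The hypothesis speaks of omega d, the construction of the flat volume h; omega d
    \<le> 2^d h turns 8^d into 16^d.\<close>
  have Vge: "V \<le> 42 * 16 ^ d * u * real T"
  proof -
    have "1 \<le> 36 * 8 ^ d * sigma_sph d * fmin * rchmin ^ d * y ^ k" using k(3) y0 unfolding qy by (simp add: divide_le_eq)
    then have "V \<le> 36 * 8 ^ d * (rchmin ^ d * (real d * omega d)) * y ^ k"
      using fmin by (simp add: V_def sigma_sph_def divide_le_eq mult_ac)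
    also have "\<dots> \<le> 36 * 8 ^ d * (rchmin ^ d * (real d * (2 ^ d * h))) * real m ^ k"
      using h m(1) y0 rch by (intro mult_mono power_mono) auto
    also have "\<dots> = 36 * 16 ^ d * u * real T"
    proof -
      have "(16::real) ^ d = 8 ^ d * 2 ^ d" by (simp add: power_mult_distrib[symmetric])
      then show ?thesis by (simp add: u_def T_def mult_ac)
    qed
    also have "\<dots> \<le> 42 * 16 ^ d * u * real T" using u by (intro mult_right_mono) auto
    finally show ?thesis .
  qed
  from cell_count[OF u d T2 Vle Vge] obtain N where N: "2 \<le> N" "N \<le> T"
    "real N * ((if N = 2 then 9 else 22) * (8 ^ d * u)) \<le> V / 2" "V / 48 \<le> 4 ^ d * (real N * (7/8 * (4 ^ d * u)))" by blast

  obtain J :: "'a set" where J: "J \<subseteq> Basis" "card J = k" using obtain_subset_with_card_n[of k "Basis :: 'a set"] k(2) by auto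
  have finJ: "finite J" by (rule finite_subset[OF J(1) finite_Basis])
  have m1: "1 \<le> m" using m(3) by simp
  obtain xs :: "'a list" where xs: "length xs = T" "distinct xs"
    "successively (\<lambda>x y. \<exists>j\<in>J. y - x = j \<or> y - x = - j) xs"
    "\<And>x i. x \<in> set xs \<Longrightarrow> i \<in> Basis - J \<Longrightarrow> x \<bullet> i = 0" "\<And>x i. x \<in> set xs \<Longrightarrow> i \<in> J \<Longrightarrow> \<exists>n<m. x \<bullet> i = real n"
    using snake_path[OF finJ J(1) m1] unfolding J(2) T_def[symmetric] by blast
  have mem: "xs ! l \<in> set xs" if "l < N" for l using that N(2) xs(1) by simp
  have "\<exists>M0 M1 K t. closed K \<and> t \<in> M1 \<and> (\<forall>y\<in>M0. \<delta>\<^sup>2 / 800 \<le> dist t y) \<and>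
    (\<forall>M\<in>{M0, M1}. tame d M \<and> K \<subseteq> M \<and>
      hausdorff_outer d (M - K) \<le> ennreal ((3/2) ^ d * (flat_vol Z * \<delta> ^ d)) \<and>
      ennreal (real N * (7/8 * real d * 4 ^ d * flat_vol Z)) \<le> hausdorff_outer d M \<and>
      hausdorff_outer d M \<le> ennreal (real N * ((if N = 2 then 9 else 22) * (real d * 8 ^ d * flat_vol Z))) \<and>
      (\<forall>x\<in>M. norm (x - (\<Sum>i\<in>J. (21 * (real m - 1)) *\<^sub>R i)) \<le> 21 * real m * sqrt (real (card J)) + 4))"
  proof (rule cell_manifolds[OF d dn J(1) N(1) _ _ _ _ \<delta>(1,2) oZ Z(2), of "\<lambda>l. xs ! l"])
    show "\<exists>j\<in>J. xs ! Suc l - xs ! l = j \<or> xs ! Suc l - xs ! l = - j" if "Suc l < N" for l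
      by (rule xs(3)[unfolded successively_conv_nth, rule_format]) (use that N(2) xs(1) in simp)
    show "inj_on (\<lambda>l. xs ! l) {..<N}" by (rule inj_on_nth[OF xs(2)]) (use N(2) xs(1) in auto)
    show "xs ! l \<bullet> i = 0" if "l < N" "i \<in> Basis - J" for l i by (rule xs(4)[OF mem[OF that(1)] that(2)])
    show "\<exists>n<m. xs ! l \<bullet> i = real n" if "l < N" "i \<in> J" for l i by (rule xs(5)[OF mem[OF that(1)] that(2)])
  qed
  then obtain M0 M1 K t where MM: "closed K \<and> t \<in> M1 \<and> (\<forall>y\<in>M0. \<delta>\<^sup>2 / 800 \<le> dist t y) \<and>
    (\<forall>M\<in>{M0, M1}. tame d M \<and> K \<subseteq> M \<and>
      hausdorff_outer d (M - K) \<le> ennreal ((3/2) ^ d * (flat_vol Z * \<delta> ^ d)) \<and>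
      ennreal (real N * (7/8 * real d * 4 ^ d * flat_vol Z)) \<le> hausdorff_outer d M \<and>
      hausdorff_outer d M \<le> ennreal (real N * ((if N = 2 then 9 else 22) * (real d * 8 ^ d * flat_vol Z))) \<and>
      (\<forall>x\<in>M. norm (x - (\<Sum>i\<in>J. (21 * (real m - 1)) *\<^sub>R i)) \<le> 21 * real m * sqrt (real (card J)) + 4))"
    by (elim exE) (rule that)
  note Q = bspec[OF MM[THEN conjunct2, THEN conjunct2, THEN conjunct2], unfolded h_def[symmetric] J(2)]
  note Q2 = Q[THEN conjunct2, THEN conjunct2]
  note M = MM[THEN conjunct1] MM[THEN conjunct2, THEN conjunct1] bspec[OF MM[THEN conjunct2, THEN conjunct2, THEN conjunct1]]
    Q[THEN conjunct1] Q[THEN conjunct2, THEN conjunct1] Q2[THEN conjunct1] Q2[THEN conjunct2, THEN conjunct1]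
    Q2[THEN conjunct2, THEN conjunct2, THEN conjunct1] bspec[OF Q2[THEN conjunct2, THEN conjunct2, THEN conjunct2]]

  define b where "b = (3/2) ^ d * (h * \<delta> ^ d)"
  define lo where "lo = real N * (7/8 * real d * 4 ^ d * h)"
  define hi where "hi = real N * ((if N = 2 then 9 else 22) * (real d * 8 ^ d * h))"
  have b0: "0 \<le> b" using h \<delta> by (simp add: b_def)
  have lo0: "0 < lo" using h N(1) d by (simp add: lo_def)
  have hi0: "0 \<le> hi" using h by (simp add: hi_def)
  define v where "v M = enn2real (hausdorff_outer d M)" for M :: "'a set"
  have v: "hausdorff_outer d M = ennreal (v M)" "lo \<le> v M" "v M \<le> hi" if "M \<in> {M0, M1}" for M
  proof -
    show e: "hausdorff_outer d M = ennreal (v M)"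
      unfolding v_def by (rule ennreal_enn2real[symmetric], rule le_less_trans[OF M(8)[OF that]]) simp
    show "lo \<le> v M" using M(7)[OF that] unfolding lo_def[symmetric] e by (simp only: ennreal_le_iff[OF enn2real_nonneg] v_def)
    show "v M \<le> hi" using M(8)[OF that] unfolding hi_def[symmetric] e using hi0 by (simp add: ennreal_le_iff)
  qed
  have vnn: "0 \<le> v M" for M by (simp add: v_def)
  \<comment> \<open>Both manifolds contain \<open>K\<close>, so their volumes differ by at most b.
    As b is at most half of the lower volume bound, their ratio lies between 1/2 and 2, which widens
    the window from V/48 to V/2 for the first manifold into V/96 to V for the second: the origin of
    96.\<close>
  have vdiff: "v M \<le> v M' + b" if MM: "M \<in> {M0, M1}" "M' \<in> {M0, M1}" for M M'
  proof -
    have "closed M" using M(4)[OF MM(1)] by (simp add: tame_def compact_imp_closed)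
    then have "hausdorff_outer d (K \<union> (M - K)) = hausdorff_outer d K + hausdorff_outer d (M - K)"
      using M(1) by (intro hausdorff_outer_Un_disjoint[OF d]) auto
    also have "\<dots> \<le> ennreal (v M') + ennreal b"
      using M(6)[OF MM(1)] hausdorff_outer_mono[OF M(5)[OF MM(2)], of d] unfolding v(1)[OF MM(2)] b_def by (rule add_mono[rotated])
    also have "K \<union> (M - K) = M" using M(5)[OF MM(1)] by blast
    finally have "ennreal (v M) \<le> ennreal (v M' + b)" unfolding v(1)[OF MM(1)] ennreal_plus[OF vnn b0] .
    then show ?thesis by (rule ennreal_le_iff[THEN iffD1, rotated]) (use b0 vnn[of M'] in linarith)
  qed
  have bhalf: "b \<le> lo / 2"
  proof -
    have "b \<le> (3/2) ^ d * (h * 1)" unfolding b_def using \<delta> h by (intro mult_left_mono power_le_one) auto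
    also have "\<dots> \<le> 2 ^ d * h" using h by (auto intro: mult_right_mono power_mono)
    finally have "2 * b \<le> (2 * 2 ^ d) * h" by simp
    also have "\<dots> \<le> (2 ^ d * 2 ^ d) * h"
    proof -
      have "(2::real) ^ 1 \<le> 2 ^ d" using d by (intro power_increasing) auto
      then show ?thesis using h by (intro mult_right_mono) auto
    qed
    also have "(2 ^ d * 2 ^ d) * h = 1 * (4 ^ d * h)" by (simp add: power_mult_distrib[symmetric])
    also have "\<dots> \<le> (real N * (7/8 * real d)) * (4 ^ d * h)"
    proof -
      have "2 * 1 \<le> real N * real d" using N(1) d by (intro mult_mono) auto
      then show ?thesis using h by (intro mult_right_mono) auto
    qed
    also have "\<dots> = lo" by (simp add: lo_def)
    finally show ?thesis by simp
  qed
  define w where "w = rchmin ^ d * v M0"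
  have rd: "0 < rchmin ^ d" using rch by simp
  have "w \<le> rchmin ^ d * hi" unfolding w_def using v(3)[of M0] rd by (intro mult_left_mono) auto
  also have "\<dots> = real N * ((if N = 2 then 9 else 22) * (8 ^ d * u))" by (simp add: hi_def u_def mult_ac)
  finally have w2: "w \<le> V / 2" using N(3) by linarith
  have "4 ^ d * (real N * (7/8 * (4 ^ d * u))) = 4 ^ d * (rchmin ^ d * lo)" by (simp add: lo_def u_def mult_ac)
  also have "\<dots> \<le> 4 ^ d * w" unfolding w_def using v(2)[of M0] rd by (intro mult_left_mono) auto
  finally have w48: "V / 48 \<le> 4 ^ d * w" using N(4) by linarith
  have w0: "0 < w" unfolding w_def using v(2)[of M0] lo0 rd by simp
  obtain a' where a': "1 \<le> a'" "a' \<le> 4" "V / 48 \<le> a' ^ d * w" "a' ^ d * w \<le> V / 2" using scale_exists[OF d w0 w2 w48] by blast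
  define a where "a = a' * rchmin"
  have a: "rchmin \<le> a" "0 < a" "a \<le> 4 * rchmin" using a' rch by (auto simp: a_def)
  have aw: "a ^ d * v M0 = a' ^ d * w" by (simp add: a_def w_def power_mult_distrib)
  have ad: "0 < a ^ d" using a by simp
  have v0: "V / 48 \<le> a ^ d * v M0" "a ^ d * v M0 \<le> V / 2" using a' aw by auto
  have vv: "v M0 / 2 \<le> v M1" "v M1 \<le> 2 * v M0"
    using vdiff[of M0 M1] vdiff[of M1 M0] bhalf v(2)[of M0] lo0 by auto
  have "a ^ d * (v M0 / 2) \<le> a ^ d * v M1" "a ^ d * v M1 \<le> a ^ d * (2 * v M0)" using vv ad by (auto intro!: mult_left_mono)
  moreover have "a ^ d * (v M0 / 2) = a ^ d * v M0 / 2" "a ^ d * (2 * v M0) = 2 * (a ^ d * v M0)" by simp_all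
  ultimately have v1: "V / 96 \<le> a ^ d * v M1" "a ^ d * v M1 \<le> V" using v0 by linarith+
  have pos: "0 < v M0" "0 < v M1" using v(2)[of M0] v(2)[of M1] lo0 by auto
  have dens: "fmin \<le> 1 / (a ^ d * v M)" "1 / (a ^ d * v M) \<le> 96 * fmin" if "M \<in> {M0, M1}" for M
  proof -
    have x: "0 < a ^ d * v M" using that pos ad by auto
    have "V / 96 \<le> a ^ d * v M" "a ^ d * v M \<le> V" using that v0 v1 V0 by auto
    then show "fmin \<le> 1 / (a ^ d * v M)" "1 / (a ^ d * v M) \<le> 96 * fmin"
      using x fmin by (auto simp: V_def field_simps)
  qed
  have dens0: "1 / (a ^ d * v M0) \<le> 48 * fmin" using v0 pos ad fmin by (simp add: V_def field_simps)
  have fx: "96 * fmin \<le> fmax" using assms(6) by simp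
  have tv: "b / v M0 + b / v M1 \<le> \<tau>"
  proof -
    have "b / v M0 + b / v M1 = (a ^ d * b) * (1 / (a ^ d * v M0) + 1 / (a ^ d * v M1))"
      using ad a(2) by (simp add: distrib_left)
    also have "\<dots> \<le> (a ^ d * b) * (144 * fmin)" using dens(2)[of M1] dens0 ad b0 by (intro mult_left_mono) auto
    also have "\<dots> \<le> ((4 * rchmin) ^ d * ((3/2) ^ d * (omega d * \<delta> ^ d))) * (144 * fmin)"
      unfolding b_def using a h \<delta> fmin by (intro mult_right_mono mult_mono power_mono) auto
    also have "\<dots> = 144 * 6 ^ d * (Y * \<delta> ^ d)"
    proof -
      have "(6::real) ^ d = 4 ^ d * (3/2) ^ d" by (simp add: power_mult_distrib[symmetric])
      then show ?thesis unfolding Y_def power_mult_distrib by (simp add: mult_ac)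
    qed
    also have "\<dots> \<le> \<tau>" using bw(3) by (simp add: \<delta>_def)
    finally show ?thesis .
  qed
  \<comment> \<open>The block of cells takes 4 times 42 / 192 = 7/8 of R, and the remaining 16
    rchmin is at most R/9 because R \<ge> 144 rchmin.\<close>
  have fits: "a * (21 * real m * sqrt (real k) + 4) \<le> R"
  proof -
    have "21 * real m * sqrt (real k) + 4 \<le> 42 * (y * sqrt (real k)) + 4" using m(2) sk by simp
    then have "a * (21 * real m * sqrt (real k) + 4) \<le> (4 * rchmin) * (42 * (y * sqrt (real k)) + 4)"
      using a sk by (intro mult_mono) auto
    also have "\<dots> = 168 * (y * (rchmin * sqrt (real k))) + 16 * rchmin" by (simp add: algebra_simps)
    also have "y * (rchmin * sqrt (real k)) = R / 192" using rch sk by (simp add: y_def)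
    also have "168 * (R / 192) + 16 * rchmin \<le> R" using assms(4) rch by linarith
    finally show ?thesis .
  qed
  \<comment> \<open>With \<delta>^2 = X / 2^20 and 800 \<le> 2^10 the bump height \<delta>^2 / 800
    is at least X / 2^30; one more factor 2 separates the two supports by more than 2
    \<epsilon>.\<close>
  have gap: "2 * \<epsilon> < a * (\<delta>\<^sup>2 / 800)"
  proof -
    have "2 * \<epsilon> < rchmin * (X / 2 ^ 30)" using assms(12) unfolding Y_def[symmetric] X_def[symmetric] by simp
    also have "\<dots> \<le> a * (\<delta>\<^sup>2 / 800)" unfolding \<delta>(3) using a bw(1) rch by (intro mult_mono) auto
    finally show ?thesis .
  qed
  assume "estimates P A (model d rchmin fmin fmax L R) \<tau> \<epsilon> \<alpha>"
  moreover have "\<not> estimates P A (model d rchmin fmin fmax L R) \<tau> \<epsilon> \<alpha>"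
  proof (rule hypothesis_pair[OF d M(4)[of M0] M(4)[of M1] M(1) M(5)[of M0] M(5)[of M1] a(2,1)
        v(1)[of M0] pos(1) v(1)[of M1] pos(2) M(6)[of M0, folded b_def] M(6)[of M1, folded b_def] b0 _ _ _ _ _ assms(7) M(2,3) gap tv assms(9)])
    fix x assume "x \<in> M0 \<union> M1"
    then have "norm (x - (\<Sum>i\<in>J. (21 * (real m - 1)) *\<^sub>R i)) \<le> 21 * real m * sqrt (real k) + 4" using M(9) by blast
    then have "a * norm (x - (\<Sum>i\<in>J. (21 * (real m - 1)) *\<^sub>R i)) \<le> a * (21 * real m * sqrt (real k) + 4)"
      using a by (intro mult_left_mono) auto
    then show "a * norm (x - (\<Sum>i\<in>J. (21 * (real m - 1)) *\<^sub>R i)) \<le> R" using fits by linarith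
  qed (use dens fx in \<open>auto intro: order_trans\<close>)
  ultimately show False by blast
qed

end
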